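(* Let $v_0,v_1$ be real-valued with $v_0,v_1\in L_1(\mathbb{R})$. Then $\mathcal{N}$ coincides with the set of positive eigenvalues of $H$, the singular continuous spectrum of $H$ is empty, and eigenvalues of $H$ can accumulate only at the point zero.
   Context: $D=-i\,d/dx$. $H$ is the self-adjoint operator in $L_2(\mathbb{R})$ associated with the closed lower semibounded form $h[u,u]=\int(|u''|^2+v_1|u'|^2+v_0|u|^2)dx$ on $\mathsf{H}^2(\mathbb{R})$ (formally $D^4+Dv_1D+v_0$). $H_0=D^4$; for $z\notin[0,\infty)$, $\zeta^4=z$, $\arg\zeta\in(0,\pi/2)$, $(H_0-z)^{-1}$ has kernel $(4\zeta^3)^{-1}(ie^{i\zeta|x-y|}-e^{-\zeta|x-y|})$ and $R_0(\lambda\pm i0)$, $\lambda>0$, denotes the operator with the limiting kernel as $z\to\lambda$ from above/below. On $\mathcal{G}=L_2(\mathbb{R})\oplus L_2(\mathbb{R})$ define $\mathbf{G}_0u=(\operatorname{sgn}(v_0)\sqrt{|v_0|}\,u,\ \operatorname{sgn}(v_1)\sqrt{|v_1|}\,Du)$ and $\mathbf{G}u=(\sqrt{|v_0|}\,u,\ \sqrt{|v_1|}\,Du)$. $\mathcal{N}$ is the set of $\lambda>0$ for which at least one of the equations $\mathbf{f}+\mathbf{G}_0R_0(\lambda\pm i0)\mathbf{G}^*\mathbf{f}=0$ has a nonzero solution $\mathbf{f}\in\mathcal{G}$. *)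

theory Defs
  imports "HOL-Analysis.Analysis"
begin

text \<open>Functions on the real line are complex valued, L2 refers to Lebesgue measure.
  Elements of L2 are handled through representatives; equality in L2 is equality a.e.\<close>

definition L2 :: "(real \<Rightarrow> complex) \<Rightarrow> bool" where
  "L2 u \<longleftrightarrow> u \<in> borel_measurable lebesgue \<and> integrable lebesgue (\<lambda>x. (cmod (u x))\<^sup>2)"

definition l2_inner :: "(real \<Rightarrow> complex) \<Rightarrow> (real \<Rightarrow> complex) \<Rightarrow> complex" where
  "l2_inner u w = (LINT x|lebesgue. u x * cnj (w x))"

definition der :: "(real \<Rightarrow> complex) \<Rightarrow> real \<Rightarrow> complex" where
  "der u x = vector_derivative u (at x)"

text \<open>Sobolev space H^2(R), via its C^1 representative: u, u' in L2, u' absolutely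
  continuous with (a.e.) derivative u'' in L2.\<close>
definition H2 :: "(real \<Rightarrow> complex) \<Rightarrow> bool" where
  "H2 u \<longleftrightarrow> L2 u \<and> (\<forall>x. u differentiable (at x)) \<and> L2 (der u) \<and> L2 (der (der u)) \<and>
     (\<forall>a b. a \<le> b \<longrightarrow> der u b - der u a = (LINT t:{a..b}|lebesgue. der (der u) t))"

definition hform :: "(real \<Rightarrow> real) \<Rightarrow> (real \<Rightarrow> real) \<Rightarrow> (real \<Rightarrow> complex) \<Rightarrow> (real \<Rightarrow> complex) \<Rightarrow> complex" where
  "hform v0 v1 u w = (LINT x|lebesgue. der (der u) x * cnj (der (der w) x)
       + complex_of_real (v1 x) * der u x * cnj (der w x) + complex_of_real (v0 x) * u x * cnj (w x))"

text \<open>The operator H associated with the form: u \<in> dom H and H u = w.\<close>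
definition Hop :: "(real \<Rightarrow> real) \<Rightarrow> (real \<Rightarrow> real) \<Rightarrow> (real \<Rightarrow> complex) \<Rightarrow> (real \<Rightarrow> complex) \<Rightarrow> bool" where
  "Hop v0 v1 u w \<longleftrightarrow> H2 u \<and> L2 w \<and> (\<forall>\<phi>. H2 \<phi> \<longrightarrow> hform v0 v1 u \<phi> = l2_inner w \<phi>)"

definition eigenvalues :: "(real \<Rightarrow> real) \<Rightarrow> (real \<Rightarrow> real) \<Rightarrow> real set" where
  "eigenvalues v0 v1 = {E. \<exists>u. \<not> (AE x in lebesgue. u x = 0) \<and> Hop v0 v1 u (\<lambda>x. complex_of_real E * u x)}"

text \<open>Spectral measure of f: the finite Borel measure mu with
  <(H - z)^{-1} f, f> = int dmu(t)/(t - z) for all nonreal z.\<close>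
definition spectral_measure :: "(real \<Rightarrow> real) \<Rightarrow> (real \<Rightarrow> real) \<Rightarrow> (real \<Rightarrow> complex) \<Rightarrow> real measure \<Rightarrow> bool" where
  "spectral_measure v0 v1 f \<mu> \<longleftrightarrow> finite_measure \<mu> \<and> sets \<mu> = sets borel \<and>
     (\<forall>z u. Im z \<noteq> 0 \<longrightarrow> Hop v0 v1 u (\<lambda>x. f x + z * u x) \<longrightarrow>
        l2_inner u f = (LINT t|\<mu>. 1 / (complex_of_real t - z)))"

definition sc_vector :: "(real \<Rightarrow> real) \<Rightarrow> (real \<Rightarrow> real) \<Rightarrow> (real \<Rightarrow> complex) \<Rightarrow> real measure \<Rightarrow> bool" where
  "sc_vector v0 v1 f \<mu> \<longleftrightarrow> L2 f \<and> spectral_measure v0 v1 f \<mu> \<and> (\<forall>x. emeasure \<mu> {x} = 0) \<and>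
     (\<exists>N \<in> sets borel. emeasure lborel N = 0 \<and> emeasure \<mu> (UNIV - N) = 0)"

text \<open>Singular continuous spectrum: the spectrum of H restricted to the singular
  continuous subspace, i.e. the points every neighbourhood of which carries
  spectral mass of some singular continuous vector.\<close>
definition sc_spectrum :: "(real \<Rightarrow> real) \<Rightarrow> (real \<Rightarrow> real) \<Rightarrow> real set" where
  "sc_spectrum v0 v1 = {E. \<forall>\<epsilon>>0. \<exists>f \<mu>. sc_vector v0 v1 f \<mu> \<and> emeasure \<mu> {E-\<epsilon><..<E+\<epsilon>} > 0}"

text \<open>Free resolvent kernel (H_0 - z)^{-1}(x,y) = k(x - y), with zeta^4 = z,
  together with its first and second derivatives.\<close>
definition r0k :: "complex \<Rightarrow> real \<Rightarrow> complex" where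
  "r0k \<zeta> s = (\<i> * exp (\<i> * \<zeta> * of_real \<bar>s\<bar>) - exp (- \<zeta> * of_real \<bar>s\<bar>)) / (4 * \<zeta> ^ 3)"

definition r0k1 :: "complex \<Rightarrow> real \<Rightarrow> complex" where
  "r0k1 \<zeta> s = vector_derivative (r0k \<zeta>) (at s)"

definition r0k2 :: "complex \<Rightarrow> real \<Rightarrow> complex" where
  "r0k2 \<zeta> s = vector_derivative (r0k1 \<zeta>) (at s)"

text \<open>u = R_0 G^* f for f = (f0,f1), G^* f = sqrt|v0| f0 + D (sqrt|v1| f1);
  the derivative in G^* is moved onto the kernel (integration by parts):
  (R_0 D g)(x) = int -i k'(x-y) g(y) dy.\<close>
definition R0Gs :: "complex \<Rightarrow> (real \<Rightarrow> real) \<Rightarrow> (real \<Rightarrow> real) \<Rightarrow> (real \<Rightarrow> complex) \<Rightarrow> (real \<Rightarrow> complex) \<Rightarrow> real \<Rightarrow> complex" where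
  "R0Gs \<zeta> v0 v1 f0 f1 x =
     (LINT y|lebesgue. r0k \<zeta> (x - y) * of_real (sqrt \<bar>v0 y\<bar>) * f0 y)
   + (LINT y|lebesgue. - \<i> * r0k1 \<zeta> (x - y) * of_real (sqrt \<bar>v1 y\<bar>) * f1 y)"

text \<open>D u = -i u' for u = R_0 G^* f, differentiated under the integral.\<close>
definition DR0Gs :: "complex \<Rightarrow> (real \<Rightarrow> real) \<Rightarrow> (real \<Rightarrow> real) \<Rightarrow> (real \<Rightarrow> complex) \<Rightarrow> (real \<Rightarrow> complex) \<Rightarrow> real \<Rightarrow> complex" where
  "DR0Gs \<zeta> v0 v1 f0 f1 x =
     (LINT y|lebesgue. - \<i> * r0k1 \<zeta> (x - y) * of_real (sqrt \<bar>v0 y\<bar>) * f0 y)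
   + (LINT y|lebesgue. - r0k2 \<zeta> (x - y) * of_real (sqrt \<bar>v1 y\<bar>) * f1 y)"

text \<open>The equation f + G_0 R_0(lambda \<pm> i0) G^* f = 0 has a nonzero solution in L2 + L2.
  For R_0(lambda + i0) zeta = lambda^(1/4), for R_0(lambda - i0) zeta = i lambda^(1/4).\<close>
definition has_nonzero_solution :: "complex \<Rightarrow> (real \<Rightarrow> real) \<Rightarrow> (real \<Rightarrow> real) \<Rightarrow> bool" where
  "has_nonzero_solution \<zeta> v0 v1 \<longleftrightarrow> (\<exists>f0 f1. L2 f0 \<and> L2 f1 \<and>
     \<not> ((AE x in lebesgue. f0 x = 0) \<and> (AE x in lebesgue. f1 x = 0)) \<and>
     (AE x in lebesgue.
        f0 x + of_real (sgn (v0 x) * sqrt \<bar>v0 x\<bar>) * R0Gs \<zeta> v0 v1 f0 f1 x = 0 \<and>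
        f1 x + of_real (sgn (v1 x) * sqrt \<bar>v1 x\<bar>) * DR0Gs \<zeta> v0 v1 f0 f1 x = 0))"

definition Ncal :: "(real \<Rightarrow> real) \<Rightarrow> (real \<Rightarrow> real) \<Rightarrow> real set" where
  "Ncal v0 v1 = {E. E > 0 \<and>
     (has_nonzero_solution (of_real (root 4 E)) v0 v1 \<or>
      has_nonzero_solution (\<i> * of_real (root 4 E)) v0 v1)}"

end

theory Submission
  imports Defs "HOL-Complex_Analysis.Great_Picard"
begin

text \<open>All assertions are reduced to the Lippmann--Schwinger equation \<open>u = R\<^sub>0(f - v\<^sub>0 u + (v\<^sub>1 u')')\<close> for bounded
  \<open>u\<close> and \<open>u'\<close>. For a homogeneous solution at a real spectral parameter the pairing of \<open>u\<close> with its source is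
  real, which forces the amplitudes of the outgoing waves to vanish; without them the kernel decays
  exponentially, hence so does \<open>u\<close>, and \<open>u\<close> is an eigenfunction. This identifies \<open>N\<close> with the set of positive
  eigenvalues.

  Bounded solutions form relatively compact families as long as \<open>\<zeta>\<close> stays away from 0. Normalised
  eigenfunctions of eigenvalues accumulating at a nonzero point would converge to a nonzero
  eigenfunction, against orthogonality. Likewise, a failure of a uniform bound from L1 to bounded functions
  for the resolvent near a compact set \<open>K\<close> free of eigenvalues and of 0 would produce an eigenvalue in \<open>K\<close>.

  Let \<open>K\<close> be moreover a Lebesgue null set and cover it by cells of length \<open>h\<close>. A sum of differences of
  resolvents at distance of order \<open>h\<close> from the cells dominates the spectral projection of \<open>K\<close>, while the
  uniform resolvent bound estimates it by the square root of the total length of the cells. As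
  \<open>h \<rightarrow> 0\<close> the spectral measure of \<open>K\<close> vanishes, and inner regularity excludes singular continuous
  spectrum.\<close>

section \<open>Square integrable functions\<close>

text \<open>With potentials merely in L1, no decay of \<open>v0\<close>, \<open>v1\<close> is
  available and weighted spaces give nothing. L1 pairs with bounded functions, which is why the
  unknown is the pair \<open>(u, u')\<close> in the sup norm; the term \<open>D v1 D\<close> becomes
  harmless once its outer derivative is moved onto the kernel, whose derivatives up to the third
  stay bounded. The difficulty sits on the boundary rays, where the kernel has decay rate 0 and
  convolution no longer maps into L2: membership in L2 must be won back from the equation, and
  statements there are reached through parameters with positive decay rate. The boundary value from
  below is the complex conjugate of the one from above, since the potentials are real. A spectral
  measure is given only by its Stieltjes transform, so spectral projections enter as finite
  combinations of resolvents, whose inner products the resolvent identity computes. Poles at heights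
  h and -2h keep every pole distinct from all conjugate poles, and their differences decay
  quadratically, so that sums over the cells stay bounded as h tends to 0.\<close>

lemma ident_lebesgue [measurable]: "(\<lambda>x::real. x) \<in> borel_measurable lebesgue"
  by (rule measurable_completion) simp

text \<open>\<open>L2\<close> speaks of Lebesgue measurable functions, so Fubini is applied to two
  copies of the completed measure; the interpretation \<open>LL\<close> rests on this fact.\<close>

lemma sigma_finite_lebesgue: "sigma_finite_measure (lebesgue :: real measure)"
proof
  obtain A :: "real set set" where A: "countable A" "A \<subseteq> sets lborel" "\<Union>A = space lborel"
    "\<forall>a\<in>A. emeasure lborel a \<noteq> \<infinity>"
    using lborel.sigma_finite_countable by blast
  then show "\<exists>A::real set set. countable A \<and> A \<subseteq> sets lebesgue \<and> \<Union>A = space lebesgue \<and>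
    (\<forall>a\<in>A. emeasure lebesgue a \<noteq> \<infinity>)"
    by (intro exI[of _ A]) (auto simp: subset_eq)
qed

interpretation LB: sigma_finite_measure "lebesgue :: real measure"
  by (rule sigma_finite_lebesgue)

interpretation LL: pair_sigma_finite "lebesgue :: real measure" "lebesgue :: real measure" ..

lemma continuous_lebesgue_measurable:
  fixes f :: "real \<Rightarrow> 'a::euclidean_space"
  shows "continuous_on UNIV f \<Longrightarrow> f \<in> borel_measurable lebesgue"
  by (rule measurable_completion) (simp add: borel_measurable_continuous_onI)

text \<open>Kernels are kept Borel so that \<open>b (x - y)\<close> stays measurable on the product
  of the two completed measures. Sources may be Lebesgue measurable, since on the product they are
  composed with a projection only.\<close>

lemma borel_diff_measurable:
  fixes b :: "real \<Rightarrow> 'a::topological_space"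
  assumes "b \<in> borel_measurable borel"
  shows "(\<lambda>y. b (x - y)) \<in> borel_measurable lebesgue"
    "(\<lambda>y. b (y - x)) \<in> borel_measurable lebesgue"
    "(\<lambda>p. b (fst p - snd p)) \<in> borel_measurable (lebesgue \<Otimes>\<^sub>M lebesgue)"
proof -
  have m: "(\<lambda>y. x - y) \<in> borel_measurable lebesgue" "(\<lambda>y. y - x) \<in> borel_measurable lebesgue"
    by measurable
  show "(\<lambda>y. b (x - y)) \<in> borel_measurable lebesgue"
    "(\<lambda>y. b (y - x)) \<in> borel_measurable lebesgue"
    using measurable_compose[OF m(1) assms] measurable_compose[OF m(2) assms] by auto
  have "fst \<in> borel_measurable ((lebesgue::real measure) \<Otimes>\<^sub>M (lebesgue::real measure))"
    by (rule measurable_compose[OF measurable_fst ident_lebesgue])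
  moreover have "snd \<in> borel_measurable ((lebesgue::real measure) \<Otimes>\<^sub>M (lebesgue::real measure))"
    by (rule measurable_compose[OF measurable_snd ident_lebesgue])
  ultimately have m3: "(\<lambda>p. fst p - snd p) \<in> borel_measurable (lebesgue \<Otimes>\<^sub>M (lebesgue::real measure))"
    by measurable
  show "(\<lambda>p. b (fst p - snd p)) \<in> borel_measurable (lebesgue \<Otimes>\<^sub>M lebesgue)"
    using measurable_compose[OF m3 assms] by auto
qed

section \<open>Exponential weights on the line\<close>

abbreviation exp_abs :: "real \<Rightarrow> real \<Rightarrow> real" where
  "exp_abs c s \<equiv> exp (- (c * \<bar>s\<bar>))"

lemma has_bochner_integral_exp_abs:
  assumes c: "c > 0"
  shows "has_bochner_integral lebesgue (\<lambda>y. exp_abs c y) (2 / c)"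
proof -
  have *: "((\<lambda>x::real. exp (-c*x)) has_integral exp (-c*0)/c) {0..}"
    by (rule has_integral_exp_minus_to_infinity[OF c])
  then have "(\<lambda>x::real. exp (-c*x)) absolutely_integrable_on {0..}"
    by (intro nonnegative_absolutely_integrable_1) (auto simp: integrable_on_def)
  then have i: "integrable lebesgue (\<lambda>x. indicat_real {0..} x * exp (-c*x))"
    by (simp add: set_integrable_def)
  have "(LINT x:{0..}|lebesgue. exp (-c*x)) = integral {0..} (\<lambda>x. exp (-c*x))"
    using i by (intro set_lebesgue_integral_eq_integral) (simp add: set_integrable_def)
  then have v: "(LINT x|lebesgue. indicat_real {0..} x * exp (-c*x)) = 1 / c"
    using * by (simp add: set_lebesgue_integral_def integral_unique)
  have h: "has_bochner_integral lebesgue (\<lambda>x. indicat_real {0..} x * exp (-c*x)) (1/c)"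
    using i v by (simp add: has_bochner_integral_iff)
  then have h2: "has_bochner_integral lebesgue (\<lambda>x. indicat_real {0..} (-x) * exp (c*x)) (1/c)"
    using has_bochner_integral_lebesgue_real_affine_iff[of "-1" "\<lambda>x. indicat_real {0..} x * exp (-c*x)" "1/c" 0]
    by simp
  have "AE x in lebesgue. x \<notin> {0::real}"
    by (rule AE_not_in) auto
  then have ae: "AE x in lebesgue. indicat_real {0..} x * exp (-c*x) + indicat_real {0..} (-x) * exp (c*x) = exp_abs c x"
    by eventually_elim (auto simp: indicator_def abs_if)
  have hs: "has_bochner_integral lebesgue (\<lambda>x. indicat_real {0..} x * exp (-c*x) + indicat_real {0..} (-x) * exp (c*x)) (1/c + 1/c)"
    using has_bochner_integral_add[OF h h2] by simp
  have m: "(\<lambda>x. exp_abs c x) \<in> borel_measurable lebesgue"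
    by (intro continuous_lebesgue_measurable continuous_intros)
  have "has_bochner_integral lebesgue (\<lambda>x. exp_abs c x) (1/c + 1/c)"
    using has_bochner_integralI_AE[OF hs m ae] by auto
  then show ?thesis by simp
qed

lemma exp_abs_integral:
  assumes c: "c > 0"
  shows "integrable lebesgue (\<lambda>y. exp_abs c (x - y))" "(LINT y|lebesgue. exp_abs c (x - y)) = 2 / c"
    "integrable lebesgue (\<lambda>y. exp_abs c (y - x))" "(LINT y|lebesgue. exp_abs c (y - x)) = 2 / c"
proof -
  have "has_bochner_integral lebesgue (\<lambda>y. exp_abs c (x - y)) (2 / c)"
    using has_bochner_integral_lebesgue_real_affine_iff[of "-1" "\<lambda>y. exp_abs c y" "2/c" x]
      has_bochner_integral_exp_abs[OF c] by simp
  then show "integrable lebesgue (\<lambda>y. exp_abs c (x - y))" "(LINT y|lebesgue. exp_abs c (x - y)) = 2 / c"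
    by (auto simp: has_bochner_integral_iff)
  then show "integrable lebesgue (\<lambda>y. exp_abs c (y - x))" "(LINT y|lebesgue. exp_abs c (y - x)) = 2 / c"
    by (simp_all add: abs_minus_commute)
qed

section \<open>Cauchy--Schwarz and the vector space structure of L2\<close>

lemma integral_CS:
  fixes f g :: "'a \<Rightarrow> real"
  assumes f: "integrable M (\<lambda>x. (f x)\<^sup>2)" and g: "integrable M (\<lambda>x. (g x)\<^sup>2)"
    and fg: "integrable M (\<lambda>x. f x * g x)"
  shows "(LINT x|M. f x * g x)\<^sup>2 \<le> (LINT x|M. (f x)\<^sup>2) * (LINT x|M. (g x)\<^sup>2)"
proof -
  define A B C where "A = (LINT x|M. (f x)\<^sup>2)" "B = (LINT x|M. f x * g x)" "C = (LINT x|M. (g x)\<^sup>2)"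
  have A0: "A \<ge> 0" "C \<ge> 0" by (auto simp: A_B_C_def)
  have q: "A * t\<^sup>2 - 2 * B * t + C \<ge> 0" for t
  proof -
    have "0 \<le> (LINT x|M. (t * f x - g x)\<^sup>2)" by simp
    also have "(\<lambda>x. (t * f x - g x)\<^sup>2) = (\<lambda>x. t\<^sup>2 * (f x)\<^sup>2 - 2 * t * (f x * g x) + (g x)\<^sup>2)"
      by (simp add: power2_eq_square algebra_simps)
    also have "(LINT x|M. t\<^sup>2 * (f x)\<^sup>2 - 2 * t * (f x * g x) + (g x)\<^sup>2) = t\<^sup>2 * A - 2 * t * B + C"
      using f g fg by (simp add: A_B_C_def)
    finally show ?thesis by (simp add: algebra_simps)
  qed
  have "B\<^sup>2 \<le> A * C"
  proof (cases "A = 0")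
    case True
    have "B = 0"
    proof (rule ccontr)
      assume "B \<noteq> 0"
      \<comment> \<open>With \<open>A = 0\<close> the quadratic is affine in \<open>t\<close> and
        takes the value -1 at this point.\<close>
      then show False using q[of "(C + 1) / (2 * B)"] True by simp
    qed
    then show ?thesis using A0 True by simp
  next
    case False
    then have "A * (B/A)\<^sup>2 - 2 * B * (B/A) + C = C - B\<^sup>2 / A"
      by (simp add: power2_eq_square field_simps)
    with q[of "B/A"] have "B\<^sup>2 / A \<le> C" by simp
    then show ?thesis using False A0 by (simp add: field_simps)
  qed
  then show ?thesis by (simp add: A_B_C_def)
qed

lemma L2D: assumes "L2 u" shows "u \<in> borel_measurable lebesgue" "integrable lebesgue (\<lambda>x. (cmod (u x))\<^sup>2)"
  using assms by (auto simp: L2_def)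

lemma L2_prod:
  assumes f: "L2 f" and g: "L2 g"
  shows "integrable lebesgue (\<lambda>x. f x * g x)" "integrable lebesgue (\<lambda>x. f x * cnj (g x))"
    "integrable lebesgue (\<lambda>x. cmod (f x) * cmod (g x))"
proof -
  note [measurable] = L2D(1)[OF f] L2D(1)[OF g]
  have i: "integrable lebesgue (\<lambda>x. (cmod (f x))\<^sup>2 + (cmod (g x))\<^sup>2)"
    using L2D(2)[OF f] L2D(2)[OF g] by simp
  have b: "a * b \<le> a\<^sup>2 + b\<^sup>2" if "a \<ge> 0" "b \<ge> 0" for a b :: real
  proof -
    have "a * b \<le> 2 * a * b" using that by simp
    also have "\<dots> \<le> a\<^sup>2 + b\<^sup>2" by (rule sum_squares_bound)
    finally show ?thesis .
  qed
  have cm: "(\<lambda>x. cnj (g x)) \<in> borel_measurable lebesgue"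
    using L2D(1)[OF g] by (rule measurable_compose) (intro borel_measurable_continuous_onI continuous_intros)
  have n: "cmod (f x) * cmod (g x) \<le> norm ((cmod (f x))\<^sup>2 + (cmod (g x))\<^sup>2)" for x
    using b[of "cmod (f x)" "cmod (g x)"] by simp
  show "integrable lebesgue (\<lambda>x. f x * g x)"
    by (rule Bochner_Integration.integrable_bound[OF i]) (measurable, use n in \<open>simp add: norm_mult\<close>)
  show "integrable lebesgue (\<lambda>x. f x * cnj (g x))"
    by (rule Bochner_Integration.integrable_bound[OF i])
       (intro borel_measurable_times L2D(1)[OF f] cm, use n in \<open>simp add: norm_mult\<close>)
  show "integrable lebesgue (\<lambda>x. cmod (f x) * cmod (g x))"
    by (rule Bochner_Integration.integrable_bound[OF i]) (measurable, use n in \<open>simp add: norm_mult\<close>)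
qed

lemma l2_CS:
  assumes f: "L2 f" and g: "L2 g"
  shows "(cmod (l2_inner f g))\<^sup>2 \<le> (LINT x|lebesgue. (cmod (f x))\<^sup>2) * (LINT x|lebesgue. (cmod (g x))\<^sup>2)"
proof -
  have "cmod (l2_inner f g) \<le> (LINT x|lebesgue. cmod (f x) * cmod (g x))"
    unfolding l2_inner_def
    using integral_norm_bound[of lebesgue "\<lambda>x. f x * cnj (g x)"] by (simp add: norm_mult)
  then have "(cmod (l2_inner f g))\<^sup>2 \<le> (LINT x|lebesgue. cmod (f x) * cmod (g x))\<^sup>2"
    by (intro power_mono) auto
  also have "\<dots> \<le> (LINT x|lebesgue. (cmod (f x))\<^sup>2) * (LINT x|lebesgue. (cmod (g x))\<^sup>2)"
    by (intro integral_CS L2_prod L2D f g)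
  finally show ?thesis .
qed

lemma L2_cmult: "L2 f \<Longrightarrow> L2 (\<lambda>x. a * f x)"
  by (auto simp: L2_def norm_mult power_mult_distrib)

lemma L2_cnj: "L2 f \<Longrightarrow> L2 (\<lambda>x. cnj (f x))"
proof -
  assume f: "L2 f"
  have "(\<lambda>x. cnj (f x)) \<in> borel_measurable lebesgue"
    using L2D(1)[OF f] by (rule measurable_compose) (intro borel_measurable_continuous_onI continuous_intros)
  then show ?thesis using L2D(2)[OF f] by (simp add: L2_def)
qed

lemma L2_add:
  assumes f: "L2 f" and g: "L2 g"
  shows "L2 (\<lambda>x. f x + g x)"
proof -
  note [measurable] = L2D(1)[OF f] L2D(1)[OF g]
  have i: "integrable lebesgue (\<lambda>x. 2 * ((cmod (f x))\<^sup>2 + (cmod (g x))\<^sup>2))"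
    using L2D(2)[OF f] L2D(2)[OF g] by simp
  have b: "(cmod (a + b))\<^sup>2 \<le> 2 * ((cmod a)\<^sup>2 + (cmod b)\<^sup>2)" for a b :: complex
  proof -
    have "(cmod (a + b))\<^sup>2 \<le> (cmod a + cmod b)\<^sup>2"
      by (intro power_mono norm_triangle_ineq) auto
    also have "\<dots> \<le> 2 * ((cmod a)\<^sup>2 + (cmod b)\<^sup>2)"
      using sum_squares_bound[of "cmod a" "cmod b"] by (simp add: power2_sum)
    finally show ?thesis .
  qed
  have "integrable lebesgue (\<lambda>x. (cmod (f x + g x))\<^sup>2)"
    by (rule Bochner_Integration.integrable_bound[OF i]) (use b in auto)
  then show ?thesis by (simp add: L2_def)
qed

lemma L2_zero: "L2 (\<lambda>x. 0)" by (simp add: L2_def)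

lemma L2_sum: "finite A \<Longrightarrow> (\<And>a. a \<in> A \<Longrightarrow> L2 (f a)) \<Longrightarrow> L2 (\<lambda>x. \<Sum>a\<in>A. f a x)"
  by (induction A rule: finite_induct) (auto simp: L2_zero L2_add)

lemma L2_bound:
  assumes "u \<in> borel_measurable lebesgue" "L2 g" "\<And>x. cmod (u x) \<le> cmod (g x)"
  shows "L2 u"
  unfolding L2_def
proof
  show "integrable lebesgue (\<lambda>x. (cmod (u x))\<^sup>2)"
    by (rule Bochner_Integration.integrable_bound[OF L2D(2)[OF assms(2)]])
       (use assms in \<open>auto intro!: power_mono\<close>)
qed fact

section \<open>Convolution with exponentially bounded kernels\<close>

definition conv :: "(real \<Rightarrow> complex) \<Rightarrow> (real \<Rightarrow> complex) \<Rightarrow> real \<Rightarrow> complex" where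
  "conv b q x = (LINT y|lebesgue. b (x - y) * q y)"

text \<open>The rate \<open>c = 0\<close> is allowed and then means a bounded kernel; this is the
  situation on the two boundary rays.\<close>

definition kern :: "real \<Rightarrow> real \<Rightarrow> (real \<Rightarrow> complex) \<Rightarrow> bool" where
  "kern A c b \<longleftrightarrow> b \<in> borel_measurable borel \<and> (\<forall>s. cmod (b s) \<le> A * exp_abs c s)"

text \<open>Sources whose convolution with \<open>exp (- c \<bar>s\<bar>)\<close> is uniformly bounded; this covers L1 for \<open>c \<ge> 0\<close>
  and L2 for \<open>c > 0\<close>.\<close>
definition src :: "real \<Rightarrow> (real \<Rightarrow> complex) \<Rightarrow> bool" where
  "src c q \<longleftrightarrow> q \<in> borel_measurable lebesgue \<and>
     (\<exists>M. \<forall>x. integrable lebesgue (\<lambda>y. exp_abs c (x - y) * cmod (q y)) \<and>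
        (LINT y|lebesgue. exp_abs c (x - y) * cmod (q y)) \<le> M)"

text \<open>The absolute convergence that Fubini's theorem needs to move a convolution from \<open>q\<close> to \<open>\<phi>\<close>.\<close>
definition ffin :: "real \<Rightarrow> (real \<Rightarrow> complex) \<Rightarrow> (real \<Rightarrow> complex) \<Rightarrow> bool" where
  "ffin c q \<phi> \<longleftrightarrow> integrable (lebesgue \<Otimes>\<^sub>M lebesgue)
     (\<lambda>p. exp_abs c (fst p - snd p) * cmod (q (snd p)) * cmod (\<phi> (fst p)))"

lemma exp_abs_le1: "c \<ge> 0 \<Longrightarrow> exp_abs c s \<le> 1" by simp

lemma exp_abs_sq: "(exp_abs c s)\<^sup>2 = exp_abs (2 * c) s"
  by (simp add: exp_of_nat_mult[symmetric] power2_eq_square exp_add[symmetric])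

lemma exp_abs_shift:
  assumes "c \<ge> 0" "\<bar>h\<bar> \<le> 1"
  shows "exp_abs c (s + h) \<le> exp c * exp_abs c s"
proof -
  have "c * \<bar>s\<bar> \<le> c * (\<bar>s + h\<bar> + 1)" using assms by (intro mult_left_mono) auto
  then show ?thesis by (simp add: exp_add[symmetric] algebra_simps)
qed

lemma kernD:
  assumes "kern A c b"
  shows "b \<in> borel_measurable borel" "cmod (b s) \<le> A * exp_abs c s" "A \<ge> 0"
proof -
  show "b \<in> borel_measurable borel" "cmod (b s) \<le> A * exp_abs c s" using assms by (auto simp: kern_def)
  have "0 \<le> cmod (b 0)" by simp
  also have "\<dots> \<le> A * exp_abs c 0" using assms unfolding kern_def by blast
  finally show "A \<ge> 0" by simp
qed

lemma kern_bound: "kern A c b \<Longrightarrow> c \<ge> 0 \<Longrightarrow> cmod (b s) \<le> A"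
proof -
  assume k: "kern A c b" and c: "c \<ge> 0"
  have "A * exp_abs c s \<le> A * 1"
    using kernD(3)[OF k] c by (intro mult_left_mono) auto
  then show ?thesis using kernD(2)[OF k, of s] by simp
qed

lemma srcE:
  assumes "src c q"
  obtains M where "q \<in> borel_measurable lebesgue" "M \<ge> 0"
    "\<And>x. integrable lebesgue (\<lambda>y. exp_abs c (x - y) * cmod (q y))"
    "\<And>x. (LINT y|lebesgue. exp_abs c (x - y) * cmod (q y)) \<le> M"
proof -
  from assms obtain M where M: "q \<in> borel_measurable lebesgue"
    "\<And>x. integrable lebesgue (\<lambda>y. exp_abs c (x - y) * cmod (q y))"
    "\<And>x. (LINT y|lebesgue. exp_abs c (x - y) * cmod (q y)) \<le> M" by (auto simp: src_def)
  have "0 \<le> (LINT y|lebesgue. exp_abs c (0 - y) * cmod (q y))" by (rule integral_nonneg_AE) simp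
  also have "\<dots> \<le> M" by (rule M(3))
  finally show ?thesis using M that by blast
qed

lemma src_meas: "src c q \<Longrightarrow> q \<in> borel_measurable lebesgue" by (simp add: src_def)

lemma conv_integrable:
  assumes k: "kern A c b" and s: "src c q"
  shows "integrable lebesgue (\<lambda>y. b (x - y) * q y)"
proof -
  obtain M where M: "q \<in> borel_measurable lebesgue"
    "\<And>x. integrable lebesgue (\<lambda>y. exp_abs c (x - y) * cmod (q y))" using srcE[OF s] by metis
  note [measurable] = M(1) borel_diff_measurable[OF kernD(1)[OF k]]
  show ?thesis
  proof (rule Bochner_Integration.integrable_bound[OF integrable_mult_right[OF M(2)[of x], of A]])
    show "(\<lambda>y. b (x - y) * q y) \<in> borel_measurable lebesgue" by measurable
    show "AE y in lebesgue. norm (b (x - y) * q y) \<le> norm (A * (exp_abs c (x - y) * cmod (q y)))"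
      using kernD(2,3)[OF k] by (intro AE_I2) (auto simp: norm_mult mult.assoc[symmetric] intro!: mult_right_mono)
  qed
qed

lemma conv_norm:
  assumes k: "kern A c b" and s: "src c q"
  shows "cmod (conv b q x) \<le> A * (LINT y|lebesgue. exp_abs c (x - y) * cmod (q y))"
proof -
  obtain M where M: "q \<in> borel_measurable lebesgue"
    "\<And>x. integrable lebesgue (\<lambda>y. exp_abs c (x - y) * cmod (q y))" using srcE[OF s] by metis
  have "cmod (conv b q x) \<le> (LINT y|lebesgue. norm (b (x - y) * q y))"
    unfolding conv_def by (rule integral_norm_bound)
  also have "\<dots> \<le> (LINT y|lebesgue. A * (exp_abs c (x - y) * cmod (q y)))"
  proof (rule integral_mono)
    show "integrable lebesgue (\<lambda>y. norm (b (x - y) * q y))"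
      using conv_integrable[OF k s] by (rule integrable_norm)
    show "norm (b (x - y) * q y) \<le> A * (exp_abs c (x - y) * cmod (q y))" for y
      using kernD(2)[OF k] by (auto simp: norm_mult mult.assoc[symmetric] intro!: mult_right_mono)
  qed (use M in simp)
  finally show ?thesis by simp
qed

lemma conv_bounded:
  assumes k: "kern A c b" and s: "src c q"
  shows "\<exists>M. \<forall>x. cmod (conv b q x) \<le> M"
proof -
  obtain M where M: "\<And>x. (LINT y|lebesgue. exp_abs c (x - y) * cmod (q y)) \<le> M" using srcE[OF s] by metis
  have "cmod (conv b q x) \<le> A * M" for x
    using conv_norm[OF k s, of x] mult_left_mono[OF M[of x] kernD(3)[OF k]] by linarith
  then show ?thesis by blast
qed

lemma src_L1: assumes "integrable lebesgue q" "c \<ge> 0" shows "src c q"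
proof -
  have m [measurable]: "q \<in> borel_measurable lebesgue" using assms(1) by (rule borel_measurable_integrable)
  have i: "integrable lebesgue (\<lambda>y. exp_abs c (x - y) * cmod (q y))" for x
  proof (rule Bochner_Integration.integrable_bound[OF integrable_norm[OF assms(1)]])
    show "AE y in lebesgue. norm (exp_abs c (x - y) * cmod (q y)) \<le> norm (cmod (q y))"
      using exp_abs_le1[OF assms(2)] by (intro AE_I2) (auto simp: mult_left_le_one_le)
  qed measurable
  moreover have "(LINT y|lebesgue. exp_abs c (x - y) * cmod (q y)) \<le> (LINT y|lebesgue. cmod (q y))" for x
    using exp_abs_le1[OF assms(2)] by (intro integral_mono i integrable_norm assms) (auto simp: mult_left_le_one_le)
  ultimately show ?thesis using m unfolding src_def by blast
qed

lemma src_bounded: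
  assumes m [measurable]: "q \<in> borel_measurable lebesgue" and b: "\<And>x. cmod (q x) \<le> M" and c: "c > 0"
  shows "src c q"
proof -
  have M: "M \<ge> 0" using b[of 0] norm_ge_zero order_trans by blast
  have le: "exp_abs c (x - y) * cmod (q y) \<le> M * exp_abs c (x - y)" for x y
    using b[of y] by (simp add: mult.commute mult_right_mono)
  have i: "integrable lebesgue (\<lambda>y. exp_abs c (x - y) * cmod (q y))" for x
  proof (rule Bochner_Integration.integrable_bound[OF integrable_mult_right[OF exp_abs_integral(1)[OF c], of M]])
    show "AE y in lebesgue. norm (exp_abs c (x - y) * cmod (q y)) \<le> norm (M * exp_abs c (x - y))"
      using le M by (intro AE_I2) simp
  qed measurable
  moreover have "(LINT y|lebesgue. exp_abs c (x - y) * cmod (q y)) \<le> (LINT y|lebesgue. M * exp_abs c (x - y))" for x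
    by (intro integral_mono i integrable_mult_right exp_abs_integral(1)[OF c] le)
  moreover have "(LINT y|lebesgue. M * exp_abs c (x - y)) = M * (2 / c)" for x
    using exp_abs_integral(2)[OF c] by simp
  ultimately show ?thesis using m unfolding src_def by metis
qed

lemma mult_le_sq: "a * b \<le> a\<^sup>2 + b\<^sup>2" if "a \<ge> 0" "b \<ge> 0" for a b :: real
proof -
  have "a * b \<le> 2 * a * b" using that by simp
  also have "\<dots> \<le> a\<^sup>2 + b\<^sup>2" by (rule sum_squares_bound)
  finally show ?thesis .
qed

lemma src_L2:
  assumes q: "L2 q" and c: "c > 0"
  shows "src c q"
proof -
  note [measurable] = L2D(1)[OF q]
  have le: "exp_abs c (x - y) * cmod (q y) \<le> exp_abs (2*c) (x - y) + (cmod (q y))\<^sup>2" for x y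
    using mult_le_sq[of "exp_abs c (x - y)" "cmod (q y)"] by (simp only: exp_abs_sq) simp
  have c2: "2 * c > 0" using c by simp
  have I: "integrable lebesgue (\<lambda>y. exp_abs (2*c) (x - y) + (cmod (q y))\<^sup>2)" for x
    by (rule Bochner_Integration.integrable_add[OF exp_abs_integral(1)[OF c2] L2D(2)[OF q]])
  have i: "integrable lebesgue (\<lambda>y. exp_abs c (x - y) * cmod (q y))" for x
  proof (rule Bochner_Integration.integrable_bound[OF I[of x]])
    show "AE y in lebesgue. norm (exp_abs c (x - y) * cmod (q y)) \<le> norm (exp_abs (2*c) (x - y) + (cmod (q y))\<^sup>2)"
      using le by (intro AE_I2) simp
  qed measurable
  moreover have "(LINT y|lebesgue. exp_abs c (x - y) * cmod (q y)) \<le> 2/(2*c) + (LINT y|lebesgue. (cmod (q y))\<^sup>2)" for x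
  proof -
    have "(LINT y|lebesgue. exp_abs c (x - y) * cmod (q y)) \<le> (LINT y|lebesgue. exp_abs (2*c) (x - y) + (cmod (q y))\<^sup>2)"
      by (intro integral_mono i I le)
    also have "\<dots> = 2/(2*c) + (LINT y|lebesgue. (cmod (q y))\<^sup>2)"
      by (subst Bochner_Integration.integral_add[OF exp_abs_integral(1)[OF c2] L2D(2)[OF q]]) (simp only: exp_abs_integral(2)[OF c2])
    finally show ?thesis .
  qed
  ultimately show ?thesis using L2D(1)[OF q] unfolding src_def by blast
qed

lemma src_add:
  assumes 1: "src c q" and 2: "src c r"
  shows "src c (\<lambda>x. q x + r x)"
proof -
  obtain M where M: "q \<in> borel_measurable lebesgue"
    "\<And>x. integrable lebesgue (\<lambda>y. exp_abs c (x - y) * cmod (q y))"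
    "\<And>x. (LINT y|lebesgue. exp_abs c (x - y) * cmod (q y)) \<le> M" using srcE[OF 1] by metis
  obtain N where N: "r \<in> borel_measurable lebesgue"
    "\<And>x. integrable lebesgue (\<lambda>y. exp_abs c (x - y) * cmod (r y))"
    "\<And>x. (LINT y|lebesgue. exp_abs c (x - y) * cmod (r y)) \<le> N" using srcE[OF 2] by metis
  note [measurable] = M(1) N(1)
  have le: "exp_abs c (x - y) * cmod (q y + r y) \<le> exp_abs c (x - y) * cmod (q y) + exp_abs c (x - y) * cmod (r y)" for x y
    using norm_triangle_ineq[of "q y" "r y"] by (simp add: distrib_left[symmetric])
  have I: "integrable lebesgue (\<lambda>y. exp_abs c (x - y) * cmod (q y) + exp_abs c (x - y) * cmod (r y))" for x
    by (intro Bochner_Integration.integrable_add M N)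
  have i: "integrable lebesgue (\<lambda>y. exp_abs c (x - y) * cmod (q y + r y))" for x
  proof (rule Bochner_Integration.integrable_bound[OF I[of x]])
    show "AE y in lebesgue. norm (exp_abs c (x - y) * cmod (q y + r y)) \<le> norm (exp_abs c (x - y) * cmod (q y) + exp_abs c (x - y) * cmod (r y))"
      using le by (intro AE_I2) simp
  qed measurable
  moreover have "(LINT y|lebesgue. exp_abs c (x - y) * cmod (q y + r y)) \<le> M + N" for x
  proof -
    have "(LINT y|lebesgue. exp_abs c (x - y) * cmod (q y + r y)) \<le> (LINT y|lebesgue. exp_abs c (x - y) * cmod (q y) + exp_abs c (x - y) * cmod (r y))"
      by (intro integral_mono i I le)
    also have "\<dots> = (LINT y|lebesgue. exp_abs c (x - y) * cmod (q y)) + (LINT y|lebesgue. exp_abs c (x - y) * cmod (r y))"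
      by (rule Bochner_Integration.integral_add[OF M(2) N(2)])
    also have "\<dots> \<le> M + N" by (intro add_mono M N)
    finally show ?thesis .
  qed
  moreover have "(\<lambda>x. q x + r x) \<in> borel_measurable lebesgue" by measurable
  ultimately show ?thesis unfolding src_def by blast
qed

lemma src_cmult:
  assumes "src c q" shows "src c (\<lambda>x. a * q x)"
proof -
  obtain M where M: "q \<in> borel_measurable lebesgue"
    "\<And>x. integrable lebesgue (\<lambda>y. exp_abs c (x - y) * cmod (q y))"
    "\<And>x. (LINT y|lebesgue. exp_abs c (x - y) * cmod (q y)) \<le> M" using srcE[OF assms] by metis
  note [measurable] = M(1)
  have eq: "(\<lambda>y. exp_abs c (x - y) * cmod (a * q y)) = (\<lambda>y. cmod a * (exp_abs c (x - y) * cmod (q y)))" for x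
    by (simp add: norm_mult fun_eq_iff)
  have "(LINT y|lebesgue. exp_abs c (x - y) * cmod (a * q y)) \<le> cmod a * M" for x
    unfolding eq using M(3)[of x] by (simp add: mult_left_mono)
  moreover have "integrable lebesgue (\<lambda>y. exp_abs c (x - y) * cmod (a * q y))" for x
    unfolding eq using M(2) by simp
  moreover have "(\<lambda>x. a * q x) \<in> borel_measurable lebesgue" by measurable
  ultimately show ?thesis unfolding src_def by blast
qed

text \<open>A jump of the kernel at 0 concerns, for fixed x, only the point y = x, a null set.
  Within distance 1 of x the weights differ by a factor of at most \<open>exp c\<close>, which
  provides the majorant.\<close>

lemma conv_continuous:
  assumes k: "kern A c b" and c: "c \<ge> 0" and s: "src c q" and cont: "\<And>s. s \<noteq> 0 \<Longrightarrow> isCont b s"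
  shows "continuous_on UNIV (conv b q)"
proof -
  obtain M where M: "q \<in> borel_measurable lebesgue"
    "\<And>x. integrable lebesgue (\<lambda>y. exp_abs c (x - y) * cmod (q y))" using srcE[OF s] by metis
  have "continuous (at x) (conv b q)" for x
  proof (rule continuous_at_sequentiallyI)
    fix u :: "nat \<Rightarrow> real" assume u: "u \<longlonglongrightarrow> x"
    then obtain N where N: "\<And>n. n \<ge> N \<Longrightarrow> \<bar>u n - x\<bar> \<le> 1"
      by (metis LIMSEQ_iff less_imp_le real_norm_def zero_less_one)
    have "(\<lambda>n. conv b q (u (n + N))) \<longlonglongrightarrow> conv b q x"
      unfolding conv_def
    proof (rule integral_dominated_convergence[where w="\<lambda>y. A * exp c * (exp_abs c (x - y) * cmod (q y))"])
      show "integrable lebesgue (\<lambda>y. A * exp c * (exp_abs c (x - y) * cmod (q y)))" using M(2)[of x] by simp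
      have "AE y in lebesgue. y \<notin> {x}" by (rule AE_not_in) auto
      then show "AE y in lebesgue. (\<lambda>n. b (u (n + N) - y) * q y) \<longlonglongrightarrow> b (x - y) * q y"
      proof eventually_elim
        case (elim y)
        have "(\<lambda>n. u (n + N) - y) \<longlonglongrightarrow> x - y"
          using LIMSEQ_ignore_initial_segment[OF u, of N] by (intro tendsto_intros)
        then have "(\<lambda>n. b (u (n + N) - y)) \<longlonglongrightarrow> b (x - y)"
          using isCont_tendsto_compose[OF cont[of "x - y"]] elim by simp
        then show ?case by (intro tendsto_intros)
      qed
      fix n
      have h: "\<bar>u (n + N) - x\<bar> \<le> 1" using N by simp
      have "cmod (b (u (n + N) - y) * q y) \<le> A * exp c * (exp_abs c (x - y) * cmod (q y))" for y
      proof -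
        have "cmod (b (u (n + N) - y)) \<le> A * exp_abs c (u (n + N) - y)" by (rule kernD(2)[OF k])
        also have "\<dots> \<le> A * (exp c * exp_abs c (x - y))"
          using exp_abs_shift[OF c h, of "x - y"] kernD(3)[OF k] by (intro mult_left_mono) (auto simp: algebra_simps)
        finally have "cmod (b (u (n + N) - y)) * cmod (q y) \<le> A * (exp c * exp_abs c (x - y)) * cmod (q y)"
          by (rule mult_right_mono) simp
        then show ?thesis by (simp add: norm_mult mult_ac)
      qed
      then show "AE y in lebesgue. norm (b (u (n + N) - y) * q y) \<le> A * exp c * (exp_abs c (x - y) * cmod (q y))"
        by simp
    qed (use borel_measurable_integrable[OF conv_integrable[OF k s]] in auto)
    then show "(\<lambda>n. conv b q (u n)) \<longlonglongrightarrow> conv b q x" by (rule LIMSEQ_offset)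
  qed
  then show ?thesis by (simp add: continuous_at_imp_continuous_on)
qed

lemma has_vector_derivative_at_quotient:
  fixes f :: "real \<Rightarrow> 'a::real_normed_vector"
  shows "(f has_vector_derivative D) (at x) \<longleftrightarrow> ((\<lambda>h. (f (x + h) - f x) /\<^sub>R h) \<longlongrightarrow> D) (at 0)"
proof -
  have "(f has_vector_derivative D) (at x) \<longleftrightarrow> ((\<lambda>h. norm (f (x + h) - f x - h *\<^sub>R D) / norm h) \<longlongrightarrow> 0) (at 0)"
    by (simp add: has_vector_derivative_def has_derivative_at bounded_linear_scaleR_left)
  also have "\<dots> \<longleftrightarrow> ((\<lambda>h. norm ((f (x + h) - f x) /\<^sub>R h - D)) \<longlongrightarrow> 0) (at 0)"
  proof (rule tendsto_cong)
    show "\<forall>\<^sub>F h in at 0. norm (f (x + h) - f x - h *\<^sub>R D) / norm h = norm ((f (x + h) - f x) /\<^sub>R h - D)"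
      unfolding eventually_at_filter
    proof (intro always_eventually allI impI)
      fix h :: real assume h: "h \<noteq> 0"
      have "(f (x + h) - f x) /\<^sub>R h - D = (f (x + h) - f x - h *\<^sub>R D) /\<^sub>R h"
        using h by (simp add: scaleR_diff_right)
      then show "norm (f (x + h) - f x - h *\<^sub>R D) / norm h = norm ((f (x + h) - f x) /\<^sub>R h - D)"
        by (simp add: divide_inverse mult.commute)
    qed
  qed
  also have "\<dots> \<longleftrightarrow> ((\<lambda>h. (f (x + h) - f x) /\<^sub>R h) \<longlongrightarrow> D) (at 0)"
    using tendsto_norm_zero_iff[of "\<lambda>h. (f (x + h) - f x) /\<^sub>R h - D" "at 0"] LIM_zero_iff by auto
  finally show ?thesis .
qed

text \<open>Difference quotients of the kernel are dominated by \<open>lip\<close>, and they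
  converge off the single point y = x. Hence the lemma also covers a continuous kernel whose
  derivative jumps at 0, as happens for the second derivative of the free kernel.\<close>

lemma conv_deriv:
  assumes k: "kern A c b" and k': "kern A' c b'" and s: "src c q" and B: "B \<ge> 0"
    and lip: "\<And>s h. \<bar>h\<bar> \<le> 1 \<Longrightarrow> cmod (b (s + h) - b s) \<le> \<bar>h\<bar> * (B * exp_abs c s)"
    and der: "\<And>s. s \<noteq> 0 \<Longrightarrow> (b has_vector_derivative b' s) (at s)"
  shows "(conv b q has_vector_derivative conv b' q x) (at x)"
  unfolding has_vector_derivative_at_quotient tendsto_at_iff_sequentially comp_def
proof (intro allI impI)
  obtain M where M: "q \<in> borel_measurable lebesgue"
    "\<And>x. integrable lebesgue (\<lambda>y. exp_abs c (x - y) * cmod (q y))" using srcE[OF s] by metis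
  fix u :: "nat \<Rightarrow> real" assume u0: "\<forall>i. u i \<in> UNIV - {0}" and u: "u \<longlonglongrightarrow> 0"
  have u0: "u i \<noteq> 0" for i using u0 by auto
  from u obtain N where N: "\<And>n. n \<ge> N \<Longrightarrow> \<bar>u n\<bar> \<le> 1"
    by (metis LIMSEQ_iff less_imp_le real_norm_def zero_less_one diff_zero)
  have uN: "(\<lambda>n. u (n + N)) \<longlonglongrightarrow> 0" using LIMSEQ_ignore_initial_segment[OF u] .
  have eq: "(conv b q (x + h) - conv b q x) /\<^sub>R h = (LINT y|lebesgue. ((b (x - y + h) - b (x - y)) /\<^sub>R h) * q y)" for h
  proof -
    have "conv b q (x + h) - conv b q x = (LINT y|lebesgue. b (x + h - y) * q y - b (x - y) * q y)"
      unfolding conv_def by (rule Bochner_Integration.integral_diff[symmetric]) (rule conv_integrable[OF k s])+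
    also have "\<dots> /\<^sub>R h = (LINT y|lebesgue. (b (x + h - y) * q y - b (x - y) * q y) /\<^sub>R h)"
      by simp
    also have "(\<lambda>y. (b (x + h - y) * q y - b (x - y) * q y) /\<^sub>R h) = (\<lambda>y. ((b (x - y + h) - b (x - y)) /\<^sub>R h) * q y)"
      by (simp add: algebra_simps)
    finally show ?thesis .
  qed
  have "(\<lambda>n. (conv b q (x + u (n + N)) - conv b q x) /\<^sub>R u (n + N)) \<longlonglongrightarrow> conv b' q x"
    unfolding conv_def[of b'] eq
  proof (rule integral_dominated_convergence[where w="\<lambda>y. B * (exp_abs c (x - y) * cmod (q y))"])
    show "integrable lebesgue (\<lambda>y. B * (exp_abs c (x - y) * cmod (q y)))" using M(2)[of x] by simp
    have "AE y in lebesgue. y \<notin> {x}" by (rule AE_not_in) auto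
    then show "AE y in lebesgue. (\<lambda>n. ((b (x - y + u (n + N)) - b (x - y)) /\<^sub>R u (n + N)) * q y) \<longlonglongrightarrow> b' (x - y) * q y"
    proof eventually_elim
      case (elim y)
      have "((\<lambda>h. (b (x - y + h) - b (x - y)) /\<^sub>R h) \<longlongrightarrow> b' (x - y)) (at 0)"
        using der[of "x - y"] elim by (simp add: has_vector_derivative_at_quotient)
      then have "(\<lambda>n. (b (x - y + u (n + N)) - b (x - y)) /\<^sub>R u (n + N)) \<longlonglongrightarrow> b' (x - y)"
        using uN u0 unfolding tendsto_at_iff_sequentially by (auto simp: comp_def)
      then show ?case by (intro tendsto_intros)
    qed
    fix n
    have h: "\<bar>u (n + N)\<bar> \<le> 1" using N by simp
    have "cmod (((b (x - y + u (n + N)) - b (x - y)) /\<^sub>R u (n + N)) * q y) \<le> B * (exp_abs c (x - y) * cmod (q y))" for y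
    proof -
      have "cmod ((b (x - y + u (n + N)) - b (x - y)) /\<^sub>R u (n + N)) \<le> B * exp_abs c (x - y)"
      proof -
        have "cmod ((b (x - y + u (n + N)) - b (x - y)) /\<^sub>R u (n + N)) = cmod (b (x - y + u (n + N)) - b (x - y)) / \<bar>u (n + N)\<bar>"
          by (simp add: divide_inverse mult.commute)
        also have "\<dots> \<le> B * exp_abs c (x - y)"
          using lip[OF h, of "x - y"] u0[of "n + N"] by (simp add: pos_divide_le_eq mult_ac)
        finally show ?thesis .
      qed
      then have "cmod ((b (x - y + u (n + N)) - b (x - y)) /\<^sub>R u (n + N)) * cmod (q y) \<le> B * exp_abs c (x - y) * cmod (q y)"
        by (rule mult_right_mono) simp
      then show ?thesis by (simp add: norm_mult mult_ac)
    qed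
    then show "AE y in lebesgue. norm (((b (x - y + u (n + N)) - b (x - y)) /\<^sub>R u (n + N)) * q y) \<le> B * (exp_abs c (x - y) * cmod (q y))"
      by simp
    note [measurable] = borel_diff_measurable[OF kernD(1)[OF k]] M(1)
    have "(\<lambda>y. b (x + u (n + N) - y)) \<in> borel_measurable lebesgue" by measurable
    then have [measurable]: "(\<lambda>y. b (x - y + u (n + N))) \<in> borel_measurable lebesgue" by (simp add: algebra_simps)
    show "(\<lambda>y. ((b (x - y + u (n + N)) - b (x - y)) /\<^sub>R u (n + N)) * q y) \<in> borel_measurable lebesgue"
      by measurable
  qed (use borel_measurable_integrable[OF conv_integrable[OF k' s]] in auto)
  then show "(\<lambda>n. (conv b q (x + u n) - conv b q x) /\<^sub>R u n) \<longlonglongrightarrow> conv b' q x"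
    by (rule LIMSEQ_offset)
qed

section \<open>Fubini for convolutions\<close>

lemma ffin_src_L1:
  assumes s: "src c q" and i: "integrable lebesgue \<phi>"
  shows "ffin c q \<phi>"
proof -
  obtain M where M: "q \<in> borel_measurable lebesgue" "M \<ge> 0"
    "\<And>x. integrable lebesgue (\<lambda>y. exp_abs c (x - y) * cmod (q y))"
    "\<And>x. (LINT y|lebesgue. exp_abs c (x - y) * cmod (q y)) \<le> M" using srcE[OF s] by metis
  have [measurable]: "\<phi> \<in> borel_measurable lebesgue" using i by (rule borel_measurable_integrable)
  note [measurable] = M(1)
  have m [measurable]: "(\<lambda>p. exp_abs c (fst p - snd p) * cmod (q (snd p)) * cmod (\<phi> (fst p))) \<in> borel_measurable (lebesgue \<Otimes>\<^sub>M lebesgue)"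
    by measurable
  show ?thesis unfolding ffin_def
  proof (rule LL.Fubini_integrable)
    have eq: "(LINT y|lebesgue. norm (exp_abs c (fst (x, y) - snd (x, y)) * cmod (q (snd (x, y))) * cmod (\<phi> (fst (x, y)))))
       = (LINT y|lebesgue. exp_abs c (x - y) * cmod (q y)) * cmod (\<phi> x)" for x
      by simp
    show "integrable lebesgue (\<lambda>x. LINT y|lebesgue. norm (exp_abs c (fst (x, y) - snd (x, y)) * cmod (q (snd (x, y))) * cmod (\<phi> (fst (x, y)))))"
    proof (rule Bochner_Integration.integrable_bound[OF integrable_mult_right[OF integrable_norm[OF i], of M]])
      show "(\<lambda>x. LINT y|lebesgue. norm (exp_abs c (fst (x, y) - snd (x, y)) * cmod (q (snd (x, y))) * cmod (\<phi> (fst (x, y))))) \<in> borel_measurable lebesgue"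
        by (rule LB.borel_measurable_lebesgue_integral) measurable
      show "AE x in lebesgue. norm (LINT y|lebesgue. norm (exp_abs c (fst (x, y) - snd (x, y)) * cmod (q (snd (x, y))) * cmod (\<phi> (fst (x, y))))) \<le> norm (M * cmod (\<phi> x))"
      proof (intro AE_I2)
        fix x
        have "0 \<le> (LINT y|lebesgue. exp_abs c (x - y) * cmod (q y))" by (rule integral_nonneg_AE) simp
        then show "norm (LINT y|lebesgue. norm (exp_abs c (fst (x, y) - snd (x, y)) * cmod (q (snd (x, y))) * cmod (\<phi> (fst (x, y))))) \<le> norm (M * cmod (\<phi> x))"
          unfolding eq using M(2,4) by (simp add: abs_mult mult_right_mono)
      qed
    qed
    show "AE x in lebesgue. integrable lebesgue (\<lambda>y. exp_abs c (fst (x, y) - snd (x, y)) * cmod (q (snd (x, y))) * cmod (\<phi> (fst (x, y))))"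
      using M(3) by simp
  qed (rule m)
qed

lemma ffin_sym: assumes "ffin c q \<phi>" shows "ffin c \<phi> q"
proof -
  have "integrable (lebesgue \<Otimes>\<^sub>M lebesgue) (\<lambda>(x,y). (\<lambda>p. exp_abs c (fst p - snd p) * cmod (q (snd p)) * cmod (\<phi> (fst p))) (y, x))"
    by (rule iffD2[OF LL.integrable_product_swap_iff]) (use assms in \<open>simp only: ffin_def\<close>)
  also have "(\<lambda>(x,y). (\<lambda>p. exp_abs c (fst p - snd p) * cmod (q (snd p)) * cmod (\<phi> (fst p))) (y, x)) =
    (\<lambda>p. exp_abs c (fst p - snd p) * cmod (\<phi> (snd p)) * cmod (q (fst p)))"
    by (auto simp: fun_eq_iff abs_minus_commute)
  finally show ?thesis by (simp add: ffin_def)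
qed

lemma ffin_mono:
  assumes f: "integrable (lebesgue \<Otimes>\<^sub>M lebesgue) f" and [measurable]: "q \<in> borel_measurable lebesgue" "\<phi> \<in> borel_measurable lebesgue"
    and le: "\<And>x y. exp_abs c (x - y) * cmod (q y) * cmod (\<phi> x) \<le> f (x, y)"
  shows "ffin c q \<phi>"
  unfolding ffin_def
proof (rule Bochner_Integration.integrable_bound[OF f])
  show "AE p in lebesgue \<Otimes>\<^sub>M lebesgue. norm (exp_abs c (fst p - snd p) * cmod (q (snd p)) * cmod (\<phi> (fst p))) \<le> norm (f p)"
  proof (intro AE_I2)
    fix p :: "real \<times> real"
    show "norm (exp_abs c (fst p - snd p) * cmod (q (snd p)) * cmod (\<phi> (fst p))) \<le> norm (f p)"
      using le[of "fst p" "snd p"] by (simp add: abs_mult)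
  qed
qed measurable

lemma ffin_add:
  assumes "ffin c q \<phi>" "ffin c r \<phi>" "q \<in> borel_measurable lebesgue" "r \<in> borel_measurable lebesgue" "\<phi> \<in> borel_measurable lebesgue"
  shows "ffin c (\<lambda>x. q x + r x) \<phi>"
proof (rule ffin_mono)
  show "integrable (lebesgue \<Otimes>\<^sub>M lebesgue) (\<lambda>p. exp_abs c (fst p - snd p) * cmod (q (snd p)) * cmod (\<phi> (fst p)) + exp_abs c (fst p - snd p) * cmod (r (snd p)) * cmod (\<phi> (fst p)))"
    using assms(1,2) unfolding ffin_def by (rule Bochner_Integration.integrable_add)
  fix x y
  have "exp_abs c (x - y) * cmod (q y + r y) * cmod (\<phi> x) \<le> exp_abs c (x - y) * (cmod (q y) + cmod (r y)) * cmod (\<phi> x)"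
    by (intro mult_right_mono mult_left_mono norm_triangle_ineq) auto
  then show "exp_abs c (x - y) * cmod (q y + r y) * cmod (\<phi> x) \<le> exp_abs c (fst (x, y) - snd (x, y)) * cmod (q (snd (x, y))) * cmod (\<phi> (fst (x, y))) + exp_abs c (fst (x, y) - snd (x, y)) * cmod (r (snd (x, y))) * cmod (\<phi> (fst (x, y)))"
    by (simp add: algebra_simps)
qed (use assms in measurable)

text \<open>The product of the two moduli is at most the sum of their squares. Each square is an L1
  function paired with the constant 1, which is a bounded source, so that the L1 case applies to
  each in turn.\<close>

lemma ffin_L2:
  assumes q: "L2 q" and p: "L2 \<phi>" and c: "c > 0"
  shows "ffin c q \<phi>"
proof (rule ffin_mono)
  let ?one = "\<lambda>x::real. 1::complex"
  have s1: "src c ?one" using c by (intro src_bounded[where M=1]) auto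
  have i: "integrable lebesgue (\<lambda>x. complex_of_real ((cmod (q x))\<^sup>2))" "integrable lebesgue (\<lambda>x. complex_of_real ((cmod (\<phi> x))\<^sup>2))"
    using L2D(2)[OF q] L2D(2)[OF p] by (auto intro!: integrable_of_real simp del: of_real_power)
  have "ffin c ?one (\<lambda>x. complex_of_real ((cmod (\<phi> x))\<^sup>2))" by (rule ffin_src_L1[OF s1 i(2)])
  moreover have "ffin c (\<lambda>x. complex_of_real ((cmod (q x))\<^sup>2)) ?one" by (rule ffin_sym[OF ffin_src_L1[OF s1 i(1)]])
  ultimately show "integrable (lebesgue \<Otimes>\<^sub>M lebesgue)
     (\<lambda>z. exp_abs c (fst z - snd z) * (cmod (\<phi> (fst z)))\<^sup>2 + exp_abs c (fst z - snd z) * (cmod (q (snd z)))\<^sup>2)"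
    unfolding ffin_def by (intro Bochner_Integration.integrable_add) (simp_all add: norm_power)
  fix x y
  have "exp_abs c (x - y) * (cmod (q y) * cmod (\<phi> x)) \<le> exp_abs c (x - y) * ((cmod (q y))\<^sup>2 + (cmod (\<phi> x))\<^sup>2)"
    by (intro mult_left_mono mult_le_sq) auto
  then show "exp_abs c (x - y) * cmod (q y) * cmod (\<phi> x) \<le> exp_abs c (fst (x, y) - snd (x, y)) * (cmod (\<phi> (fst (x, y))))\<^sup>2 + exp_abs c (fst (x, y) - snd (x, y)) * (cmod (q (snd (x, y))))\<^sup>2"
    by (simp add: algebra_simps)
qed (use L2D(1)[OF q] L2D(1)[OF p] in auto)

lemma conv_adjoint:
  assumes k: "kern A c b" and m: "q \<in> borel_measurable lebesgue" "\<phi> \<in> borel_measurable lebesgue" and f: "ffin c q \<phi>"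
  shows "(LINT x|lebesgue. conv b q x * \<phi> x) = (LINT y|lebesgue. q y * (LINT x|lebesgue. b (x - y) * \<phi> x))"
    "integrable lebesgue (\<lambda>x. conv b q x * \<phi> x)"
    "integrable lebesgue (\<lambda>y. q y * (LINT x|lebesgue. b (x - y) * \<phi> x))"
proof -
  note [measurable] = m borel_diff_measurable[OF kernD(1)[OF k]]
  define F where "F = (\<lambda>x y. b (x - y) * q y * \<phi> x)"
  have "integrable (lebesgue \<Otimes>\<^sub>M lebesgue) (\<lambda>p. b (fst p - snd p) * q (snd p) * \<phi> (fst p))"
  proof (rule Bochner_Integration.integrable_bound[OF integrable_mult_right[OF f[unfolded ffin_def], of A]])
    show "AE p in lebesgue \<Otimes>\<^sub>M lebesgue. norm (b (fst p - snd p) * q (snd p) * \<phi> (fst p)) \<le> norm (A * (exp_abs c (fst p - snd p) * cmod (q (snd p)) * cmod (\<phi> (fst p))))"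
    proof (intro AE_I2)
      fix p :: "real \<times> real"
      have "cmod (b (fst p - snd p)) * (cmod (q (snd p)) * cmod (\<phi> (fst p))) \<le> A * exp_abs c (fst p - snd p) * (cmod (q (snd p)) * cmod (\<phi> (fst p)))"
        by (intro mult_right_mono kernD(2)[OF k]) auto
      then show "norm (b (fst p - snd p) * q (snd p) * \<phi> (fst p)) \<le> norm (A * (exp_abs c (fst p - snd p) * cmod (q (snd p)) * cmod (\<phi> (fst p))))"
        using kernD(3)[OF k] by (simp add: norm_mult abs_mult mult_ac)
    qed
  qed measurable
  then have I: "integrable (lebesgue \<Otimes>\<^sub>M lebesgue) (case_prod F)"
    by (simp add: F_def case_prod_beta')
  have e1: "(LINT y|lebesgue. F x y) = conv b q x * \<phi> x" for x
    unfolding F_def conv_def by (rule integral_mult_left_zero)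
  have e2: "(LINT x|lebesgue. F x y) = q y * (LINT x|lebesgue. b (x - y) * \<phi> x)" for y
  proof -
    have "F x y = q y * (b (x - y) * \<phi> x)" for x by (simp add: F_def)
    then show ?thesis by (simp only: integral_mult_right_zero)
  qed
  show "(LINT x|lebesgue. conv b q x * \<phi> x) = (LINT y|lebesgue. q y * (LINT x|lebesgue. b (x - y) * \<phi> x))"
    using LL.Fubini_integral[OF I] by (simp only: e1 e2)
  show "integrable lebesgue (\<lambda>x. conv b q x * \<phi> x)"
    using LL.integrable_fst'[OF I] by (simp add: e1)
  show "integrable lebesgue (\<lambda>y. q y * (LINT x|lebesgue. b (x - y) * \<phi> x))"
    using LL.integrable_snd[OF I] by (simp only: e2)
qed

lemma conv_exp_abs_integrable:
  fixes g :: "real \<Rightarrow> real"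
  assumes g: "integrable lebesgue g" and g0: "\<And>x. g x \<ge> 0" and c: "c > 0"
  shows "integrable lebesgue (\<lambda>x. LINT y|lebesgue. exp_abs c (x - y) * g y)"
proof -
  let ?one = "\<lambda>x::real. 1::complex"
  have s1: "src c ?one" using c by (intro src_bounded[where M=1]) auto
  have "ffin c (\<lambda>x. complex_of_real (g x)) ?one"
    by (rule ffin_sym[OF ffin_src_L1[OF s1]]) (use g in \<open>rule integrable_of_real\<close>)
  then have "integrable (lebesgue \<Otimes>\<^sub>M lebesgue) (\<lambda>p. exp_abs c (fst p - snd p) * g (snd p))"
    using g0 by (simp add: ffin_def)
  from LL.integrable_fst'[OF this] show ?thesis by simp
qed

text \<open>A form of Young's inequality. For an L1 source, \<open>Q\<close> is both bounded and
  integrable, so its square is at most a multiple of \<open>Q\<close>. For an L2 source, the weight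
  is split into two factors of half the rate and Cauchy--Schwarz puts one of them onto the
  source.\<close>

lemma conv_L2:
  assumes k: "kern A c b" and c: "c > 0" and q: "integrable lebesgue q \<or> L2 q"
    and m: "conv b q \<in> borel_measurable lebesgue"
  shows "L2 (conv b q)"
proof -
  have qm [measurable]: "q \<in> borel_measurable lebesgue" using q by (auto simp: L2_def)
  have s: "src c q" using q c by (auto intro: src_L1 src_L2)
  define Q where "Q = (\<lambda>x. LINT y|lebesgue. exp_abs c (x - y) * cmod (q y))"
  have iQ: "integrable lebesgue (\<lambda>y. exp_abs c (x - y) * cmod (q y))" for x using s by (auto simp: src_def)
  have Q0: "Q x \<ge> 0" for x unfolding Q_def by (rule integral_nonneg_AE) simp
  have "\<exists>C G. integrable lebesgue G \<and> (\<forall>x. (Q x)\<^sup>2 \<le> C * G x)"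
    using q
  proof
    assume i: "integrable lebesgue q"
    have "Q x \<le> (LINT y|lebesgue. cmod (q y))" for x unfolding Q_def
      using exp_abs_le1[of c] c by (intro integral_mono iQ integrable_norm i) (auto simp: mult_left_le_one_le)
    then have "(Q x)\<^sup>2 \<le> (LINT y|lebesgue. cmod (q y)) * Q x" for x
      using Q0 by (simp add: power2_eq_square mult_right_mono)
    moreover have "integrable lebesgue Q"
      unfolding Q_def using i c by (intro conv_exp_abs_integrable) auto
    ultimately show ?thesis by blast
  next
    assume l: "L2 q"
    define G where "G = (\<lambda>x. LINT y|lebesgue. exp_abs c (x - y) * (cmod (q y))\<^sup>2)"
    have sq: "(exp_abs (c/2) s)\<^sup>2 = exp_abs c s" for s by (simp only: exp_abs_sq) simp
    have "(Q x)\<^sup>2 \<le> (2/c) * G x" for x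
    proof -
      have e: "exp_abs c (x - y) * cmod (q y) = exp_abs (c/2) (x - y) * (exp_abs (c/2) (x - y) * cmod (q y))" for y
        using sq[of "x - y"] by (simp add: power2_eq_square mult.assoc[symmetric])
      have e2: "(exp_abs (c/2) (x - y) * cmod (q y))\<^sup>2 = exp_abs c (x - y) * (cmod (q y))\<^sup>2" for y
        using sq[of "x - y"] by (simp only: power_mult_distrib)
      have i2: "integrable lebesgue (\<lambda>y. exp_abs c (x - y) * (cmod (q y))\<^sup>2)"
        by (rule Bochner_Integration.integrable_bound[OF L2D(2)[OF l]])
           (measurable, use exp_abs_le1[of c] c in \<open>auto simp: abs_mult mult_left_le_one_le\<close>)
      have "(LINT y|lebesgue. exp_abs (c/2) (x - y) * (exp_abs (c/2) (x - y) * cmod (q y)))\<^sup>2 \<le>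
        (LINT y|lebesgue. (exp_abs (c/2) (x - y))\<^sup>2) * (LINT y|lebesgue. (exp_abs (c/2) (x - y) * cmod (q y))\<^sup>2)"
      proof (rule integral_CS)
        show "integrable lebesgue (\<lambda>y. (exp_abs (c/2) (x - y))\<^sup>2)" unfolding sq by (rule exp_abs_integral(1)[OF c])
        show "integrable lebesgue (\<lambda>y. (exp_abs (c/2) (x - y) * cmod (q y))\<^sup>2)" unfolding e2 by (rule i2)
        show "integrable lebesgue (\<lambda>y. exp_abs (c/2) (x - y) * (exp_abs (c/2) (x - y) * cmod (q y)))"
          using iQ[of x] unfolding e .
      qed
      then show ?thesis unfolding Q_def G_def e2 sq e[symmetric] using exp_abs_integral(2)[OF c] by simp
    qed
    moreover have "integrable lebesgue G"
      unfolding G_def using L2D(2)[OF l] c by (intro conv_exp_abs_integrable) auto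
    ultimately show ?thesis by blast
  qed
  then obtain C G where G: "integrable lebesgue G" "\<And>x. (Q x)\<^sup>2 \<le> C * G x" by blast
  have le: "(cmod (conv b q x))\<^sup>2 \<le> A\<^sup>2 * (C * G x)" for x
  proof -
    have "(cmod (conv b q x))\<^sup>2 \<le> (A * Q x)\<^sup>2"
      using conv_norm[OF k s, of x] by (intro power_mono) (auto simp: Q_def)
    also have "\<dots> = A\<^sup>2 * (Q x)\<^sup>2" by (simp add: power_mult_distrib)
    also have "\<dots> \<le> A\<^sup>2 * (C * G x)" using G(2)[of x] by (intro mult_left_mono) auto
    finally show ?thesis .
  qed
  have "integrable lebesgue (\<lambda>x. (cmod (conv b q x))\<^sup>2)"
  proof (rule Bochner_Integration.integrable_bound)
    show "integrable lebesgue (\<lambda>x. A\<^sup>2 * (C * G x))" using G(1) by (intro integrable_mult_right)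
    show "(\<lambda>x. (cmod (conv b q x))\<^sup>2) \<in> borel_measurable lebesgue" using m by measurable
    show "AE x in lebesgue. norm ((cmod (conv b q x))\<^sup>2) \<le> norm (A\<^sup>2 * (C * G x))"
      using le by (intro AE_I2) (simp only: real_norm_def, metis abs_ge_self abs_of_nonneg order_trans zero_le_power2)
  qed
  then show ?thesis using m by (simp add: L2_def)
qed

section \<open>Absolutely continuous functions\<close>

text \<open>Fubini over the triangle below the diagonal of the square. The triangle is encoded by
  convolution with the Heaviside function, a kernel of rate 0, so that \<open>conv_adjoint\<close>
  performs the exchange of integrations.\<close>

lemma ac_ibp:
  fixes F G f g :: "real \<Rightarrow> complex"
  assumes ab: "a \<le> b"
    and f: "set_integrable lebesgue {a..b} f" and g: "set_integrable lebesgue {a..b} g"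
    and F: "\<And>x y. a \<le> x \<Longrightarrow> x \<le> y \<Longrightarrow> y \<le> b \<Longrightarrow> F y - F x = (LINT t:{x..y}|lebesgue. f t)"
    and G: "\<And>x y. a \<le> x \<Longrightarrow> x \<le> y \<Longrightarrow> y \<le> b \<Longrightarrow> G y - G x = (LINT t:{x..y}|lebesgue. g t)"
  shows "(LINT x:{a..b}|lebesgue. F x * g x + f x * G x) = F b * G b - F a * G a"
proof -
  define f0 g0 where "f0 = (\<lambda>x. indicat_real {a..b} x *\<^sub>R f x)" and "g0 = (\<lambda>x. indicat_real {a..b} x *\<^sub>R g x)"
  have i: "integrable lebesgue f0" "integrable lebesgue g0"
    using f g by (auto simp: f0_def g0_def set_integrable_def)
  define h :: "real \<Rightarrow> complex" where "h = indicator {0..}"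
  have k: "kern 1 0 h" by (auto simp: kern_def h_def indicator_def)
  have ff: "ffin 0 f0 g0" by (intro ffin_src_L1 src_L1 i) simp
  note adj = conv_adjoint[OF k borel_measurable_integrable[OF i(1)] borel_measurable_integrable[OF i(2)] ff]
  have c1: "conv h f0 x * g0 x = (F x - F a) * g0 x" for x
  proof (cases "x \<in> {a..b}")
    case True
    have "conv h f0 x = (LINT t:{a..x}|lebesgue. f t)"
      unfolding conv_def set_lebesgue_integral_def
      using True by (intro Bochner_Integration.integral_cong) (auto simp: h_def f0_def indicator_def)
    then show ?thesis using F[of a x] True by simp
  qed (simp add: g0_def)
  have c2: "f0 y * (LINT x|lebesgue. h (x - y) * g0 x) = f0 y * (G b - G y)" for y
  proof (cases "y \<in> {a..b}")
    case True
    have "(LINT x|lebesgue. h (x - y) * g0 x) = (LINT t:{y..b}|lebesgue. g t)"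
      unfolding set_lebesgue_integral_def
      using True by (intro Bochner_Integration.integral_cong) (auto simp: h_def g0_def indicator_def)
    then show ?thesis using G[of y b] True by simp
  qed (simp add: f0_def)
  have I1: "integrable lebesgue (\<lambda>x. (F x - F a) * g0 x)" using adj(2) by (simp only: c1)
  have I2: "integrable lebesgue (\<lambda>x. f0 x * (G b - G x))" using adj(3) by (simp only: c2)
  have E: "(LINT x|lebesgue. (F x - F a) * g0 x) = (LINT x|lebesgue. f0 x * (G b - G x))"
    using adj(1) by (simp only: c1 c2)
  have Gi: "(LINT x|lebesgue. g0 x) = G b - G a" using G[of a b] ab by (simp add: g0_def set_lebesgue_integral_def)
  have Fi: "(LINT x|lebesgue. f0 x) = F b - F a" using F[of a b] ab by (simp add: f0_def set_lebesgue_integral_def)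
  have "(LINT x:{a..b}|lebesgue. F x * g x + f x * G x) =
     (LINT x|lebesgue. ((F x - F a) * g0 x + F a * g0 x) + (f0 x * G b - f0 x * (G b - G x)))"
    unfolding set_lebesgue_integral_def
    by (intro Bochner_Integration.integral_cong) (auto simp: f0_def g0_def indicator_def algebra_simps)
  also have "\<dots> = ((LINT x|lebesgue. (F x - F a) * g0 x) + F a * (G b - G a)) +
     ((F b - F a) * G b - (LINT x|lebesgue. f0 x * (G b - G x)))"
    using I1 I2 i by (simp add: Gi Fi)
  also have "\<dots> = F b * G b - F a * G a" unfolding E by (simp add: algebra_simps)
  finally show ?thesis .
qed

lemma tendsto_integrable_imp_zero:
  fixes h :: "real \<Rightarrow> complex"
  assumes h: "(h \<longlongrightarrow> L) at_top" and i: "set_integrable lebesgue {a..} h"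
  shows "L = 0"
proof (rule ccontr)
  assume L: "L \<noteq> 0"
  then have "\<forall>\<^sub>F x in at_top. dist (h x) L < cmod L / 2" using h by (intro tendstoD) auto
  then obtain N where N: "\<And>x. x \<ge> N \<Longrightarrow> dist (h x) L < cmod L / 2" by (auto simp: eventually_at_top_linorder)
  define M where "M = max N a"
  have big: "cmod (h x) \<ge> cmod L / 2" if "x \<ge> M" for x
    using N[of x] that norm_triangle_ineq2[of L "L - h x"] by (simp add: M_def dist_norm norm_minus_commute)
  have in': "integrable lebesgue (\<lambda>x. indicat_real {a..} x * cmod (h x))"
    using integrable_norm[OF i[unfolded set_integrable_def]] by simp
  define I where "I = (LINT x|lebesgue. indicat_real {a..} x * cmod (h x))"
  have "real n * (cmod L / 2) \<le> I" for n :: nat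
  proof -
    have "(LINT x|lebesgue. (cmod L / 2) * indicat_real {M..M + real n} x) \<le> I"
      unfolding I_def
    proof (rule integral_mono)
      show "(cmod L / 2) * indicat_real {M..M + real n} x \<le> indicat_real {a..} x * cmod (h x)" for x
        using big[of x] by (auto simp: indicator_def M_def)
    qed (use in' in auto)
    then show ?thesis by (simp add: mult.commute)
  qed
  moreover obtain n :: nat where "real n > I / (cmod L / 2)" using reals_Archimedean2 by blast
  ultimately show False using L by (smt (verit) divide_less_eq half_gt_zero_iff zero_less_norm_iff)
qed

text \<open>The boundary term at infinity: by the formula on bounded intervals
  \<open>F b * G b\<close> has a limit, and since \<open>F * G\<close> is itself integrable, this
  limit is 0.\<close>

lemma ac_ibp_atLeast:
  fixes F G f g :: "real \<Rightarrow> complex"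
  assumes f: "\<And>b. set_integrable lebesgue {a..b} f" and g: "\<And>b. set_integrable lebesgue {a..b} g"
    and F: "\<And>x y. a \<le> x \<Longrightarrow> x \<le> y \<Longrightarrow> F y - F x = (LINT t:{x..y}|lebesgue. f t)"
    and G: "\<And>x y. a \<le> x \<Longrightarrow> x \<le> y \<Longrightarrow> G y - G x = (LINT t:{x..y}|lebesgue. g t)"
    and i: "set_integrable lebesgue {a..} (\<lambda>x. F x * g x)" "set_integrable lebesgue {a..} (\<lambda>x. f x * G x)"
      "set_integrable lebesgue {a..} (\<lambda>x. F x * G x)"
  shows "(LINT x:{a..}|lebesgue. F x * g x) = - F a * G a - (LINT x:{a..}|lebesgue. f x * G x)"
proof -
  have I: "set_integrable lebesgue {a..} (\<lambda>x. F x * g x + f x * G x)" by (intro set_integral_add i)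
  have "((\<lambda>b. LINT x:{a..b}|lebesgue. F x * g x + f x * G x) \<longlongrightarrow> (LINT x:{a..}|lebesgue. F x * g x + f x * G x)) at_top"
    by (rule tendsto_set_lebesgue_integral_at_top[OF _ I]) auto
  then have "((\<lambda>b. F a * G a + (LINT x:{a..b}|lebesgue. F x * g x + f x * G x)) \<longlongrightarrow> F a * G a + (LINT x:{a..}|lebesgue. F x * g x + f x * G x)) at_top"
    by (intro tendsto_intros)
  moreover have "\<forall>\<^sub>F b in at_top. F a * G a + (LINT x:{a..b}|lebesgue. F x * g x + f x * G x) = F b * G b"
    using eventually_ge_at_top[of a]
  proof eventually_elim
    case (elim b)
    show ?case using ac_ibp[OF elim f g F G] by simp
  qed
  ultimately have "((\<lambda>b. F b * G b) \<longlongrightarrow> F a * G a + (LINT x:{a..}|lebesgue. F x * g x + f x * G x)) at_top"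
    using tendsto_cong by force
  from tendsto_integrable_imp_zero[OF this i(3)]
  have "F a * G a + ((LINT x:{a..}|lebesgue. F x * g x) + (LINT x:{a..}|lebesgue. f x * G x)) = 0"
    using set_integral_add(2)[OF i(1,2)] by simp
  then show ?thesis by (simp add: algebra_simps add_eq_0_iff)
qed

lemma ftc_lebesgue:
  fixes F :: "real \<Rightarrow> complex"
  assumes d: "\<And>x. (F has_vector_derivative f x) (at x)" and c: "continuous_on UNIV f"
  shows "set_integrable lebesgue {a..b} f" "a \<le> b \<Longrightarrow> F b - F a = (LINT t:{a..b}|lebesgue. f t)"
proof -
  show i: "set_integrable lebesgue {a..b} f"
    by (rule absolutely_integrable_continuous_real) (rule continuous_on_subset[OF c], simp)
  assume ab: "a \<le> b"
  have "(f has_integral (F b - F a)) {a..b}"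
    by (rule fundamental_theorem_of_calculus[OF ab]) (rule has_vector_derivative_at_within[OF d])
  then show "F b - F a = (LINT t:{a..b}|lebesgue. f t)"
    using set_lebesgue_integral_eq_integral(2)[OF i] by (simp add: integral_unique)
qed

text \<open>A local form of \<open>H2\<close> that imposes nothing at infinity and carries the
  derivatives as parameters. It serves for test functions, for translates of the kernel, and for
  bounded solutions whose square integrability is still open.\<close>

definition W2 :: "(real \<Rightarrow> complex) \<Rightarrow> (real \<Rightarrow> complex) \<Rightarrow> (real \<Rightarrow> complex) \<Rightarrow> bool" where
  "W2 \<phi> \<phi>1 \<phi>2 \<longleftrightarrow> (\<forall>x. (\<phi> has_vector_derivative \<phi>1 x) (at x)) \<and>
    (\<forall>a b. set_integrable lebesgue {a..b} \<phi>2) \<and>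
    (\<forall>a b. a \<le> b \<longrightarrow> \<phi>1 b - \<phi>1 a = (LINT t:{a..b}|lebesgue. \<phi>2 t))"

lemma ac_continuous:
  fixes F :: "real \<Rightarrow> complex"
  assumes i: "\<And>a b. set_integrable lebesgue {a..b} f"
    and F: "\<And>a b. a \<le> b \<Longrightarrow> F b - F a = (LINT t:{a..b}|lebesgue. f t)"
  shows "continuous_on UNIV F"
proof -
  have "continuous (at x) F" for x
  proof -
    have io: "f integrable_on {x - 1..x + 1}"
      using set_lebesgue_integral_eq_integral(1)[OF i] .
    have "continuous_on {x - 1..x + 1} (\<lambda>y. integral {x - 1..y} f)"
      by (rule indefinite_integral_continuous_1[OF io])
    then have "continuous_on {x - 1..x + 1} (\<lambda>y. F (x - 1) + integral {x - 1..y} f)"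
      by (intro continuous_intros)
    then have "continuous_on {x - 1..x + 1} F"
    proof (rule continuous_on_eq)
      fix y assume "y \<in> {x - 1..x + 1}"
      then show "F (x - 1) + integral {x - 1..y} f = F y"
        using F[of "x - 1" y] set_lebesgue_integral_eq_integral(2)[OF i, of "x - 1" y]
        by (simp add: algebra_simps)
    qed
    then have "continuous_on {x - 1<..<x + 1} F" by (rule continuous_on_subset) auto
    then show ?thesis by (simp add: continuous_on_eq_continuous_at)
  qed
  then show ?thesis by (simp add: continuous_at_imp_continuous_on)
qed

lemma W2_cont:
  assumes "W2 \<phi> \<phi>1 \<phi>2"
  shows "continuous_on UNIV \<phi>" "continuous_on UNIV \<phi>1"
proof -
  have "continuous (at x) \<phi>" for x using assms has_vector_derivative_continuous unfolding W2_def by blast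
  then show "continuous_on UNIV \<phi>" by (simp add: continuous_at_imp_continuous_on)
  show "continuous_on UNIV \<phi>1" using assms unfolding W2_def by (intro ac_continuous) auto
qed

lemma set_integral_reflect:
  fixes f :: "real \<Rightarrow> complex"
  shows "set_integrable lebesgue A f \<longleftrightarrow> set_integrable lebesgue (uminus ` A) (\<lambda>x. f (- x))"
    "(LINT x:A|lebesgue. f x) = (LINT x:uminus ` A|lebesgue. f (- x))"
proof -
  have e: "indicat_real A (- x) = indicat_real (uminus ` A) x" for x
    by (auto simp: indicator_def image_iff)
  show "set_integrable lebesgue A f \<longleftrightarrow> set_integrable lebesgue (uminus ` A) (\<lambda>x. f (- x))"
    using lebesgue_integrable_real_affine_iff[of "-1" "\<lambda>x. indicat_real A x *\<^sub>R f x" 0]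
    by (simp add: set_integrable_def e)
  show "(LINT x:A|lebesgue. f x) = (LINT x:uminus ` A|lebesgue. f (- x))"
    using lebesgue_integral_real_affine[of "-1" "\<lambda>x. indicat_real A x *\<^sub>R f x" 0]
    by (simp add: set_lebesgue_integral_def e)
qed

lemma W2_reflect:
  assumes W: "W2 \<phi> \<phi>1 \<phi>2"
  shows "W2 (\<lambda>x. \<phi> (- x)) (\<lambda>x. - \<phi>1 (- x)) (\<lambda>x. \<phi>2 (- x))"
  unfolding W2_def
proof (intro conjI allI impI)
  fix x
  have d: "(\<phi> has_vector_derivative \<phi>1 (- x)) (at (- x))" using W by (simp add: W2_def)
  have "((\<phi> \<circ> uminus) has_vector_derivative (- 1) *\<^sub>R \<phi>1 (- x)) (at x)"
    by (rule vector_diff_chain_at) (auto intro!: derivative_eq_intros d)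
  then show "((\<lambda>x. \<phi> (- x)) has_vector_derivative - \<phi>1 (- x)) (at x)" by (simp add: comp_def)
next
  fix a b :: real
  show "set_integrable lebesgue {a..b} (\<lambda>x. \<phi>2 (- x))"
    using W set_integral_reflect(1)[of "{-b..-a}" \<phi>2] by (simp add: W2_def)
  assume "a \<le> b"
  then have "\<phi>1 (-a) - \<phi>1 (-b) = (LINT t:{-b..-a}|lebesgue. \<phi>2 t)" using W by (simp add: W2_def)
  then show "- \<phi>1 (- b) - - \<phi>1 (- a) = (LINT t:{a..b}|lebesgue. \<phi>2 (- t))"
    using set_integral_reflect(2)[of "{-b..-a}" \<phi>2] by simp
qed

lemma W2_cnj:
  assumes W: "W2 \<phi> \<phi>1 \<phi>2"
  shows "W2 (\<lambda>x. cnj (\<phi> x)) (\<lambda>x. cnj (\<phi>1 x)) (\<lambda>x. cnj (\<phi>2 x))"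
  unfolding W2_def
proof (intro conjI allI impI)
  fix x
  show "((\<lambda>x. cnj (\<phi> x)) has_vector_derivative cnj (\<phi>1 x)) (at x)"
    using W by (auto simp: W2_def intro!: has_vector_derivative_cnj)
next
  fix a b :: real
  have e: "(\<lambda>x. indicat_real {a..b} x *\<^sub>R cnj (\<phi>2 x)) = (\<lambda>x. cnj (indicat_real {a..b} x *\<^sub>R \<phi>2 x))" by simp
  have i: "set_integrable lebesgue {a..b} \<phi>2" using W by (simp add: W2_def)
  then show "set_integrable lebesgue {a..b} (\<lambda>x. cnj (\<phi>2 x))"
    unfolding set_integrable_def e by (rule integrable_bounded_linear[OF bounded_linear_cnj])
  assume "a \<le> b"
  then have "\<phi>1 b - \<phi>1 a = (LINT t:{a..b}|lebesgue. \<phi>2 t)" using W by (simp add: W2_def)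
  then have "cnj (\<phi>1 b) - cnj (\<phi>1 a) = cnj (LINT t:{a..b}|lebesgue. \<phi>2 t)" by (metis complex_cnj_diff)
  also have "\<dots> = (LINT t:{a..b}|lebesgue. cnj (\<phi>2 t))"
    unfolding set_lebesgue_integral_def e
    by (rule integral_bounded_linear[OF bounded_linear_cnj i[unfolded set_integrable_def], symmetric])
  finally show "cnj (\<phi>1 b) - cnj (\<phi>1 a) = (LINT t:{a..b}|lebesgue. cnj (\<phi>2 t))" .
qed

section \<open>The free resolvent kernel\<close>

text \<open>The boundary rays are included: \<open>\<zeta> = k\<close> and \<open>\<zeta> = \<i> k\<close> with \<open>k > 0\<close> give \<open>R\<^sub>0(\<lambda> + i0)\<close> and
  \<open>R\<^sub>0(\<lambda> - i0)\<close> for \<open>\<lambda> = k^4\<close>, and there the decay rate of the kernel is 0.\<close>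
definition quadrant :: "complex \<Rightarrow> bool" where
  "quadrant \<zeta> \<longleftrightarrow> \<zeta> \<noteq> 0 \<and> 0 \<le> Re \<zeta> \<and> 0 \<le> Im \<zeta>"

definition decay_rate :: "complex \<Rightarrow> real" where "decay_rate \<zeta> = min (Re \<zeta>) (Im \<zeta>)"

text \<open>The \<open>j\<close>-th derivative of the free resolvent kernel on the half line \<open>s \<ge> 0\<close>; \<open>green\<close> is its extension
  to the line by parity.\<close>
definition green_half :: "complex \<Rightarrow> nat \<Rightarrow> real \<Rightarrow> complex" where
  "green_half \<zeta> j s = (\<i> * (\<i> * \<zeta>) ^ j * exp (\<i> * \<zeta> * of_real s) - (- \<zeta>) ^ j * exp (- \<zeta> * of_real s)) / (4 * \<zeta> ^ 3)"

definition green :: "complex \<Rightarrow> nat \<Rightarrow> real \<Rightarrow> complex" where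
  "green \<zeta> j s = (if even j then 1 else of_real (sgn s)) * green_half \<zeta> j \<bar>s\<bar>"

text \<open>Each of the two exponentials in the kernel contributes at most half of this.\<close>

definition green_norm :: "complex \<Rightarrow> nat \<Rightarrow> real" where "green_norm \<zeta> j = cmod \<zeta> ^ j / (2 * cmod \<zeta> ^ 3)"

lemma decay_rate_nonneg: "quadrant \<zeta> \<Longrightarrow> decay_rate \<zeta> \<ge> 0" by (simp add: quadrant_def decay_rate_def)

lemma green_norm_nonneg: "green_norm \<zeta> j \<ge> 0" by (simp add: green_norm_def)

lemma green_half_deriv: "(green_half \<zeta> j has_vector_derivative green_half \<zeta> (Suc j) s) (at s)"
proof -
  have "((\<lambda>z. \<i> * (\<i> * \<zeta>) ^ j * exp (\<i> * \<zeta> * z) - (- \<zeta>) ^ j * exp (- \<zeta> * z)) has_field_derivative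
    \<i> * (\<i> * \<zeta>) ^ Suc j * exp (\<i> * \<zeta> * of_real s) - (- \<zeta>) ^ Suc j * exp (- \<zeta> * of_real s)) (at (of_real s))"
    by (auto intro!: derivative_eq_intros simp: algebra_simps)
  from has_vector_derivative_real_field[OF DERIV_cdivide[OF this, of "4 * \<zeta> ^ 3"]] show ?thesis by (simp add: green_half_def[abs_def])
qed

lemma green_half_cont: "continuous_on UNIV (green_half \<zeta> j)"
proof -
  have "continuous (at x) (green_half \<zeta> j)" for x using has_vector_derivative_continuous[OF green_half_deriv] .
  then show ?thesis by (simp add: continuous_at_imp_continuous_on)
qed

text \<open>These values say that the extension by parity is a fundamental solution: the first
  derivative is continuous at 0, the third jumps from -1/2 to 1/2, and four derivatives reproduce
  the kernel with factor \<zeta>^4.\<close>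

lemma green_half_vals: "\<zeta> \<noteq> 0 \<Longrightarrow> green_half \<zeta> 1 0 = 0" "\<zeta> \<noteq> 0 \<Longrightarrow> green_half \<zeta> 3 0 = 1/2" "green_half \<zeta> (Suc (Suc (Suc (Suc j)))) s = \<zeta> ^ 4 * green_half \<zeta> j s"
proof -
  show "\<zeta> \<noteq> 0 \<Longrightarrow> green_half \<zeta> 1 0 = 0" by (simp add: green_half_def)
  show "\<zeta> \<noteq> 0 \<Longrightarrow> green_half \<zeta> 3 0 = 1/2" by (simp add: green_half_def power3_eq_cube field_simps)
  have n: "Suc (Suc (Suc (Suc j))) = 4 + j" by simp
  have "(\<i> * \<zeta>) ^ Suc (Suc (Suc (Suc j))) = \<zeta> ^ 4 * (\<i> * \<zeta>) ^ j"
    unfolding n power_add by (simp add: power_mult_distrib)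
  moreover have "(- \<zeta>) ^ Suc (Suc (Suc (Suc j))) = \<zeta> ^ 4 * (- \<zeta>) ^ j"
    unfolding n power_add by simp
  ultimately show "green_half \<zeta> (Suc (Suc (Suc (Suc j)))) s = \<zeta> ^ 4 * green_half \<zeta> j s"
    unfolding green_half_def by (simp only: times_divide_eq_right) (simp add: algebra_simps)
qed

lemma green_half_norm:
  assumes q: "quadrant \<zeta>" and s: "s \<ge> 0"
  shows "cmod (green_half \<zeta> j s) \<le> green_norm \<zeta> j * exp_abs (decay_rate \<zeta>) s"
proof -
  have e1: "cmod (exp (\<i> * \<zeta> * of_real s)) \<le> exp_abs (decay_rate \<zeta>) s"
    using s by (simp add: norm_exp_eq_Re decay_rate_def mult_right_mono)
  have e2: "cmod (exp (- \<zeta> * of_real s)) \<le> exp_abs (decay_rate \<zeta>) s"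
    using s by (simp add: norm_exp_eq_Re decay_rate_def mult_right_mono)
  have "cmod (\<i> * (\<i> * \<zeta>) ^ j * exp (\<i> * \<zeta> * of_real s) - (- \<zeta>) ^ j * exp (- \<zeta> * of_real s))
    \<le> cmod \<zeta> ^ j * cmod (exp (\<i> * \<zeta> * of_real s)) + cmod \<zeta> ^ j * cmod (exp (- \<zeta> * of_real s))"
    by (rule order_trans[OF norm_triangle_ineq4]) (simp add: norm_mult norm_power del: norm_exp_eq_Re)
  also have "\<dots> \<le> cmod \<zeta> ^ j * exp_abs (decay_rate \<zeta>) s + cmod \<zeta> ^ j * exp_abs (decay_rate \<zeta>) s"
    by (intro add_mono mult_left_mono e1 e2) auto
  finally have "cmod (green_half \<zeta> j s) \<le> (cmod \<zeta> ^ j * exp_abs (decay_rate \<zeta>) s + cmod \<zeta> ^ j * exp_abs (decay_rate \<zeta>) s) / cmod (4 * \<zeta> ^ 3)"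
    unfolding green_half_def norm_divide by (rule divide_right_mono) simp
  then show ?thesis by (simp add: green_norm_def norm_mult norm_power)
qed

lemma green_norm: "quadrant \<zeta> \<Longrightarrow> cmod (green \<zeta> j s) \<le> green_norm \<zeta> j * exp_abs (decay_rate \<zeta>) s"
  using green_half_norm[of \<zeta> "\<bar>s\<bar>" j] green_norm_nonneg[of \<zeta> j] by (auto simp: green_def norm_mult sgn_if)

lemma green_kern: assumes "quadrant \<zeta>" shows "kern (green_norm \<zeta> j) (decay_rate \<zeta>) (green \<zeta> j)"
proof -
  have [measurable]: "(\<lambda>s. green_half \<zeta> j \<bar>s\<bar>) \<in> borel_measurable borel"
    by (intro borel_measurable_continuous_onI continuous_on_compose2[OF green_half_cont] continuous_intros) auto
  have [measurable]: "(\<lambda>s::real. complex_of_real (sgn s)) \<in> borel_measurable borel"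
    by (simp add: sgn_if) 
  have "green \<zeta> j \<in> borel_measurable borel"
    unfolding green_def[abs_def] by (cases "even j") simp_all
  then show ?thesis using green_norm[OF assms] by (simp add: kern_def)
qed

lemma green_pos: "s > 0 \<Longrightarrow> green \<zeta> j s = green_half \<zeta> j s" by (simp add: green_def)
lemma green_neg: "s < 0 \<Longrightarrow> green \<zeta> j s = (-1) ^ j * green_half \<zeta> j (- s)" by (auto simp: green_def)

lemma green_deriv_nz:
  assumes "s \<noteq> 0"
  shows "(green \<zeta> j has_vector_derivative green \<zeta> (Suc j) s) (at s)"
proof (cases "s > 0")
  case True
  show ?thesis
  proof (rule has_vector_derivative_transform_within_open)
    show "(green_half \<zeta> j has_vector_derivative green \<zeta> (Suc j) s) (at s)" using green_half_deriv[of \<zeta> j s] green_pos[OF True] by simp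
    show "open {0::real<..}" "s \<in> {0<..}" using True by auto
  qed (simp add: green_pos)
next
  case False
  then have s: "s < 0" using assms by simp
  show ?thesis
  proof (rule has_vector_derivative_transform_within_open)
    have "((green_half \<zeta> j \<circ> uminus) has_vector_derivative (-1) *\<^sub>R green_half \<zeta> (Suc j) (- s)) (at s)"
      by (rule vector_diff_chain_at) (auto intro!: derivative_eq_intros green_half_deriv)
    then have "((\<lambda>x. (-1) ^ j * green_half \<zeta> j (- x)) has_vector_derivative (-1) ^ j * ((-1) *\<^sub>R green_half \<zeta> (Suc j) (- s))) (at s)"
      unfolding comp_def by (rule has_vector_derivative_mult_right)
    then show "((\<lambda>x. (-1) ^ j * green_half \<zeta> j (- x)) has_vector_derivative green \<zeta> (Suc j) s) (at s)"
      by (simp add: green_neg[OF s])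
    show "open {..<0::real}" "s \<in> {..<0}" using s by auto
  qed (simp add: green_neg)
qed

text \<open>At 0 everything is expressed by the one-sided quotient \<open>Q\<close> at
  \<bar>h\<bar>. For j = 0 the quotients agree up to sign, which is harmless as the limit is 0; for
  j = 1 the sign of the odd extension cancels that of h.\<close>

lemma green_deriv:
  assumes z: "\<zeta> \<noteq> 0" and j: "j \<le> 1"
  shows "(green \<zeta> j has_vector_derivative green \<zeta> (Suc j) s) (at s)"
proof (cases "s = 0")
  case True
  define Q where "Q = (\<lambda>t. (green_half \<zeta> j t - green_half \<zeta> j 0) /\<^sub>R t)"
  have "(Q \<longlongrightarrow> green_half \<zeta> (Suc j) 0) (at 0)"
    using green_half_deriv[of \<zeta> j 0] unfolding has_vector_derivative_at_quotient by (simp add: Q_def)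
  moreover have "filterlim (\<lambda>h::real. \<bar>h\<bar>) (at 0) (at 0)"
    unfolding filterlim_at by (auto intro!: tendsto_eq_intros simp: eventually_at_filter)
  ultimately have q: "((\<lambda>h. Q \<bar>h\<bar>) \<longlongrightarrow> green_half \<zeta> (Suc j) 0) (at 0)" by (rule filterlim_compose)
  have "j = 0 \<or> j = 1" using j by auto
  then show ?thesis
  proof
    assume j: "j = 0"
    have q0: "((\<lambda>h. Q \<bar>h\<bar>) \<longlongrightarrow> 0) (at 0)" using q green_half_vals(1)[OF z] j by simp
    have "((\<lambda>h. (green \<zeta> j (0 + h) - green \<zeta> j 0) /\<^sub>R h) \<longlongrightarrow> 0) (at 0)"
      by (rule Lim_null_comparison[OF always_eventually tendsto_norm_zero[OF q0]])
         (simp add: Q_def green_def j)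
    then show ?thesis unfolding has_vector_derivative_at_quotient True by (simp add: j green_def)
  next
    assume j: "j = 1"
    have "(green \<zeta> j (0 + h) - green \<zeta> j 0) /\<^sub>R h = Q \<bar>h\<bar>" for h
      using green_half_vals(1)[OF z] by (cases "h > 0"; cases "h = 0") (auto simp: Q_def green_def j)
    then show ?thesis using q unfolding has_vector_derivative_at_quotient True by (simp add: j green_def)
  qed
qed (rule green_deriv_nz)

lemma green_cont:
  assumes z: "\<zeta> \<noteq> 0" and j: "j \<le> 2"
  shows "continuous_on UNIV (green \<zeta> j)"
proof (cases "j = 2")
  case True
  then have "green \<zeta> j = (\<lambda>s. green_half \<zeta> j \<bar>s\<bar>)" by (auto simp: green_def)
  then show ?thesis
    by (simp add: continuous_on_compose2[OF green_half_cont] continuous_intros)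
next
  case False
  then have "j \<le> 1" using j by simp
  then have "continuous (at x) (green \<zeta> j)" for x using has_vector_derivative_continuous[OF green_deriv[OF z]] by blast
  then show ?thesis by (simp add: continuous_at_imp_continuous_on)
qed

lemma green_isCont: "s \<noteq> 0 \<Longrightarrow> isCont (green \<zeta> j) s"
  using has_vector_derivative_continuous[OF green_deriv_nz] .

text \<open>For j = 2 the kernel is continuous but has a corner at 0, so the fundamental theorem of
  calculus is used with 0 as exceptional point.\<close>

lemma green_lip_le:
  assumes q: "quadrant \<zeta>" and j: "j \<le> 2" and ab: "a \<le> b" and B: "B \<ge> 0"
    and le: "\<And>t. a \<le> t \<Longrightarrow> t \<le> b \<Longrightarrow> green_norm \<zeta> (Suc j) * exp_abs (decay_rate \<zeta>) t \<le> B"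
  shows "cmod (green \<zeta> j b - green \<zeta> j a) \<le> B * (b - a)"
proof -
  have z: "\<zeta> \<noteq> 0" using q by (simp add: quadrant_def)
  have "(green \<zeta> (Suc j) has_integral (green \<zeta> j b - green \<zeta> j a)) {a..b}"
    by (rule fundamental_theorem_of_calculus_interior_strong[of "{0}"])
       (auto intro: green_deriv_nz ab continuous_on_subset[OF green_cont[OF z j]])
  then have "norm (green \<zeta> j b - green \<zeta> j a) \<le> B * measure lborel (cbox a b)"
    by (intro has_integral_bound[OF B]) (auto intro!: order_trans[OF green_norm[OF q] le])
  then show ?thesis using ab by simp
qed

lemma green_lip:
  assumes q: "quadrant \<zeta>" and j: "j \<le> 2" and h: "\<bar>h\<bar> \<le> 1"
  shows "cmod (green \<zeta> j (s + h) - green \<zeta> j s) \<le> \<bar>h\<bar> * (green_norm \<zeta> (Suc j) * exp (decay_rate \<zeta>) * exp_abs (decay_rate \<zeta>) s)"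
proof -
  let ?B = "green_norm \<zeta> (Suc j) * exp (decay_rate \<zeta>) * exp_abs (decay_rate \<zeta>) s"
  have le: "green_norm \<zeta> (Suc j) * exp_abs (decay_rate \<zeta>) t \<le> ?B" if "\<bar>t - s\<bar> \<le> 1" for t
    using exp_abs_shift[OF decay_rate_nonneg[OF q] that, of s] green_norm_nonneg[of \<zeta> "Suc j"]
    by (simp add: mult.assoc mult_left_mono)
  have B: "?B \<ge> 0" using green_norm_nonneg by simp
  show ?thesis
  proof (cases "h \<ge> 0")
    case True
    show ?thesis
      using green_lip_le[OF q j _ B le, of s "s + h"] True h by (simp add: mult.commute)
  next
    case False
    show ?thesis
      using green_lip_le[OF q j _ B le, of "s + h" s] False h by (simp add: mult.commute norm_minus_commute)
  qed
qed

lemma r0k_eq: "r0k \<zeta> = green \<zeta> 0"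
  by (simp add: r0k_def green_def green_half_def fun_eq_iff)

lemma r0k1_eq: "\<zeta> \<noteq> 0 \<Longrightarrow> r0k1 \<zeta> = green \<zeta> 1"
  using vector_derivative_at[OF green_deriv[of \<zeta> 0]] by (simp add: r0k1_def[abs_def] r0k_eq)

lemma r0k2_eq: "\<zeta> \<noteq> 0 \<Longrightarrow> r0k2 \<zeta> = green \<zeta> 2"
  using vector_derivative_at[OF green_deriv[of \<zeta> 1]] by (simp add: r0k2_def[abs_def] r0k1_eq numeral_2_eq_2)

text \<open>The \<open>j\<close>-th derivative of \<open>R\<^sub>0(q + r')\<close>, with the derivative of \<open>r\<close> moved onto the kernel.\<close>
definition green_op :: "complex \<Rightarrow> nat \<Rightarrow> (real \<Rightarrow> complex) \<Rightarrow> (real \<Rightarrow> complex) \<Rightarrow> real \<Rightarrow> complex" where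
  "green_op \<zeta> j q r x = conv (green \<zeta> j) q x + conv (green \<zeta> (Suc j)) r x"

lemma conv_green_deriv:
  assumes q: "quadrant \<zeta>" and j: "j \<le> 2" and s: "src (decay_rate \<zeta>) q"
  shows "(conv (green \<zeta> j) q has_vector_derivative conv (green \<zeta> (Suc j)) q x) (at x)"
  by (rule conv_deriv[OF green_kern[OF q] green_kern[OF q] s _ _ green_deriv_nz, of "green_norm \<zeta> (Suc j) * exp (decay_rate \<zeta>)"])
     (use green_lip[OF q j] green_norm_nonneg in auto)

lemma green_op_deriv:
  assumes "quadrant \<zeta>" "j \<le> 1" "src (decay_rate \<zeta>) q" "src (decay_rate \<zeta>) r"
  shows "(green_op \<zeta> j q r has_vector_derivative green_op \<zeta> (Suc j) q r x) (at x)"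
  unfolding green_op_def[abs_def] using assms by (intro has_vector_derivative_add conv_green_deriv) auto

lemma conv_green_cont:
  assumes q: "quadrant \<zeta>" and s: "src (decay_rate \<zeta>) q"
  shows "continuous_on UNIV (conv (green \<zeta> j) q)"
  by (rule conv_continuous[OF green_kern[OF q] decay_rate_nonneg[OF q] s green_isCont])

lemma green_op_cont:
  assumes "quadrant \<zeta>" "src (decay_rate \<zeta>) q" "src (decay_rate \<zeta>) r"
  shows "continuous_on UNIV (green_op \<zeta> j q r)"
  unfolding green_op_def[abs_def] using assms by (intro continuous_intros conv_green_cont)

lemma green_op_bounded:
  assumes q: "quadrant \<zeta>" and s: "src (decay_rate \<zeta>) q" "src (decay_rate \<zeta>) r"
  shows "\<exists>M. \<forall>x. cmod (green_op \<zeta> j q r x) \<le> M"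
proof -
  obtain M N where "\<And>x. cmod (conv (green \<zeta> j) q x) \<le> M" "\<And>x. cmod (conv (green \<zeta> (Suc j)) r x) \<le> N"
    using conv_bounded[OF green_kern[OF q] s(1)] conv_bounded[OF green_kern[OF q] s(2)] by blast
  then have "cmod (green_op \<zeta> j q r x) \<le> M + N" for x
    unfolding green_op_def by (meson add_mono norm_triangle_le)
  then show ?thesis by blast
qed

lemma green_op_W2:
  assumes "quadrant \<zeta>" "src (decay_rate \<zeta>) q" "src (decay_rate \<zeta>) r"
  shows "W2 (green_op \<zeta> 0 q r) (green_op \<zeta> 1 q r) (green_op \<zeta> 2 q r)"
  unfolding W2_def
proof (intro conjI allI impI)
  have d: "(green_op \<zeta> 1 q r has_vector_derivative green_op \<zeta> 2 q r x) (at x)" for x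
    using green_op_deriv[OF assms(1) _ assms(2,3), of 1] by (simp add: numeral_2_eq_2)
  show "(green_op \<zeta> 0 q r has_vector_derivative green_op \<zeta> 1 q r x) (at x)" for x
    using green_op_deriv[OF assms(1) _ assms(2,3), of 0] by simp
  show "set_integrable lebesgue {a..b} (green_op \<zeta> 2 q r)" for a b
    by (rule ftc_lebesgue[OF d green_op_cont[OF assms]])
  show "green_op \<zeta> 1 q r b - green_op \<zeta> 1 q r a = (LINT t:{a..b}|lebesgue. green_op \<zeta> 2 q r t)" if "a \<le> b" for a b
    by (rule ftc_lebesgue(2)[OF d green_op_cont[OF assms] that])
qed

lemma green_W2:
  assumes q: "quadrant \<zeta>"
  shows "W2 (\<lambda>x. green \<zeta> 0 (x - y)) (\<lambda>x. green \<zeta> 1 (x - y)) (\<lambda>x. green \<zeta> 2 (x - y))"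
  unfolding W2_def
proof (intro conjI allI impI)
  have z: "\<zeta> \<noteq> 0" using q by (simp add: quadrant_def)
  have sh: "((\<lambda>x. green \<zeta> j (x - y)) has_vector_derivative green \<zeta> (Suc j) (x - y)) (at x)" if "j \<le> 1" for j x
  proof -
    have "((green \<zeta> j \<circ> (\<lambda>x. x - y)) has_vector_derivative 1 *\<^sub>R green \<zeta> (Suc j) (x - y)) (at x)"
      by (rule vector_diff_chain_at) (auto intro!: derivative_eq_intros green_deriv z that)
    then show ?thesis by (simp add: comp_def)
  qed
  have d: "((\<lambda>x. green \<zeta> 1 (x - y)) has_vector_derivative green \<zeta> 2 (x - y)) (at x)" for x
    using sh[of 1] by (simp add: numeral_2_eq_2)
  show "((\<lambda>x. green \<zeta> 0 (x - y)) has_vector_derivative green \<zeta> 1 (x - y)) (at x)" for x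
    using sh[of 0] by simp
  have c: "continuous_on UNIV (\<lambda>x. green \<zeta> 2 (x - y))"
    by (intro continuous_on_compose2[OF green_cont[OF z]] continuous_intros) auto
  show "set_integrable lebesgue {a..b} (\<lambda>x. green \<zeta> 2 (x - y))" for a b
    by (rule ftc_lebesgue[OF d c])
  show "green \<zeta> 1 (b - y) - green \<zeta> 1 (a - y) = (LINT t:{a..b}|lebesgue. green \<zeta> 2 (t - y))" if "a \<le> b" for a b
    by (rule ftc_lebesgue(2)[OF d c that])
qed

section \<open>Green's formulas for the free kernel\<close>

lemma green_half_src_integrable:
  assumes q: "quadrant \<zeta>" and s: "src (decay_rate \<zeta>) \<psi>"
  shows "set_integrable lebesgue {y..} (\<lambda>x. green_half \<zeta> j (x - y) * \<psi> x)"
  unfolding set_integrable_def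
proof -
  have i: "integrable lebesgue (\<lambda>x. green_norm \<zeta> j * (exp_abs (decay_rate \<zeta>) (y - x) * cmod (\<psi> x)))"
    using s by (intro integrable_mult_right) (auto simp: src_def)
  have [measurable]: "\<psi> \<in> borel_measurable lebesgue" using s by (rule src_meas)
  have [measurable]: "(\<lambda>x. green_half \<zeta> j (x - y)) \<in> borel_measurable lebesgue"
    by (intro continuous_lebesgue_measurable continuous_on_compose2[OF green_half_cont] continuous_intros) auto
  show "integrable lebesgue (\<lambda>x. indicat_real {y..} x *\<^sub>R (green_half \<zeta> j (x - y) * \<psi> x))"
  proof (rule Bochner_Integration.integrable_bound[OF i])
    show "AE x in lebesgue. norm (indicat_real {y..} x *\<^sub>R (green_half \<zeta> j (x - y) * \<psi> x)) \<le> norm (green_norm \<zeta> j * (exp_abs (decay_rate \<zeta>) (y - x) * cmod (\<psi> x)))"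
    proof (intro AE_I2)
      fix x
      show "norm (indicat_real {y..} x *\<^sub>R (green_half \<zeta> j (x - y) * \<psi> x)) \<le> norm (green_norm \<zeta> j * (exp_abs (decay_rate \<zeta>) (y - x) * cmod (\<psi> x)))"
        using mult_right_mono[OF green_half_norm[OF q, of "x - y" j], of "cmod (\<psi> x)"] green_norm_nonneg[of \<zeta> j]
        by (auto simp: indicator_def norm_mult abs_mult mult.assoc abs_minus_commute)
    qed
  qed measurable
qed

text \<open>Two integrations by parts on the half line to the right of y. Boundary terms arise at y
  only, where the kernel takes its values at 0.\<close>

lemma half_line_identity:
  assumes q: "quadrant \<zeta>" and W: "W2 \<phi> \<phi>1 \<phi>2" and s: "src (decay_rate \<zeta>) \<phi>" "src (decay_rate \<zeta>) \<phi>1" "src (decay_rate \<zeta>) \<phi>2"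
  shows "(LINT x:{y..}|lebesgue. green_half \<zeta> j (x - y) * \<phi>2 x) =
    - green_half \<zeta> j 0 * \<phi>1 y + green_half \<zeta> (Suc j) 0 * \<phi> y + (LINT x:{y..}|lebesgue. green_half \<zeta> (Suc (Suc j)) (x - y) * \<phi> x)"
proof -
  have d: "((\<lambda>x. green_half \<zeta> j (x - y)) has_vector_derivative green_half \<zeta> (Suc j) (x - y)) (at x)" for j x
  proof -
    have "((green_half \<zeta> j \<circ> (\<lambda>x. x - y)) has_vector_derivative 1 *\<^sub>R green_half \<zeta> (Suc j) (x - y)) (at x)"
      by (rule vector_diff_chain_at) (auto intro!: derivative_eq_intros green_half_deriv)
    then show ?thesis by (simp add: comp_def)
  qed
  have c: "continuous_on UNIV (\<lambda>x. green_half \<zeta> j (x - y))" for j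
    by (intro continuous_on_compose2[OF green_half_cont] continuous_intros) auto
  have d0: "(\<phi> has_vector_derivative \<phi>1 x) (at x)" for x using W by (simp add: W2_def)
  note i = green_half_src_integrable[OF q s(1)] green_half_src_integrable[OF q s(2)] green_half_src_integrable[OF q s(3)]
  have 1: "(LINT x:{y..}|lebesgue. green_half \<zeta> j (x - y) * \<phi>2 x) =
     - green_half \<zeta> j (y - y) * \<phi>1 y - (LINT x:{y..}|lebesgue. green_half \<zeta> (Suc j) (x - y) * \<phi>1 x)"
    by (rule ac_ibp_atLeast) (use W in \<open>auto simp: W2_def intro!: i ftc_lebesgue(1)[OF d c] ftc_lebesgue(2)[OF d c]\<close>)
  have 2: "(LINT x:{y..}|lebesgue. green_half \<zeta> (Suc j) (x - y) * \<phi>1 x) =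
     - green_half \<zeta> (Suc j) (y - y) * \<phi> y - (LINT x:{y..}|lebesgue. green_half \<zeta> (Suc (Suc j)) (x - y) * \<phi> x)"
    by (rule ac_ibp_atLeast)
       (auto intro!: i ftc_lebesgue(1)[OF d c] ftc_lebesgue(2)[OF d c] ftc_lebesgue(1)[OF d0 W2_cont(2)[OF W]] ftc_lebesgue(2)[OF d0 W2_cont(2)[OF W]])
  show ?thesis unfolding 1 2 by simp
qed

lemma src_reflect: assumes "src c q" shows "src c (\<lambda>x. q (- x))"
proof -
  obtain M where M: "q \<in> borel_measurable lebesgue"
    "\<And>x. integrable lebesgue (\<lambda>y. exp_abs c (x - y) * cmod (q y))"
    "\<And>x. (LINT y|lebesgue. exp_abs c (x - y) * cmod (q y)) \<le> M" using srcE[OF assms] by metis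
  have e: "exp_abs c (- x + y) = exp_abs c (x - y)" for x y by (simp add: abs_minus_commute)
  have "(\<lambda>x. q (- x)) \<in> borel_measurable lebesgue"
    using measurable_compose[OF lebesgue_affine_measurable[where c="\<lambda>x::real. -1" and t=0] M(1)] by simp
  moreover have "integrable lebesgue (\<lambda>y. exp_abs c (x - y) * cmod (q (- y)))" for x
    using lebesgue_integrable_real_affine_iff[of "-1" "\<lambda>y. exp_abs c (- x - y) * cmod (q y)" 0] M(2)[of "-x"]
    by (simp add: e abs_minus_commute)
  moreover have "(LINT y|lebesgue. exp_abs c (x - y) * cmod (q (- y))) \<le> M" for x
    using lebesgue_integral_real_affine[of "-1" "\<lambda>y. exp_abs c (- x - y) * cmod (q y)" 0] M(3)[of "-x"]
    by (simp add: e abs_minus_commute)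
  ultimately show ?thesis unfolding src_def by blast
qed

text \<open>The left half line is reflected onto a right one, so that
  \<open>half_line_identity\<close> serves both sides; parity of the kernel accounts for the
  sign.\<close>

lemma green_split:
  assumes q: "quadrant \<zeta>" and s: "src (decay_rate \<zeta>) \<psi>"
  shows "(LINT x|lebesgue. green \<zeta> j (x - y) * \<psi> x) =
    (LINT x:{y..}|lebesgue. green_half \<zeta> j (x - y) * \<psi> x) + (-1) ^ j * (LINT x:{-y..}|lebesgue. green_half \<zeta> j (x - (- y)) * \<psi> (- x))"
proof -
  have i1: "integrable lebesgue (\<lambda>x. indicat_real {y..} x *\<^sub>R (green_half \<zeta> j (x - y) * \<psi> x))"
    using green_half_src_integrable[OF q s] by (simp add: set_integrable_def)
  have "set_integrable lebesgue {-y..} (\<lambda>x. green_half \<zeta> j (x - (- y)) * \<psi> (- x))"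
    by (rule green_half_src_integrable[OF q src_reflect[OF s]])
  then have i2: "integrable lebesgue (\<lambda>x. indicat_real {..y} x *\<^sub>R (green_half \<zeta> j (y - x) * \<psi> x))"
    using set_integral_reflect(1)[of "{-y..}" "\<lambda>x. green_half \<zeta> j (x - (- y)) * \<psi> (- x)"]
    by (simp add: set_integrable_def)
  have e2: "(LINT x:{-y..}|lebesgue. green_half \<zeta> j (x - (- y)) * \<psi> (- x)) = (LINT x|lebesgue. indicat_real {..y} x *\<^sub>R (green_half \<zeta> j (y - x) * \<psi> x))"
    using set_integral_reflect(2)[of "{-y..}" "\<lambda>x. green_half \<zeta> j (x - (- y)) * \<psi> (- x)"]
    by (simp add: set_lebesgue_integral_def)
  have [measurable]: "\<psi> \<in> borel_measurable lebesgue" using s by (rule src_meas)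
  note [measurable] = borel_diff_measurable[OF kernD(1)[OF green_kern[OF q]]]
  have "AE x in lebesgue. x \<notin> {y}" by (rule AE_not_in) auto
  then have "AE x in lebesgue. green \<zeta> j (x - y) * \<psi> x = indicat_real {y..} x *\<^sub>R (green_half \<zeta> j (x - y) * \<psi> x) + (-1) ^ j * (indicat_real {..y} x *\<^sub>R (green_half \<zeta> j (y - x) * \<psi> x))"
  proof eventually_elim
    case (elim x)
    then show ?case by (cases "x > y") (auto simp: green_pos green_neg)
  qed
  then have "(LINT x|lebesgue. green \<zeta> j (x - y) * \<psi> x) = (LINT x|lebesgue. indicat_real {y..} x *\<^sub>R (green_half \<zeta> j (x - y) * \<psi> x) + (-1) ^ j * (indicat_real {..y} x *\<^sub>R (green_half \<zeta> j (y - x) * \<psi> x)))"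
    using borel_measurable_integrable[OF i1] borel_measurable_integrable[OF i2]
    by (intro integral_cong_AE borel_measurable_add borel_measurable_times borel_measurable_const) (simp_all, measurable)
  also have "\<dots> = (LINT x|lebesgue. indicat_real {y..} x *\<^sub>R (green_half \<zeta> j (x - y) * \<psi> x)) +
      (LINT x|lebesgue. (-1) ^ j * (indicat_real {..y} x *\<^sub>R (green_half \<zeta> j (y - x) * \<psi> x)))"
    by (intro Bochner_Integration.integral_add integrable_mult_right i1 i2)
  also have "\<dots> = (LINT x:{y..}|lebesgue. green_half \<zeta> j (x - y) * \<psi> x) +
      (-1) ^ j * (LINT x|lebesgue. indicat_real {..y} x *\<^sub>R (green_half \<zeta> j (y - x) * \<psi> x))"
    by (simp only: integral_mult_right_zero set_lebesgue_integral_def)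
  finally show ?thesis unfolding e2 .
qed

text \<open>The boundary terms of the two half lines combine. For the second derivative of the
  kernel those with \<open>\<phi>1\<close> cancel and those with \<open>\<phi>\<close> add up to
  twice one half; for the third derivative it is the other way round. This represents a function by
  its second derivative, the weak form of the kernel being a fundamental solution.\<close>

lemma kernel_identity:
  assumes q: "quadrant \<zeta>" and W: "W2 \<phi> \<phi>1 \<phi>2" and s: "src (decay_rate \<zeta>) \<phi>" "src (decay_rate \<zeta>) \<phi>1" "src (decay_rate \<zeta>) \<phi>2"
  shows "(LINT x|lebesgue. green \<zeta> 2 (x - y) * \<phi>2 x) = \<zeta> ^ 4 * (LINT x|lebesgue. green \<zeta> 0 (x - y) * \<phi> x) + \<phi> y"
    "(LINT x|lebesgue. green \<zeta> 3 (x - y) * \<phi>2 x) = \<zeta> ^ 4 * (LINT x|lebesgue. green \<zeta> 1 (x - y) * \<phi> x) - \<phi>1 y"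
proof -
  have z: "\<zeta> \<noteq> 0" using q by (simp add: quadrant_def)
  have s': "src (decay_rate \<zeta>) (\<lambda>x. - \<phi>1 (- x))" using src_cmult[OF src_reflect[OF s(2)], of "-1"] by simp
  note R = half_line_identity[OF q W s, of y]
  note L = half_line_identity[OF q W2_reflect[OF W] src_reflect[OF s(1)] s' src_reflect[OF s(3)], of "-y"]
  have n: "Suc (Suc 2) = Suc (Suc (Suc (Suc 0)))" "Suc (Suc 3) = Suc (Suc (Suc (Suc 1)))" "Suc 2 = 3" "Suc 3 = Suc (Suc (Suc (Suc 0)))" by simp_all
  have E4: "green_half \<zeta> (Suc (Suc 2)) t = \<zeta>^4 * green_half \<zeta> 0 t" "green_half \<zeta> (Suc (Suc 3)) t = \<zeta>^4 * green_half \<zeta> 1 t" for t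
    unfolding n green_half_vals(3) by simp_all
  have E3: "green_half \<zeta> (Suc 2) 0 = 1/2" using green_half_vals(2)[OF z] by (simp add: numeral_3_eq_3 numeral_2_eq_2)
  have E3': "green_half \<zeta> 3 0 = 1/2" using green_half_vals(2)[OF z] .
  note sp = green_split[OF q s(3), of _ y] green_split[OF q s(1), of _ y]
  show "(LINT x|lebesgue. green \<zeta> 2 (x - y) * \<phi>2 x) = \<zeta> ^ 4 * (LINT x|lebesgue. green \<zeta> 0 (x - y) * \<phi> x) + \<phi> y"
    unfolding sp R[of 2] L[of 2] E4 E3 mult.assoc set_integral_mult_right by (simp add: algebra_simps)
  show "(LINT x|lebesgue. green \<zeta> 3 (x - y) * \<phi>2 x) = \<zeta> ^ 4 * (LINT x|lebesgue. green \<zeta> 1 (x - y) * \<phi> x) - \<phi>1 y"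
    unfolding sp R[of 3] L[of 3] E4 E3' mult.assoc set_integral_mult_right by (simp add: algebra_simps)
qed

text \<open>\<open>green_op\<close> solves \<open>u'''' - \<zeta>^4 u = q + r'\<close> weakly.
  Fubini moves the kernels from the sources onto the test function, where
  \<open>kernel_identity\<close> evaluates them; the minus sign before the term with
  \<open>\<phi>1\<close> comes from testing a derivative.\<close>

lemma weak_identity:
  fixes \<zeta> defines "c \<equiv> decay_rate \<zeta>"
  assumes z: "quadrant \<zeta>" and W: "W2 \<phi> \<phi>1 \<phi>2" and s: "src c \<phi>" "src c \<phi>1" "src c \<phi>2"
    and m: "q \<in> borel_measurable lebesgue" "r \<in> borel_measurable lebesgue"
    and ff: "ffin c q \<phi>" "ffin c q \<phi>2" "ffin c r \<phi>" "ffin c r \<phi>2"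
    and i: "integrable lebesgue (\<lambda>x. q x * \<phi> x)" "integrable lebesgue (\<lambda>x. r x * \<phi>1 x)"
  shows "integrable lebesgue (\<lambda>x. green_op \<zeta> 2 q r x * \<phi>2 x)" "integrable lebesgue (\<lambda>x. green_op \<zeta> 0 q r x * \<phi> x)"
    "(LINT x|lebesgue. green_op \<zeta> 2 q r x * \<phi>2 x) = \<zeta> ^ 4 * (LINT x|lebesgue. green_op \<zeta> 0 q r x * \<phi> x)
       + (LINT x|lebesgue. q x * \<phi> x) - (LINT x|lebesgue. r x * \<phi>1 x)"
proof -
  have k: "kern (green_norm \<zeta> j) c (green \<zeta> j)" for j unfolding c_def by (rule green_kern[OF z])
  have mp: "\<phi> \<in> borel_measurable lebesgue" "\<phi>2 \<in> borel_measurable lebesgue"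
    using s by (auto intro: src_meas)
  note KI = kernel_identity[OF z W s[unfolded c_def]]
  note a20 = conv_adjoint[OF k m(1) mp(2) ff(2), of 2]
  note a31 = conv_adjoint[OF k m(2) mp(2) ff(4), of 3]
  note a00 = conv_adjoint[OF k m(1) mp(1) ff(1), of 0]
  note a11 = conv_adjoint[OF k m(2) mp(1) ff(3), of 1]
  have e2: "green_op \<zeta> 2 q r x * \<phi>2 x = conv (green \<zeta> 2) q x * \<phi>2 x + conv (green \<zeta> 3) r x * \<phi>2 x" for x
    by (simp add: green_op_def algebra_simps numeral_3_eq_3 numeral_2_eq_2)
  have e0: "green_op \<zeta> 0 q r x * \<phi> x = conv (green \<zeta> 0) q x * \<phi> x + conv (green \<zeta> 1) r x * \<phi> x" for x
    by (simp add: green_op_def algebra_simps)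
  show "integrable lebesgue (\<lambda>x. green_op \<zeta> 2 q r x * \<phi>2 x)"
    unfolding e2 by (intro Bochner_Integration.integrable_add a20 a31)
  show "integrable lebesgue (\<lambda>x. green_op \<zeta> 0 q r x * \<phi> x)"
    unfolding e0 by (intro Bochner_Integration.integrable_add a00 a11)
  have 1: "(LINT y|lebesgue. q y * (\<zeta> ^ 4 * (LINT x|lebesgue. green \<zeta> 0 (x - y) * \<phi> x) + \<phi> y)) =
     \<zeta> ^ 4 * (LINT y|lebesgue. q y * (LINT x|lebesgue. green \<zeta> 0 (x - y) * \<phi> x)) + (LINT x|lebesgue. q x * \<phi> x)"
  proof -
    have "(LINT y|lebesgue. q y * (\<zeta> ^ 4 * (LINT x|lebesgue. green \<zeta> 0 (x - y) * \<phi> x) + \<phi> y)) =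
      (LINT y|lebesgue. \<zeta> ^ 4 * (q y * (LINT x|lebesgue. green \<zeta> 0 (x - y) * \<phi> x)) + q y * \<phi> y)"
      by (intro Bochner_Integration.integral_cong) (auto simp: algebra_simps)
    also have "\<dots> = (LINT y|lebesgue. \<zeta> ^ 4 * (q y * (LINT x|lebesgue. green \<zeta> 0 (x - y) * \<phi> x))) + (LINT x|lebesgue. q x * \<phi> x)"
      by (intro Bochner_Integration.integral_add integrable_mult_right a00 i)
    finally show ?thesis by (simp only: integral_mult_right_zero)
  qed
  have 2: "(LINT y|lebesgue. r y * (\<zeta> ^ 4 * (LINT x|lebesgue. green \<zeta> 1 (x - y) * \<phi> x) - \<phi>1 y)) =
     \<zeta> ^ 4 * (LINT y|lebesgue. r y * (LINT x|lebesgue. green \<zeta> 1 (x - y) * \<phi> x)) - (LINT x|lebesgue. r x * \<phi>1 x)"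
  proof -
    have "(LINT y|lebesgue. r y * (\<zeta> ^ 4 * (LINT x|lebesgue. green \<zeta> 1 (x - y) * \<phi> x) - \<phi>1 y)) =
      (LINT y|lebesgue. \<zeta> ^ 4 * (r y * (LINT x|lebesgue. green \<zeta> 1 (x - y) * \<phi> x)) - r y * \<phi>1 y)"
      by (intro Bochner_Integration.integral_cong) (auto simp: algebra_simps)
    also have "\<dots> = (LINT y|lebesgue. \<zeta> ^ 4 * (r y * (LINT x|lebesgue. green \<zeta> 1 (x - y) * \<phi> x))) - (LINT x|lebesgue. r x * \<phi>1 x)"
      by (intro Bochner_Integration.integral_diff integrable_mult_right a11 i)
    finally show ?thesis by (simp only: integral_mult_right_zero)
  qed
  have "(LINT x|lebesgue. green_op \<zeta> 2 q r x * \<phi>2 x) = (LINT x|lebesgue. conv (green \<zeta> 2) q x * \<phi>2 x) + (LINT x|lebesgue. conv (green \<zeta> 3) r x * \<phi>2 x)"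
    unfolding e2 by (intro Bochner_Integration.integral_add a20 a31)
  also have "\<dots> = \<zeta> ^ 4 * (LINT x|lebesgue. conv (green \<zeta> 0) q x * \<phi> x) + (LINT x|lebesgue. q x * \<phi> x)
     + (\<zeta> ^ 4 * (LINT x|lebesgue. conv (green \<zeta> 1) r x * \<phi> x) - (LINT x|lebesgue. r x * \<phi>1 x))"
    unfolding a20(1) a31(1) KI 1 2 a00(1) a11(1) ..
  finally show "(LINT x|lebesgue. green_op \<zeta> 2 q r x * \<phi>2 x) = \<zeta> ^ 4 * (LINT x|lebesgue. green_op \<zeta> 0 q r x * \<phi> x)
       + (LINT x|lebesgue. q x * \<phi> x) - (LINT x|lebesgue. r x * \<phi>1 x)"
    unfolding e0 Bochner_Integration.integral_add[OF a00(2) a11(2)] by (simp add: algebra_simps)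
qed

lemma bdd_mult_integrable:
  fixes v :: "real \<Rightarrow> real" and u :: "real \<Rightarrow> complex"
  assumes v: "integrable lebesgue v" and m: "u \<in> borel_measurable lebesgue" and b: "\<And>x. cmod (u x) \<le> M"
  shows "integrable lebesgue (\<lambda>x. of_real (v x) * u x)"
proof (rule Bochner_Integration.integrable_bound)
  show "integrable lebesgue (\<lambda>x. M * \<bar>v x\<bar>)" using v by simp
  have [measurable]: "v \<in> borel_measurable lebesgue" using v by simp
  note [measurable] = m
  show "(\<lambda>x. of_real (v x) * u x) \<in> borel_measurable lebesgue" by measurable
  show "AE x in lebesgue. norm (of_real (v x) * u x) \<le> norm (M * \<bar>v x\<bar>)"
  proof (intro AE_I2)
    fix x
    have "0 \<le> M" using b[of x] norm_ge_zero order_trans by blast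
    then show "norm (of_real (v x) * u x) \<le> norm (M * \<bar>v x\<bar>)"
      using b[of x] by (simp add: norm_mult abs_mult mult.commute[of "\<bar>v x\<bar>"] mult_right_mono)
  qed
qed

lemma bdd_mult_integrable':
  fixes q u :: "real \<Rightarrow> complex"
  assumes v: "integrable lebesgue q" and m: "u \<in> borel_measurable lebesgue" and b: "\<And>x. cmod (u x) \<le> M"
  shows "integrable lebesgue (\<lambda>x. q x * u x)"
proof (rule Bochner_Integration.integrable_bound)
  show "integrable lebesgue (\<lambda>x. M * cmod (q x))" using v by simp
  show "(\<lambda>x. q x * u x) \<in> borel_measurable lebesgue"
    using borel_measurable_integrable[OF v] m by simp
  show "AE x in lebesgue. norm (q x * u x) \<le> norm (M * cmod (q x))"
  proof (intro AE_I2)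
    fix x
    have "0 \<le> M" using b[of x] norm_ge_zero order_trans by blast
    then show "norm (q x * u x) \<le> norm (M * cmod (q x))"
      using b[of x] by (simp add: norm_mult abs_mult mult.commute[of "cmod (q x)"] mult_right_mono)
  qed
qed

lemma conv_add:
  assumes "kern A c b" "src c q" "src c r"
  shows "conv b (\<lambda>x. q x + r x) x = conv b q x + conv b r x"
  unfolding conv_def using conv_integrable[OF assms(1,2)] conv_integrable[OF assms(1,3)]
  by (simp add: distrib_left)

lemma conv_cmult: "conv b (\<lambda>x. a * q x) x = a * conv b q x"
proof -
  have "(\<lambda>y. b (x - y) * (a * q y)) = (\<lambda>y. a * (b (x - y) * q y))" by (simp add: fun_eq_iff)
  then show ?thesis unfolding conv_def by (simp only: integral_mult_right_zero)
qed

lemma src_minus: "src c q \<Longrightarrow> src c (\<lambda>x. - q x)" using src_cmult[of c q "-1"] by simp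

lemma src_diff: "src c q \<Longrightarrow> src c r \<Longrightarrow> src c (\<lambda>x. q x - r x)"
  using src_add[OF _ src_minus, of c q r] by simp

lemma conv_minus: "conv b (\<lambda>x. - q x) x = - conv b q x"
  using conv_cmult[of b "-1" q x] by simp

lemma conv_diff:
  assumes "kern A c b" "src c q" "src c r"
  shows "conv b (\<lambda>x. q x - r x) x = conv b q x - conv b r x"
  using conv_add[OF assms(1,2) src_minus[OF assms(3)], of x] by (simp add: conv_minus)

lemma cnj_measurable: "q \<in> borel_measurable M \<Longrightarrow> (\<lambda>x. cnj (q x)) \<in> borel_measurable M"
  by (rule measurable_compose[where N=borel]) (auto intro: borel_measurable_continuous_onI continuous_intros)

section \<open>Functions in H2\<close>

lemma L2_set_integrable:
  assumes "L2 q" shows "set_integrable lebesgue {a..b} q"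
proof -
  have i: "integrable lebesgue (indicat_real {a..b})" by (intro integrable_real_indicator) (auto simp: emeasure_lborel_Icc_eq)
  have "L2 (\<lambda>x. complex_of_real (indicat_real {a..b} x))"
    unfolding L2_def
  proof
    show "integrable lebesgue (\<lambda>x. (cmod (complex_of_real (indicat_real {a..b} x)))\<^sup>2)"
      by (rule Bochner_Integration.integrable_bound[OF i]) (auto simp: indicator_def)
  qed auto
  from L2_prod(1)[OF this assms] show ?thesis
    by (simp add: set_integrable_def scaleR_conv_of_real)
qed

lemma H2D:
  assumes "H2 u"
  shows "L2 u" "L2 (der u)" "L2 (der (der u))" "W2 u (der u) (der (der u))"
proof -
  show l: "L2 u" "L2 (der u)" "L2 (der (der u))" using assms by (auto simp: H2_def)
  show "W2 u (der u) (der (der u))"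
    using assms L2_set_integrable[OF l(3)] unfolding W2_def H2_def der_def
    by (auto simp: vector_derivative_works)
qed

lemma W2_der: assumes "W2 u w t" shows "der u = w"
  using assms by (auto simp: W2_def der_def fun_eq_iff vector_derivative_at)

text \<open>The definition of \<open>H2\<close> takes \<open>der\<close> of \<open>der u\<close>
  pointwise. Therefore \<open>w\<close> is assumed differentiable everywhere, which pins
  \<open>t\<close> down at every point and not just almost everywhere.\<close>

lemma H2I:
  assumes W: "W2 u w t" and d: "\<And>x. (w has_vector_derivative t x) (at x)" and l: "L2 u" "L2 w" "L2 t"
  shows "H2 u" "der u = w" "der (der u) = t"
proof -
  show w: "der u = w" by (rule W2_der[OF W])
  show t: "der (der u) = t" unfolding w using d by (auto simp: der_def fun_eq_iff vector_derivative_at)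
  show "H2 u" unfolding H2_def t unfolding w using l W
    by (auto simp: W2_def intro: differentiableI_vector)
qed

lemma kern_reflect: "kern A c b \<Longrightarrow> kern A c (\<lambda>s. b (- s))"
  unfolding kern_def by (auto intro: measurable_compose[where N=borel and f=uminus] simp: abs_minus_cancel) (metis abs_minus_cancel)

lemma conv_reflect: "(LINT x|lebesgue. b (x - y) * q x) = conv (\<lambda>s. b (- s)) q y"
  by (simp add: conv_def)

lemma green_minus: "green \<zeta> j (- s) = (-1) ^ j * green \<zeta> j s"
  by (simp add: green_def)

text \<open>The Sobolev embedding, read off from \<open>kernel_identity\<close>: at
  \<open>1 + \<i>\<close> the kernel decays, and convolutions of such a kernel with L2 functions are
  bounded.\<close>

lemma H2_bounded:
  assumes u: "H2 u"
  obtains M where "\<And>x. cmod (u x) \<le> M" "\<And>x. cmod (der u x) \<le> M"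
proof -
  define z where "z = 1 + \<i>"
  have z: "quadrant z" "decay_rate z > 0" by (auto simp: z_def quadrant_def decay_rate_def complex_eq_iff)
  note h = H2D[OF u]
  note s = src_L2[OF h(1) z(2)] src_L2[OF h(2) z(2)] src_L2[OF h(3) z(2)]
  note KI = kernel_identity[OF z(1) h(4) s]
  have B: "\<exists>M. \<forall>y. cmod (LINT x|lebesgue. green z j (x - y) * q x) \<le> M" if "src (decay_rate z) q" for j q
    unfolding conv_reflect by (rule conv_bounded[OF kern_reflect[OF green_kern[OF z(1)]] that])
  obtain M1 where M1: "\<And>y. cmod (LINT x|lebesgue. green z 2 (x - y) * der (der u) x) \<le> M1" using B[OF s(3)] by blast
  obtain M2 where M2: "\<And>y. cmod (LINT x|lebesgue. green z 0 (x - y) * u x) \<le> M2" using B[OF s(1)] by blast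
  obtain M3 where M3: "\<And>y. cmod (LINT x|lebesgue. green z 3 (x - y) * der (der u) x) \<le> M3" using B[OF s(3)] by blast
  obtain M4 where M4: "\<And>y. cmod (LINT x|lebesgue. green z 1 (x - y) * u x) \<le> M4" using B[OF s(1)] by blast
  have 1: "cmod (u y) \<le> M1 + cmod (z^4) * M2" for y
  proof -
    have "u y = (LINT x|lebesgue. green z 2 (x - y) * der (der u) x) - z^4 * (LINT x|lebesgue. green z 0 (x - y) * u x)"
      unfolding KI by simp
    then have "cmod (u y) \<le> cmod (LINT x|lebesgue. green z 2 (x - y) * der (der u) x) + cmod (z^4 * (LINT x|lebesgue. green z 0 (x - y) * u x))"
      by (metis norm_triangle_ineq4)
    also have "\<dots> \<le> M1 + cmod (z^4) * M2"
      unfolding norm_mult by (intro add_mono mult_left_mono M1 M2) auto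
    finally show ?thesis .
  qed
  have 2: "cmod (der u y) \<le> cmod (z^4) * M4 + M3" for y
  proof -
    have "der u y = z^4 * (LINT x|lebesgue. green z 1 (x - y) * u x) - (LINT x|lebesgue. green z 3 (x - y) * der (der u) x)"
      unfolding KI by simp
    then have "cmod (der u y) \<le> cmod (z^4 * (LINT x|lebesgue. green z 1 (x - y) * u x)) + cmod (LINT x|lebesgue. green z 3 (x - y) * der (der u) x)"
      by (metis norm_triangle_ineq4)
    also have "\<dots> \<le> cmod (z^4) * M4 + M3"
      unfolding norm_mult by (intro add_mono mult_left_mono M3 M4) auto
    finally show ?thesis .
  qed
  show ?thesis
    by (rule that[of "max (M1 + cmod (z^4) * M2) (cmod (z^4) * M4 + M3)"])
       (use 1 2 in \<open>auto simp: le_max_iff_disj\<close>)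
qed

section \<open>The Lippmann--Schwinger equation\<close>

text \<open>The Lippmann--Schwinger equation \<open>u = R\<^sub>0(f - v\<^sub>0 u + (v\<^sub>1 u')')\<close>,
  written for the pair \<open>(u, w) = (u, u')\<close> of bounded functions.\<close>
definition LS :: "complex \<Rightarrow> (real \<Rightarrow> real) \<Rightarrow> (real \<Rightarrow> real) \<Rightarrow> (real \<Rightarrow> complex) \<Rightarrow> (real \<Rightarrow> complex) \<Rightarrow> (real \<Rightarrow> complex) \<Rightarrow> bool" where
  "LS \<zeta> v0 v1 f u w \<longleftrightarrow> u \<in> borel_measurable lebesgue \<and> w \<in> borel_measurable lebesgue \<and>
     (\<exists>M. \<forall>x. cmod (u x) \<le> M \<and> cmod (w x) \<le> M) \<and>
     (\<forall>x. u x = green_op \<zeta> 0 (\<lambda>x. f x - of_real (v0 x) * u x) (\<lambda>x. of_real (v1 x) * w x) x) \<and>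
     (\<forall>x. w x = green_op \<zeta> 1 (\<lambda>x. f x - of_real (v0 x) * u x) (\<lambda>x. of_real (v1 x) * w x) x)"

lemma LSD:
  assumes L: "LS \<zeta> v0 v1 f u w"
  shows "u \<in> borel_measurable lebesgue" "w \<in> borel_measurable lebesgue"
    "\<exists>M. \<forall>x. cmod (u x) \<le> M \<and> cmod (w x) \<le> M"
    "u = green_op \<zeta> 0 (\<lambda>x. f x - of_real (v0 x) * u x) (\<lambda>x. of_real (v1 x) * w x)"
    "w = green_op \<zeta> 1 (\<lambda>x. f x - of_real (v0 x) * u x) (\<lambda>x. of_real (v1 x) * w x)"
proof -
  let ?q = "\<lambda>x. f x - of_real (v0 x) * u x" and ?r = "\<lambda>x. of_real (v1 x) * w x"
  have *: "\<forall>x. u x = green_op \<zeta> 0 ?q ?r x" "\<forall>x. w x = green_op \<zeta> 1 ?q ?r x"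
    using L unfolding LS_def by blast+
  show "u = green_op \<zeta> 0 ?q ?r" using fun_eq_iff[THEN iffD2, OF *(1)] .
  show "w = green_op \<zeta> 1 ?q ?r" using fun_eq_iff[THEN iffD2, OF *(2)] .
qed (use L in \<open>unfold LS_def, blast+\<close>)

text \<open>Only the equation for \<open>u\<close> has to be checked: differentiating it yields a
  formula for the derivative, which must be \<open>w\<close> by uniqueness.\<close>

lemma LSI:
  fixes \<zeta> f u w v0 v1
  defines "q \<equiv> \<lambda>x. f x - of_real (v0 x) * u x" and "r \<equiv> \<lambda>x. of_real (v1 x) * w x"
  assumes z: "quadrant \<zeta>" and s: "src (decay_rate \<zeta>) q" "src (decay_rate \<zeta>) r"
    and u: "\<And>x. u x = green_op \<zeta> 0 q r x" and d: "\<And>x. (u has_vector_derivative w x) (at x)"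
    and w: "w \<in> borel_measurable lebesgue" and b: "\<And>x. cmod (u x) \<le> M" "\<And>x. cmod (w x) \<le> M"
  shows "LS \<zeta> v0 v1 f u w"
proof -
  have e: "u = green_op \<zeta> 0 q r" using u by (rule ext)
  have "(u has_vector_derivative green_op \<zeta> 1 q r x) (at x)" for x
    using green_op_deriv[OF z _ s, of 0 x] unfolding e[symmetric] by simp
  then have "w x = green_op \<zeta> 1 q r x" for x using d vector_derivative_unique_at by blast
  moreover have "u \<in> borel_measurable lebesgue"
    unfolding e by (rule continuous_lebesgue_measurable[OF green_op_cont[OF z s]])
  ultimately show ?thesis unfolding LS_def using u w b unfolding q_def r_def by blast
qed

locale potentials =
  fixes v0 v1 :: "real \<Rightarrow> real"
  assumes v0: "integrable lebesgue v0" and v1: "integrable lebesgue v1"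
begin

lemma LS_integrable:
  assumes "LS \<zeta> v0 v1 f u w"
  shows "integrable lebesgue (\<lambda>x. of_real (v0 x) * u x)" "integrable lebesgue (\<lambda>x. of_real (v1 x) * w x)"
proof -
  obtain M where "\<And>x. cmod (u x) \<le> M" "\<And>x. cmod (w x) \<le> M" "u \<in> borel_measurable lebesgue" "w \<in> borel_measurable lebesgue"
    using LSD(1-3)[OF assms] by blast
  then show "integrable lebesgue (\<lambda>x. of_real (v0 x) * u x)" "integrable lebesgue (\<lambda>x. of_real (v1 x) * w x)"
    by (auto intro: bdd_mult_integrable[OF v0] bdd_mult_integrable[OF v1])
qed

lemma LS_src:
  assumes L: "LS \<zeta> v0 v1 f u w" and z: "quadrant \<zeta>" and f: "src (decay_rate \<zeta>) f"
  shows "src (decay_rate \<zeta>) (\<lambda>x. f x - of_real (v0 x) * u x)" "src (decay_rate \<zeta>) (\<lambda>x. of_real (v1 x) * w x)"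
  by (rule src_diff[OF f src_L1[OF LS_integrable(1)[OF L] decay_rate_nonneg[OF z]]],
      rule src_L1[OF LS_integrable(2)[OF L] decay_rate_nonneg[OF z]])

lemma LS_W2:
  fixes \<zeta> f u w defines "t \<equiv> green_op \<zeta> 2 (\<lambda>x. f x - of_real (v0 x) * u x) (\<lambda>x. of_real (v1 x) * w x)"
  assumes L: "LS \<zeta> v0 v1 f u w" and z: "quadrant \<zeta>" and f: "src (decay_rate \<zeta>) f"
  shows "W2 u w t" "\<And>x. (w has_vector_derivative t x) (at x)"
proof -
  let ?q = "\<lambda>x. f x - of_real (v0 x) * u x" and ?r = "\<lambda>x. of_real (v1 x) * w x"
  note e = LSD(4,5)[OF L]
  show "W2 u w t"
    using green_op_W2[OF z LS_src[OF L z f]] unfolding t_def e[symmetric] .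
  show "(w has_vector_derivative t x) (at x)" for x
    using green_op_deriv[OF z _ LS_src[OF L z f], of 1] unfolding t_def e(2)[symmetric] by (simp add: numeral_2_eq_2)
qed

text \<open>With positive decay rate convolution maps both L1 and L2 into L2, so the part of the
  source with \<open>f\<close> and the parts with the potentials, treated separately, put
  \<open>u\<close>, \<open>u'\<close>, \<open>u''\<close> into L2. In the form the potential terms
  then cancel against those produced by \<open>weak_identity\<close>.\<close>

lemma LS_Hop:
  assumes L: "LS \<zeta> v0 v1 f u w" and z: "quadrant \<zeta>" "decay_rate \<zeta> > 0" and f: "L2 f"
  shows "Hop v0 v1 u (\<lambda>x. f x + \<zeta> ^ 4 * u x)"
proof -
  let ?q = "\<lambda>x. f x - of_real (v0 x) * u x" and ?r = "\<lambda>x. of_real (v1 x) * w x"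
  define t where "t = green_op \<zeta> 2 ?q ?r"
  have sf: "src (decay_rate \<zeta>) f" by (rule src_L2[OF f z(2)])
  note s = LS_src[OF L z(1) sf] and iv = LS_integrable[OF L]
  have sv: "src (decay_rate \<zeta>) (\<lambda>x. of_real (v0 x) * u x)" using z by (intro src_L1 iv) simp
  note e = LSD(4,5)[OF L]
  have cm: "conv (green \<zeta> j) g \<in> borel_measurable lebesgue" if "src (decay_rate \<zeta>) g" for j g
    by (rule continuous_lebesgue_measurable[OF conv_green_cont[OF z(1) that]])
  have l: "L2 (green_op \<zeta> j ?q ?r)" for j
  proof -
    have "L2 (\<lambda>x. (conv (green \<zeta> j) f x + (-1) * conv (green \<zeta> j) (\<lambda>x. of_real (v0 x) * u x) x) + conv (green \<zeta> (Suc j)) ?r x)"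
      by (intro L2_add L2_cmult conv_L2[OF green_kern[OF z(1)] z(2)] cm sf sv s(2)) (use f iv in auto)
    then show ?thesis unfolding green_op_def[abs_def] conv_diff[OF green_kern[OF z(1)] sf sv] by simp
  qed
  note W = LS_W2[OF L z(1) sf, folded t_def]
  have lu: "L2 u" "L2 w" "L2 t" using l[of 0] l[of 1] l[of 2] e by (simp_all add: t_def)
  note H = H2I[OF W(1,2) lu]
  have "hform v0 v1 u \<phi> = l2_inner (\<lambda>x. f x + \<zeta> ^ 4 * u x) \<phi>" if p: "H2 \<phi>" for \<phi>
  proof -
    note hp = H2D[OF p]
    obtain M where M: "\<And>x. cmod (\<phi> x) \<le> M" "\<And>x. cmod (der \<phi> x) \<le> M" using H2_bounded[OF p] by metis
    let ?p0 = "\<lambda>x. cnj (\<phi> x)" and ?p1 = "\<lambda>x. cnj (der \<phi> x)" and ?p2 = "\<lambda>x. cnj (der (der \<phi>) x)"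
    have lp: "L2 ?p0" "L2 ?p1" "L2 ?p2" using hp by (auto intro: L2_cnj)
    note sp = src_L2[OF lp(1) z(2)] src_L2[OF lp(2) z(2)] src_L2[OF lp(3) z(2)]
    have fi: "ffin (decay_rate \<zeta>) g p" if "integrable lebesgue g" "src (decay_rate \<zeta>) p" for g p
      by (rule ffin_sym[OF ffin_src_L1[OF that(2,1)]])
    have fq: "ffin (decay_rate \<zeta>) ?q p" if "L2 p" for p
    proof -
      have "ffin (decay_rate \<zeta>) (\<lambda>x. f x + (- (of_real (v0 x) * u x))) p"
        using iv(1) that z f
        by (intro ffin_add ffin_L2 fi integrable_minus src_L2 that z) (auto dest: L2D(1))
      then show ?thesis by simp
    qed
    have i0: "integrable lebesgue (\<lambda>x. (of_real (v0 x) * u x) * ?p0 x)"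
      by (rule bdd_mult_integrable'[OF iv(1) L2D(1)[OF lp(1)], of M]) (use M in auto)
    have i1: "integrable lebesgue (\<lambda>x. ?r x * ?p1 x)"
      by (rule bdd_mult_integrable'[OF iv(2) L2D(1)[OF lp(2)], of M]) (use M in auto)
    have if0: "integrable lebesgue (\<lambda>x. f x * ?p0 x)" by (rule L2_prod(1)[OF f lp(1)])
    have iq: "integrable lebesgue (\<lambda>x. ?q x * ?p0 x)"
      using Bochner_Integration.integrable_diff[OF if0 i0] by (simp add: left_diff_distrib)
    note WI = weak_identity[OF z(1) W2_cnj[OF hp(4)] sp src_meas[OF s(1)] src_meas[OF s(2)] fq[OF lp(1)] fq[OF lp(3)]
       fi[OF iv(2) sp(1)] fi[OF iv(2) sp(3)] iq i1, folded e t_def]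
    have "hform v0 v1 u \<phi> = (LINT x|lebesgue. (t x * ?p2 x + ?r x * ?p1 x) + (of_real (v0 x) * u x) * ?p0 x)"
      unfolding hform_def H(3) unfolding H(2) by simp
    also have "\<dots> = ((LINT x|lebesgue. t x * ?p2 x) + (LINT x|lebesgue. ?r x * ?p1 x)) + (LINT x|lebesgue. (of_real (v0 x) * u x) * ?p0 x)"
      by (subst Bochner_Integration.integral_add, intro Bochner_Integration.integrable_add WI i1, rule i0,
          subst Bochner_Integration.integral_add, rule WI, rule i1, rule refl)
    also have "(LINT x|lebesgue. t x * ?p2 x) = \<zeta> ^ 4 * (LINT x|lebesgue. u x * ?p0 x) + (LINT x|lebesgue. ?q x * ?p0 x) - (LINT x|lebesgue. ?r x * ?p1 x)"
      by (rule WI(3))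
    also have "(LINT x|lebesgue. ?q x * ?p0 x) = (LINT x|lebesgue. f x * ?p0 x) - (LINT x|lebesgue. (of_real (v0 x) * u x) * ?p0 x)"
      unfolding left_diff_distrib by (rule Bochner_Integration.integral_diff[OF if0 i0])
    finally have "hform v0 v1 u \<phi> = \<zeta> ^ 4 * (LINT x|lebesgue. u x * ?p0 x) + (LINT x|lebesgue. f x * ?p0 x)" by simp
    also have "\<dots> = (LINT x|lebesgue. f x * ?p0 x) + (LINT x|lebesgue. \<zeta> ^ 4 * (u x * ?p0 x))"
      by (simp only: integral_mult_right_zero add.commute)
    also have "\<dots> = (LINT x|lebesgue. f x * ?p0 x + \<zeta> ^ 4 * (u x * ?p0 x))"
      by (rule Bochner_Integration.integral_add[symmetric, OF if0 integrable_mult_right[OF WI(2)]])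
    also have "\<dots> = l2_inner (\<lambda>x. f x + \<zeta> ^ 4 * u x) \<phi>"
      unfolding l2_inner_def by (intro Bochner_Integration.integral_cong) (auto simp: algebra_simps)
    finally show ?thesis .
  qed
  moreover have "L2 (\<lambda>x. f x + \<zeta> ^ 4 * u x)" by (intro L2_add L2_cmult f lu)
  ultimately show ?thesis using H(1) by (simp add: Hop_def)
qed

text \<open>With positive decay rate the kernel centred at y lies in \<open>H2\<close> and may be
  used as test function. The form identity then becomes the integral equation at y, the value
  \<open>u y\<close> being produced by \<open>kernel_identity\<close>.\<close>

lemma Hop_LS:
  assumes H: "Hop v0 v1 u g" and z: "quadrant \<zeta>" "decay_rate \<zeta> > 0"
  shows "LS \<zeta> v0 v1 (\<lambda>x. g x - \<zeta> ^ 4 * u x) u (der u)"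
proof -
  have u: "H2 u" and g: "L2 g" using H by (auto simp: Hop_def)
  note hu = H2D[OF u]
  obtain M where M: "\<And>x. cmod (u x) \<le> M" "\<And>x. cmod (der u x) \<le> M" using H2_bounded[OF u] by metis
  note mu = L2D(1)[OF hu(1)] L2D(1)[OF hu(2)] L2D(1)[OF hu(3)]
  let ?f = "\<lambda>x. g x - \<zeta> ^ 4 * u x"
  let ?q = "\<lambda>x. ?f x - of_real (v0 x) * u x" and ?r = "\<lambda>x. of_real (v1 x) * der u x"
  have iv: "integrable lebesgue (\<lambda>x. of_real (v0 x) * u x)" "integrable lebesgue ?r"
    using M mu by (auto intro: bdd_mult_integrable[OF v0] bdd_mult_integrable[OF v1])
  have sg: "src (decay_rate \<zeta>) g" by (rule src_L2[OF g z(2)])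
  have su: "src (decay_rate \<zeta>) u" "src (decay_rate \<zeta>) (der u)" "src (decay_rate \<zeta>) (der (der u))" using hu z by (auto intro: src_L2)
  have sq: "src (decay_rate \<zeta>) ?q" and sr: "src (decay_rate \<zeta>) ?r"
    by (rule src_diff[OF src_diff[OF sg src_cmult[OF su(1)]] src_L1[OF iv(1) decay_rate_nonneg[OF z(1)]]],
        rule src_L1[OF iv(2) decay_rate_nonneg[OF z(1)]])
  have k: "kern (green_norm \<zeta> j) (decay_rate \<zeta>) (\<lambda>s. green \<zeta> j (- s))" for j by (rule kern_reflect[OF green_kern[OF z(1)]])
  have uy: "u y = green_op \<zeta> 0 ?q ?r y" for y
  proof -
    have z0: "\<zeta> \<noteq> 0" using z by (simp add: quadrant_def)
    let ?k = "\<lambda>j x. green \<zeta> j (x - y)"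
    have W: "W2 (?k 0) (?k 1) (?k 2)" by (rule green_W2[OF z(1)])
    have lk: "L2 (?k j)" for j
    proof -
      have m: "?k j \<in> borel_measurable lebesgue" by (rule borel_diff_measurable[OF kernD(1)[OF green_kern[OF z(1)]]])
      have c2: "2 * decay_rate \<zeta> > 0" using z by simp
      have "L2 (\<lambda>x. complex_of_real (green_norm \<zeta> j * exp_abs (decay_rate \<zeta>) (x - y)))"
        unfolding L2_def
      proof
        show "(\<lambda>x. complex_of_real (green_norm \<zeta> j * exp_abs (decay_rate \<zeta>) (x - y))) \<in> borel_measurable lebesgue" by measurable
        have "(\<lambda>x. (cmod (complex_of_real (green_norm \<zeta> j * exp_abs (decay_rate \<zeta>) (x - y))))\<^sup>2) = (\<lambda>x. (green_norm \<zeta> j)\<^sup>2 * exp_abs (2 * decay_rate \<zeta>) (x - y))"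
          unfolding norm_of_real power2_abs power_mult_distrib exp_abs_sq ..
        then show "integrable lebesgue (\<lambda>x. (cmod (complex_of_real (green_norm \<zeta> j * exp_abs (decay_rate \<zeta>) (x - y))))\<^sup>2)"
          using integrable_mult_right[OF exp_abs_integral(3)[OF c2, of y], of "(green_norm \<zeta> j)\<^sup>2"] by simp
      qed
      from L2_bound[OF m this] show ?thesis using green_norm[OF z(1), of j] green_norm_nonneg[of \<zeta> j] by (simp add: norm_mult)
    qed
    note lc = L2_cnj[OF lk]
    have d2: "((\<lambda>x. cnj (?k 1 x)) has_vector_derivative cnj (?k 2 x)) (at x)" for x
    proof -
      have "((green \<zeta> 1 \<circ> (\<lambda>x. x - y)) has_vector_derivative 1 *\<^sub>R green \<zeta> 2 (x - y)) (at x)"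
        by (rule vector_diff_chain_at) (auto intro!: derivative_eq_intros green_deriv[OF z0, of 1, simplified, folded numeral_2_eq_2])
      then show ?thesis by (intro has_vector_derivative_cnj) (simp add: comp_def)
    qed
    \<comment> \<open>\<open>hform\<close> and \<open>l2_inner\<close> conjugate their second
      argument; the conjugated kernel as test function puts the kernel itself under the
      integrals.\<close>
    note Hk = H2I[OF W2_cnj[OF W] d2 lc[of 0] lc[of 1] lc[of 2]]
    have "hform v0 v1 u (\<lambda>x. cnj (?k 0 x)) = l2_inner g (\<lambda>x. cnj (?k 0 x))"
      using H Hk(1) by (simp add: Hop_def)
    then have 1: "(LINT x|lebesgue. (der (der u) x * ?k 2 x + ?r x * ?k 1 x) + (of_real (v0 x) * u x) * ?k 0 x) = (LINT x|lebesgue. g x * ?k 0 x)"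
      unfolding hform_def l2_inner_def Hk(3) unfolding Hk(2) by simp
    have b: "cmod (?k j x) \<le> green_norm \<zeta> j" for j x by (rule kern_bound[OF green_kern[OF z(1)] decay_rate_nonneg[OF z(1)]])
    have i0: "integrable lebesgue (\<lambda>x. (of_real (v0 x) * u x) * ?k 0 x)"
      by (rule bdd_mult_integrable'[OF iv(1) L2D(1)[OF lk] b])
    have i1: "integrable lebesgue (\<lambda>x. ?r x * ?k 1 x)"
      by (rule bdd_mult_integrable'[OF iv(2) L2D(1)[OF lk] b])
    have i2: "integrable lebesgue (\<lambda>x. der (der u) x * ?k 2 x)"
      by (rule L2_prod(1)[OF hu(3) lk])
    have ig: "integrable lebesgue (\<lambda>x. g x * ?k 0 x)" "integrable lebesgue (\<lambda>x. u x * ?k 0 x)"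
      by (rule L2_prod(1)[OF g lk], rule L2_prod(1)[OF hu(1) lk])
    have 2: "(LINT x|lebesgue. der (der u) x * ?k 2 x) + (LINT x|lebesgue. ?r x * ?k 1 x) + (LINT x|lebesgue. (of_real (v0 x) * u x) * ?k 0 x) = (LINT x|lebesgue. g x * ?k 0 x)"
      using 1 i0 i1 i2 by simp
    have 3: "(LINT x|lebesgue. der (der u) x * ?k 2 x) = \<zeta> ^ 4 * (LINT x|lebesgue. u x * ?k 0 x) + u y"
      using kernel_identity(1)[OF z(1) hu(4) su, of y] by (simp only: mult.commute[of "green \<zeta> _ _"])
    have c0: "conv (green \<zeta> 0) h y = (LINT x|lebesgue. h x * ?k 0 x)" for h
    proof -
      have "green \<zeta> 0 (y - x) = ?k 0 x" for x using green_minus[of \<zeta> 0 "x - y"] by simp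
      then show ?thesis unfolding conv_def by (simp only: mult.commute)
    qed
    have c1: "conv (green \<zeta> 1) h y = - (LINT x|lebesgue. h x * ?k 1 x)" for h
    proof -
      have "green \<zeta> 1 (y - x) * h x = - (h x * ?k 1 x)" for x using green_minus[of \<zeta> 1 "x - y"] by simp
      then show ?thesis unfolding conv_def by (simp only: integral_minus)
    qed
    have "conv (green \<zeta> 0) ?q y = (conv (green \<zeta> 0) g y - \<zeta> ^ 4 * conv (green \<zeta> 0) u y) - conv (green \<zeta> 0) (\<lambda>x. of_real (v0 x) * u x) y"
      using conv_diff[OF green_kern[OF z(1)] src_diff[OF sg src_cmult[OF su(1)]] src_L1[OF iv(1) decay_rate_nonneg[OF z(1)]]]
        conv_diff[OF green_kern[OF z(1)] sg src_cmult[OF su(1)]] by (simp only: conv_cmult)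
    then have "green_op \<zeta> 0 ?q ?r y = ((LINT x|lebesgue. g x * ?k 0 x) - \<zeta> ^ 4 * (LINT x|lebesgue. u x * ?k 0 x))
        - (LINT x|lebesgue. (of_real (v0 x) * u x) * ?k 0 x) - (LINT x|lebesgue. ?r x * ?k 1 x)"
      using c1[of ?r] by (simp add: green_op_def c0)
    also have "\<dots> = u y" unfolding 2[symmetric] 3 by simp
    finally show ?thesis by simp
  qed
  have d: "(u has_vector_derivative der u x) (at x)" for x using hu(4) by (simp add: W2_def)
  show ?thesis by (rule LSI[OF z(1) sq sr uy d mu(2)]) (use M in auto)
qed

end

section \<open>Decay of homogeneous solutions\<close>

lemma green_half_tendsto:
  assumes z: "\<zeta>n \<longlonglongrightarrow> \<zeta>" "\<zeta> \<noteq> 0"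
  shows "(\<lambda>n. green_half (\<zeta>n n) j s) \<longlonglongrightarrow> green_half \<zeta> j s"
  unfolding green_half_def using z(2) by (intro tendsto_intros z(1)) auto

lemma green_tendsto:
  assumes z: "\<zeta>n \<longlonglongrightarrow> \<zeta>" "\<zeta> \<noteq> 0"
  shows "(\<lambda>n. green (\<zeta>n n) j s) \<longlonglongrightarrow> green \<zeta> j s"
  unfolding green_def by (intro tendsto_intros green_half_tendsto[OF z])

lemma green_norm_bounded:
  assumes z: "\<zeta>n \<longlonglongrightarrow> \<zeta>" "\<zeta> \<noteq> 0"
  obtains A where "\<And>n. green_norm (\<zeta>n n) j \<le> A" "A > 0"
proof -
  have "(\<lambda>n. green_norm (\<zeta>n n) j) \<longlonglongrightarrow> green_norm \<zeta> j"
    unfolding green_norm_def using z(2) by (intro tendsto_intros z(1)) auto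
  then have "Bseq (\<lambda>n. green_norm (\<zeta>n n) j)" using convergent_imp_Bseq convergent_def by blast
  then obtain A where A: "A > 0" "\<And>n. norm (green_norm (\<zeta>n n) j) \<le> A" by (auto simp: Bseq_def)
  show ?thesis by (rule that[of A]) (use A abs_le_D1 in auto)
qed

text \<open>The decay rates along the sequence may tend to 0, so the domination relies on the
  uniform bound \<open>A\<close> of the kernels and the integrable majorant of the sources. The
  limit may lie on a boundary ray.\<close>

lemma conv_limit:
  assumes z: "\<zeta>n \<longlonglongrightarrow> \<zeta>" "\<zeta> \<noteq> 0" and q: "\<And>n. quadrant (\<zeta>n n)" and m: "\<And>n. qn n \<in> borel_measurable lebesgue"
    and l: "\<And>x. (\<lambda>n. qn n x) \<longlonglongrightarrow> q x" and h: "integrable lebesgue h" "\<And>n x. cmod (qn n x) \<le> h x"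
  shows "(\<lambda>n. conv (green (\<zeta>n n) j) (qn n) x) \<longlonglongrightarrow> conv (green \<zeta> j) q x"
proof -
  obtain A where A: "\<And>n. green_norm (\<zeta>n n) j \<le> A" "A > 0" using green_norm_bounded[OF z] by blast
  have m2: "(\<lambda>y. green (\<zeta>n n) j (x - y) * qn n y) \<in> borel_measurable lebesgue" for n
    using borel_diff_measurable(1)[OF kernD(1)[OF green_kern[OF q]]] m by (intro borel_measurable_times)
  have l2: "(\<lambda>n. green (\<zeta>n n) j (x - y) * qn n y) \<longlonglongrightarrow> green \<zeta> j (x - y) * q y" for y
    by (intro tendsto_intros green_tendsto z l)
  show ?thesis
    unfolding conv_def
  proof (rule integral_dominated_convergence[where w="\<lambda>y. A * h y"])
    show "(\<lambda>y. green \<zeta> j (x - y) * q y) \<in> borel_measurable lebesgue"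
      by (rule borel_measurable_LIMSEQ_metric[OF m2 l2])
    show "AE y in lebesgue. norm (green (\<zeta>n n) j (x - y) * qn n y) \<le> A * h y" for n
      using kern_bound[OF green_kern[OF q] decay_rate_nonneg[OF q]] A(1)[of n] h(2)
      by (intro AE_I2) (auto simp: norm_mult intro!: mult_mono order_trans[OF _ A(1)] less_imp_le[OF A(2)])
  qed (use h m2 l2 in auto)
qed

text \<open>Cauchy--Schwarz against the weight. The dependence on \<open>c\<close> is what matters:
  when the rate tends to 0, the convolution grows no faster than its inverse square root.\<close>

lemma conv_L2_bound:
  assumes k: "kern A c b" and c: "c > 0" and u: "L2 u"
  shows "(cmod (conv b u x))\<^sup>2 \<le> A\<^sup>2 * ((1 / c) * (LINT x|lebesgue. (cmod (u x))\<^sup>2))"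
proof -
  have s: "src c u" by (rule src_L2[OF u c])
  have c2: "2 * c > 0" using c by simp
  have i: "integrable lebesgue (\<lambda>y. exp_abs c (x - y) * cmod (u y))" using s by (auto simp: src_def)
  have "(cmod (conv b u x))\<^sup>2 \<le> (A * (LINT y|lebesgue. exp_abs c (x - y) * cmod (u y)))\<^sup>2"
    using conv_norm[OF k s, of x] by (intro power_mono) auto
  also have "\<dots> = A\<^sup>2 * (LINT y|lebesgue. exp_abs c (x - y) * cmod (u y))\<^sup>2" by (simp add: power_mult_distrib)
  also have "\<dots> \<le> A\<^sup>2 * ((LINT y|lebesgue. (exp_abs c (x - y))\<^sup>2) * (LINT y|lebesgue. (cmod (u y))\<^sup>2))"
  proof (rule mult_left_mono[OF integral_CS])
    show "integrable lebesgue (\<lambda>y. (exp_abs c (x - y))\<^sup>2)" by (simp only: exp_abs_sq exp_abs_integral[OF c2])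
  qed (use i L2D[OF u] in auto)
  also have "(LINT y|lebesgue. (exp_abs c (x - y))\<^sup>2) = 1 / c" by (simp only: exp_abs_sq exp_abs_integral[OF c2])
  finally show ?thesis .
qed

text \<open>Bootstrapping: with the weight \<open>exp (c (x - a))\<close> truncated at \<open>exp (c n)\<close> the weighted supremum is
  finite and can be absorbed; then \<open>n \<rightarrow> \<infinity>\<close>.\<close>
lemma exponential_decay:
  fixes U W :: "real \<Rightarrow> real"
  assumes Um: "U \<in> borel_measurable lebesgue" and U0: "\<And>x. 0 \<le> U x" and US: "\<And>x. U x \<le> S"
    and W: "integrable lebesgue W" and W0: "\<And>x. 0 \<le> W x" and A: "A \<ge> 0" and c: "c \<ge> 0"
    and ineq: "\<And>x. U x \<le> A * (LINT y|lebesgue. exp (- c * max (x - y) 0) * (W y * U y))"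
    and small: "A * (LINT y|lebesgue. indicat_real {a..} y * W y) \<le> 1/4"
    and x: "x \<ge> a"
  shows "U x \<le> 2 * A * S * (LINT y|lebesgue. W y) * exp (- c * (x - a))"
proof -
  have Wm [measurable]: "W \<in> borel_measurable lebesgue" using W by simp
  note [measurable] = Um
  have S0: "S \<ge> 0" using U0[of 0] US[of 0] by linarith
  define N where "N = (LINT y|lebesgue. W y)"
  have N0: "N \<ge> 0" unfolding N_def using W0 by simp
  have iW: "integrable lebesgue (\<lambda>y. indicat_real {a..} y * W y)"
    using W by (rule Bochner_Integration.integrable_bound) (auto simp: indicator_def)
  have main: "U x * min (exp (c * (x - a))) (exp (c * n)) \<le> 2 * A * S * N" if x: "x \<ge> a" for x and n :: real
  proof -
    define \<omega> where "\<omega> = (\<lambda>x. min (exp (c * (x - a))) (exp (c * n)))"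
    have w0: "\<omega> x > 0" for x by (simp add: \<omega>_def)
    \<comment> \<open>The weight grows at rate at most \<open>c\<close> and never decreases, so the
      decay of the kernel to the left of x pays for moving the weight from x to y, and to the right
      of x monotonicity does.\<close>
    have wle: "\<omega> x * exp (- c * max (x - y) 0) \<le> \<omega> y" for x y
    proof (cases "y \<le> x")
      case True
      have "\<omega> x * exp (- c * (x - y)) \<le> exp (c * (x - a)) * exp (- c * (x - y))"
        by (intro mult_right_mono) (auto simp: \<omega>_def)
      also have "\<dots> = exp (c * (y - a))" by (simp add: exp_add[symmetric] algebra_simps)
      finally have 1: "\<omega> x * exp (- c * (x - y)) \<le> exp (c * (y - a))" .
      have "\<omega> x * exp (- c * (x - y)) \<le> exp (c * n) * 1"
        using True c by (intro mult_mono) (auto simp: \<omega>_def mult_nonneg_nonneg)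
      with 1 show ?thesis using True by (simp add: \<omega>_def)
    next
      case False
      then have "\<omega> x \<le> \<omega> y" using c unfolding \<omega>_def by (intro min.mono) (auto simp: mult_left_mono)
      then show ?thesis using False by simp
    qed
    define B where "B = (SUP x\<in>{a..}. U x * \<omega> x)"
    have bdd: "bdd_above ((\<lambda>x. U x * \<omega> x) ` {a..})"
    proof (rule bdd_aboveI2)
      show "U x * \<omega> x \<le> S * exp (c * n)" for x
        using U0 US S0 by (intro mult_mono) (auto simp: \<omega>_def)
    qed
    have leB: "U y * \<omega> y \<le> B" if "y \<ge> a" for y
      unfolding B_def using that by (intro cSUP_upper bdd) auto
    have B0: "B \<ge> 0" using leB[of a] mult_nonneg_nonneg[OF U0[of a] less_imp_le[OF w0[of a]]] by linarith
    have step: "U x * \<omega> x \<le> A * S * N + B / 4" if x: "x \<ge> a" for x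
    proof -
      \<comment> \<open>From \<open>a\<close> on the unknown is measured by the weighted supremum
        \<open>B\<close>. Before \<open>a\<close> it is measured by \<open>S\<close>, and there the
        kernel loses at least the factor that the weight gains.\<close>
      have pt: "\<omega> x * (exp (- c * max (x - y) 0) * (W y * U y)) \<le> S * W y + B * (indicat_real {a..} y * W y)" for y
      proof (cases "y \<ge> a")
        case True
        have "\<omega> x * exp (- c * max (x - y) 0) * (W y * U y) \<le> \<omega> y * (W y * U y)"
          using wle W0 U0 by (intro mult_right_mono) auto
        also have "\<dots> = W y * (U y * \<omega> y)" by simp
        also have "\<dots> \<le> W y * B" using leB[OF True] W0 by (intro mult_left_mono) auto
        also have "\<dots> \<le> S * W y + B * (indicat_real {a..} y * W y)" using True S0 W0[of y] by simp
        finally show ?thesis by (simp add: mult_ac)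
      next
        case False
        have "\<omega> x * exp (- c * max (x - y) 0) \<le> exp (c * (x - a)) * exp (- c * (x - y))"
          using False x by (intro mult_mono) (auto simp: \<omega>_def)
        also have "\<dots> = exp (c * (y - a))" by (simp add: exp_add[symmetric] algebra_simps)
        also have "\<dots> \<le> 1" using False c by (simp add: mult_nonneg_nonpos)
        finally have "\<omega> x * exp (- c * max (x - y) 0) * (W y * U y) \<le> 1 * (W y * S)"
          using W0 U0 US by (intro mult_mono mult_left_mono) auto
        then show ?thesis using False by (simp add: mult_ac)
      qed
      have ig: "integrable lebesgue (\<lambda>y. S * W y + B * (indicat_real {a..} y * W y))"
        using W iW by simp
      have il: "integrable lebesgue (\<lambda>y. \<omega> x * (exp (- c * max (x - y) 0) * (W y * U y)))"
      proof (rule Bochner_Integration.integrable_bound[OF ig])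
        have "(\<lambda>y. exp (- c * max (x - y) 0)) \<in> borel_measurable lebesgue"
          by (intro continuous_lebesgue_measurable continuous_intros)
        then show "(\<lambda>y. \<omega> x * (exp (- c * max (x - y) 0) * (W y * U y))) \<in> borel_measurable lebesgue" by measurable
        show "AE y in lebesgue. norm (\<omega> x * (exp (- c * max (x - y) 0) * (W y * U y))) \<le> norm (S * W y + B * (indicat_real {a..} y * W y))"
          using pt w0[of x] W0 U0 S0 B0 by (intro AE_I2) (simp add: abs_mult)
      qed
      have "U x * \<omega> x \<le> A * (LINT y|lebesgue. exp (- c * max (x - y) 0) * (W y * U y)) * \<omega> x"
        using ineq[of x] w0[of x] by (intro mult_right_mono) auto
      also have "\<dots> = A * (LINT y|lebesgue. \<omega> x * (exp (- c * max (x - y) 0) * (W y * U y)))" by simp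
      also have "\<dots> \<le> A * (LINT y|lebesgue. S * W y + B * (indicat_real {a..} y * W y))"
        using A by (intro mult_left_mono integral_mono il ig pt)
      also have "\<dots> = A * S * N + B * (A * (LINT y|lebesgue. indicat_real {a..} y * W y))"
        using W iW by (simp add: N_def algebra_simps)
      also have "\<dots> \<le> A * S * N + B * (1/4)" using small B0 by (intro add_left_mono mult_left_mono) auto
      finally show ?thesis by simp
    qed
    have "(SUP x\<in>{a..}. U x * \<omega> x) \<le> A * S * N + B / 4"
      by (rule cSUP_least) (use step in auto)
    then have "B \<le> A * S * N + B / 4" by (simp only: B_def[symmetric])
    \<comment> \<open>Absorbing \<open>B / 4\<close>, which is finite by the truncation of the
      weight, gives the factor 4/3, rounded up to 2.\<close>
    then have "B \<le> 2 * A * S * N" using B0 by linarith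
    then show ?thesis using leB[OF x] by (simp add: \<omega>_def)
  qed
  \<comment> \<open>The bound is uniform in \<open>n\<close>; at \<open>n = x - a\<close> both
    entries of the minimum coincide, which gives the full weight at x.\<close>
  have "U x * exp (c * (x - a)) \<le> 2 * A * S * N" using main[OF x, of "x - a"] by simp
  then have "U x * exp (c * (x - a)) * exp (- c * (x - a)) \<le> 2 * A * S * N * exp (- c * (x - a))"
    by (rule mult_right_mono) simp
  then show ?thesis by (simp add: N_def mult.assoc exp_add[symmetric])
qed

section \<open>Boundary values on the two rays and their amplitudes\<close>

lemma green_half_imag: "green_half (\<i> * of_real k) j s = cnj (green_half (of_real k) j s)"
proof -
  define K :: complex where "K = of_real k"
  define X Y where "X = \<i> * (- K) ^ j * exp (- K * of_real s) - (- (\<i> * K)) ^ j * exp (- (\<i> * K) * of_real s)"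
    and "Y = - \<i> * (- \<i> * K) ^ j * exp (- \<i> * K * of_real s) - (- K) ^ j * exp (- K * of_real s)"
  have i: "\<i> * (\<i> * K) = - K" by simp
  have "green_half (\<i> * K) j s = X / (4 * (\<i> * K) ^ 3)" unfolding green_half_def X_def i ..
  also have "X = - \<i> * Y" by (simp add: X_def Y_def algebra_simps)
  also have "(\<i> * K) ^ 3 = - \<i> * K ^ 3" unfolding power_mult_distrib by (simp add: power3_eq_cube)
  also have "- \<i> * Y / (4 * (- \<i> * K ^ 3)) = Y / (4 * K ^ 3)" by simp
  also have "\<dots> = cnj (green_half K j s)" by (simp add: green_half_def Y_def K_def exp_cnj)
  finally show ?thesis by (simp add: K_def)
qed

lemma green_imag: "green (\<i> * of_real k) j s = cnj (green (of_real k) j s)"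
  by (simp add: green_def green_half_imag)

lemma conv_cnj: "conv (\<lambda>s. cnj (b s)) (\<lambda>y. cnj (q y)) x = cnj (conv b q x)"
  unfolding conv_def using Bochner_Integration.integral_cnj[of lebesgue "\<lambda>y. b (x - y) * q y"] by simp

lemma green_op_imag: "green_op (\<i> * of_real k) j (\<lambda>x. cnj (q x)) (\<lambda>x. cnj (r x)) x = cnj (green_op (of_real k) j q r x)"
  unfolding green_op_def green_imag[abs_def] conv_cnj by simp

text \<open>The potentials are real, so conjugation carries solutions for the boundary value from
  below to solutions for the one from above.\<close>

lemma LS_imag:
  assumes L: "LS (\<i> * of_real k) v0 v1 f u w"
  shows "LS (of_real k) v0 v1 (\<lambda>x. cnj (f x)) (\<lambda>x. cnj (u x)) (\<lambda>x. cnj (w x))"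
proof -
  note e = LSD[OF L]
  let ?q = "\<lambda>x. cnj (f x) - of_real (v0 x) * cnj (u x)" and ?r = "\<lambda>x. of_real (v1 x) * cnj (w x)"
  have p: "green_op (\<i> * of_real k) j (\<lambda>x. f x - of_real (v0 x) * u x) (\<lambda>x. of_real (v1 x) * w x) x = cnj (green_op (of_real k) j ?q ?r x)" for j x
    using green_op_imag[of k j ?q ?r x] by simp
  have aux: "cnj a = b" if "a = cnj b" for a b using that by simp
  have "u x = cnj (green_op (of_real k) 0 ?q ?r x)" "w x = cnj (green_op (of_real k) 1 ?q ?r x)" for x
    using fun_cong[OF e(4), of x] fun_cong[OF e(5), of x] unfolding p by blast+
  then have "\<forall>x. cnj (u x) = green_op (of_real k) 0 ?q ?r x" "\<forall>x. cnj (w x) = green_op (of_real k) 1 ?q ?r x"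
    using aux by blast+
  moreover have "\<exists>M. \<forall>x. cmod (cnj (u x)) \<le> M \<and> cmod (cnj (w x)) \<le> M" using e(3) by simp
  ultimately show ?thesis unfolding LS_def using e(1,2)[THEN cnj_measurable] by blast
qed

definition fexp :: "real \<Rightarrow> real \<Rightarrow> complex" where "fexp k x = exp (\<i> * of_real (k * x))"

lemma fexp_props: "cmod (fexp k x) = 1" "cnj (fexp k x) = fexp (- k) x" "fexp k (x - y) = fexp k x * fexp (- k) y"
  "fexp k 0 = 1" "continuous_on UNIV (fexp k)"
  by (auto simp: fexp_def norm_exp_eq_Re exp_cnj exp_add[symmetric] algebra_simps intro!: continuous_intros)

lemma fexp_integrable: "integrable lebesgue q \<Longrightarrow> integrable lebesgue (\<lambda>y. fexp k y * q y)"
  using bdd_mult_integrable'[of q "fexp k" 1, OF _ continuous_lebesgue_measurable[OF fexp_props(5)]] fexp_props(1)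
  by (simp add: mult.commute)

lemma conv_fexp: "conv (\<lambda>s. a * fexp k s) q x = a * fexp k x * (LINT y|lebesgue. fexp (- k) y * q y)"
proof -
  have "(\<lambda>y. a * fexp k (x - y) * q y) = (\<lambda>y. (a * fexp k x) * (fexp (- k) y * q y))"
    by (simp add: fexp_props(3) fun_eq_iff)
  then show ?thesis unfolding conv_def by (simp only: integral_mult_right_zero)
qed

text \<open>The evanescent exponential has real coefficients and drops out. What remains are plane
  waves, whose formula also holds across s = 0: the kernel and its conjugate have the same
  singularity there.\<close>

lemma green_real_im:
  fixes k :: real assumes k: "k > 0"
  shows "green (of_real k) j s - cnj (green (of_real k) j s) =
    \<i> * (\<i> * k) ^ j / (4 * k ^ 3) * fexp k s + \<i> * (- \<i> * k) ^ j / (4 * k ^ 3) * fexp (- k) s"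
proof -
  have *: "green_half (of_real k) j t - cnj (green_half (of_real k) j t) =
    \<i> * (\<i> * k) ^ j / (4 * k ^ 3) * fexp k t + \<i> * (- \<i> * k) ^ j / (4 * k ^ 3) * fexp (- k) t" for t
    using k by (simp add: green_half_def fexp_def exp_cnj divide_simps)
      (simp add: algebra_simps, metis mult_minus_left power_mult_distrib)
  consider "s > 0" | "s = 0" | "s < 0" by linarith
  then show ?thesis
  proof cases
    case 1 then show ?thesis using *[of s] by (simp add: green_pos)
  next
    case 2
    show ?thesis
    proof (cases "even j")
      case True then show ?thesis using *[of 0] 2 by (simp add: green_def)
    next
      case False
      have "(- \<i> * complex_of_real k) ^ j = - ((\<i> * complex_of_real k) ^ j)"
        using False by (simp add: power_minus_odd)
      then show ?thesis using 2 False by (simp add: green_def fexp_props(4))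
    qed
  next
    case 3
    have "green (of_real k) j s - cnj (green (of_real k) j s) = (-1)^j * (green_half (of_real k) j (-s) - cnj (green_half (of_real k) j (-s)))"
      using 3 by (simp add: green_neg right_diff_distrib)
    also have "\<dots> = \<i> * ((-1)^j * (\<i> * k) ^ j) / (4 * k ^ 3) * fexp k (-s) + \<i> * ((-1)^j * (- \<i> * k) ^ j) / (4 * k ^ 3) * fexp (- k) (-s)"
      unfolding * by (simp add: algebra_simps)
    also have "(-1)^j * (\<i> * k) ^ j = (- \<i> * k) ^ j" by (simp flip: power_mult_distrib)
    also have "(-1)^j * (- \<i> * k) ^ j = (\<i> * k) ^ j" by (simp flip: power_mult_distrib)
    finally show ?thesis by (simp add: fexp_def add.commute)
  qed
qed

text \<open>The imaginary part of \<open>\<langle>u, q + r'\<rangle>\<close> for \<open>u = R\<^sub>0(q + r')\<close> is a positive multiple of the sum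
  of the squared moduli of the Fourier transform of \<open>q + r'\<close> at \<open>\<plusminus>k\<close>.\<close>
lemma amplitudes_vanish:
  fixes k :: real
  assumes k: "k > 0" and q: "integrable lebesgue q" and r: "integrable lebesgue r"
    and re: "(LINT x|lebesgue. green_op (of_real k) 0 q r x * cnj (q x) - green_op (of_real k) 1 q r x * cnj (r x)) \<in> \<real>"
  shows "(LINT y|lebesgue. fexp (- k) y * q y) + \<i> * k * (LINT y|lebesgue. fexp (- k) y * r y) = 0"
    "(LINT y|lebesgue. fexp k y * q y) - \<i> * k * (LINT y|lebesgue. fexp k y * r y) = 0"
proof -
  define z where "z = complex_of_real k"
  have z: "quadrant z" "decay_rate z = 0" using k by (auto simp: z_def quadrant_def decay_rate_def)
  note kn = green_kern[OF z(1), unfolded z(2)]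
  have knc: "kern (green_norm z j) 0 (\<lambda>s. cnj (green z j s))" for j
    using kn[of j] by (auto simp: kern_def intro: cnj_measurable)
  have qc: "integrable lebesgue (\<lambda>x. cnj (q x))" "integrable lebesgue (\<lambda>x. cnj (r x))"
    using q r by (auto intro: integrable_bounded_linear[OF bounded_linear_cnj])
  have m: "q \<in> borel_measurable lebesgue" "r \<in> borel_measurable lebesgue"
    "(\<lambda>x. cnj (q x)) \<in> borel_measurable lebesgue" "(\<lambda>x. cnj (r x)) \<in> borel_measurable lebesgue"
    using q r qc by (auto intro: borel_measurable_integrable)
  have ff: "ffin 0 g h" if "integrable lebesgue g" "integrable lebesgue h" for g h
    by (rule ffin_src_L1[OF src_L1 that(2)]) (use that in auto)
  define a where "a = (\<lambda>s. LINT y|lebesgue. fexp s y * q y)"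
  define b where "b = (\<lambda>s. LINT y|lebesgue. fexp s y * r y)"
  define p where "p = (\<lambda>j. \<i> * (\<i> * k) ^ j / (4 * k ^ 3))"
  define n where "n = (\<lambda>j. \<i> * (- \<i> * k) ^ j / (4 * k ^ 3))"
  define T where "T = (\<lambda>j g h. LINT x|lebesgue. conv (green z j) g x * cnj (h x))"
  define Tc where "Tc = (\<lambda>j g h. LINT x|lebesgue. conv (\<lambda>s. cnj (green z j s)) g x * cnj (h x))"
  have iT: "integrable lebesgue (\<lambda>x. conv (green z j) g x * cnj (h x))"
    "integrable lebesgue (\<lambda>x. conv (\<lambda>s. cnj (green z j s)) g x * cnj (h x))"
    if "integrable lebesgue g" "integrable lebesgue h" for j g h
  proof -
    have hc: "integrable lebesgue (\<lambda>x. cnj (h x))" using that by (auto intro: integrable_bounded_linear[OF bounded_linear_cnj])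
    show "integrable lebesgue (\<lambda>x. conv (green z j) g x * cnj (h x))"
      by (rule conv_adjoint(2)[OF kn borel_measurable_integrable[OF that(1)] borel_measurable_integrable[OF hc] ff[OF that(1) hc]])
    show "integrable lebesgue (\<lambda>x. conv (\<lambda>s. cnj (green z j s)) g x * cnj (h x))"
      by (rule conv_adjoint(2)[OF knc borel_measurable_integrable[OF that(1)] borel_measurable_integrable[OF hc] ff[OF that(1) hc]])
  qed
  \<comment> \<open>Parity of the kernel: exchanging the arguments of the sesquilinear form
    conjugates the kernel and costs the sign \<open>(-1) ^ j\<close>.\<close>
  have sym: "cnj (T j g h) = (-1) ^ j * Tc j h g" if g: "integrable lebesgue g" and h: "integrable lebesgue h" for j g h
  proof -
    have gc: "integrable lebesgue (\<lambda>x. cnj (g x))" using g by (auto intro: integrable_bounded_linear[OF bounded_linear_cnj])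
    have "cnj (T j g h) = (LINT x|lebesgue. cnj (conv (green z j) g x * cnj (h x)))"
      unfolding T_def by (rule Bochner_Integration.integral_cnj[symmetric])
    also have "\<dots> = (LINT x|lebesgue. conv (\<lambda>s. cnj (green z j s)) (\<lambda>y. cnj (g y)) x * h x)"
      by (simp add: conv_cnj)
    also have "\<dots> = (LINT y|lebesgue. cnj (g y) * (LINT x|lebesgue. cnj (green z j (x - y)) * h x))"
      by (rule conv_adjoint(1)[OF knc borel_measurable_integrable[OF gc] borel_measurable_integrable[OF h] ff[OF gc h]])
    also have "(\<lambda>y. cnj (g y) * (LINT x|lebesgue. cnj (green z j (x - y)) * h x)) = (\<lambda>y. (-1)^j * (conv (\<lambda>s. cnj (green z j s)) h y * cnj (g y)))"
    proof
      fix y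
      have "(LINT x|lebesgue. cnj (green z j (x - y)) * h x) = (LINT x|lebesgue. (-1)^j * (cnj (green z j (y - x)) * h x))"
        using green_minus[of z j "y - x" for x] by (simp add: mult.assoc)
      also have "\<dots> = (-1)^j * conv (\<lambda>s. cnj (green z j s)) h y" unfolding conv_def by (rule integral_mult_right_zero)
      finally show "cnj (g y) * (LINT x|lebesgue. cnj (green z j (x - y)) * h x) = (-1)^j * (conv (\<lambda>s. cnj (green z j s)) h y * cnj (g y))" by simp
    qed
    also have "(LINT y|lebesgue. (-1)^j * (conv (\<lambda>s. cnj (green z j s)) h y * cnj (g y))) = (-1)^j * Tc j h g"
      unfolding Tc_def by (rule integral_mult_right_zero)
    finally show ?thesis .
  qed
  \<comment> \<open>The difference of the two kernels is a sum of two plane waves, and a plane wave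
    as convolution kernel factorises into Fourier coefficients of the two arguments.\<close>
  have dif: "T j g h - Tc j g h = p j * (LINT y|lebesgue. fexp (- k) y * g y) * cnj (LINT y|lebesgue. fexp (- k) y * h y)
      + n j * (LINT y|lebesgue. fexp k y * g y) * cnj (LINT y|lebesgue. fexp k y * h y)"
    if g: "integrable lebesgue g" and h: "integrable lebesgue h" for j g h
  proof -
    have hc: "integrable lebesgue (\<lambda>x. cnj (h x))" using h by (auto intro: integrable_bounded_linear[OF bounded_linear_cnj])
    have s: "src 0 g" using g by (intro src_L1) auto
    have KR: "green z j s - cnj (green z j s) = p j * fexp k s + n j * fexp (- k) s" for s
      unfolding p_def n_def z_def by (rule green_real_im[OF k])
    have "conv (green z j) g x - conv (\<lambda>s. cnj (green z j s)) g x =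
       p j * fexp k x * (LINT y|lebesgue. fexp (- k) y * g y) + n j * fexp (- k) x * (LINT y|lebesgue. fexp k y * g y)" for x
    proof -
      have "conv (green z j) g x - conv (\<lambda>s. cnj (green z j s)) g x = (LINT y|lebesgue. green z j (x - y) * g y - cnj (green z j (x - y)) * g y)"
        unfolding conv_def by (rule Bochner_Integration.integral_diff[symmetric, OF conv_integrable[OF kn s] conv_integrable[OF knc s]])
      also have "\<dots> = (LINT y|lebesgue. p j * fexp k (x - y) * g y + n j * fexp (- k) (x - y) * g y)"
        by (simp only: left_diff_distrib[symmetric] KR distrib_right)
      also have "\<dots> = (LINT y|lebesgue. p j * fexp k (x - y) * g y) + (LINT y|lebesgue. n j * fexp (- k) (x - y) * g y)"
      proof (rule Bochner_Integration.integral_add)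
        have e: "a * fexp s (x - y) * g y = (a * fexp s x) * (fexp (- s) y * g y)" for a s y by (simp add: fexp_props(3))
        show "integrable lebesgue (\<lambda>y. p j * fexp k (x - y) * g y)" "integrable lebesgue (\<lambda>y. n j * fexp (- k) (x - y) * g y)"
          unfolding e by (intro integrable_mult_right fexp_integrable g)+
      qed
      finally show ?thesis using conv_fexp[of "p j" k g x] conv_fexp[of "n j" "- k" g x] by (simp add: conv_def)
    qed
    then have e: "conv (green z j) g x * cnj (h x) - conv (\<lambda>s. cnj (green z j s)) g x * cnj (h x) =
       (p j * (LINT y|lebesgue. fexp (- k) y * g y)) * (fexp k x * cnj (h x)) + (n j * (LINT y|lebesgue. fexp k y * g y)) * (fexp (- k) x * cnj (h x))" for x
      by (simp add: left_diff_distrib[symmetric] algebra_simps)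
    have c: "(LINT x|lebesgue. fexp s x * cnj (h x)) = cnj (LINT x|lebesgue. fexp (- s) x * h x)" for s
      using Bochner_Integration.integral_cnj[of lebesgue "\<lambda>x. fexp (- s) x * h x"] by (simp add: fexp_props(2))
    have "T j g h - Tc j g h = (LINT x|lebesgue. conv (green z j) g x * cnj (h x) - conv (\<lambda>s. cnj (green z j s)) g x * cnj (h x))"
      unfolding T_def Tc_def by (rule Bochner_Integration.integral_diff[symmetric]) (rule iT[OF g h])+
    also have "\<dots> = (p j * (LINT y|lebesgue. fexp (- k) y * g y)) * (LINT x|lebesgue. fexp k x * cnj (h x)) + (n j * (LINT y|lebesgue. fexp k y * g y)) * (LINT x|lebesgue. fexp (- k) x * cnj (h x))"
      unfolding e by (subst Bochner_Integration.integral_add) (intro integrable_mult_right fexp_integrable hc, intro integrable_mult_right fexp_integrable hc, simp only: integral_mult_right_zero)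
    finally show ?thesis unfolding c by (simp add: mult.assoc)
  qed
  let ?S = "LINT x|lebesgue. green_op z 0 q r x * cnj (q x) - green_op z 1 q r x * cnj (r x)"
  have S: "?S = (T 0 q q + T 1 r q) - (T 1 q r + T 2 r r)"
  proof -
    have "?S = (LINT x|lebesgue. (conv (green z 0) q x * cnj (q x) + conv (green z 1) r x * cnj (q x)) - (conv (green z 1) q x * cnj (r x) + conv (green z 2) r x * cnj (r x)))"
      by (simp add: green_op_def distrib_right numeral_2_eq_2)
    also have "\<dots> = (T 0 q q + T 1 r q) - (T 1 q r + T 2 r r)"
      unfolding T_def using iT(1)[OF q q, of 0] iT(1)[OF r q, of 1] iT(1)[OF q r, of 1] iT(1)[OF r r, of 2]
      by simp
    finally show ?thesis .
  qed
  have c1: "cnj ?S = (Tc 0 q q - Tc 1 q r) - (- Tc 1 r q + Tc 2 r r)"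
    unfolding S by (simp add: sym[OF q q] sym[OF r q] sym[OF q r] sym[OF r r])
  have c2: "cnj ?S = ?S" using re by (simp add: z_def Reals_cnj_iff)
  have "(T 0 q q + T 1 r q) - (T 1 q r + T 2 r r) = (Tc 0 q q - Tc 1 q r) - (- Tc 1 r q + Tc 2 r r)"
    using trans[OF c2[THEN HOL.sym] c1] unfolding S .
  then have eq: "(T 0 q q - Tc 0 q q) + (T 1 r q - Tc 1 r q) - (T 1 q r - Tc 1 q r) - (T 2 r r - Tc 2 r r) = 0"
    by (simp add: algebra_simps)
  \<comment> \<open>The Fourier transform of \<open>q + r'\<close> at k and at -k, the derivative
    having become multiplication by \<plusminus>ik. These are the amplitudes of the two outgoing
    waves.\<close>
  define \<alpha> \<beta> where "\<alpha> = a (- k) + \<i> * k * b (- k)" and "\<beta> = a k - \<i> * k * b k"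
  have "(T 0 q q - Tc 0 q q) + (T 1 r q - Tc 1 r q) - (T 1 q r - Tc 1 q r) - (T 2 r r - Tc 2 r r) =
     \<i> / (4 * k ^ 3) * (\<alpha> * cnj \<alpha> + \<beta> * cnj \<beta>)"
  proof -
    define C where "C = \<i> / (4 * complex_of_real k ^ 3)"
    have pn: "p j = C * (\<i> * k) ^ j" "n j = C * (- \<i> * k) ^ j" for j by (simp_all add: p_def n_def C_def)
    have d: "T 0 q q - Tc 0 q q = p 0 * a (- k) * cnj (a (- k)) + n 0 * a k * cnj (a k)"
      "T 1 r q - Tc 1 r q = p 1 * b (- k) * cnj (a (- k)) + n 1 * b k * cnj (a k)"
      "T 1 q r - Tc 1 q r = p 1 * a (- k) * cnj (b (- k)) + n 1 * a k * cnj (b k)"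
      "T 2 r r - Tc 2 r r = p 2 * b (- k) * cnj (b (- k)) + n 2 * b k * cnj (b k)"
      unfolding dif[OF q q] dif[OF r q] dif[OF q r] dif[OF r r] a_def b_def by (rule refl)+
    have Cq: "\<i> / (4 * k ^ 3) = C" by (simp add: C_def)
    show ?thesis unfolding d pn \<alpha>_def \<beta>_def Cq by (simp add: algebra_simps power2_eq_square)
  qed
  then have "\<alpha> * cnj \<alpha> + \<beta> * cnj \<beta> = 0" using eq k by simp
  then have "complex_of_real ((cmod \<alpha>)\<^sup>2 + (cmod \<beta>)\<^sup>2) = 0"
    by (simp only: of_real_add complex_norm_square)
  then have "(cmod \<alpha>)\<^sup>2 + (cmod \<beta>)\<^sup>2 = 0" using of_real_eq_0_iff by blast
  then have "\<alpha> = 0" "\<beta> = 0" by (simp_all add: sum_power2_eq_zero_iff)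
  then show "(LINT y|lebesgue. fexp (- k) y * q y) + \<i> * k * (LINT y|lebesgue. fexp (- k) y * r y) = 0"
    "(LINT y|lebesgue. fexp k y * q y) - \<i> * k * (LINT y|lebesgue. fexp k y * r y) = 0"
    by (auto simp: \<alpha>_def \<beta>_def a_def b_def)
qed

lemma conv_weight_bound:
  assumes h: "h \<in> borel_measurable borel" and b: "\<And>s. cmod (h s) \<le> B * g s" and g: "g \<in> borel_measurable borel"
    "\<And>s. 0 \<le> g s" "\<And>s. g s \<le> 1" and q: "integrable lebesgue q" and Q: "integrable lebesgue Q" "\<And>y. cmod (q y) \<le> Q y" and B: "B \<ge> 0"
  shows "cmod (conv h q x) \<le> B * (LINT y|lebesgue. g (x - y) * Q y)"
proof -
  have Q0: "Q y \<ge> 0" for y using Q(2)[of y] norm_ge_zero order_trans by blast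
  have [measurable]: "(\<lambda>y. h (x - y)) \<in> borel_measurable lebesgue" "(\<lambda>y. g (x - y)) \<in> borel_measurable lebesgue"
    using borel_diff_measurable(1)[OF h] borel_diff_measurable(1)[OF g(1)] by auto
  have [measurable]: "q \<in> borel_measurable lebesgue" "Q \<in> borel_measurable lebesgue" using q Q by auto
  have i: "integrable lebesgue (\<lambda>y. g (x - y) * Q y)"
    by (rule Bochner_Integration.integrable_bound[OF Q(1)]) (measurable, use g Q0 in \<open>auto simp: abs_mult mult_left_le_one_le\<close>)
  have le: "cmod (h (x - y) * q y) \<le> B * (g (x - y) * Q y)" for y
    unfolding norm_mult mult.assoc[symmetric] using b g Q B by (intro mult_mono) auto
  have i2: "integrable lebesgue (\<lambda>y. h (x - y) * q y)"
    by (rule Bochner_Integration.integrable_bound[OF integrable_mult_right[OF i, of B]])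
       (measurable, use le g Q0 B in \<open>auto simp: abs_mult\<close>)
  have "cmod (conv h q x) \<le> (LINT y|lebesgue. cmod (h (x - y) * q y))"
    unfolding conv_def by (rule integral_norm_bound)
  also have "\<dots> \<le> (LINT y|lebesgue. B * (g (x - y) * Q y))"
    by (intro integral_mono integrable_norm i2 integrable_mult_right i le)
  finally show ?thesis by simp
qed

section \<open>Decay inequalities for homogeneous solutions\<close>

context potentials
begin

definition potential_weight :: "real \<Rightarrow> real" where "potential_weight x = \<bar>v0 x\<bar> + \<bar>v1 x\<bar>"

lemma potential_weight_integrable: "integrable lebesgue potential_weight"
  unfolding potential_weight_def[abs_def] using v0 v1 by simp

lemma potential_weight_nonneg: "potential_weight x \<ge> 0" by (simp add: potential_weight_def)

text \<open>The kernels \<open>h\<close> and the weight \<open>g\<close> are left open because two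
  kinds are inserted: the free kernel where it decays by itself, and the free kernel minus a plane
  wave. Four convolutions are bounded by \<open>B\<close> times the integral, whence the factor
  4.\<close>

lemma kernel_ineq:
  assumes um: "u \<in> borel_measurable lebesgue" "w \<in> borel_measurable lebesgue" and S: "\<And>x. cmod (u x) + cmod (w x) \<le> S"
    and e: "\<And>x. u x = conv (h 0) (\<lambda>x. - (of_real (v0 x) * u x)) x + conv (h 1) (\<lambda>x. of_real (v1 x) * w x) x"
      "\<And>x. w x = conv (h 1) (\<lambda>x. - (of_real (v0 x) * u x)) x + conv (h 2) (\<lambda>x. of_real (v1 x) * w x) x"
    and h: "\<And>j. h j \<in> borel_measurable borel" and b: "\<And>s j. j \<le> (2::nat) \<Longrightarrow> cmod (h j s) \<le> B * g s" and g: "g \<in> borel_measurable borel"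
    "\<And>s. 0 \<le> g s" "\<And>s. g s \<le> 1" and B: "B \<ge> 0"
  shows "cmod (u x) + cmod (w x) \<le> 4 * B * (LINT y|lebesgue. g (x - y) * (potential_weight y * (cmod (u y) + cmod (w y))))"
proof -
  let ?q = "\<lambda>x. - (of_real (v0 x) * u x)" and ?r = "\<lambda>x. of_real (v1 x) * w x"
  let ?Q = "\<lambda>y. potential_weight y * (cmod (u y) + cmod (w y))"
  let ?I = "LINT y|lebesgue. g (x - y) * ?Q y"
  have le: "cmod (u x) \<le> S" "cmod (w x) \<le> S" for x using S[of x] norm_ge_zero[of "u x"] norm_ge_zero[of "w x"] by linarith+
  have i: "integrable lebesgue ?q" "integrable lebesgue ?r"
    using bdd_mult_integrable[OF v0 um(1) le(1)] bdd_mult_integrable[OF v1 um(2) le(2)] by auto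
  have Q: "integrable lebesgue ?Q"
  proof (rule Bochner_Integration.integrable_bound[OF integrable_mult_right[OF potential_weight_integrable, of S]])
    have [measurable]: "potential_weight \<in> borel_measurable lebesgue" using potential_weight_integrable by simp
    note [measurable] = um
    show "?Q \<in> borel_measurable lebesgue" by measurable
    have S0: "S \<ge> 0" using le(1)[of 0] norm_ge_zero order_trans by blast
    show "AE x in lebesgue. norm (?Q x) \<le> norm (S * potential_weight x)"
    proof (intro AE_I2)
      fix x
      have "potential_weight x * (cmod (u x) + cmod (w x)) \<le> potential_weight x * S" by (rule mult_left_mono[OF S potential_weight_nonneg])
      then show "norm (?Q x) \<le> norm (S * potential_weight x)" using potential_weight_nonneg[of x] S0 by (simp add: abs_mult mult.commute[of S])
    qed
  qed
  have qQ: "cmod (?q y) \<le> ?Q y" "cmod (?r y) \<le> ?Q y" for y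
    by (auto simp: norm_mult potential_weight_def intro!: mult_mono)
  have c: "cmod (conv (h j) ?q x) \<le> B * ?I" "cmod (conv (h j) ?r x) \<le> B * ?I" if "j \<le> 2" for j
    by (rule conv_weight_bound[OF h b[OF that] g i(1) Q qQ(1) B], rule conv_weight_bound[OF h b[OF that] g i(2) Q qQ(2) B])
  have "cmod (u x) \<le> cmod (conv (h 0) ?q x) + cmod (conv (h 1) ?r x)"
    by (subst e(1)) (rule norm_triangle_ineq)
  moreover have "cmod (w x) \<le> cmod (conv (h 1) ?q x) + cmod (conv (h 2) ?r x)"
    by (subst e(2)) (rule norm_triangle_ineq)
  ultimately show ?thesis using c(1)[of 0] c(2)[of 1] c(1)[of 1] c(2)[of 2] by simp
qed

lemma LS0_real_amplitudes:
  assumes L: "LS (of_real k) v0 v1 (\<lambda>_. 0) u w" and k: "k > 0"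
  defines "q \<equiv> \<lambda>x. - (of_real (v0 x) * u x)" and "r \<equiv> \<lambda>x. of_real (v1 x) * w x"
  shows "(LINT y|lebesgue. fexp (- k) y * q y) + \<i> * k * (LINT y|lebesgue. fexp (- k) y * r y) = 0"
    "(LINT y|lebesgue. fexp k y * q y) - \<i> * k * (LINT y|lebesgue. fexp k y * r y) = 0"
proof -
  have i: "integrable lebesgue q" "integrable lebesgue r"
    unfolding q_def r_def using LS_integrable[OF L] by auto
  have e: "green_op (of_real k) 0 q r = u" "green_op (of_real k) 1 q r = w"
    using LSD(4,5)[OF L, symmetric] by (simp_all add: q_def r_def)
  \<comment> \<open>Here the reality of the potentials enters.\<close>
  have "u x * cnj (q x) - w x * cnj (r x) = of_real (- v0 x * (cmod (u x))\<^sup>2 - v1 x * (cmod (w x))\<^sup>2)" for x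
    unfolding of_real_diff of_real_mult complex_norm_square by (simp add: q_def r_def)
  then have re: "(LINT x|lebesgue. green_op (of_real k) 0 q r x * cnj (q x) - green_op (of_real k) 1 q r x * cnj (r x)) \<in> \<real>"
    unfolding e by (simp only: integral_complex_of_real Reals_of_real)
  note amplitudes_vanish[OF k i re]
  then show "(LINT y|lebesgue. fexp (- k) y * q y) + \<i> * k * (LINT y|lebesgue. fexp (- k) y * r y) = 0"
    "(LINT y|lebesgue. fexp k y * q y) - \<i> * k * (LINT y|lebesgue. fexp k y * r y) = 0" by blast+
qed

definition wave_coeff :: "real \<Rightarrow> nat \<Rightarrow> complex" where "wave_coeff k j = \<i> * (\<i> * of_real k) ^ j / (4 * of_real k ^ 3)"

text \<open>Subtracting a plane wave leaves a kernel that decays in one direction. The amplitude of the plane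
  wave vanishes on homogeneous solutions, so these satisfy one-sided decaying inequalities.\<close>
lemma green_minus_wave:
  assumes k: "k > 0"
  shows "cmod (green (of_real k) j s - wave_coeff k j * fexp k s) \<le> 2 * green_norm (of_real k) j * exp (- (k / 2) * max s 0)"
    "cmod (green (of_real k) j s - (-1) ^ j * wave_coeff k j * fexp (- k) s) \<le> 2 * green_norm (of_real k) j * exp (- (k / 2) * max (- s) 0)"
proof -
  have A: "green_norm (of_real k) j = k ^ j / (2 * k ^ 3)" using k by (simp add: green_norm_def)
  have p: "cmod (wave_coeff k j) = green_norm (of_real k) j / 2" using k by (simp add: wave_coeff_def green_norm_def norm_mult norm_power norm_divide)
  have q: "quadrant (of_real k)" "decay_rate (of_real k) = 0" using k by (auto simp: quadrant_def decay_rate_def)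
  have A0: "green_norm (of_real k) j \<ge> 0" by (rule green_norm_nonneg)
  \<comment> \<open>On the side without decay the wave, of modulus half of
    \<open>green_norm\<close>, is simply added; 3/2 is rounded up to 2.\<close>
  have crude: "cmod (green (of_real k) j s - c * fexp k' s) \<le> 2 * green_norm (of_real k) j" if "cmod c = green_norm (of_real k) j / 2" for c k' s
    using norm_triangle_ineq4[of "green (of_real k) j s" "c * fexp k' s"] green_norm[OF q(1), of j s] that A0
    by (simp add: norm_mult fexp_props(1) q(2))
  have fine: "green_half (of_real k) j t - wave_coeff k j * fexp k t = - ((- of_real k) ^ j * exp (- of_real k * of_real t)) / (4 * of_real k ^ 3)" for t
    by (simp add: green_half_def wave_coeff_def fexp_def diff_divide_distrib mult.assoc)
  have fine_norm: "cmod (green_half (of_real k) j t - wave_coeff k j * fexp k t) \<le> 2 * green_norm (of_real k) j * exp (- (k / 2) * t)" if "t > 0" for t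
  proof -
    have "cmod (green_half (of_real k) j t - wave_coeff k j * fexp k t) = k ^ j * exp (- k * t) / (4 * k ^ 3)"
      unfolding fine using k by (simp add: norm_divide norm_mult norm_power norm_exp_eq_Re)
    also have "\<dots> = green_norm (of_real k) j / 2 * exp (- k * t)" unfolding A by simp
    \<comment> \<open>The rate k is weakened to k/2, a rate also valid on the diagonal of the
      quadrant, so that one inequality covers every real spectral parameter.\<close>
    also have "\<dots> \<le> 2 * green_norm (of_real k) j * exp (- (k / 2) * t)"
      using k that A0 by (intro mult_mono) auto
    finally show ?thesis .
  qed
  show "cmod (green (of_real k) j s - wave_coeff k j * fexp k s) \<le> 2 * green_norm (of_real k) j * exp (- (k / 2) * max s 0)"
    using fine_norm[of s] crude[of "wave_coeff k j" s k] p by (cases "s > 0") (auto simp: green_pos)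
  show "cmod (green (of_real k) j s - (-1) ^ j * wave_coeff k j * fexp (- k) s) \<le> 2 * green_norm (of_real k) j * exp (- (k / 2) * max (- s) 0)"
  proof (cases "s < 0")
    case True
    have "green (of_real k) j s - (-1) ^ j * wave_coeff k j * fexp (- k) s = (-1) ^ j * (green_half (of_real k) j (- s) - wave_coeff k j * fexp k (- s))"
      unfolding green_neg[OF True] by (simp add: fexp_def right_diff_distrib mult.assoc)
    then have "cmod (green (of_real k) j s - (-1) ^ j * wave_coeff k j * fexp (- k) s) = cmod (green_half (of_real k) j (- s) - wave_coeff k j * fexp k (- s))"
      by (simp add: norm_mult norm_power)
    then show ?thesis using fine_norm[of "- s"] True by simp
  next
    case False
    then show ?thesis using crude[of "(-1) ^ j * wave_coeff k j" s "- k"] p by (simp add: norm_mult norm_power)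
  qed
qed

text \<open>Together the subtracted waves contribute a multiple of the amplitude that vanishes by
  \<open>a\<close>. The hypotheses \<open>m\<close> make the coefficients geometric, so that this
  one amplitude serves all derivatives of the kernel.\<close>

lemma conv_minus_wave:
  assumes k: "k > 0" and i: "integrable lebesgue q" "integrable lebesgue r"
    and a: "c 0 * (LINT y|lebesgue. fexp (- l) y * q y) + c 1 * (LINT y|lebesgue. fexp (- l) y * r y) = 0"
    and m: "c (Suc j) = c j * d" "c 1 = c 0 * d" "c 0 \<noteq> 0"
  shows "green_op (of_real k) j q r x = conv (\<lambda>s. green (of_real k) j s - c j * fexp l s) q x + conv (\<lambda>s. green (of_real k) (Suc j) s - c (Suc j) * fexp l s) r x"
proof -
  have z: "quadrant (of_real k)" "decay_rate (of_real k) = 0" using k by (auto simp: quadrant_def decay_rate_def)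
  have s: "src 0 q" "src 0 r" using i by (auto intro: src_L1)
  have kn: "kern (green_norm (of_real k) j) 0 (green (of_real k) j)" for j using green_kern[OF z(1)] z(2) by simp
  have split: "conv (\<lambda>s. green (of_real k) j s - c' * fexp l s) g x = conv (green (of_real k) j) g x - c' * fexp l x * (LINT y|lebesgue. fexp (- l) y * g y)"
    if g: "integrable lebesgue g" for g c' j
  proof -
    have "(\<lambda>y. c' * fexp l (x - y) * g y) = (\<lambda>y. (c' * fexp l x) * (fexp (- l) y * g y))"
      by (simp add: fexp_props(3) fun_eq_iff)
    then have "integrable lebesgue (\<lambda>y. c' * fexp l (x - y) * g y)"
      using fexp_integrable[OF g, of "- l"] by simp
    moreover have "integrable lebesgue (\<lambda>y. green (of_real k) j (x - y) * g y)"
      using conv_integrable[OF kn src_L1[OF g]] by simp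
    ultimately show ?thesis
      unfolding conv_fexp[of c' l g x, symmetric] unfolding conv_def by (simp add: left_diff_distrib)
  qed
  have "c j * fexp l x * (LINT y|lebesgue. fexp (- l) y * q y) + c (Suc j) * fexp l x * (LINT y|lebesgue. fexp (- l) y * r y)
     = c j / c 0 * fexp l x * (c 0 * (LINT y|lebesgue. fexp (- l) y * q y) + c 1 * (LINT y|lebesgue. fexp (- l) y * r y))"
    unfolding m(1,2) using m(3) by (simp add: field_simps)
  then show ?thesis unfolding split[OF i(1)] split[OF i(2)] green_op_def a by (simp add: algebra_simps)
qed

text \<open>Subtracting the wave outgoing to the right leaves a kernel decaying for x beyond y,
  subtracting the one outgoing to the left a kernel decaying for x before y. As both amplitudes
  vanish, either kernel represents the same solution.\<close>

lemma LS0_ineq_real: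
  assumes L: "LS (of_real k) v0 v1 (\<lambda>_. 0) u w" and k: "k > 0"
    and B: "\<And>j. j \<le> 2 \<Longrightarrow> 2 * green_norm (of_real k) j \<le> B"
  shows "cmod (u x) + cmod (w x) \<le> 4 * B * (LINT y|lebesgue. exp (- (k / 2) * max (x - y) 0) * (potential_weight y * (cmod (u y) + cmod (w y))))"
    "cmod (u x) + cmod (w x) \<le> 4 * B * (LINT y|lebesgue. exp (- (k / 2) * max (y - x) 0) * (potential_weight y * (cmod (u y) + cmod (w y))))"
proof -
  let ?q = "\<lambda>x. - (of_real (v0 x) * u x)" and ?r = "\<lambda>x. of_real (v1 x) * w x"
  have i: "integrable lebesgue ?q" "integrable lebesgue ?r" using LS_integrable[OF L] by auto
  note am = LS0_real_amplitudes[OF L k]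
  have e: "u x = green_op (of_real k) 0 ?q ?r x" "w x = green_op (of_real k) 1 ?q ?r x" for x
    using fun_cong[OF LSD(4)[OF L], of x] fun_cong[OF LSD(5)[OF L], of x] by (metis (no_types, lifting) diff_0 ext)+
  have z: "quadrant (of_real k)" using k by (auto simp: quadrant_def)
  have B0: "B \<ge> 0" using B[of 0] green_norm_nonneg[of "of_real k" 0] by simp
  obtain S0 where S0: "\<And>x. cmod (u x) \<le> S0 \<and> cmod (w x) \<le> S0" using LSD(3)[OF L] by blast
  have S: "cmod (u x) + cmod (w x) \<le> S0 + S0" for x using S0[of x] by (intro add_mono) auto
  have p0: "wave_coeff k 0 \<noteq> 0" using k by (simp add: wave_coeff_def)
  have fm: "fexp l \<in> borel_measurable borel" for l
    by (intro borel_measurable_continuous_onI fexp_props)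
  have Km: "green (of_real k) j \<in> borel_measurable borel" for j by (rule kernD(1)[OF green_kern[OF z]])
  have 1: "wave_coeff k 0 * (LINT y|lebesgue. fexp (- k) y * ?q y) + wave_coeff k 1 * (LINT y|lebesgue. fexp (- k) y * ?r y) = 0"
  proof -
    have "wave_coeff k 0 * ((LINT y|lebesgue. fexp (- k) y * ?q y) + \<i> * k * (LINT y|lebesgue. fexp (- k) y * ?r y)) = 0"
      unfolding am(1) by simp
    moreover have "wave_coeff k 1 = wave_coeff k 0 * (\<i> * k)" by (simp add: wave_coeff_def)
    ultimately show ?thesis by (simp only: distrib_left mult.assoc)
  qed
  \<comment> \<open>By parity the left-going wave carries the sign \<open>(-1) ^ j\<close> in the
    j-th derivative; its coefficients are geometric with ratio \<open>- \<i> * k\<close>.\<close>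
  define c2 where "c2 = (\<lambda>j. (-1) ^ j * wave_coeff k j)"
  have 2: "c2 0 * (LINT y|lebesgue. fexp (- (- k)) y * ?q y) + c2 1 * (LINT y|lebesgue. fexp (- (- k)) y * ?r y) = 0"
  proof -
    have "wave_coeff k 0 * ((LINT y|lebesgue. fexp k y * ?q y) - \<i> * k * (LINT y|lebesgue. fexp k y * ?r y)) = 0"
      unfolding am(2) by simp
    then show ?thesis unfolding c2_def minus_minus by (simp add: wave_coeff_def right_diff_distrib mult.assoc)
  qed
  have m1: "wave_coeff k (Suc j) = wave_coeff k j * (\<i> * of_real k)" for j
    by (simp only: wave_coeff_def power_Suc times_divide_eq_left times_divide_eq_right mult_ac)
  have m2: "c2 (Suc j) = c2 j * (- \<i> * of_real k)" for j by (simp add: c2_def m1)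
  have c20: "c2 0 \<noteq> 0" using p0 by (simp add: c2_def)
  note P1 = conv_minus_wave[OF k i, of "wave_coeff k" k, OF 1 m1 m1[of 0, folded One_nat_def] p0]
  note P2 = conv_minus_wave[OF k i, of c2 "- k", OF 2 m2 m2[of 0, folded One_nat_def] c20]
  show "cmod (u x) + cmod (w x) \<le> 4 * B * (LINT y|lebesgue. exp (- (k / 2) * max (x - y) 0) * (potential_weight y * (cmod (u y) + cmod (w y))))"
  proof (rule kernel_ineq[OF LSD(1,2)[OF L] S, where h="\<lambda>j s. green (of_real k) j s - wave_coeff k j * fexp k s" and g="\<lambda>s. exp (- (k / 2) * max s 0)"])
    show "u x = conv (\<lambda>s. green (of_real k) 0 s - wave_coeff k 0 * fexp k s) ?q x + conv (\<lambda>s. green (of_real k) 1 s - wave_coeff k 1 * fexp k s) ?r x" for x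
      using e(1)[of x] P1[of 0 x] by (simp only: One_nat_def)
    show "w x = conv (\<lambda>s. green (of_real k) 1 s - wave_coeff k 1 * fexp k s) ?q x + conv (\<lambda>s. green (of_real k) 2 s - wave_coeff k 2 * fexp k s) ?r x" for x
      using e(2)[of x] P1[of 1 x] by (simp only: One_nat_def numeral_2_eq_2)
    show "(\<lambda>s. green (of_real k) j s - wave_coeff k j * fexp k s) \<in> borel_measurable borel" for j
      using fm Km by measurable
    show "cmod (green (of_real k) j s - wave_coeff k j * fexp k s) \<le> B * exp (- (k / 2) * max s 0)" if "j \<le> 2" for j s
      by (rule order_trans[OF green_minus_wave(1)[OF k] mult_right_mono[OF B[OF that]]]) simp
    show "(\<lambda>s. exp (- (k / 2) * max s 0)) \<in> borel_measurable borel"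
      by (intro borel_measurable_continuous_onI continuous_intros)
  qed (use k B0 in auto)
  have "cmod (u x) + cmod (w x) \<le> 4 * B * (LINT y|lebesgue. exp (- (k / 2) * max (- (x - y)) 0) * (potential_weight y * (cmod (u y) + cmod (w y))))"
  proof (rule kernel_ineq[OF LSD(1,2)[OF L] S, where h="\<lambda>j s. green (of_real k) j s - c2 j * fexp (- k) s" and g="\<lambda>s. exp (- (k / 2) * max (- s) 0)"])
    show "u x = conv (\<lambda>s. green (of_real k) 0 s - c2 0 * fexp (- k) s) ?q x + conv (\<lambda>s. green (of_real k) 1 s - c2 1 * fexp (- k) s) ?r x" for x
      using e(1)[of x] P2[of 0 x] by (simp only: One_nat_def)
    show "w x = conv (\<lambda>s. green (of_real k) 1 s - c2 1 * fexp (- k) s) ?q x + conv (\<lambda>s. green (of_real k) 2 s - c2 2 * fexp (- k) s) ?r x" for x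
      using e(2)[of x] P2[of 1 x] by (simp only: One_nat_def numeral_2_eq_2)
    show "(\<lambda>s. green (of_real k) j s - c2 j * fexp (- k) s) \<in> borel_measurable borel" for j
      using fm Km by measurable
    show "cmod (green (of_real k) j s - c2 j * fexp (- k) s) \<le> B * exp (- (k / 2) * max (- s) 0)" if "j \<le> 2" for j s
      unfolding c2_def by (rule order_trans[OF green_minus_wave(2)[OF k] mult_right_mono[OF B[OF that]]]) simp
    show "(\<lambda>s. exp (- (k / 2) * max (- s) 0)) \<in> borel_measurable borel"
      by (intro borel_measurable_continuous_onI continuous_intros)
  qed (use k B0 in auto)
  then show "cmod (u x) + cmod (w x) \<le> 4 * B * (LINT y|lebesgue. exp (- (k / 2) * max (y - x) 0) * (potential_weight y * (cmod (u y) + cmod (w y))))"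
    by simp
qed

text \<open>With a, b the real and imaginary parts, the imaginary part of \<zeta>^4 is 4ab(a^2 -
  b^2). Its zeros are the two axes, where \<zeta>^4 is positive, and the diagonal, where it is
  negative.\<close>

lemma real_fourth_power_cases:
  assumes z: "quadrant \<zeta>" and i: "Im (\<zeta> ^ 4) = 0"
  obtains k where "k > 0" "\<zeta> = of_real k" "cmod \<zeta> = k" | k where "k > 0" "\<zeta> = \<i> * of_real k" "cmod \<zeta> = k"
    | "decay_rate \<zeta> > 0" "cmod \<zeta> / 2 \<le> decay_rate \<zeta>"
proof -
  define a b where "a = Re \<zeta>" and "b = Im \<zeta>"
  have ab: "a \<ge> 0" "b \<ge> 0" "a \<noteq> 0 \<or> b \<noteq> 0" using z by (auto simp: quadrant_def a_def b_def complex_eq_iff)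
  have "Im (\<zeta> ^ 4) = 4 * a * b * (a\<^sup>2 - b\<^sup>2)"
    by (simp add: a_def b_def power4_eq_xxxx power2_eq_square algebra_simps)
  then have "a = 0 \<or> b = 0 \<or> a\<^sup>2 = b\<^sup>2" using i by auto
  then consider "b = 0" | "a = 0" | "a = b" using ab by auto
  then show ?thesis
  proof cases
    case 1
    then have "\<zeta> = of_real a" "a > 0" using ab by (auto simp: complex_eq_iff a_def b_def)
    then show ?thesis using that(1)[of a] by simp
  next
    case 2
    then have e: "\<zeta> = \<i> * of_real b" "b > 0" using ab by (auto simp: complex_eq_iff a_def b_def)
    then have "cmod \<zeta> = b" by (simp add: norm_mult)
    then show ?thesis using that(2)[OF e(2,1)] by simp
  next
    case 3
    have "cmod \<zeta> \<le> \<bar>Re \<zeta>\<bar> + \<bar>Im \<zeta>\<bar>" by (rule cmod_le)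
    then have "cmod \<zeta> / 2 \<le> decay_rate \<zeta>" "decay_rate \<zeta> > 0" using 3 ab by (auto simp: decay_rate_def a_def b_def)
    then show ?thesis using that(3) by simp
  qed
qed

text \<open>The real ray is \<open>LS0_ineq_real\<close>, the imaginary ray follows by conjugation,
  and on the diagonal the kernel decays by itself. The common form with rate
  \<open>cmod \<zeta> / 2\<close> is what makes later constants uniform in \<zeta>.\<close>

lemma LS0_ineq:
  assumes L: "LS \<zeta> v0 v1 (\<lambda>_. 0) u w" and z: "quadrant \<zeta>" and i: "Im (\<zeta> ^ 4) = 0"
    and B: "\<And>j. j \<le> 2 \<Longrightarrow> 2 * green_norm \<zeta> j \<le> B"
  shows "cmod (u x) + cmod (w x) \<le> 4 * B * (LINT y|lebesgue. exp (- (cmod \<zeta> / 2) * max (x - y) 0) * (potential_weight y * (cmod (u y) + cmod (w y))))"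
    "cmod (u x) + cmod (w x) \<le> 4 * B * (LINT y|lebesgue. exp (- (cmod \<zeta> / 2) * max (y - x) 0) * (potential_weight y * (cmod (u y) + cmod (w y))))"
proof -
  consider k where "k > 0" "\<zeta> = of_real k" "cmod \<zeta> = k" | k where "k > 0" "\<zeta> = \<i> * of_real k" "cmod \<zeta> = k"
    | "decay_rate \<zeta> > 0" "cmod \<zeta> / 2 \<le> decay_rate \<zeta>" using real_fourth_power_cases[OF z i] by metis
  then have "cmod (u x) + cmod (w x) \<le> 4 * B * (LINT y|lebesgue. exp (- (cmod \<zeta> / 2) * max (x - y) 0) * (potential_weight y * (cmod (u y) + cmod (w y)))) \<and>
    cmod (u x) + cmod (w x) \<le> 4 * B * (LINT y|lebesgue. exp (- (cmod \<zeta> / 2) * max (y - x) 0) * (potential_weight y * (cmod (u y) + cmod (w y))))"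
  proof cases
    case (1 k)
    then show ?thesis using LS0_ineq_real[of k u w B x] L B by auto
  next
    case (2 k)
    have "LS (of_real k) v0 v1 (\<lambda>_. 0) (\<lambda>x. cnj (u x)) (\<lambda>x. cnj (w x))"
      using LS_imag[of k v0 v1 "\<lambda>_. 0" u w] L 2(2) by simp
    moreover have "2 * green_norm (of_real k) j \<le> B" if "j \<le> 2" for j
      using B[OF that] 2 by (simp add: green_norm_def norm_mult)
    ultimately show ?thesis
      using LS0_ineq_real[of k "\<lambda>x. cnj (u x)" "\<lambda>x. cnj (w x)" B x] 2 by simp
  next
    case 3
    let ?q = "\<lambda>x. - (of_real (v0 x) * u x)" and ?r = "\<lambda>x. of_real (v1 x) * w x"
    have e: "u x = green_op \<zeta> 0 ?q ?r x" "w x = green_op \<zeta> 1 ?q ?r x" for x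
      using fun_cong[OF LSD(4)[OF L], of x] fun_cong[OF LSD(5)[OF L], of x] by (metis (no_types, lifting) diff_0 ext)+
    obtain S0 where S0: "\<And>x. cmod (u x) \<le> S0 \<and> cmod (w x) \<le> S0" using LSD(3)[OF L] by blast
    have S: "cmod (u x) + cmod (w x) \<le> S0 + S0" for x using S0[of x] by (intro add_mono) auto
    have B0: "B \<ge> 0" using B[of 0] green_norm_nonneg[of \<zeta> 0] by simp
    have Kb: "cmod (green \<zeta> j s) \<le> B * exp (- (cmod \<zeta> / 2) * t)" if "j \<le> 2" "t \<le> \<bar>s\<bar>" "0 \<le> t" for j s t
    proof -
      have "cmod \<zeta> / 2 * t \<le> decay_rate \<zeta> * \<bar>s\<bar>" using 3 that by (intro mult_mono) auto
      then have "green_norm \<zeta> j * exp_abs (decay_rate \<zeta>) s \<le> B * exp (- (cmod \<zeta> / 2) * t)"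
        using B[OF that(1)] green_norm_nonneg[of \<zeta> j] by (intro mult_mono) auto
      then show ?thesis using green_norm[OF z, of j s] by simp
    qed
    \<comment> \<open>The two signs \<sigma> give the two one-sided weights, each of which majorises
      the two-sided decay.\<close>
    have "cmod (u x) + cmod (w x) \<le> 4 * B * (LINT y|lebesgue. (\<lambda>s. exp (- (cmod \<zeta> / 2) * max (\<sigma> * s) 0)) (x - y) * (potential_weight y * (cmod (u y) + cmod (w y))))"
      if sg: "\<bar>\<sigma>\<bar> = (1::real)" for \<sigma>
    proof (rule kernel_ineq[OF LSD(1,2)[OF L] S, where h="green \<zeta>"])
      show "u x = conv (green \<zeta> 0) ?q x + conv (green \<zeta> 1) ?r x" for x using e(1)[of x] by (simp only: green_op_def One_nat_def)
      show "w x = conv (green \<zeta> 1) ?q x + conv (green \<zeta> 2) ?r x" for x using e(2)[of x] by (simp only: green_op_def One_nat_def numeral_2_eq_2)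
      show "green \<zeta> j \<in> borel_measurable borel" for j by (rule kernD(1)[OF green_kern[OF z]])
      show "cmod (green \<zeta> j s) \<le> B * exp (- (cmod \<zeta> / 2) * max (\<sigma> * s) 0)" if "j \<le> 2" for j s
        using sg abs_ge_self[of "\<sigma> * s"] by (intro Kb that) (auto simp: abs_mult)
      show "(\<lambda>s. exp (- (cmod \<zeta> / 2) * max (\<sigma> * s) 0)) \<in> borel_measurable borel"
        by (intro borel_measurable_continuous_onI continuous_intros)
    qed (use B0 in auto)
    from this[of 1] this[of "-1"] show ?thesis by simp
  qed
  then show "cmod (u x) + cmod (w x) \<le> 4 * B * (LINT y|lebesgue. exp (- (cmod \<zeta> / 2) * max (x - y) 0) * (potential_weight y * (cmod (u y) + cmod (w y))))"
    "cmod (u x) + cmod (w x) \<le> 4 * B * (LINT y|lebesgue. exp (- (cmod \<zeta> / 2) * max (y - x) 0) * (potential_weight y * (cmod (u y) + cmod (w y))))"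
    by blast+
qed

lemma small_tail:
  assumes "A \<ge> 0"
  obtains a where "a \<ge> 0" "A * (LINT y|lebesgue. indicat_real {a..} y * potential_weight y) \<le> 1/4"
    "A * (LINT y|lebesgue. indicat_real {a..} y * potential_weight (- y)) \<le> 1/4"
proof -
  have lim: "(\<lambda>n. LINT y|lebesgue. indicat_real {real n..} y * F y) \<longlonglongrightarrow> integral\<^sup>L lebesgue (\<lambda>y::real. 0)"
    if F: "integrable lebesgue F" for F :: "real \<Rightarrow> real"
  proof (rule integral_dominated_convergence[where w="\<lambda>y. \<bar>F y\<bar>"])
    show "AE y in lebesgue. (\<lambda>n. indicat_real {real n..} y * F y) \<longlonglongrightarrow> 0"
    proof (intro AE_I2)
      fix y :: real
      obtain N :: nat where N: "y < real N" using reals_Archimedean2 by blast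
      have "\<forall>\<^sub>F n in sequentially. indicat_real {real n..} y * F y = 0"
        using eventually_ge_at_top[of N] by eventually_elim (use N in \<open>auto simp: indicator_def\<close>)
      then show "(\<lambda>n. indicat_real {real n..} y * F y) \<longlonglongrightarrow> 0" by (rule tendsto_eventually)
    qed
    have [measurable]: "F \<in> borel_measurable lebesgue" using F by simp
    show "(\<lambda>y. indicat_real {real n..} y * F y) \<in> borel_measurable lebesgue" for n by measurable
  qed (use F in \<open>auto simp: indicator_def\<close>)
  have F2: "integrable lebesgue (\<lambda>y. potential_weight (- y))"
    using lebesgue_integrable_real_affine_iff[of "-1" potential_weight 0] potential_weight_integrable by simp
  have l: "(\<lambda>n. A * (LINT y|lebesgue. indicat_real {real n..} y * potential_weight y)) \<longlonglongrightarrow> A * 0"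
    "(\<lambda>n. A * (LINT y|lebesgue. indicat_real {real n..} y * potential_weight (- y))) \<longlonglongrightarrow> A * 0"
    using lim[OF potential_weight_integrable] lim[OF F2] by (intro tendsto_intros; simp)+
  have "\<forall>\<^sub>F n in sequentially. A * (LINT y|lebesgue. indicat_real {real n..} y * potential_weight y) < 1/4"
    "\<forall>\<^sub>F n in sequentially. A * (LINT y|lebesgue. indicat_real {real n..} y * potential_weight (- y)) < 1/4"
    using order_tendstoD(2)[OF l(1), of "1/4"] order_tendstoD(2)[OF l(2), of "1/4"] by simp_all
  then have "\<forall>\<^sub>F n in sequentially. A * (LINT y|lebesgue. indicat_real {real n..} y * potential_weight y) < 1/4 \<and>
     A * (LINT y|lebesgue. indicat_real {real n..} y * potential_weight (- y)) < 1/4"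
    by (rule eventually_conj)
  from eventually_happens'[OF sequentially_bot this] obtain n :: nat
    where "A * (LINT y|lebesgue. indicat_real {real n..} y * potential_weight y) < 1/4 \<and>
     A * (LINT y|lebesgue. indicat_real {real n..} y * potential_weight (- y)) < 1/4" by blast
  then show ?thesis using that[of "real n"] by simp
qed

text \<open>The constant depends on the potentials and on the annulus between m and M, neither on
  the solution nor on \<zeta>. This uniformity supplies one square integrable majorant for a whole
  sequence of eigenfunctions.\<close>

lemma eigen_decay:
  assumes m: "m > 0"
  obtains C where "C > 0" "\<And>\<zeta> u w S x. quadrant \<zeta> \<Longrightarrow> Im (\<zeta> ^ 4) = 0 \<Longrightarrow> m \<le> cmod \<zeta> \<Longrightarrow> cmod \<zeta> \<le> M \<Longrightarrow>
     LS \<zeta> v0 v1 (\<lambda>_. 0) u w \<Longrightarrow> (\<And>x. cmod (u x) + cmod (w x) \<le> S) \<Longrightarrow>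
     cmod (u x) + cmod (w x) \<le> C * S * exp_abs (m / 2) x"
proof -
  \<comment> \<open>Bounds \<open>2 * green_norm \<zeta> j\<close> for \<open>j \<le> 2\<close> on
    the annulus; \<open>1 + M\<close> instead of \<open>M\<close> makes the powers monotone in
    \<open>j\<close>.\<close>
  define B where "B = (1 + M)\<^sup>2 / m ^ 3"
  define A where "A = 4 * B"
  define N where "N = (LINT y|lebesgue. potential_weight y)"
  have N0: "N \<ge> 0" unfolding N_def using potential_weight_nonneg by simp
  have B0: "B \<ge> 0" using m by (simp add: B_def)
  then have A0: "A \<ge> 0" by (simp add: A_def)
  obtain a where a: "a \<ge> 0" "A * (LINT y|lebesgue. indicat_real {a..} y * potential_weight y) \<le> 1/4"
    "A * (LINT y|lebesgue. indicat_real {a..} y * potential_weight (- y)) \<le> 1/4" using small_tail[OF A0] by blast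
  define c where "c = m / 2"
  have c0: "c > 0" using m by (simp add: c_def)
  \<comment> \<open>The summand 1 covers the points with \<bar>x\<bar> < a, where \<open>S\<close>
    is the bound and \<open>exp (c * a)\<close> makes up for the exponential factor.\<close>
  define C where "C = (2 * A * N + 1) * exp (c * a)"
  have "C > 0" using A0 N0 by (simp add: C_def add_nonneg_pos)
  moreover have "cmod (u x) + cmod (w x) \<le> C * S * exp_abs c x"
    if z: "quadrant \<zeta>" "Im (\<zeta> ^ 4) = 0" "m \<le> cmod \<zeta>" "cmod \<zeta> \<le> M" and L: "LS \<zeta> v0 v1 (\<lambda>_. 0) u w"
      and S: "\<And>x. cmod (u x) + cmod (w x) \<le> S" for \<zeta> u w S x
  proof -
    define U where "U = (\<lambda>x. cmod (u x) + cmod (w x))"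
    have Um [measurable]: "U \<in> borel_measurable lebesgue" unfolding U_def using LSD(1,2)[OF L] by simp
    have U0: "0 \<le> U x" for x by (simp add: U_def)
    have US: "U x \<le> S" for x using S by (simp add: U_def)
    have S0: "0 \<le> S" using U0[of 0] US[of 0] by linarith
    have Wm [measurable]: "potential_weight \<in> borel_measurable lebesgue" using potential_weight_integrable by simp
    have BA: "2 * green_norm \<zeta> j \<le> B" if "j \<le> 2" for j
    proof -
      have M: "M \<ge> 0" using z norm_ge_zero order_trans by blast
      have "cmod \<zeta> ^ j \<le> (1 + M) ^ j" using z M by (intro power_mono) auto
      also have "\<dots> \<le> (1 + M)\<^sup>2" using M that by (intro power_increasing) auto
      finally have "cmod \<zeta> ^ j / cmod \<zeta> ^ 3 \<le> (1 + M)\<^sup>2 / m ^ 3"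
        using z m by (intro frac_le power_mono) auto
      then show ?thesis by (simp add: green_norm_def B_def)
    qed
    have mono: "4 * B * (LINT y|lebesgue. exp (- (cmod \<zeta> / 2) * max (s y) 0) * (potential_weight y * U y)) \<le>
       A * (LINT y|lebesgue. exp (- c * max (s y) 0) * (potential_weight y * U y))" if s: "continuous_on UNIV s" for s :: "real \<Rightarrow> real"
    proof -
      have i: "integrable lebesgue (\<lambda>y. exp (- d * max (s y) 0) * (potential_weight y * U y))" if "d \<ge> 0" for d :: real
      proof (rule Bochner_Integration.integrable_bound[OF integrable_mult_right[OF potential_weight_integrable, of S]])
        have [measurable]: "(\<lambda>y. exp (- d * max (s y) 0)) \<in> borel_measurable lebesgue"
          by (intro continuous_lebesgue_measurable continuous_intros s)
        show "(\<lambda>y. exp (- d * max (s y) 0) * (potential_weight y * U y)) \<in> borel_measurable lebesgue" by measurable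
        show "AE y in lebesgue. norm (exp (- d * max (s y) 0) * (potential_weight y * U y)) \<le> norm (S * potential_weight y)"
        proof (intro AE_I2)
          fix y
          have "exp (- d * max (s y) 0) * (potential_weight y * U y) \<le> 1 * (potential_weight y * S)"
            using that US potential_weight_nonneg U0 by (intro mult_mono mult_left_mono) auto
          then show "norm (exp (- d * max (s y) 0) * (potential_weight y * U y)) \<le> norm (S * potential_weight y)"
            using potential_weight_nonneg[of y] U0[of y] S0 by (simp add: abs_mult mult.commute)
        qed
      qed
      have "(LINT y|lebesgue. exp (- (cmod \<zeta> / 2) * max (s y) 0) * (potential_weight y * U y)) \<le> (LINT y|lebesgue. exp (- c * max (s y) 0) * (potential_weight y * U y))"
      proof (intro integral_mono i)
        show "exp (- (cmod \<zeta> / 2) * max (s y) 0) * (potential_weight y * U y) \<le> exp (- c * max (s y) 0) * (potential_weight y * U y)" for y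
          using z U0 potential_weight_nonneg by (intro mult_right_mono) (auto simp: c_def mult_right_mono)
      qed (use c0 in auto)
      then show ?thesis unfolding A_def using B0 by (intro mult_left_mono) auto
    qed
    have 1: "U x \<le> A * (LINT y|lebesgue. exp (- c * max (x - y) 0) * (potential_weight y * U y))" for x
      using LS0_ineq(1)[OF L z(1,2) BA, of x] mono[of "\<lambda>y. x - y"] unfolding U_def
      by (simp add: continuous_intros)
    have 2: "U x \<le> A * (LINT y|lebesgue. exp (- c * max (y - x) 0) * (potential_weight y * U y))" for x
      using LS0_ineq(2)[OF L z(1,2) BA, of x] mono[of "\<lambda>y. y - x"] unfolding U_def
      by (simp add: continuous_intros)
    have pos: "U x \<le> 2 * A * S * N * exp (- c * (x - a))" if "x \<ge> a" for x
      unfolding N_def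
      by (rule exponential_decay[OF Um U0 US potential_weight_integrable potential_weight_nonneg A0 less_imp_le[OF c0] 1 a(2) that])
    have neg: "U (- x) \<le> 2 * A * S * N * exp (- c * (x - a))" if "x \<ge> a" for x
    proof -
      have N': "N = (LINT y|lebesgue. potential_weight (- y))"
        unfolding N_def using lebesgue_integral_real_affine[of "-1" potential_weight 0] by simp
      have F2: "integrable lebesgue (\<lambda>y. potential_weight (- y))"
        using lebesgue_integrable_real_affine_iff[of "-1" potential_weight 0] potential_weight_integrable by simp
      have Um': "(\<lambda>x. U (- x)) \<in> borel_measurable lebesgue"
        using measurable_compose[OF lebesgue_affine_measurable[where c="\<lambda>x::real. -1" and t=0] Um] by simp
      have i2: "U (- x) \<le> A * (LINT y|lebesgue. exp (- c * max (x - y) 0) * (potential_weight (- y) * U (- y)))" for x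
        using 2[of "- x"] lebesgue_integral_real_affine[of "-1" "\<lambda>y. exp (- c * max (y - (- x)) 0) * (potential_weight y * U y)" 0]
        by simp
      show ?thesis
        unfolding N' by (rule exponential_decay[OF Um' _ _ F2 _ A0 less_imp_le[OF c0] i2 a(3) that]) (use U0 US potential_weight_nonneg in auto)
    qed
    have "U x \<le> C * S * exp_abs c x"
    proof (cases "\<bar>x\<bar> \<ge> a")
      case True
      have "U x \<le> 2 * A * S * N * exp (- c * (\<bar>x\<bar> - a))"
        using pos[of x] neg[of "- x"] True by (cases "x \<ge> 0") auto
      also have "\<dots> = (2 * A * N) * exp (c * a) * S * exp_abs c x"
        by (simp add: exp_add[symmetric] algebra_simps)
      also have "\<dots> \<le> C * S * exp_abs c x"
        unfolding C_def using S0 by (intro mult_right_mono) auto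
      finally show ?thesis .
    next
      case False
      have g1: "1 \<le> exp (c * a) * exp_abs c x" using False c0 by (simp add: exp_add[symmetric])
      have "exp (c * a) * exp_abs c x \<le> (2 * A * N + 1) * (exp (c * a) * exp_abs c x)"
        using A0 N0 mult_right_mono[of 1 "2 * A * N + 1" "exp (c * a) * exp_abs c x"] by simp
      from order_trans[OF g1 this] have "1 \<le> C * exp_abs c x" by (simp only: C_def mult.assoc)
      then have "1 * S \<le> C * exp_abs c x * S" using S0 by (rule mult_right_mono)
      then show ?thesis using US[of x] by (simp add: mult_ac)
    qed
    then show ?thesis by (simp add: U_def)
  qed
  ultimately show ?thesis using that[of C] unfolding c_def by blast
qed

lemma exp_abs_L2: "c > 0 \<Longrightarrow> L2 (\<lambda>x. complex_of_real (a * exp_abs c x))"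
  unfolding L2_def
proof
  assume c: "c > 0"
  then have c2: "2 * c > 0" by simp
  show "(\<lambda>x. complex_of_real (a * exp_abs c x)) \<in> borel_measurable lebesgue"
    by (intro continuous_lebesgue_measurable continuous_intros)
  have "(\<lambda>x. (cmod (complex_of_real (a * exp_abs c x)))\<^sup>2) = (\<lambda>x. a\<^sup>2 * exp_abs (2 * c) (x - 0))"
    unfolding norm_of_real power2_abs power_mult_distrib exp_abs_sq diff_0_right ..
  then show "integrable lebesgue (\<lambda>x. (cmod (complex_of_real (a * exp_abs c x)))\<^sup>2)"
    using integrable_mult_right[OF exp_abs_integral(3)[OF c2, of 0], of "a\<^sup>2"] by simp
qed

lemma LS0_L2:
  assumes L: "LS \<zeta> v0 v1 (\<lambda>_. 0) u w" and z: "quadrant \<zeta>" "Im (\<zeta> ^ 4) = 0"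
  shows "L2 u"
proof -
  have m: "cmod \<zeta> > 0" using z by (simp add: quadrant_def)
  obtain S where S: "\<And>x. cmod (u x) \<le> S \<and> cmod (w x) \<le> S" using LSD(3)[OF L] by blast
  have S2: "cmod (u x) + cmod (w x) \<le> S + S" for x using S[of x] by (intro add_mono) auto
  have S0: "S \<ge> 0" using S[of 0] norm_ge_zero order_trans by blast
  obtain C where C: "C > 0" "\<And>x. cmod (u x) + cmod (w x) \<le> C * (S + S) * exp_abs (cmod \<zeta> / 2) x"
    using eigen_decay[OF m, of "cmod \<zeta>"] z L S2 by (metis order_refl)
  have c: "cmod \<zeta> / 2 > 0" using m by simp
  show ?thesis
  proof (rule L2_bound[OF LSD(1)[OF L] exp_abs_L2[OF c, of "C * (S + S)"]])
    show "cmod (u x) \<le> cmod (complex_of_real (C * (S + S) * exp_abs (cmod \<zeta> / 2) x))" for x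
      using C(2)[of x] norm_ge_zero[of "w x"] C(1) S0 unfolding norm_of_real by linarith
  qed
qed

lemma src_zero: "src c (\<lambda>_. 0)" by (auto simp: src_def)

text \<open>On the continuous spectrum the kernel does not decay; the equation is first
  transferred to the spectral parameter \<open>(1 + \<i>)\<^sup>4\<close> by the resolvent identity.\<close>
lemma LS0_Hop:
  assumes L: "LS \<zeta> v0 v1 (\<lambda>_. 0) u w" and z: "quadrant \<zeta>" and i: "Im (\<zeta> ^ 4) = 0"
  shows "Hop v0 v1 u (\<lambda>x. \<zeta> ^ 4 * u x)"
proof -
  define z' where "z' = 1 + \<i>"
  have z': "quadrant z'" "decay_rate z' = 1" by (auto simp: z'_def quadrant_def decay_rate_def complex_eq_iff)
  have c': "decay_rate z' > 0" by (simp add: z')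
  let ?q = "\<lambda>x. 0 - of_real (v0 x) * u x" and ?r = "\<lambda>x. of_real (v1 x) * w x"
  define t where "t = green_op \<zeta> 2 ?q ?r"
  note e = LSD(4,5)[OF L]
  note iv = LS_integrable[OF L]
  have iq: "integrable lebesgue ?q" "integrable lebesgue ?r" using iv by auto
  note s = LS_src[OF L z src_zero]
  note W = LS_W2[OF L z src_zero, folded t_def]
  obtain S where S: "\<And>x. cmod (u x) \<le> S" "\<And>x. cmod (w x) \<le> S" using LSD(3)[OF L] by blast
  obtain T where T: "\<And>x. cmod (t x) \<le> T" using green_op_bounded[OF z s] unfolding t_def by blast
  have tm: "t \<in> borel_measurable lebesgue" unfolding t_def by (rule continuous_lebesgue_measurable[OF green_op_cont[OF z s]])
  have su: "src (decay_rate z') u" "src (decay_rate z') w" "src (decay_rate z') t"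
    using src_bounded[OF LSD(1)[OF L] S(1) c'] src_bounded[OF LSD(2)[OF L] S(2) c'] src_bounded[OF tm T c'] by auto
  \<comment> \<open>The source that is added when the spectral parameter is moved from \<zeta>^4 to
    \<open>z' ^ 4\<close>.\<close>
  define f where "f = (\<lambda>x. (\<zeta> ^ 4 - z' ^ 4) * u x)"
  have "u y = green_op z' 0 (\<lambda>x. f x - of_real (v0 x) * u x) ?r y" for y
  proof -
    let ?k = "\<lambda>j x. green z' j (x - y)"
    have km: "?k j \<in> borel_measurable lebesgue" for j by (rule borel_diff_measurable[OF kernD(1)[OF green_kern[OF z'(1)]]])
    have ik: "integrable lebesgue (?k j)" for j
    proof (rule Bochner_Integration.integrable_bound[OF integrable_mult_right[OF exp_abs_integral(3)[OF c', of y], of "green_norm z' j"] km])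
      show "AE x in lebesgue. norm (?k j x) \<le> norm (green_norm z' j * exp_abs (decay_rate z') (x - y))"
        using green_norm[OF z'(1), of j] green_norm_nonneg[of z' j] by (intro AE_I2) (simp add: abs_mult)
    qed
    have kb: "cmod (?k j x) \<le> green_norm z' j" for j x by (rule kern_bound[OF green_kern[OF z'(1)] decay_rate_nonneg[OF z'(1)]])
    have sk: "src (decay_rate \<zeta>) (?k j)" for j by (rule src_L1[OF ik decay_rate_nonneg[OF z]])
    have ff: "ffin (decay_rate \<zeta>) g (?k j)" if "integrable lebesgue g" for g j
      by (rule ffin_src_L1[OF src_L1[OF that decay_rate_nonneg[OF z]] ik])
    \<comment> \<open>The translated kernel at \<open>z'\<close> is integrable and hence an
      admissible test function even where the kernel at \<zeta> does not decay. Comparing with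
      \<open>KI\<close>, which applies the same kernel to the bounded function \<open>u\<close>,
      eliminates the second derivative.\<close>
    note WI = weak_identity(3)[OF z green_W2[OF z'(1), of y] sk sk sk src_meas[OF s(1)] src_meas[OF s(2)] ff[OF iq(1)] ff[OF iq(1)] ff[OF iq(2)] ff[OF iq(2)]
        bdd_mult_integrable'[OF iq(1) km kb] bdd_mult_integrable'[OF iq(2) km kb], folded e t_def]
    have KI: "(LINT x|lebesgue. t x * ?k 2 x) = z' ^ 4 * (LINT x|lebesgue. u x * ?k 0 x) + u y"
      using kernel_identity(1)[OF z'(1) W(1) su, of y] by (simp only: mult.commute[of "green z' _ _"])
    have c0: "conv (green z' 0) h y = (LINT x|lebesgue. h x * ?k 0 x)" for h
    proof -
      have "green z' 0 (y - x) = ?k 0 x" for x using green_minus[of z' 0 "x - y"] by simp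
      then show ?thesis unfolding conv_def by (simp only: mult.commute)
    qed
    have c1: "conv (green z' 1) h y = - (LINT x|lebesgue. h x * ?k 1 x)" for h
    proof -
      have "green z' 1 (y - x) * h x = - (h x * ?k 1 x)" for x using green_minus[of z' 1 "x - y"] by simp
      then show ?thesis unfolding conv_def by (simp only: integral_minus)
    qed
    have "conv (green z' 0) (\<lambda>x. f x - of_real (v0 x) * u x) y = (\<zeta> ^ 4 - z' ^ 4) * conv (green z' 0) u y - conv (green z' 0) (\<lambda>x. of_real (v0 x) * u x) y"
      unfolding f_def conv_cmult[symmetric]
      by (rule conv_diff[OF green_kern[OF z'(1)] src_cmult[OF su(1)] src_L1[OF iv(1) decay_rate_nonneg[OF z'(1)]]])
    moreover have "(LINT x|lebesgue. ?q x * ?k 0 x) = - (LINT x|lebesgue. (of_real (v0 x) * u x) * ?k 0 x)"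
      by (simp only: diff_0 mult_minus_left integral_minus)
    ultimately have "green_op z' 0 (\<lambda>x. f x - of_real (v0 x) * u x) ?r y =
        (\<zeta> ^ 4 - z' ^ 4) * (LINT x|lebesgue. u x * ?k 0 x) + (LINT x|lebesgue. ?q x * ?k 0 x) - (LINT x|lebesgue. ?r x * ?k 1 x)"
      unfolding green_op_def One_nat_def[symmetric] c0 c1 by simp
    also have "\<dots> = u y" using WI KI by (simp add: algebra_simps)
    finally show ?thesis by simp
  qed
  note uy = this
  \<comment> \<open>Up to here boundedness of \<open>u\<close> was enough. The new source is square
    integrable because of the exponential decay of \<open>u\<close>.\<close>
  have lu: "L2 u" by (rule LS0_L2[OF L z i])
  have lf: "L2 f" unfolding f_def by (rule L2_cmult[OF lu])
  have "LS z' v0 v1 f u w"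
  proof (rule LSI[OF z'(1) _ _ uy])
    show "src (decay_rate z') (\<lambda>x. f x - of_real (v0 x) * u x)" "src (decay_rate z') ?r"
      using src_diff[OF src_L2[OF lf c'] src_L1[OF iv(1) less_imp_le[OF c']]] src_L1[OF iv(2) less_imp_le[OF c']] by auto
    show "(u has_vector_derivative w x) (at x)" for x using W(1) by (simp add: W2_def)
  qed (use LSD(2)[OF L] S in auto)
  from LS_Hop[OF this z'(1) c' lf]
  have "Hop v0 v1 u (\<lambda>x. f x + z' ^ 4 * u x)" .
  moreover have "(\<lambda>x. f x + z' ^ 4 * u x) = (\<lambda>x. \<zeta> ^ 4 * u x)" by (simp add: f_def fun_eq_iff algebra_simps)
  ultimately show ?thesis by simp
qed

end

lemma conv_L1_bound:
  assumes k: "kern A c b" and c: "c \<ge> 0" and q: "integrable lebesgue q"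
  shows "cmod (conv b q x) \<le> A * (LINT y|lebesgue. cmod (q y))"
  using conv_weight_bound[of b A "\<lambda>_. 1" q "\<lambda>y. cmod (q y)" x] kernD[OF k] kern_bound[OF k c] q by simp

lemma imaginary_unit_cancel: "- \<i> * (a * (\<i> * c)) = a * c" "- \<i> * (a * (- \<i> * c)) = - (a * c)"
  by (simp_all add: complex_eq_iff algebra_simps)

section \<open>Eigenvalues and homogeneous solutions\<close>

text \<open>A quarter of \<open>Arg2pi\<close> lies in [0, pi/2), so the root lands in the quadrant,
  and for positive z on its real ray.\<close>

lemma fourth_root:
  assumes z: "z \<noteq> 0"
  obtains \<zeta> where "quadrant \<zeta>" "\<zeta> ^ 4 = z"
proof -
  define t where "t = Arg2pi z / 4"
  have t: "0 \<le> t" "t < pi / 2" using Arg2pi[of z] by (auto simp: t_def)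
  define \<zeta> where "\<zeta> = of_real (root 4 (cmod z)) * exp (\<i> * of_real t)"
  have "\<zeta> ^ 4 = of_real (root 4 (cmod z) ^ 4) * exp (of_nat 4 * (\<i> * of_real t))"
    by (simp only: \<zeta>_def power_mult_distrib of_real_power exp_of_nat_mult)
  also have "root 4 (cmod z) ^ 4 = cmod z" by simp
  also have "of_nat 4 * (\<i> * of_real t) = \<i> * of_real (Arg2pi z)" by (simp add: t_def)
  finally have "\<zeta> ^ 4 = z" using Arg2pi_eq[of z] by simp
  moreover have "quadrant \<zeta>"
    unfolding quadrant_def
  proof (intro conjI)
    show "\<zeta> \<noteq> 0" using z by (simp add: \<zeta>_def)
    have "cos t \<ge> 0" "sin t \<ge> 0" using t by (auto intro!: cos_ge_zero sin_ge_zero)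
    then show "0 \<le> Re \<zeta>" "0 \<le> Im \<zeta>" by (auto simp: \<zeta>_def Re_exp Im_exp)
  qed
  ultimately show ?thesis using that by blast
qed

lemma decay_rate_pos:
  assumes z: "quadrant \<zeta>" and i: "Im (\<zeta> ^ 4) \<noteq> 0"
  shows "decay_rate \<zeta> > 0"
proof -
  have "Im (\<zeta> ^ 4) = 4 * Re \<zeta> * Im \<zeta> * ((Re \<zeta>)\<^sup>2 - (Im \<zeta>)\<^sup>2)"
    by (simp add: power4_eq_xxxx power2_eq_square algebra_simps)
  then have "Re \<zeta> \<noteq> 0" "Im \<zeta> \<noteq> 0" using i by auto
  then show ?thesis using z by (auto simp: quadrant_def decay_rate_def)
qed

lemma continuous_AE_zero:
  fixes u :: "real \<Rightarrow> complex"
  assumes c: "continuous_on UNIV u" and ae: "AE x in lebesgue. u x = 0"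
  shows "u x = 0"
proof (rule ccontr)
  assume "u x \<noteq> 0"
  have "open {x. u x \<noteq> 0}"
    using open_Collect_neq[OF c continuous_on_const] by simp
  then have "\<not> negligible {x. u x \<noteq> 0}" using \<open>u x \<noteq> 0\<close> open_not_negligible by blast
  moreover have "{x. u x \<noteq> 0} \<in> null_sets lebesgue"
    using ae sets_completionI_sets[of "{x. u x \<noteq> 0}" lborel] borel_open[OF \<open>open {x. u x \<noteq> 0}\<close>]
    by (subst (asm) AE_iff_null) auto
  ultimately show False by (simp add: negligible_iff_null_sets)
qed

context potentials
begin

lemma LS_scale:
  assumes L: "LS \<zeta> v0 v1 f u w" and z: "quadrant \<zeta>"
  shows "LS \<zeta> v0 v1 (\<lambda>x. a * f x) (\<lambda>x. a * u x) (\<lambda>x. a * w x)"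
proof -
  have q: "(\<lambda>x. a * f x - of_real (v0 x) * (a * u x)) = (\<lambda>x. a * (f x - of_real (v0 x) * u x))"
    "(\<lambda>x. of_real (v1 x) * (a * w x)) = (\<lambda>x. a * (of_real (v1 x) * w x))"
    by (simp_all add: fun_eq_iff algebra_simps)
  obtain M where M: "\<And>x. cmod (u x) \<le> M \<and> cmod (w x) \<le> M" using LSD(3)[OF L] by blast
  have "cmod (a * u x) \<le> cmod a * M \<and> cmod (a * w x) \<le> cmod a * M" for x
    using M[of x] by (auto simp: norm_mult intro!: mult_left_mono)
  moreover have "\<forall>x. a * u x = green_op \<zeta> 0 (\<lambda>x. a * (f x - of_real (v0 x) * u x)) (\<lambda>x. a * (of_real (v1 x) * w x)) x"
    using fun_cong[OF LSD(4)[OF L]] unfolding green_op_def conv_cmult by (metis (no_types, lifting) distrib_left)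
  moreover have "\<forall>x. a * w x = green_op \<zeta> 1 (\<lambda>x. a * (f x - of_real (v0 x) * u x)) (\<lambda>x. a * (of_real (v1 x) * w x)) x"
    using fun_cong[OF LSD(5)[OF L]] unfolding green_op_def conv_cmult by (metis (no_types, lifting) distrib_left)
  moreover have "(\<lambda>x. a * u x) \<in> borel_measurable lebesgue" "(\<lambda>x. a * w x) \<in> borel_measurable lebesgue"
    using LSD(1,2)[OF L] by simp_all
  ultimately show ?thesis unfolding LS_def q by blast
qed

text \<open>The parameters \<open>Z n\<close> approach \<zeta> with positive decay rate, where
  \<open>Hop_LS\<close> gives the equation with the extra source \<open>(E - Z n ^ 4) u\<close>. Its
  contribution vanishes in the limit: the factor is of order \<open>e n\<close>, while by
  \<open>conv_L2_bound\<close> the convolution grows at most like the inverse square root of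
  \<open>e n\<close>. In this way the boundary rays are reached.\<close>

lemma eigen_LS:
  assumes H: "Hop v0 v1 u (\<lambda>x. of_real E * u x)" and z: "quadrant \<zeta>" and zE: "\<zeta> ^ 4 = of_real E"
  shows "LS \<zeta> v0 v1 (\<lambda>_. 0) u (der u)"
proof -
  have u: "H2 u" using H by (simp add: Hop_def)
  note hu = H2D[OF u]
  have z0: "\<zeta> \<noteq> 0" using z by (simp add: quadrant_def)
  obtain M where M: "\<And>x. cmod (u x) \<le> M" "\<And>x. cmod (der u x) \<le> M" using H2_bounded[OF u] by metis
  note mu = L2D(1)[OF hu(1)] L2D(1)[OF hu(2)]
  let ?v = "\<lambda>x. of_real (v0 x) * u x" and ?r = "\<lambda>x. of_real (v1 x) * der u x"
  have iv: "integrable lebesgue ?v" "integrable lebesgue ?r"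
    using M mu by (auto intro: bdd_mult_integrable[OF v0] bdd_mult_integrable[OF v1])
  have iq: "integrable lebesgue (\<lambda>x. 0 - ?v x)" using iv by simp
  define e where "e = (\<lambda>n. inverse (real (Suc n)))"
  have e0: "e n > 0" for n by (simp add: e_def)
  have el: "e \<longlonglongrightarrow> 0" unfolding e_def by (rule LIMSEQ_inverse_real_of_nat)
  define Z where "Z = (\<lambda>n. \<zeta> + of_real (e n) * (1 + \<i>))"
  have Zl: "Z \<longlonglongrightarrow> \<zeta>"
  proof -
    have "(\<lambda>n. \<zeta> + of_real (e n) * (1 + \<i>)) \<longlonglongrightarrow> \<zeta> + of_real 0 * (1 + \<i>)" by (intro tendsto_intros el)
    then show ?thesis by (simp add: Z_def)
  qed
  have Zq: "quadrant (Z n)" and Zc: "decay_rate (Z n) \<ge> e n" for n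
    using z e0[of n] by (auto simp: quadrant_def decay_rate_def Z_def complex_eq_iff)
  have Zc0: "decay_rate (Z n) > 0" for n using Zc[of n] e0[of n] by linarith
  obtain A where A: "\<And>n. green_norm (Z n) 0 \<le> A" "A > 0" using green_norm_bounded[OF Zl z0] by blast
  define N where "N = (LINT x|lebesgue. (cmod (u x))\<^sup>2)"
  have N0: "N \<ge> 0" by (simp add: N_def)
  have uy: "u y = green_op \<zeta> 0 (\<lambda>x. 0 - ?v x) ?r y" for y
  proof -
    define a where "a = (\<lambda>n. (of_real E - Z n ^ 4) * conv (green (Z n) 0) u y)"
    have eq: "u y = a n + conv (green (Z n) 0) (\<lambda>x. 0 - ?v x) y + conv (green (Z n) 1) ?r y" for n
    proof -
      have k: "kern (green_norm (Z n) 0) (decay_rate (Z n)) (green (Z n) 0)" by (rule green_kern[OF Zq])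
      have su: "src (decay_rate (Z n)) u" by (rule src_L2[OF hu(1) Zc0])
      have sv: "src (decay_rate (Z n)) (\<lambda>x. 0 - ?v x)" by (rule src_L1[OF iq decay_rate_nonneg[OF Zq]])
      have "u y = conv (green (Z n) 0) (\<lambda>x. (of_real E * u x - Z n ^ 4 * u x) - ?v x) y + conv (green (Z n) 1) ?r y"
        using fun_cong[OF LSD(4)[OF Hop_LS[OF H Zq Zc0]], of y n] unfolding green_op_def by simp
      also have "(\<lambda>x. (of_real E * u x - Z n ^ 4 * u x) - ?v x) = (\<lambda>x. (of_real E - Z n ^ 4) * u x + (0 - ?v x))"
        by (simp add: fun_eq_iff algebra_simps)
      also have "conv (green (Z n) 0) \<dots> y = a n + conv (green (Z n) 0) (\<lambda>x. 0 - ?v x) y"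
        unfolding conv_add[OF k src_cmult[OF su] sv] conv_cmult a_def ..
      finally show ?thesis .
    qed
    have "(\<lambda>n. conv (green (Z n) 0) (\<lambda>x. 0 - ?v x) y) \<longlonglongrightarrow> conv (green \<zeta> 0) (\<lambda>x. 0 - ?v x) y"
      by (rule conv_limit[OF Zl z0 Zq _ _ integrable_norm[OF iq]]) (use borel_measurable_integrable[OF iq] in auto)
    moreover have "(\<lambda>n. conv (green (Z n) 1) ?r y) \<longlonglongrightarrow> conv (green \<zeta> 1) ?r y"
      by (rule conv_limit[OF Zl z0 Zq _ _ integrable_norm[OF iv(2)]]) (use borel_measurable_integrable[OF iv(2)] in auto)
    moreover have "a \<longlonglongrightarrow> 0"
    proof -
      \<comment> \<open>The binomial expansion of \<open>Z n ^ 4 - \<zeta> ^ 4\<close>, divided by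
        \<open>e n\<close>; it has a limit.\<close>
      define g where "g = (\<lambda>n. (1 + \<i>) * (4 * \<zeta> ^ 3 + 6 * \<zeta>\<^sup>2 * (of_real (e n) * (1 + \<i>)) + 4 * \<zeta> * (of_real (e n) * (1 + \<i>))\<^sup>2 + (of_real (e n) * (1 + \<i>)) ^ 3))"
      have Zg: "of_real E - Z n ^ 4 = - (of_real (e n) * g n)" for n
      proof -
        have "(\<zeta> + d) ^ 4 = \<zeta> ^ 4 + d * (4 * \<zeta> ^ 3 + 6 * \<zeta>\<^sup>2 * d + 4 * \<zeta> * d\<^sup>2 + d ^ 3)" for d
          by (simp add: power4_eq_xxxx power3_eq_cube power2_eq_square algebra_simps)
        then have "Z n ^ 4 = of_real E + of_real (e n) * (1 + \<i>) * (4 * \<zeta> ^ 3 + 6 * \<zeta>\<^sup>2 * (of_real (e n) * (1 + \<i>)) + 4 * \<zeta> * (of_real (e n) * (1 + \<i>))\<^sup>2 + (of_real (e n) * (1 + \<i>)) ^ 3)"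
          unfolding Z_def zE[symmetric] .
        then show ?thesis by (simp only: g_def mult.assoc) simp
      qed
      have "g \<longlonglongrightarrow> (1 + \<i>) * (4 * \<zeta> ^ 3 + 6 * \<zeta>\<^sup>2 * (of_real 0 * (1 + \<i>)) + 4 * \<zeta> * (of_real 0 * (1 + \<i>))\<^sup>2 + (of_real 0 * (1 + \<i>)) ^ 3)"
        unfolding g_def by (intro tendsto_intros el)
      then have "(\<lambda>n. e n * (cmod (g n))\<^sup>2 * (A\<^sup>2 * N)) \<longlonglongrightarrow> 0 * (cmod ((1 + \<i>) * (4 * \<zeta> ^ 3 + 6 * \<zeta>\<^sup>2 * (of_real 0 * (1 + \<i>)) + 4 * \<zeta> * (of_real 0 * (1 + \<i>))\<^sup>2 + (of_real 0 * (1 + \<i>)) ^ 3)))\<^sup>2 * (A\<^sup>2 * N)"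
        by (intro tendsto_intros el)
      then have lim: "(\<lambda>n. e n * (cmod (g n))\<^sup>2 * (A\<^sup>2 * N)) \<longlonglongrightarrow> 0" by simp
      have le: "(cmod (a n))\<^sup>2 \<le> e n * (cmod (g n))\<^sup>2 * (A\<^sup>2 * N)" for n
      proof -
        have "(cmod (conv (green (Z n) 0) u y))\<^sup>2 \<le> (green_norm (Z n) 0)\<^sup>2 * ((1 / decay_rate (Z n)) * N)"
          unfolding N_def by (rule conv_L2_bound[OF green_kern[OF Zq] Zc0 hu(1)])
        also have "\<dots> \<le> A\<^sup>2 * ((1 / e n) * N)"
          using A green_norm_nonneg Zc e0 N0 Zc0 by (intro mult_mono power_mono frac_le) (auto simp: less_imp_le)
        finally have "(cmod (of_real E - Z n ^ 4))\<^sup>2 * (cmod (conv (green (Z n) 0) u y))\<^sup>2 \<le> (e n * cmod (g n))\<^sup>2 * (A\<^sup>2 * ((1 / e n) * N))"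
          unfolding Zg using e0[of n] by (intro mult_mono) (auto simp: norm_mult)
        also have "\<dots> = e n * (cmod (g n))\<^sup>2 * (A\<^sup>2 * N)" using e0[of n] by (simp add: power_mult_distrib power2_eq_square)
        finally show ?thesis by (simp add: a_def norm_mult power_mult_distrib)
      qed
      have "(\<lambda>n. (cmod (a n))\<^sup>2) \<longlonglongrightarrow> 0"
        by (rule tendsto_sandwich[OF _ _ tendsto_const lim]) (use le in auto)
      then show ?thesis by (simp add: tendsto_norm_zero_iff)
    qed
    ultimately have "(\<lambda>n. a n + conv (green (Z n) 0) (\<lambda>x. 0 - ?v x) y + conv (green (Z n) 1) ?r y) \<longlonglongrightarrow>
        0 + conv (green \<zeta> 0) (\<lambda>x. 0 - ?v x) y + conv (green \<zeta> 1) ?r y"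
      by (intro tendsto_add)
    then have "(\<lambda>n. u y) \<longlonglongrightarrow> green_op \<zeta> 0 (\<lambda>x. 0 - ?v x) ?r y" unfolding eq[symmetric] by (simp add: green_op_def)
    then show ?thesis by (simp add: LIMSEQ_const_iff)
  qed
  have d: "(u has_vector_derivative der u x) (at x)" for x using hu(4) by (simp add: W2_def)
  show ?thesis
    by (rule LSI[OF z src_L1[OF iq decay_rate_nonneg[OF z]] src_L1[OF iv(2) decay_rate_nonneg[OF z]] uy d mu(2)]) (use M in auto)
qed

lemma LS0_eigenvalue:
  assumes L: "LS \<zeta> v0 v1 (\<lambda>_. 0) u w" and z: "quadrant \<zeta>" and E: "\<zeta> ^ 4 = of_real E" and u: "u x \<noteq> 0"
  shows "E \<in> eigenvalues v0 v1"
proof -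
  have "Hop v0 v1 u (\<lambda>x. of_real E * u x)" using LS0_Hop[OF L z] E by simp
  moreover have "\<not> (AE x in lebesgue. u x = 0)"
    using continuous_AE_zero[OF W2_cont(1)[OF LS_W2(1)[OF L z src_zero]]] u by blast
  ultimately show ?thesis unfolding eigenvalues_def by blast
qed

lemma sqrt_L2:
  assumes "integrable lebesgue v" shows "L2 (\<lambda>x. complex_of_real (a * sqrt \<bar>v x\<bar>))"
proof -
  have [measurable]: "v \<in> borel_measurable lebesgue" using assms by simp
  have "(\<lambda>x. complex_of_real (a * sqrt \<bar>v x\<bar>)) \<in> borel_measurable lebesgue" by measurable
  moreover have "(\<lambda>x. (cmod (complex_of_real (a * sqrt \<bar>v x\<bar>)))\<^sup>2) = (\<lambda>x. a\<^sup>2 * \<bar>v x\<bar>)"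
    unfolding norm_of_real power2_abs by (simp add: power_mult_distrib)
  ultimately show ?thesis using assms unfolding L2_def by simp
qed

lemma sgn_sqrt: "sqrt \<bar>v\<bar> * (sgn v * sqrt \<bar>v\<bar>) = (v::real)"
proof -
  have "sqrt \<bar>v\<bar> * (sgn v * sqrt \<bar>v\<bar>) = sgn v * (sqrt \<bar>v\<bar> * sqrt \<bar>v\<bar>)" by (simp only: mult_ac)
  also have "\<dots> = v" by (simp add: sgn_mult_abs)
  finally show ?thesis .
qed

text \<open>The factors \<open>- \<i>\<close> stem from D = -i d/dx: one is put into the source
  \<open>r\<close>, the other remains in front of the derivative.\<close>

lemma R0Gs_green_op:
  assumes z: "\<zeta> \<noteq> 0"
  defines "q \<equiv> \<lambda>f0 x. of_real (sqrt \<bar>v0 x\<bar>) * f0 x" and "r \<equiv> \<lambda>f1 x. - \<i> * (of_real (sqrt \<bar>v1 x\<bar>) * f1 x)"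
  shows "R0Gs \<zeta> v0 v1 f0 f1 x = green_op \<zeta> 0 (q f0) (r f1) x"
    "DR0Gs \<zeta> v0 v1 f0 f1 x = - \<i> * green_op \<zeta> 1 (q f0) (r f1) x"
proof -
  have a: "r0k \<zeta> (x - y) * of_real (sqrt \<bar>v0 y\<bar>) * f0 y = green \<zeta> 0 (x - y) * q f0 y" for y
    by (simp add: r0k_eq q_def)
  have b: "- \<i> * r0k1 \<zeta> (x - y) * of_real (sqrt \<bar>v1 y\<bar>) * f1 y = green \<zeta> 1 (x - y) * r f1 y" for y
    by (simp add: r0k1_eq[OF z] r_def)
  have c: "- \<i> * r0k1 \<zeta> (x - y) * of_real (sqrt \<bar>v0 y\<bar>) * f0 y = - \<i> * (green \<zeta> 1 (x - y) * q f0 y)" for y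
    by (simp add: r0k1_eq[OF z] q_def)
  have d: "- r0k2 \<zeta> (x - y) * of_real (sqrt \<bar>v1 y\<bar>) * f1 y = - \<i> * (green \<zeta> 2 (x - y) * r f1 y)" for y
    unfolding r0k2_eq[OF z] r_def imaginary_unit_cancel(2) by simp
  show "R0Gs \<zeta> v0 v1 f0 f1 x = green_op \<zeta> 0 (q f0) (r f1) x"
    unfolding R0Gs_def a b green_op_def conv_def by simp
  show "DR0Gs \<zeta> v0 v1 f0 f1 x = - \<i> * green_op \<zeta> 1 (q f0) (r f1) x"
    unfolding DR0Gs_def c d green_op_def conv_def integral_mult_right_zero by (simp add: numeral_2_eq_2 algebra_simps)
qed

text \<open>Put \<open>u = R_0 G^* f\<close>. By the equation, which holds a.e., the sources built
  from \<open>f\<close> agree a.e. with those built from \<open>u\<close> and \<open>u'\<close>, and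
  convolutions do not see the difference; so \<open>u\<close> solves the homogeneous integral
  equation everywhere. Were \<open>u\<close> identically 0, the equation would return
  \<open>f = 0\<close>.\<close>

lemma solution_eigenvalue:
  assumes h: "has_nonzero_solution \<zeta> v0 v1" and z: "quadrant \<zeta>" and E: "\<zeta> ^ 4 = of_real E"
  shows "E \<in> eigenvalues v0 v1"
proof -
  have z0: "\<zeta> \<noteq> 0" using z by (simp add: quadrant_def)
  obtain f0 f1 where f: "L2 f0" "L2 f1" and nz: "\<not> ((AE x in lebesgue. f0 x = 0) \<and> (AE x in lebesgue. f1 x = 0))"
    and eq: "AE x in lebesgue. f0 x + of_real (sgn (v0 x) * sqrt \<bar>v0 x\<bar>) * R0Gs \<zeta> v0 v1 f0 f1 x = 0 \<and>
        f1 x + of_real (sgn (v1 x) * sqrt \<bar>v1 x\<bar>) * DR0Gs \<zeta> v0 v1 f0 f1 x = 0"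
    using h unfolding has_nonzero_solution_def by blast
  define q r where "q = (\<lambda>x. of_real (sqrt \<bar>v0 x\<bar>) * f0 x)" and "r = (\<lambda>x. - \<i> * (of_real (sqrt \<bar>v1 x\<bar>) * f1 x))"
  have iq: "integrable lebesgue q" unfolding q_def using L2_prod(1)[OF sqrt_L2[OF v0, of 1] f(1)] by simp
  have ir: "integrable lebesgue r" unfolding r_def using L2_prod(1)[OF sqrt_L2[OF v1, of 1] f(2)] by simp
  have s: "src (decay_rate \<zeta>) q" "src (decay_rate \<zeta>) r" using src_L1[OF iq decay_rate_nonneg[OF z]] src_L1[OF ir decay_rate_nonneg[OF z]] by auto
  define u w where "u = green_op \<zeta> 0 q r" and "w = green_op \<zeta> 1 q r"
  have R: "R0Gs \<zeta> v0 v1 f0 f1 x = u x" "DR0Gs \<zeta> v0 v1 f0 f1 x = - \<i> * w x" for x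
    using R0Gs_green_op[OF z0] by (simp_all add: u_def w_def q_def[abs_def] r_def[abs_def])
  have um: "u \<in> borel_measurable lebesgue" "w \<in> borel_measurable lebesgue"
    unfolding u_def w_def by (auto intro!: continuous_lebesgue_measurable green_op_cont[OF z s])
  have ae: "AE x in lebesgue. q x = 0 - of_real (v0 x) * u x \<and> r x = of_real (v1 x) * w x"
    using eq
  proof eventually_elim
    case (elim x)
    then have e: "f0 x = - (of_real (sgn (v0 x) * sqrt \<bar>v0 x\<bar>) * u x)" "f1 x = of_real (sgn (v1 x) * sqrt \<bar>v1 x\<bar>) * (\<i> * w x)"
      unfolding R by (auto simp: add_eq_0_iff)
    have "q x = - (of_real (sqrt \<bar>v0 x\<bar> * (sgn (v0 x) * sqrt \<bar>v0 x\<bar>)) * u x)"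
      unfolding q_def e(1) of_real_mult by simp
    moreover have "r x = of_real (sqrt \<bar>v1 x\<bar> * (sgn (v1 x) * sqrt \<bar>v1 x\<bar>)) * w x"
      unfolding r_def e(2) of_real_mult
      using imaginary_unit_cancel(1)[of "of_real (sqrt \<bar>v1 x\<bar>) * (of_real (sgn (v1 x)) * of_real (sqrt \<bar>v1 x\<bar>))" "w x"]
      by (simp only: mult.assoc)
    ultimately show ?case unfolding sgn_sqrt by simp
  qed
  obtain M0 where M0: "\<And>x. cmod (u x) \<le> M0" using green_op_bounded[OF z s, of 0] unfolding u_def by blast
  obtain M1 where M1: "\<And>x. cmod (w x) \<le> M1" using green_op_bounded[OF z s, of 1] unfolding w_def by blast
  have iv: "integrable lebesgue (\<lambda>x. 0 - of_real (v0 x) * u x)" "integrable lebesgue (\<lambda>x. of_real (v1 x) * w x)"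
    using bdd_mult_integrable[OF v0 um(1) M0] bdd_mult_integrable[OF v1 um(2) M1] by auto
  have cq: "conv (green \<zeta> j) q x = conv (green \<zeta> j) (\<lambda>x. 0 - of_real (v0 x) * u x) x" for j x
    unfolding conv_def
  proof (rule integral_cong_AE)
    show "(\<lambda>y. green \<zeta> j (x - y) * q y) \<in> borel_measurable lebesgue"
      by (rule borel_measurable_integrable[OF conv_integrable[OF green_kern[OF z] s(1)]])
    show "(\<lambda>y. green \<zeta> j (x - y) * (0 - of_real (v0 y) * u y)) \<in> borel_measurable lebesgue"
      by (rule borel_measurable_integrable[OF conv_integrable[OF green_kern[OF z] src_L1[OF iv(1) decay_rate_nonneg[OF z]]]])
    show "AE y in lebesgue. green \<zeta> j (x - y) * q y = green \<zeta> j (x - y) * (0 - of_real (v0 y) * u y)"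
      using ae by eventually_elim simp
  qed
  have cr: "conv (green \<zeta> j) r x = conv (green \<zeta> j) (\<lambda>x. of_real (v1 x) * w x) x" for j x
    unfolding conv_def
  proof (rule integral_cong_AE)
    show "(\<lambda>y. green \<zeta> j (x - y) * r y) \<in> borel_measurable lebesgue"
      by (rule borel_measurable_integrable[OF conv_integrable[OF green_kern[OF z] s(2)]])
    show "(\<lambda>y. green \<zeta> j (x - y) * (of_real (v1 y) * w y)) \<in> borel_measurable lebesgue"
      by (rule borel_measurable_integrable[OF conv_integrable[OF green_kern[OF z] src_L1[OF iv(2) decay_rate_nonneg[OF z]]]])
    show "AE y in lebesgue. green \<zeta> j (x - y) * r y = green \<zeta> j (x - y) * (of_real (v1 y) * w y)"
      using ae by eventually_elim simp
  qed
  have P: "green_op \<zeta> j q r x = green_op \<zeta> j (\<lambda>x. 0 - of_real (v0 x) * u x) (\<lambda>x. of_real (v1 x) * w x) x" for j x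
    unfolding green_op_def cq cr ..
  have "(u has_vector_derivative w x) (at x)" for x
    using green_op_W2[OF z s] by (simp add: W2_def u_def w_def)
  moreover have "u x = green_op \<zeta> 0 (\<lambda>x. 0 - of_real (v0 x) * u x) (\<lambda>x. of_real (v1 x) * w x) x" for x
    using P[of 0 x] by (simp add: u_def)
  moreover have "cmod (u x) \<le> max M0 M1" "cmod (w x) \<le> max M0 M1" for x
    using M0 M1 by (auto simp: le_max_iff_disj)
  ultimately have L: "LS \<zeta> v0 v1 (\<lambda>_. 0) u w"
    by (intro LSI[OF z src_L1[OF iv(1) decay_rate_nonneg[OF z]] src_L1[OF iv(2) decay_rate_nonneg[OF z]] _ _ um(2)])
  have "\<exists>x. u x \<noteq> 0"
  proof (rule ccontr)
    assume "\<nexists>x. u x \<noteq> 0"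
    then have u0: "u = (\<lambda>x. 0)" by (simp add: fun_eq_iff)
    then have "((\<lambda>x. 0) has_vector_derivative w x) (at x)" for x
      using LS_W2(1)[OF L z src_zero] by (simp add: W2_def)
    then have w0: "w x = 0" for x
      using vector_derivative_unique_at has_vector_derivative_const by blast
    have "AE x in lebesgue. f0 x = 0" "AE x in lebesgue. f1 x = 0"
      using eq unfolding R u0 w0 by auto
    then show False using nz by blast
  qed
  then show ?thesis using LS0_eigenvalue[OF L z E] by blast
qed

text \<open>The pair is read off from the eigenfunction by the equation itself. If it vanished a.e.,
  both sources would vanish a.e., and then \<open>u\<close> by its integral equation.\<close>

lemma eigenvalue_solution:
  assumes E: "E \<in> eigenvalues v0 v1" and z: "quadrant \<zeta>" and zE: "\<zeta> ^ 4 = of_real E"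
  shows "has_nonzero_solution \<zeta> v0 v1"
proof -
  have z0: "\<zeta> \<noteq> 0" using z by (simp add: quadrant_def)
  obtain u where nz: "\<not> (AE x in lebesgue. u x = 0)" and H: "Hop v0 v1 u (\<lambda>x. of_real E * u x)"
    using E unfolding eigenvalues_def by blast
  note L = eigen_LS[OF H z zE]
  define w where "w = der u"
  note L = L[folded w_def]
  obtain M where M: "\<And>x. cmod (u x) \<le> M" "\<And>x. cmod (w x) \<le> M" using LSD(3)[OF L] by blast
  \<comment> \<open>\<open>f1\<close> carries \<open>\<i>\<close> with a plus sign because the
    equation asks for minus \<open>D u\<close>, and \<open>D u = - \<i> u'\<close>.\<close>
  define f0 f1 where "f0 = (\<lambda>x. - (of_real (sgn (v0 x) * sqrt \<bar>v0 x\<bar>) * u x))" and "f1 = (\<lambda>x. of_real (sgn (v1 x) * sqrt \<bar>v1 x\<bar>) * (\<i> * w x))"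
  have vm: "v0 \<in> borel_measurable lebesgue" "v1 \<in> borel_measurable lebesgue" using v0 v1 by simp_all
  have M0: "M \<ge> 0" using M(1)[of 0] norm_ge_zero order_trans by blast
  have sgnm: "(\<lambda>x. sgn (v x)) \<in> borel_measurable lebesgue" if "v \<in> borel_measurable lebesgue" for v :: "real \<Rightarrow> real"
    using that unfolding sgn_if by measurable
  have bd: "cmod (of_real (sgn a * sqrt \<bar>a\<bar>) * b) \<le> cmod (complex_of_real (M * sqrt \<bar>a\<bar>))" if "cmod b \<le> M" for a b
  proof -
    have "\<bar>sgn a\<bar> * sqrt \<bar>a\<bar> * cmod b \<le> 1 * sqrt \<bar>a\<bar> * M" using that M0 by (intro mult_mono) (auto simp: abs_sgn_eq)
    then show ?thesis using M0 by (simp add: norm_mult abs_mult mult.commute)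
  qed
  have m0: "f0 \<in> borel_measurable lebesgue" "f1 \<in> borel_measurable lebesgue"
    unfolding f0_def f1_def using vm sgnm[OF vm(1)] sgnm[OF vm(2)] LSD(1,2)[OF L] by measurable
  have l: "L2 f0" "L2 f1"
    by (rule L2_bound[OF m0(1) sqrt_L2[OF v0, of M]], unfold f0_def norm_minus_cancel, rule bd, rule M,
        rule L2_bound[OF m0(2) sqrt_L2[OF v1, of M]], unfold f1_def, rule bd, use M in \<open>simp add: norm_mult\<close>)
  have q: "of_real (sqrt \<bar>v0 x\<bar>) * f0 x = 0 - of_real (v0 x) * u x" for x
  proof -
    have "of_real (sqrt \<bar>v0 x\<bar>) * f0 x = - (of_real (sqrt \<bar>v0 x\<bar> * (sgn (v0 x) * sqrt \<bar>v0 x\<bar>)) * u x)"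
      unfolding f0_def of_real_mult by simp
    then show ?thesis unfolding sgn_sqrt by simp
  qed
  have r: "- \<i> * (of_real (sqrt \<bar>v1 x\<bar>) * f1 x) = of_real (v1 x) * w x" for x
  proof -
    have "- \<i> * (of_real (sqrt \<bar>v1 x\<bar>) * f1 x) = of_real (sqrt \<bar>v1 x\<bar> * (sgn (v1 x) * sqrt \<bar>v1 x\<bar>)) * w x"
      unfolding f1_def of_real_mult
      using imaginary_unit_cancel(1)[of "of_real (sqrt \<bar>v1 x\<bar>) * (of_real (sgn (v1 x)) * of_real (sqrt \<bar>v1 x\<bar>))" "w x"]
      by (simp only: mult.assoc)
    then show ?thesis unfolding sgn_sqrt by simp
  qed
  have R: "R0Gs \<zeta> v0 v1 f0 f1 x = u x" "DR0Gs \<zeta> v0 v1 f0 f1 x = - \<i> * w x" for x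
    using fun_cong[OF LSD(4)[OF L], of x] fun_cong[OF LSD(5)[OF L], of x] R0Gs_green_op[OF z0, of f0 f1 x]
    unfolding q r by simp_all
  have "\<not> ((AE x in lebesgue. f0 x = 0) \<and> (AE x in lebesgue. f1 x = 0))"
  proof
    assume a: "(AE x in lebesgue. f0 x = 0) \<and> (AE x in lebesgue. f1 x = 0)"
    have c0: "conv (green \<zeta> j) g x = 0" if "AE y in lebesgue. g y = 0" for j g x
      unfolding conv_def by (rule integral_eq_zero_AE) (use that in \<open>eventually_elim, simp\<close>)
    have a0: "AE x in lebesgue. 0 - of_real (v0 x) * u x = 0" using a unfolding q[symmetric] by (auto elim: AE_mp)
    have a1: "AE x in lebesgue. of_real (v1 x) * w x = 0" using a unfolding r[symmetric] by (auto elim: AE_mp)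
    have "u x = 0" for x
      by (rule trans[OF fun_cong[OF LSD(4)[OF L]]]) (simp only: green_op_def c0[OF a0] c0[OF a1] add_0)
    then show False using nz by simp
  qed
  then show ?thesis
    unfolding has_nonzero_solution_def using l R by (intro exI[of _ f0] exI[of _ f1]) (simp add: f0_def f1_def)
qed

lemma Ncal_eq: "Ncal v0 v1 = {E \<in> eigenvalues v0 v1. E > 0}"
proof -
  have z: "quadrant (of_real (root 4 E))" "quadrant (\<i> * of_real (root 4 E))" "(of_real (root 4 E)) ^ 4 = complex_of_real E"
    "(\<i> * of_real (root 4 E)) ^ 4 = complex_of_real E" if "E > 0" for E
  proof -
    have "root 4 E ^ 4 = E" using that by simp
    then show r: "(of_real (root 4 E)) ^ 4 = complex_of_real E" by (metis of_real_power)
    then show "(\<i> * of_real (root 4 E)) ^ 4 = complex_of_real E" by (simp add: power_mult_distrib)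
  qed (use that in \<open>auto simp: quadrant_def\<close>)
  show ?thesis
    unfolding Ncal_def using z solution_eigenvalue eigenvalue_solution by blast
qed

section \<open>Compactness and limiting absorption\<close>

text \<open>The solution enters the right-hand side only through the integrals of
  \<open>v0 u\<close> and \<open>v1 w\<close>. Unlike the supremum, these pass to the limit along
  pointwise convergent bounded sequences.\<close>

lemma LS_pointwise_bound:
  assumes L: "LS \<zeta> v0 v1 f u w" and z: "quadrant \<zeta>" and f: "integrable lebesgue f" and A: "\<And>j. j \<le> 2 \<Longrightarrow> green_norm \<zeta> j \<le> A"
  shows "cmod (u x) + cmod (w x) \<le> 2 * A * ((LINT y|lebesgue. cmod (f y)) + (LINT y|lebesgue. cmod (of_real (v0 y) * u y)) + (LINT y|lebesgue. cmod (of_real (v1 y) * w y)))"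
proof -
  let ?q = "\<lambda>x. f x - of_real (v0 x) * u x" and ?r = "\<lambda>x. of_real (v1 x) * w x"
  note iv = LS_integrable[OF L]
  have iq: "integrable lebesgue ?q" using f iv by simp
  have c: "cmod (conv (green \<zeta> j) g x) \<le> A * (LINT y|lebesgue. cmod (g y))" if "integrable lebesgue g" "j \<le> 2" for g j
    using conv_L1_bound[OF green_kern[OF z] decay_rate_nonneg[OF z] that(1), of j x] mult_right_mono[OF A[OF that(2)], of "LINT y|lebesgue. cmod (g y)"]
    by simp
  have q: "(LINT y|lebesgue. cmod (?q y)) \<le> (LINT y|lebesgue. cmod (f y)) + (LINT y|lebesgue. cmod (of_real (v0 y) * u y))"
  proof -
    have "(LINT y|lebesgue. cmod (?q y)) \<le> (LINT y|lebesgue. cmod (f y) + cmod (of_real (v0 y) * u y))"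
      using f iv iq by (intro integral_mono norm_triangle_ineq4) auto
    then show ?thesis using f iv by simp
  qed
  have A0: "A \<ge> 0" using A[of 0] green_norm_nonneg[of \<zeta> 0] by simp
  have "cmod (u x) \<le> A * (LINT y|lebesgue. cmod (?q y)) + A * (LINT y|lebesgue. cmod (?r y))"
    by (subst LSD(4)[OF L], unfold green_op_def, rule order_trans[OF norm_triangle_ineq add_mono[OF c c]]) (use iq iv in auto)
  moreover have "cmod (w x) \<le> A * (LINT y|lebesgue. cmod (?q y)) + A * (LINT y|lebesgue. cmod (?r y))"
    by (subst LSD(5)[OF L], unfold green_op_def, rule order_trans[OF norm_triangle_ineq add_mono[OF c c]]) (use iq iv in auto)
  moreover have "A * (LINT y|lebesgue. cmod (?q y)) \<le> A * ((LINT y|lebesgue. cmod (f y)) + (LINT y|lebesgue. cmod (of_real (v0 y) * u y)))"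
    by (rule mult_left_mono[OF q A0])
  ultimately show ?thesis by (simp add: algebra_simps)
qed

end

lemma vector_lipschitz:
  fixes f :: "real \<Rightarrow> complex"
  assumes d: "\<And>x. (f has_vector_derivative f' x) (at x)" and B: "\<And>x. cmod (f' x) \<le> B"
  shows "cmod (f x - f y) \<le> B * \<bar>x - y\<bar>"
proof -
  have "norm (f x - f y) \<le> B * norm (x - y)"
  proof (rule differentiable_bound[where S=UNIV and f'="\<lambda>x h. h *\<^sub>R f' x"])
    show "(f has_derivative (\<lambda>h. h *\<^sub>R f' x)) (at x within UNIV)" for x
      using d[of x] by (simp add: has_vector_derivative_def)
    show "onorm (\<lambda>h. h *\<^sub>R f' x) \<le> B" for x
    proof (rule onorm_le)
      fix h
      show "norm (h *\<^sub>R f' x) \<le> B * norm h"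
        using mult_left_mono[OF B[of x] abs_ge_zero[of h]] by (simp add: mult.commute)
    qed
  qed auto
  then show ?thesis by simp
qed

text \<open>An Arzela--Ascoli argument: a diagonal subsequence converges at the rationals, and the
  common Lipschitz constant carries the Cauchy property to all points. Pointwise convergence is the
  mode that dominated convergence against L1 potentials asks for.\<close>

lemma pointwise_compactness:
  fixes F :: "nat \<Rightarrow> real \<Rightarrow> 'a::{banach, heine_borel}"
  assumes M: "\<And>n x. norm (F n x) \<le> M" and L: "\<And>n x y. norm (F n x - F n y) \<le> L * \<bar>x - y\<bar>"
  obtains r G where "strict_mono (r :: nat \<Rightarrow> nat)" "\<And>x. (\<lambda>n. F (r n) x) \<longlonglongrightarrow> G x"
proof -
  have cQ: "countable (\<rat> :: real set)" by (rule countable_rat)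
  obtain r where r: "strict_mono r" "\<And>x. x \<in> \<rat> \<Longrightarrow> \<exists>l. (\<lambda>n. F (r n) x) \<longlonglongrightarrow> l"
    using function_convergent_subsequence[OF cQ, of F M] M by metis
  have L0: "L \<ge> 0" using order_trans[OF norm_ge_zero L[of 0 0 1]] by simp
  have "Cauchy (\<lambda>n. F (r n) x)" for x
  proof (rule CauchyI)
    fix e :: real assume e: "e > 0"
    define d where "d = e / (3 * (L + 1))"
    have d: "d > 0" using e L0 by (simp add: d_def)
    obtain q where q: "q \<in> \<rat>" "x < q" "q < x + d" using Rats_dense_in_real[of x "x + d"] d by auto
    have Ld: "L * \<bar>x - q\<bar> < e / 3"
    proof -
      have "L * \<bar>x - q\<bar> \<le> L * d" using q L0 by (intro mult_left_mono) auto
      also have "\<dots> < (L + 1) * d" using d by simp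
      also have "\<dots> = e / 3" using L0 by (simp add: d_def field_simps)
      finally show ?thesis .
    qed
    have "Cauchy (\<lambda>n. F (r n) q)" using r(2)[OF q(1)] by (auto intro: LIMSEQ_imp_Cauchy)
    then obtain N where N: "\<And>m n. m \<ge> N \<Longrightarrow> n \<ge> N \<Longrightarrow> norm (F (r m) q - F (r n) q) < e / 3"
      using e by (meson CauchyD divide_pos_pos zero_less_numeral)
    have "norm (F (r m) x - F (r n) x) < e" if "m \<ge> N" "n \<ge> N" for m n
    proof -
      let ?a = "F (r m) x - F (r m) q" and ?b = "F (r m) q - F (r n) q" and ?c = "F (r n) x - F (r n) q"
      have "norm (?a + ?b - ?c) \<le> norm ?a + norm ?b + norm ?c"
        using norm_triangle_ineq4[of "?a + ?b" ?c] norm_triangle_ineq[of ?a ?b] by linarith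
      moreover have "?a + ?b - ?c = F (r m) x - F (r n) x" by simp
      ultimately have "norm (F (r m) x - F (r n) x) \<le> norm ?a + norm ?b + norm ?c" by metis
      then show ?thesis using L[of "r m" x q] L[of "r n" x q] N[OF that] Ld by linarith
    qed
    then show "\<exists>N. \<forall>m\<ge>N. \<forall>n\<ge>N. norm (F (r m) x - F (r n) x) < e" by blast
  qed
  then have "\<exists>l. (\<lambda>n. F (r n) x) \<longlonglongrightarrow> l" for x using Cauchy_convergent_iff convergent_def by blast
  then show ?thesis using r(1) that by metis
qed

context potentials
begin

text \<open>Convergence is assumed of the fourth powers, since a positive limit has roots on both
  boundary rays; passing to a subsequence selects one. The sources tend to 0 in L1, which makes the
  limit a homogeneous solution.\<close>

lemma LS_compactness:
  assumes z: "(\<lambda>n. \<zeta>n n ^ 4) \<longlonglongrightarrow> z" "z \<noteq> 0" and q: "\<And>n. quadrant (\<zeta>n n)" and L: "\<And>n. LS (\<zeta>n n) v0 v1 (g n) (u n) (w n)"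
    and g: "\<And>n. integrable lebesgue (g n)" "(\<lambda>n. LINT x|lebesgue. cmod (g n x)) \<longlonglongrightarrow> 0"
    and b: "\<And>n x. cmod (u n x) + cmod (w n x) \<le> 1" and nz: "\<And>n. \<exists>x. cmod (u n x) + cmod (w n x) \<ge> 1/2"
  obtains r \<zeta> G G2 x where "strict_mono (r :: nat \<Rightarrow> nat)" "quadrant \<zeta>" "\<zeta> ^ 4 = z" "(\<lambda>n. \<zeta>n (r n)) \<longlonglongrightarrow> \<zeta>"
    "\<And>x. (\<lambda>n. u (r n) x) \<longlonglongrightarrow> G x" "LS \<zeta> v0 v1 (\<lambda>_. 0) G G2" "G x \<noteq> 0"
proof -
  have "Bseq (\<lambda>n. \<zeta>n n ^ 4)" using z(1) convergent_imp_Bseq convergent_def by blast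
  then obtain K where K: "K > 0" "\<And>n. cmod (\<zeta>n n ^ 4) \<le> K" by (auto simp: Bseq_def)
  have "cmod (\<zeta>n n) \<le> root 4 K" for n
    using K(2)[of n] by (metis norm_ge_zero norm_power real_root_le_iff real_root_power_cancel zero_less_numeral)
  then have in1: "\<forall>n. \<zeta>n n \<in> cball 0 (root 4 K)" by simp
  obtain \<zeta> r1 where r1: "strict_mono (r1 :: nat \<Rightarrow> nat)" "(\<zeta>n \<circ> r1) \<longlonglongrightarrow> \<zeta>"
    using seq_compactE[OF compact_imp_seq_compact[OF compact_cball] in1] by metis
  have r1': "(\<lambda>n. \<zeta>n (r1 n)) \<longlonglongrightarrow> \<zeta>" using r1(2) by (simp add: comp_def)
  have "(\<lambda>n. \<zeta>n (r1 n) ^ 4) \<longlonglongrightarrow> z" using LIMSEQ_subseq_LIMSEQ[OF z(1) r1(1)] by (simp add: comp_def)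
  moreover have "(\<lambda>n. \<zeta>n (r1 n) ^ 4) \<longlonglongrightarrow> \<zeta> ^ 4" by (intro tendsto_intros r1')
  ultimately have z4: "\<zeta> ^ 4 = z" by (metis LIMSEQ_unique)
  have z0: "\<zeta> \<noteq> 0" using z4 z(2) by auto
  have "Re \<zeta> \<ge> 0" by (rule LIMSEQ_le_const[OF tendsto_Re[OF r1']]) (use q in \<open>auto simp: quadrant_def\<close>)
  moreover have "Im \<zeta> \<ge> 0" by (rule LIMSEQ_le_const[OF tendsto_Im[OF r1']]) (use q in \<open>auto simp: quadrant_def\<close>)
  ultimately have cz: "quadrant \<zeta>" using z0 by (simp add: quadrant_def)
  obtain A0 where A0: "\<And>n. green_norm (\<zeta>n (r1 n)) 0 \<le> A0" "A0 > 0" using green_norm_bounded[OF r1' z0] by blast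
  obtain A1 where A1: "\<And>n. green_norm (\<zeta>n (r1 n)) 1 \<le> A1" "A1 > 0" using green_norm_bounded[OF r1' z0] by blast
  obtain A2 where A2: "\<And>n. green_norm (\<zeta>n (r1 n)) 2 \<le> A2" "A2 > 0" using green_norm_bounded[OF r1' z0] by blast
  obtain A3 where A3: "\<And>n. green_norm (\<zeta>n (r1 n)) 3 \<le> A3" "A3 > 0" using green_norm_bounded[OF r1' z0] by blast
  define A where "A = A0 + A1 + A2 + A3"
  have A: "green_norm (\<zeta>n (r1 n)) j \<le> A" if "j \<le> 3" for n j
  proof -
    have "j = 0 \<or> j = 1 \<or> j = 2 \<or> j = 3" using that by auto
    then show ?thesis using A0(1)[of n] A1(1)[of n] A2(1)[of n] A3(1)[of n] A0(2) A1(2) A2(2) A3(2) unfolding A_def by auto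
  qed
  have Ap: "A > 0" using A0 A1 A2 A3 by (simp add: A_def)
  define U W R where "U = (\<lambda>n. u (r1 n))" and "W = (\<lambda>n. w (r1 n))" and "R = (\<lambda>n. g (r1 n))"
  define Z where "Z = (\<lambda>n. \<zeta>n (r1 n))"
  have A: "green_norm (Z n) j \<le> A" if "j \<le> 3" for n j using A[OF that] by (simp add: Z_def)
  have Zl: "Z \<longlonglongrightarrow> \<zeta>" using r1' by (simp add: Z_def)
  have Zq: "quadrant (Z n)" for n using q by (simp add: Z_def)
  have LU: "LS (Z n) v0 v1 (R n) (U n) (W n)" for n using L by (simp add: Z_def R_def U_def W_def)
  have Ri: "integrable lebesgue (R n)" for n using g by (simp add: R_def)
  have R0: "(\<lambda>n. LINT x|lebesgue. cmod (R n x)) \<longlonglongrightarrow> 0"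
    using LIMSEQ_subseq_LIMSEQ[OF g(2) r1(1)] by (simp add: comp_def R_def)
  have UW: "cmod (U n x) + cmod (W n x) \<le> 1" for n x using b by (simp add: U_def W_def)
  have U1: "cmod (U n x) \<le> 1" "cmod (W n x) \<le> 1" for n x
    using UW[of n x] norm_ge_zero[of "U n x"] norm_ge_zero[of "W n x"] by linarith+
  have sR: "src (decay_rate (Z n)) (R n)" for n by (rule src_L1[OF Ri decay_rate_nonneg[OF Zq]])
  obtain KR where KR: "\<And>n. (LINT x|lebesgue. cmod (R n x)) \<le> KR"
  proof -
    have "Bseq (\<lambda>n. LINT x|lebesgue. cmod (R n x))" using R0 convergent_imp_Bseq convergent_def by blast
    then obtain KR where "\<And>n. norm (LINT x|lebesgue. cmod (R n x)) \<le> KR" by (auto simp: Bseq_def)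
    then show ?thesis using that[of KR] by (metis abs_le_D1 real_norm_def)
  qed
  have iv: "integrable lebesgue (\<lambda>x. of_real (v0 x) * U n x)" "integrable lebesgue (\<lambda>x. of_real (v1 x) * W n x)" for n
    using LS_integrable[OF LU] by auto
  define N where "N = (LINT x|lebesgue. \<bar>v0 x\<bar>) + (LINT x|lebesgue. \<bar>v1 x\<bar>)"
  \<comment> \<open>The second derivatives; their uniform bound makes the functions
    \<open>W n\<close> equi-Lipschitz.\<close>
  define t where "t = (\<lambda>n. green_op (Z n) 2 (\<lambda>x. R n x - of_real (v0 x) * U n x) (\<lambda>x. of_real (v1 x) * W n x))"
  have tb: "cmod (t n x) \<le> A * (KR + N)" for n x
  proof -
    let ?q = "\<lambda>x. R n x - of_real (v0 x) * U n x" and ?r = "\<lambda>x. of_real (v1 x) * W n x"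
    have iq: "integrable lebesgue ?q" using Ri iv by simp
    have c: "cmod (conv (green (Z n) j) h x) \<le> A * (LINT y|lebesgue. cmod (h y))" if "integrable lebesgue h" "j \<le> 3" for h j
      by (rule order_trans[OF conv_L1_bound[OF green_kern[OF Zq] decay_rate_nonneg[OF Zq] that(1)] mult_right_mono[OF A[OF that(2)]]]) simp
    have "(LINT y|lebesgue. cmod (?q y)) \<le> (LINT y|lebesgue. cmod (R n y) + \<bar>v0 y\<bar>)"
    proof (rule integral_mono)
      show "cmod (?q y) \<le> cmod (R n y) + \<bar>v0 y\<bar>" for y
        using norm_triangle_ineq4[of "R n y" "of_real (v0 y) * U n y"] mult_left_mono[OF U1(1)[of n y], of "\<bar>v0 y\<bar>"]
        by (simp add: norm_mult)
    qed (use iq Ri v0 in auto)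
    also have "\<dots> = (LINT y|lebesgue. cmod (R n y)) + (LINT y|lebesgue. \<bar>v0 y\<bar>)" using Ri v0 by simp
    finally have 1: "(LINT y|lebesgue. cmod (?q y)) \<le> KR + (LINT y|lebesgue. \<bar>v0 y\<bar>)" using KR[of n] by linarith
    have 2: "(LINT y|lebesgue. cmod (?r y)) \<le> (LINT y|lebesgue. \<bar>v1 y\<bar>)"
    proof (rule integral_mono)
      show "cmod (?r y) \<le> \<bar>v1 y\<bar>" for y
        using mult_left_mono[OF U1(2)[of n y], of "\<bar>v1 y\<bar>"] by (simp add: norm_mult)
    qed (use iv v1 in auto)
    have "cmod (t n x) \<le> cmod (conv (green (Z n) 2) ?q x) + cmod (conv (green (Z n) 3) ?r x)"
      unfolding t_def green_op_def by (simp add: norm_triangle_ineq numeral_3_eq_3 numeral_2_eq_2)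
    also have "\<dots> \<le> A * (LINT y|lebesgue. cmod (?q y)) + A * (LINT y|lebesgue. cmod (?r y))"
      by (intro add_mono c iq iv) auto
    also have "\<dots> \<le> A * (KR + (LINT y|lebesgue. \<bar>v0 y\<bar>)) + A * (LINT y|lebesgue. \<bar>v1 y\<bar>)"
      using 1 2 Ap by (intro add_mono mult_left_mono) auto
    also have "\<dots> = A * (KR + N)" by (simp add: N_def algebra_simps)
    finally show ?thesis .
  qed
  note WU = LS_W2[OF LU Zq sR, folded t_def]
  have l1: "cmod (U n x - U n y) \<le> 1 * \<bar>x - y\<bar>" for n x y
    by (rule vector_lipschitz[where f'="W n"]) (use WU(1)[of n] U1 in \<open>auto simp: W2_def\<close>)
  have l2: "cmod (W n x - W n y) \<le> A * (KR + N) * \<bar>x - y\<bar>" for n x y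
    by (rule vector_lipschitz[where f'="t n"]) (use WU(2)[of n] tb in \<open>auto simp: t_def\<close>)
  obtain r2 G where r2: "strict_mono (r2 :: nat \<Rightarrow> nat)" "\<And>x. (\<lambda>n. (U (r2 n) x, W (r2 n) x)) \<longlonglongrightarrow> G x"
  proof (rule pointwise_compactness[of "\<lambda>n x. (U n x, W n x)" 1 "1 + A * (KR + N)"])
    show "norm (U n x, W n x) \<le> 1" for n x
      using norm_Pair_le[of "U n x" "W n x"] UW[of n x] by simp
    show "norm ((U n x, W n x) - (U n y, W n y)) \<le> (1 + A * (KR + N)) * \<bar>x - y\<bar>" for n x y
      using norm_Pair_le[of "U n x - U n y" "W n x - W n y"] l1[of n x y] l2[of n x y]
      by (simp add: distrib_right)
  qed blast
  define G1 G2 where "G1 = (\<lambda>x. fst (G x))" and "G2 = (\<lambda>x. snd (G x))"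
  have U': "(\<lambda>n. U (r2 n) x) \<longlonglongrightarrow> G1 x" and W': "(\<lambda>n. W (r2 n) x) \<longlonglongrightarrow> G2 x" for x
    using tendsto_fst[OF r2(2)[of x]] tendsto_snd[OF r2(2)[of x]] by (simp_all add: G1_def G2_def)
  have Gm: "G1 \<in> borel_measurable lebesgue" "G2 \<in> borel_measurable lebesgue"
    using borel_measurable_LIMSEQ_metric[OF LSD(1)[OF LU] U'] borel_measurable_LIMSEQ_metric[OF LSD(2)[OF LU] W'] by auto
  have Gb: "cmod (G1 x) \<le> 1" "cmod (G2 x) \<le> 1" for x
    by (rule LIMSEQ_le_const2[OF tendsto_norm[OF U']], use U1 in blast, rule LIMSEQ_le_const2[OF tendsto_norm[OF W']], use U1 in blast)
  have Z2: "(\<lambda>n. Z (r2 n)) \<longlonglongrightarrow> \<zeta>" using LIMSEQ_subseq_LIMSEQ[OF Zl r2(1)] by (simp add: comp_def)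
  have R2: "(\<lambda>n. LINT x|lebesgue. cmod (R (r2 n) x)) \<longlonglongrightarrow> 0"
    using LIMSEQ_subseq_LIMSEQ[OF R0 r2(1)] by (simp add: comp_def)
  have lim: "(\<lambda>n. green_op (Z (r2 n)) j (\<lambda>x. R (r2 n) x - of_real (v0 x) * U (r2 n) x) (\<lambda>x. of_real (v1 x) * W (r2 n) x) x)
     \<longlonglongrightarrow> green_op \<zeta> j (\<lambda>x. 0 - of_real (v0 x) * G1 x) (\<lambda>x. of_real (v1 x) * G2 x) x" if j: "j \<le> 1" for j x
  proof -
    have e: "conv (green (Z n) j) (\<lambda>x. R n x - of_real (v0 x) * U n x) x = conv (green (Z n) j) (R n) x + conv (green (Z n) j) (\<lambda>x. 0 - of_real (v0 x) * U n x) x" for n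
    proof -
      have i: "integrable lebesgue (\<lambda>x. 0 - of_real (v0 x) * U n x)" using iv(1) by simp
      have "conv (green (Z n) j) (\<lambda>x. R n x + (0 - of_real (v0 x) * U n x)) x =
         conv (green (Z n) j) (R n) x + conv (green (Z n) j) (\<lambda>x. 0 - of_real (v0 x) * U n x) x"
        by (rule conv_add[OF green_kern[OF Zq] sR src_L1[OF i decay_rate_nonneg[OF Zq]]])
      then show ?thesis by simp
    qed
    have "(\<lambda>n. conv (green (Z (r2 n)) j) (R (r2 n)) x) \<longlonglongrightarrow> 0"
    proof (rule Lim_null_comparison)
      show "(\<lambda>n. A * (LINT x|lebesgue. cmod (R (r2 n) x))) \<longlonglongrightarrow> 0" using tendsto_mult_right_zero[OF R2] .
      show "\<forall>\<^sub>F n in sequentially. norm (conv (green (Z (r2 n)) j) (R (r2 n)) x) \<le> A * (LINT x|lebesgue. cmod (R (r2 n) x))"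
      proof (intro always_eventually allI)
        fix n
        have "green_norm (Z (r2 n)) j \<le> A" using A j by simp
        from mult_right_mono[OF this, of "LINT x|lebesgue. cmod (R (r2 n) x)"]
        show "norm (conv (green (Z (r2 n)) j) (R (r2 n)) x) \<le> A * (LINT x|lebesgue. cmod (R (r2 n) x))"
          using conv_L1_bound[OF green_kern[OF Zq] decay_rate_nonneg[OF Zq] Ri, of "r2 n" j "r2 n" x] by simp
      qed
    qed
    moreover have "(\<lambda>n. conv (green (Z (r2 n)) j) (\<lambda>x. 0 - of_real (v0 x) * U (r2 n) x) x) \<longlonglongrightarrow> conv (green \<zeta> j) (\<lambda>x. 0 - of_real (v0 x) * G1 x) x"
    proof (rule conv_limit[OF Z2 z0 Zq, where h="\<lambda>x. \<bar>v0 x\<bar>"])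
      show "(\<lambda>x. 0 - of_real (v0 x) * U (r2 n) x) \<in> borel_measurable lebesgue" for n
        using borel_measurable_integrable[OF iv(1)[of "r2 n"]] by simp
      show "(\<lambda>n. 0 - of_real (v0 x) * U (r2 n) x) \<longlonglongrightarrow> 0 - of_real (v0 x) * G1 x" for x by (intro tendsto_intros U')
      show "cmod (0 - of_real (v0 x) * U (r2 n) x) \<le> \<bar>v0 x\<bar>" for n x
        using mult_left_mono[OF U1(1)[of "r2 n" x], of "\<bar>v0 x\<bar>"] by (simp add: norm_mult)
    qed (use v0 in simp)
    moreover have "(\<lambda>n. conv (green (Z (r2 n)) (Suc j)) (\<lambda>x. of_real (v1 x) * W (r2 n) x) x) \<longlonglongrightarrow> conv (green \<zeta> (Suc j)) (\<lambda>x. of_real (v1 x) * G2 x) x"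
    proof (rule conv_limit[OF Z2 z0 Zq, where h="\<lambda>x. \<bar>v1 x\<bar>"])
      show "(\<lambda>x. of_real (v1 x) * W (r2 n) x) \<in> borel_measurable lebesgue" for n
        using borel_measurable_integrable[OF iv(2)[of "r2 n"]] by simp
      show "(\<lambda>n. of_real (v1 x) * W (r2 n) x) \<longlonglongrightarrow> of_real (v1 x) * G2 x" for x by (intro tendsto_intros W')
      show "cmod (of_real (v1 x) * W (r2 n) x) \<le> \<bar>v1 x\<bar>" for n x
        using mult_left_mono[OF U1(2)[of "r2 n" x], of "\<bar>v1 x\<bar>"] by (simp add: norm_mult)
    qed (use v1 in simp)
    ultimately have "(\<lambda>n. conv (green (Z (r2 n)) j) (R (r2 n)) x + conv (green (Z (r2 n)) j) (\<lambda>x. 0 - of_real (v0 x) * U (r2 n) x) x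
       + conv (green (Z (r2 n)) (Suc j)) (\<lambda>x. of_real (v1 x) * W (r2 n) x) x)
      \<longlonglongrightarrow> 0 + conv (green \<zeta> j) (\<lambda>x. 0 - of_real (v0 x) * G1 x) x + conv (green \<zeta> (Suc j)) (\<lambda>x. of_real (v1 x) * G2 x) x"
      by (intro tendsto_add)
    then show ?thesis unfolding green_op_def e by simp
  qed
  have L0: "LS \<zeta> v0 v1 (\<lambda>_. 0) G1 G2"
  proof -
    have "(\<lambda>n. U (r2 n) x) \<longlonglongrightarrow> green_op \<zeta> 0 (\<lambda>x. 0 - of_real (v0 x) * G1 x) (\<lambda>x. of_real (v1 x) * G2 x) x" for x
      using lim[of 0 x] unfolding LSD(4)[OF LU, symmetric] by simp
    moreover have "(\<lambda>n. W (r2 n) x) \<longlonglongrightarrow> green_op \<zeta> 1 (\<lambda>x. 0 - of_real (v0 x) * G1 x) (\<lambda>x. of_real (v1 x) * G2 x) x" for x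
      using lim[of 1 x] unfolding LSD(5)[OF LU, symmetric] by simp
    ultimately have "\<forall>x. G1 x = green_op \<zeta> 0 (\<lambda>x. 0 - of_real (v0 x) * G1 x) (\<lambda>x. of_real (v1 x) * G2 x) x"
      "\<forall>x. G2 x = green_op \<zeta> 1 (\<lambda>x. 0 - of_real (v0 x) * G1 x) (\<lambda>x. of_real (v1 x) * G2 x) x"
      using LIMSEQ_unique U' W' by blast+
    then show ?thesis unfolding LS_def using Gm Gb by blast
  qed
  \<comment> \<open>A normalisation by the supremum need not survive pointwise convergence. If the
    limit vanished, however, the integrals in \<open>LS_pointwise_bound\<close> would tend to 0 and
    force the supremum below 1/2.\<close>
  have "\<exists>x. G1 x \<noteq> 0"
  proof (rule ccontr)
    assume "\<nexists>x. G1 x \<noteq> 0"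
    then have u0: "G1 = (\<lambda>x. 0)" by (simp add: fun_eq_iff)
    then have "((\<lambda>x. 0) has_vector_derivative G2 x) (at x)" for x
      using LS_W2(1)[OF L0 cz src_zero] by (simp add: W2_def)
    then have w0: "G2 x = 0" for x
      using vector_derivative_unique_at has_vector_derivative_const by blast
    have "(\<lambda>n. LINT x|lebesgue. cmod (of_real (v0 x) * U (r2 n) x)) \<longlonglongrightarrow> integral\<^sup>L lebesgue (\<lambda>x::real. 0)"
    proof (rule integral_dominated_convergence[where w="\<lambda>x. \<bar>v0 x\<bar>"])
      show "AE x in lebesgue. (\<lambda>n. cmod (of_real (v0 x) * U (r2 n) x)) \<longlonglongrightarrow> 0"
      proof (intro AE_I2)
        fix x
        have "(\<lambda>n. cmod (of_real (v0 x) * U (r2 n) x)) \<longlonglongrightarrow> cmod (of_real (v0 x) * G1 x)" by (intro tendsto_intros U')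
        then show "(\<lambda>n. cmod (of_real (v0 x) * U (r2 n) x)) \<longlonglongrightarrow> 0" by (simp add: u0)
      qed
      show "AE x in lebesgue. norm (cmod (of_real (v0 x) * U (r2 n) x)) \<le> \<bar>v0 x\<bar>" for n
        using mult_left_mono[OF U1(1), of "\<bar>v0 x\<bar>" for x] by (intro AE_I2) (simp add: norm_mult)
      show "(\<lambda>x. cmod (of_real (v0 x) * U (r2 n) x)) \<in> borel_measurable lebesgue" for n
        using borel_measurable_integrable[OF iv(1)[of "r2 n"]] by simp
    qed (use v0 in auto)
    moreover have "(\<lambda>n. LINT x|lebesgue. cmod (of_real (v1 x) * W (r2 n) x)) \<longlonglongrightarrow> integral\<^sup>L lebesgue (\<lambda>x::real. 0)"
    proof (rule integral_dominated_convergence[where w="\<lambda>x. \<bar>v1 x\<bar>"])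
      show "AE x in lebesgue. (\<lambda>n. cmod (of_real (v1 x) * W (r2 n) x)) \<longlonglongrightarrow> 0"
      proof (intro AE_I2)
        fix x
        have "(\<lambda>n. cmod (of_real (v1 x) * W (r2 n) x)) \<longlonglongrightarrow> cmod (of_real (v1 x) * G2 x)" by (intro tendsto_intros W')
        then show "(\<lambda>n. cmod (of_real (v1 x) * W (r2 n) x)) \<longlonglongrightarrow> 0" by (simp add: w0)
      qed
      show "AE x in lebesgue. norm (cmod (of_real (v1 x) * W (r2 n) x)) \<le> \<bar>v1 x\<bar>" for n
        using mult_left_mono[OF U1(2), of "\<bar>v1 x\<bar>" for x] by (intro AE_I2) (simp add: norm_mult)
      show "(\<lambda>x. cmod (of_real (v1 x) * W (r2 n) x)) \<in> borel_measurable lebesgue" for n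
        using borel_measurable_integrable[OF iv(2)[of "r2 n"]] by simp
    qed (use v1 in auto)
    ultimately have "(\<lambda>n. 2 * A * ((LINT x|lebesgue. cmod (R (r2 n) x)) + (LINT x|lebesgue. cmod (of_real (v0 x) * U (r2 n) x)) + (LINT x|lebesgue. cmod (of_real (v1 x) * W (r2 n) x))))
      \<longlonglongrightarrow> 2 * A * (0 + integral\<^sup>L lebesgue (\<lambda>x::real. 0) + integral\<^sup>L lebesgue (\<lambda>x::real. 0))"
      by (intro tendsto_intros R2)
    then have "(\<lambda>n. 2 * A * ((LINT x|lebesgue. cmod (R (r2 n) x)) + (LINT x|lebesgue. cmod (of_real (v0 x) * U (r2 n) x)) + (LINT x|lebesgue. cmod (of_real (v1 x) * W (r2 n) x))))
      \<longlonglongrightarrow> 0" by simp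
    then have "\<forall>\<^sub>F n in sequentially. 2 * A * ((LINT x|lebesgue. cmod (R (r2 n) x)) + (LINT x|lebesgue. cmod (of_real (v0 x) * U (r2 n) x)) + (LINT x|lebesgue. cmod (of_real (v1 x) * W (r2 n) x))) < 1/2"
      by (rule order_tendstoD(2)) simp
    from eventually_happens'[OF sequentially_bot this] obtain n where
      n: "2 * A * ((LINT x|lebesgue. cmod (R (r2 n) x)) + (LINT x|lebesgue. cmod (of_real (v0 x) * U (r2 n) x)) + (LINT x|lebesgue. cmod (of_real (v1 x) * W (r2 n) x))) < 1/2" by blast
    obtain x where x: "cmod (U (r2 n) x) + cmod (W (r2 n) x) \<ge> 1/2" using nz[of "r1 (r2 n)"] by (auto simp: U_def W_def)
    have "cmod (U (r2 n) x) + cmod (W (r2 n) x) < 1/2"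
      using LS_pointwise_bound[OF LU Zq Ri, of "r2 n" A x] A n by fastforce
    then show False using x by simp
  qed
  then obtain x where x: "G1 x \<noteq> 0" by blast
  show ?thesis
    by (rule that[OF _ cz z4 _ _ L0 x, of "\<lambda>n. r1 (r2 n)"])
       (use Z2 U' r1(1) r2(1) in \<open>auto simp: Z_def U_def strict_mono_def\<close>)
qed

end

section \<open>Symmetry of H and accumulation of eigenvalues\<close>

lemma l2_inner_sym: "l2_inner a b = cnj (l2_inner b a)"
  unfolding l2_inner_def Bochner_Integration.integral_cnj[symmetric] by (simp add: mult.commute)

lemma hform_sym: "hform v0 v1 a b = cnj (hform v0 v1 b a)"
  unfolding hform_def Bochner_Integration.integral_cnj[symmetric] by (simp add: mult_ac)

lemma Hop_symmetric:
  assumes "Hop v0 v1 u f" "Hop v0 v1 w g"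
  shows "l2_inner f w = l2_inner u g"
proof -
  have "l2_inner f w = hform v0 v1 u w" "l2_inner g u = hform v0 v1 w u"
    using assms by (auto simp: Hop_def)
  then show ?thesis by (metis hform_sym l2_inner_sym)
qed

lemma l2_inner_add_left:
  assumes "L2 f" "L2 u" "L2 w"
  shows "l2_inner (\<lambda>x. f x + z * u x) w = l2_inner f w + z * l2_inner u w"
proof -
  have "l2_inner (\<lambda>x. f x + z * u x) w = (LINT x|lebesgue. f x * cnj (w x) + z * (u x * cnj (w x)))"
    unfolding l2_inner_def by (simp add: algebra_simps)
  also have "\<dots> = l2_inner f w + (LINT x|lebesgue. z * (u x * cnj (w x)))"
    unfolding l2_inner_def using assms by (intro Bochner_Integration.integral_add integrable_mult_right L2_prod(2))
  finally show ?thesis by (simp only: l2_inner_def integral_mult_right_zero)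
qed

lemma l2_inner_cmult_left: "l2_inner (\<lambda>x. z * u x) w = z * l2_inner u w"
  unfolding l2_inner_def by (simp add: mult.assoc)

lemma l2_inner_add_right:
  assumes "L2 f" "L2 u" "L2 w"
  shows "l2_inner w (\<lambda>x. f x + z * u x) = l2_inner w f + cnj z * l2_inner w u"
  using l2_inner_add_left[OF assms, of z] by (metis complex_cnj_add complex_cnj_mult l2_inner_sym)

lemma l2_inner_self: "l2_inner u u = of_real (LINT x|lebesgue. (cmod (u x))\<^sup>2)"
  unfolding l2_inner_def complex_norm_square[symmetric] by (rule integral_complex_of_real)

lemma l2_inner_self_zero:
  assumes u: "L2 u" and c: "continuous_on UNIV u" and z: "l2_inner u u = 0"
  shows "u x = 0"
proof -
  have "(LINT x|lebesgue. (cmod (u x))\<^sup>2) = 0" using z unfolding l2_inner_self by simp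
  then have "AE x in lebesgue. (cmod (u x))\<^sup>2 = 0"
    using integral_nonneg_eq_0_iff_AE[OF L2D(2)[OF u]] by simp
  then have "AE x in lebesgue. u x = 0" by simp
  then show ?thesis by (rule continuous_AE_zero[OF c])
qed

lemma l2_inner_tendsto:
  assumes a: "\<And>n. a n \<in> borel_measurable lebesgue" "\<And>x. (\<lambda>n. a n x) \<longlonglongrightarrow> a' x" "\<And>n x. cmod (a n x) \<le> cmod (h x)"
    and b: "\<And>n. b n \<in> borel_measurable lebesgue" "\<And>x. (\<lambda>n. b n x) \<longlonglongrightarrow> b' x" "\<And>n x. cmod (b n x) \<le> cmod (h x)"
    and h: "L2 h"
  shows "(\<lambda>n. l2_inner (a n) (b n)) \<longlonglongrightarrow> l2_inner a' b'"
  unfolding l2_inner_def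
proof (rule integral_dominated_convergence[where w="\<lambda>x. cmod (h x) * cmod (h x)"])
  have m: "(\<lambda>x. a n x * cnj (b n x)) \<in> borel_measurable lebesgue" for n
    by (intro borel_measurable_times a cnj_measurable b)
  show "(\<lambda>x. a n x * cnj (b n x)) \<in> borel_measurable lebesgue" for n by (rule m)
  have l: "(\<lambda>n. a n x * cnj (b n x)) \<longlonglongrightarrow> a' x * cnj (b' x)" for x by (intro tendsto_intros a b)
  show "(\<lambda>x. a' x * cnj (b' x)) \<in> borel_measurable lebesgue"
    by (rule borel_measurable_LIMSEQ_metric[OF m l])
  show "AE x in lebesgue. (\<lambda>n. a n x * cnj (b n x)) \<longlonglongrightarrow> a' x * cnj (b' x)" using l by simp
  show "integrable lebesgue (\<lambda>x. cmod (h x) * cmod (h x))" by (rule L2_prod(3)[OF h h])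
  show "AE x in lebesgue. norm (a n x * cnj (b n x)) \<le> cmod (h x) * cmod (h x)" for n
    using a(3) b(3) by (intro AE_I2) (auto simp: norm_mult intro!: mult_mono)
qed

context potentials
begin

text \<open>The supremum need not be attained, hence 1/2 instead of 1 as the value reached
  somewhere.\<close>

lemma LS_normalise:
  assumes L: "LS \<zeta> v0 v1 f u w" and pos: "cmod (u x) + cmod (w x) > 0"
  shows "\<exists>a>0. (\<forall>y. a * (cmod (u y) + cmod (w y)) \<le> 1) \<and> (\<exists>y. a * (cmod (u y) + cmod (w y)) \<ge> 1/2)"
proof -
  define U where "U = (\<lambda>x. cmod (u x) + cmod (w x))"
  obtain M where M: "\<And>x. cmod (u x) \<le> M \<and> cmod (w x) \<le> M" using LSD(3)[OF L] by blast
  have "U x \<le> M + M" for x using M[of x] unfolding U_def by (intro add_mono) auto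
  then have bdd: "bdd_above (range U)" by (rule bdd_aboveI2)
  define s where "s = (SUP x. U x)"
  have le: "U y \<le> s" for y unfolding s_def by (rule cSUP_upper[OF _ bdd]) simp
  have s0: "s > 0" using le[of x] pos by (simp add: U_def)
  then have "s / 2 < s" by simp
  then obtain y where y: "s / 2 < U y"
    using less_cSUP_iff[OF _ bdd, of "s / 2"] unfolding s_def[symmetric] by auto
  have "(1 / s) * U y \<ge> 1/2" using y s0 by (simp add: field_simps)
  moreover have "(1 / s) * U z \<le> 1" for z using le[of z] s0 by (simp add: field_simps)
  ultimately show ?thesis using s0 unfolding U_def by (intro exI[of _ "1 / s"]) auto
qed

lemma islimpt_eigenvalues:
  assumes x: "x islimpt eigenvalues v0 v1"
  shows "x = 0"
proof (rule ccontr)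
  assume x0: "x \<noteq> 0"
  obtain E0 :: "nat \<Rightarrow> real" where E0: "\<And>n. E0 n \<in> eigenvalues v0 v1" "\<And>n. E0 n \<noteq> x" "E0 \<longlonglongrightarrow> x"
    using x unfolding islimpt_sequential by auto
  have "\<forall>\<^sub>F n in sequentially. dist (E0 n) x < \<bar>x\<bar> / 2" using E0(3) x0 by (intro tendstoD) auto
  then obtain N where N: "\<And>n. n \<ge> N \<Longrightarrow> dist (E0 n) x < \<bar>x\<bar> / 2" by (auto simp: eventually_sequentially)
  define E where "E = (\<lambda>n. E0 (n + N))"
  have E: "E n \<in> eigenvalues v0 v1" for n using E0 by (simp add: E_def)
  have Ex: "E n \<noteq> x" for n using E0(2) by (simp add: E_def)
  have El: "E \<longlonglongrightarrow> x" unfolding E_def by (rule LIMSEQ_ignore_initial_segment[OF E0(3)])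
  have Eb: "\<bar>x\<bar> / 2 \<le> \<bar>E n\<bar>" "\<bar>E n\<bar> \<le> 2 * \<bar>x\<bar>" for n
  proof -
    have "\<bar>E n - x\<bar> < \<bar>x\<bar> / 2" using N[of "n + N"] by (simp add: E_def dist_real_def)
    then show "\<bar>x\<bar> / 2 \<le> \<bar>E n\<bar>" "\<bar>E n\<bar> \<le> 2 * \<bar>x\<bar>" by linarith+
  qed
  have E0': "E n \<noteq> 0" for n using Eb(1)[of n] x0 by auto
  have "\<exists>\<zeta>. quadrant \<zeta> \<and> \<zeta> ^ 4 = of_real (E n)" for n using fourth_root[of "of_real (E n)"] E0'[of n] by (metis of_real_eq_0_iff)
  then obtain Z where Z: "\<And>n. quadrant (Z n)" "\<And>n. Z n ^ 4 = of_real (E n)" by metis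
  have "\<exists>u. \<not> (AE x in lebesgue. u x = 0) \<and> Hop v0 v1 u (\<lambda>x. of_real (E n) * u x)" for n
    using E[of n] by (simp add: eigenvalues_def)
  then obtain u where u: "\<And>n. \<not> (AE x in lebesgue. u n x = 0)" "\<And>n. Hop v0 v1 (u n) (\<lambda>x. of_real (E n) * u n x)" by metis
  have L: "LS (Z n) v0 v1 (\<lambda>_. 0) (u n) (der (u n))" for n by (rule eigen_LS[OF u(2) Z])
  have "\<exists>a>0. (\<forall>y. a * (cmod (u n y) + cmod (der (u n) y)) \<le> 1) \<and> (\<exists>y. a * (cmod (u n y) + cmod (der (u n) y)) \<ge> 1/2)" for n
  proof -
    obtain y where "u n y \<noteq> 0"
    proof (rule ccontr)
      assume "\<not> thesis"
      then have "u n = (\<lambda>x. 0)" using that by auto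
      then show False using u(1)[of n] by simp
    qed
    then have "cmod (u n y) + cmod (der (u n) y) > 0" by (simp add: add_pos_nonneg)
    from LS_normalise[OF L this] show ?thesis .
  qed
  then obtain a where a: "\<And>n. a n > 0" "\<And>n y. a n * (cmod (u n y) + cmod (der (u n) y)) \<le> 1" "\<And>n. \<exists>y. a n * (cmod (u n y) + cmod (der (u n) y)) \<ge> 1/2"
    by metis
  define U W where "U = (\<lambda>n x. of_real (a n) * u n x)" and "W = (\<lambda>n x. of_real (a n) * der (u n) x)"
  have UW: "cmod (U n y) + cmod (W n y) = a n * (cmod (u n y) + cmod (der (u n) y))" for n y
    using a(1)[of n] by (simp add: U_def W_def norm_mult distrib_left)
  have LU: "LS (Z n) v0 v1 (\<lambda>_. 0) (U n) (W n)" for n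
    using LS_scale[OF L Z(1), of n "of_real (a n)"] by (simp add: U_def W_def)
  have U1: "cmod (U n y) + cmod (W n y) \<le> 1" for n y using a(2) by (simp add: UW)
  have nzU: "\<exists>y. cmod (U n y) + cmod (W n y) \<ge> 1/2" for n using a(3) by (simp add: UW)
  have Zl: "(\<lambda>n. Z n ^ 4) \<longlonglongrightarrow> of_real x" unfolding Z(2) by (intro tendsto_intros El)
  have z3: "integrable lebesgue (\<lambda>_::real. 0 :: complex)" "(\<lambda>n::nat. LINT x::real|lebesgue. cmod 0) \<longlonglongrightarrow> 0" "complex_of_real x \<noteq> 0"
    using x0 by auto
  obtain r \<zeta> G G2 y where r: "strict_mono (r :: nat \<Rightarrow> nat)" "quadrant \<zeta>" "\<zeta> ^ 4 = of_real x"
    "\<And>x. (\<lambda>n. U (r n) x) \<longlonglongrightarrow> G x" "LS \<zeta> v0 v1 (\<lambda>_. 0) G G2" "G y \<noteq> 0"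
    by (rule LS_compactness[OF Zl z3(3) Z(1) LU z3(1,2) U1 nzU]) (rule that; assumption)
  have cm: "root 4 (\<bar>x\<bar> / 2) \<le> cmod (Z n)" "cmod (Z n) \<le> root 4 (2 * \<bar>x\<bar>)" for n
  proof -
    have "cmod (Z n) ^ 4 = \<bar>E n\<bar>" using Z(2)[of n] by (metis norm_of_real norm_power)
    then have "cmod (Z n) = root 4 \<bar>E n\<bar>" by (metis norm_ge_zero real_root_power_cancel zero_less_numeral)
    then show "root 4 (\<bar>x\<bar> / 2) \<le> cmod (Z n)" "cmod (Z n) \<le> root 4 (2 * \<bar>x\<bar>)" using Eb[of n] by simp_all
  qed
  have mp: "root 4 (\<bar>x\<bar> / 2) > 0" using x0 by simp
  define m where "m = root 4 (\<bar>x\<bar> / 2)"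
  obtain C where C: "C > 0" "\<And>\<zeta> u w S x'. quadrant \<zeta> \<Longrightarrow> Im (\<zeta> ^ 4) = 0 \<Longrightarrow> m \<le> cmod \<zeta> \<Longrightarrow> cmod \<zeta> \<le> root 4 (2 * \<bar>x\<bar>) \<Longrightarrow>
     LS \<zeta> v0 v1 (\<lambda>_. 0) u w \<Longrightarrow> (\<And>x. cmod (u x) + cmod (w x) \<le> S) \<Longrightarrow> cmod (u x') + cmod (w x') \<le> C * S * exp_abs (m / 2) x'"
    using eigen_decay[OF mp, of "root 4 (2 * \<bar>x\<bar>)"] unfolding m_def by metis
  \<comment> \<open>One majorant for all normalised eigenfunctions, by the uniformity of
    \<open>eigen_decay\<close>. It turns pointwise convergence into convergence of inner
    products.\<close>
  define h where "h = (\<lambda>x. complex_of_real (C * exp_abs (m / 2) x))"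
  have h: "L2 h" unfolding h_def by (rule exp_abs_L2) (use mp in \<open>simp add: m_def\<close>)
  have Uh: "cmod (U n y) \<le> cmod (h y)" for n y
  proof -
    have "cmod (U n y) + cmod (W n y) \<le> C * 1 * exp_abs (m / 2) y"
      by (rule C(2)[OF Z(1) _ _ cm(2) LU U1]) (use Z(2)[of n] cm(1)[of n] in \<open>simp_all add: m_def\<close>)
    moreover have "0 \<le> C * exp_abs (m / 2) y" using C(1) by simp
    ultimately show ?thesis using norm_ge_zero[of "W n y"] unfolding h_def norm_of_real by linarith
  qed
  have Um: "U n \<in> borel_measurable lebesgue" for n by (rule LSD(1)[OF LU])
  have UL: "L2 (U n)" for n by (rule L2_bound[OF Um h Uh])
  have orth: "l2_inner (U n) (U k) = 0" if "E n \<noteq> E k" for n k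
  proof -
    have "l2_inner (\<lambda>x. of_real (E n) * u n x) (u k) = l2_inner (u n) (\<lambda>x. of_real (E k) * u k x)"
      by (rule Hop_symmetric[OF u(2) u(2)])
    also have "\<dots> = of_real (E k) * l2_inner (u n) (u k)"
      by (subst l2_inner_sym, subst l2_inner_cmult_left, subst (2) l2_inner_sym) simp
    finally have "l2_inner (u n) (u k) = 0" using that by (simp add: l2_inner_cmult_left)
    then show ?thesis unfolding U_def
      by (subst l2_inner_cmult_left, subst l2_inner_sym, subst l2_inner_cmult_left, subst l2_inner_sym) simp
  qed
  \<comment> \<open>Along the subsequence the eigenvalues tend to \<open>x\<close>, which differs
    from \<open>E n\<close>, so eventually they differ from \<open>E n\<close> and orthogonality
    applies, even if the sequence repeats values.\<close>
  have UG: "l2_inner (U n) G = 0" for n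
  proof -
    have c: "(\<lambda>k. l2_inner (U n) (U (r k))) \<longlonglongrightarrow> l2_inner (U n) G"
      by (rule l2_inner_tendsto[OF Um _ Uh Um r(4) Uh h]) simp
    have ev: "\<forall>\<^sub>F k in sequentially. l2_inner (U n) (U (r k)) = 0"
    proof -
      have "(\<lambda>k. E (r k)) \<longlonglongrightarrow> x" using LIMSEQ_subseq_LIMSEQ[OF El r(1)] by (simp add: comp_def)
      then have "\<forall>\<^sub>F k in sequentially. E (r k) \<noteq> E n"
        using Ex[of n] by (intro tendsto_imp_eventually_ne) auto
      then show ?thesis by eventually_elim (rule orth, simp)
    qed
    show ?thesis by (rule LIMSEQ_unique[OF c tendsto_eventually[OF ev]])
  qed
  have Gm: "G \<in> borel_measurable lebesgue" by (rule LSD(1)[OF r(5)])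
  have Gh: "cmod (G x) \<le> cmod (h x)" for x
    by (rule LIMSEQ_le_const2[OF tendsto_norm[OF r(4)]]) (use Uh in blast)
  have "(\<lambda>k. l2_inner (U (r k)) G) \<longlonglongrightarrow> l2_inner G G"
    by (rule l2_inner_tendsto[OF Um r(4) Uh Gm _ Gh h]) simp
  then have "l2_inner G G = 0" unfolding UG by (simp add: LIMSEQ_const_iff)
  then have "G y = 0"
    by (rule l2_inner_self_zero[OF L2_bound[OF Gm h Gh] W2_cont(1)[OF LS_W2(1)[OF r(5) r(2) src_zero]]])
  then show False using r(6) by simp
qed

text \<open>Compact sets avoiding 0 contain finitely many eigenvalues. Countability lets a measure
  without atoms ignore the eigenvalues.\<close>

lemma countable_eigenvalues: "countable (eigenvalues v0 v1)"
proof -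
  let ?S = "eigenvalues v0 v1"
  define A where "A = (\<lambda>n. {x :: real. inverse (real (Suc n)) \<le> \<bar>x\<bar> \<and> \<bar>x\<bar> \<le> real n})"
  have fin: "finite (A n \<inter> ?S)" for n
  proof (rule finite_not_islimpt_in_compact)
    have "closed (A n)" unfolding A_def
      by (intro closed_Collect_conj closed_Collect_le continuous_intros)
    moreover have "bounded (A n)" by (rule boundedI[of _ "real n"]) (auto simp: A_def)
    ultimately show "compact (A n)" by (simp add: compact_eq_bounded_closed)
    show "\<not> z islimpt ?S" if "z \<in> A n" for z
      using islimpt_eigenvalues[of z] that by (auto simp: A_def)
  qed
  have "?S \<subseteq> {0} \<union> (\<Union>n. A n \<inter> ?S)"
  proof
    fix x assume x: "x \<in> ?S"
    show "x \<in> {0} \<union> (\<Union>n. A n \<inter> ?S)"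
    proof (cases "x = 0")
      case False
      obtain n1 where n1: "inverse (real (Suc n1)) < \<bar>x\<bar>" using reals_Archimedean[of "\<bar>x\<bar>"] False by auto
      obtain n2 :: nat where n2: "\<bar>x\<bar> < real n2" using reals_Archimedean2 by blast
      have "inverse (real (Suc (max n1 n2))) \<le> inverse (real (Suc n1))" by (intro le_imp_inverse_le) auto
      then have "inverse (real (Suc (max n1 n2))) \<le> \<bar>x\<bar>" using n1 by linarith
      moreover have "\<bar>x\<bar> \<le> real (max n1 n2)" using n2 unfolding of_nat_max by linarith
      ultimately have "x \<in> A (max n1 n2)" by (simp only: A_def mem_Collect_eq) 
      then show ?thesis using x by blast
    qed simp
  qed
  moreover have "countable ({0} \<union> (\<Union>n. A n \<inter> ?S))"
  proof -
    have "countable (\<Union>n. A n \<inter> ?S)" by (rule countable_UN) (auto intro: countable_finite fin)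
    then show ?thesis by simp
  qed
  ultimately show ?thesis using countable_subset by blast
qed

text \<open>A sequence violating every bound has spectral parameters accumulating at a point of the
  compact set \<open>K\<close>, where the rescaled solutions leave a homogeneous solution behind.
  The bound concerns the upper half plane, on which its use in the estimate of the spectral measure
  is arranged.\<close>

lemma limiting_absorption:
  assumes K: "compact K" "K \<inter> eigenvalues v0 v1 = {}" "0 \<notin> K" "K \<noteq> {}"
  obtains \<delta> C where "\<delta> > 0" "C > 0" "\<And>\<zeta> g u w x. quadrant \<zeta> \<Longrightarrow> 0 < Im (\<zeta> ^ 4) \<Longrightarrow> Im (\<zeta> ^ 4) < \<delta> \<Longrightarrow> infdist (Re (\<zeta> ^ 4)) K < \<delta> \<Longrightarrow>
     integrable lebesgue g \<Longrightarrow> LS \<zeta> v0 v1 g u w \<Longrightarrow> cmod (u x) + cmod (w x) \<le> C * (LINT x|lebesgue. cmod (g x))"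
proof -
  have "\<exists>\<delta>>0. \<exists>C>0. \<forall>\<zeta> g u w x. quadrant \<zeta> \<longrightarrow> 0 < Im (\<zeta> ^ 4) \<longrightarrow> Im (\<zeta> ^ 4) < \<delta> \<longrightarrow> infdist (Re (\<zeta> ^ 4)) K < \<delta> \<longrightarrow>
     integrable lebesgue g \<longrightarrow> LS \<zeta> v0 v1 g u w \<longrightarrow> cmod (u x) + cmod (w x) \<le> C * (LINT x|lebesgue. cmod (g x))"
  proof (rule ccontr)
    assume neg: "\<not> ?thesis"
    define d where "d = (\<lambda>n. inverse (real (Suc n)))"
    have d0: "d n > 0" for n by (simp add: d_def)
    have dl: "d \<longlonglongrightarrow> 0" unfolding d_def by (rule LIMSEQ_inverse_real_of_nat)
    have "\<exists>\<zeta> g u w x. quadrant \<zeta> \<and> 0 < Im (\<zeta> ^ 4) \<and> Im (\<zeta> ^ 4) < d n \<and> infdist (Re (\<zeta> ^ 4)) K < d n \<and>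
     integrable lebesgue g \<and> LS \<zeta> v0 v1 g u w \<and> cmod (u x) + cmod (w x) > real (Suc n) * (LINT x|lebesgue. cmod (g x))" for n
      using neg d0[of n] by (metis not_le of_nat_0_less_iff zero_less_Suc)
    then obtain Z g u w X where Z: "\<And>n. quadrant (Z n)" "\<And>n. 0 < Im (Z n ^ 4)" "\<And>n. Im (Z n ^ 4) < d n" "\<And>n. infdist (Re (Z n ^ 4)) K < d n"
      and g: "\<And>n. integrable lebesgue (g n)" and L: "\<And>n. LS (Z n) v0 v1 (g n) (u n) (w n)"
      and big: "\<And>n. cmod (u n (X n)) + cmod (w n (X n)) > real (Suc n) * (LINT x|lebesgue. cmod (g n x))" by metis
    have g0: "(LINT x|lebesgue. cmod (g n x)) \<ge> 0" for n by simp
    have "\<exists>a>0. (\<forall>y. a * (cmod (u n y) + cmod (w n y)) \<le> 1) \<and> (\<exists>y. a * (cmod (u n y) + cmod (w n y)) \<ge> 1/2)" for n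
    proof -
      have "cmod (u n (X n)) + cmod (w n (X n)) > 0" using big[of n] g0[of n] by (smt (verit) mult_nonneg_nonneg of_nat_0_le_iff)
      from LS_normalise[OF L this] show ?thesis .
    qed
    then obtain a where a: "\<And>n. a n > 0" "\<And>n y. a n * (cmod (u n y) + cmod (w n y)) \<le> 1" "\<And>n. \<exists>y. a n * (cmod (u n y) + cmod (w n y)) \<ge> 1/2"
      by metis
    have "\<exists>k\<in>K. infdist (Re (Z n ^ 4)) K = dist (Re (Z n ^ 4)) k" for n
      using infdist_attains_inf[OF compact_imp_closed[OF K(1)] K(4)] by metis
    then obtain k where k: "\<And>n. k n \<in> K" "\<And>n. infdist (Re (Z n ^ 4)) K = dist (Re (Z n ^ 4)) (k n)" by metis
    obtain E r where r: "E \<in> K" "strict_mono (r :: nat \<Rightarrow> nat)" "(k \<circ> r) \<longlonglongrightarrow> E"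
      using seq_compactE[OF compact_imp_seq_compact[OF K(1)], of k] k(1) by metis
    have dr: "(\<lambda>n. d (r n)) \<longlonglongrightarrow> 0" using LIMSEQ_subseq_LIMSEQ[OF dl r(2)] by (simp add: comp_def)
    have "(\<lambda>n. Re (Z (r n) ^ 4) - k (r n)) \<longlonglongrightarrow> 0"
      by (rule Lim_null_comparison[OF always_eventually dr]) (use Z(4) k(2) in \<open>auto simp: dist_real_def less_imp_le\<close>)
    then have "(\<lambda>n. (Re (Z (r n) ^ 4) - k (r n)) + (k \<circ> r) n) \<longlonglongrightarrow> 0 + E" by (intro tendsto_add r(3))
    then have Rl: "(\<lambda>n. Re (Z (r n) ^ 4)) \<longlonglongrightarrow> E" by simp
    have Il: "(\<lambda>n. Im (Z (r n) ^ 4)) \<longlonglongrightarrow> 0"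
      by (rule Lim_null_comparison[OF always_eventually dr]) (use Z(2,3) in \<open>auto simp: less_imp_le\<close>)
    have Zl: "(\<lambda>n. Z (r n) ^ 4) \<longlonglongrightarrow> of_real E"
      unfolding tendsto_complex_iff using Rl Il by simp
    define U W R where "U = (\<lambda>n x. of_real (a (r n)) * u (r n) x)" and "W = (\<lambda>n x. of_real (a (r n)) * w (r n) x)" and "R = (\<lambda>n x. of_real (a (r n)) * g (r n) x)"
    have UW: "cmod (U n y) + cmod (W n y) = a (r n) * (cmod (u (r n) y) + cmod (w (r n) y))" for n y
      using a(1)[of "r n"] by (simp add: U_def W_def norm_mult distrib_left)
    have LU: "LS (Z (r n)) v0 v1 (R n) (U n) (W n)" for n
      using LS_scale[OF L Z(1), of "r n" "of_real (a (r n))"] by (simp add: U_def W_def R_def)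
    have U1: "cmod (U n y) + cmod (W n y) \<le> 1" for n y using a(2) by (simp add: UW)
    have nzU: "\<exists>y. cmod (U n y) + cmod (W n y) \<ge> 1/2" for n using a(3) by (simp add: UW)
    have Ri: "integrable lebesgue (R n)" for n using g by (simp add: R_def)
    \<comment> \<open>The bound with constant \<open>Suc (r n)\<close> fails at
      \<open>X (r n)\<close>, while the rescaled solution is at most 1; so the rescaled source has
      norm at most the reciprocal.\<close>
    have Rle: "(LINT x|lebesgue. cmod (R n x)) \<le> d (r n)" for n
    proof -
      have "(LINT x|lebesgue. cmod (R n x)) = a (r n) * (LINT x|lebesgue. cmod (g (r n) x))"
        using a(1)[of "r n"] by (simp add: R_def norm_mult)
      moreover have "real (Suc (r n)) * (a (r n) * (LINT x|lebesgue. cmod (g (r n) x))) \<le> 1"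
      proof -
        have "a (r n) * (real (Suc (r n)) * (LINT x|lebesgue. cmod (g (r n) x))) \<le> a (r n) * (cmod (u (r n) (X (r n))) + cmod (w (r n) (X (r n))))"
          using big[of "r n"] a(1)[of "r n"] by (intro mult_left_mono) auto
        also have "\<dots> \<le> 1" by (rule a(2))
        finally show ?thesis by (simp only: mult_ac)
      qed
      ultimately show ?thesis by (simp add: d_def field_simps)
    qed
    have Rl0: "(\<lambda>n. LINT x|lebesgue. cmod (R n x)) \<longlonglongrightarrow> 0"
      by (rule tendsto_sandwich[OF _ _ tendsto_const dr]) (use Rle in auto)
    have E0: "complex_of_real E \<noteq> 0" using r(1) K(3) by auto
    obtain \<zeta> G G2 y where "quadrant \<zeta>" "\<zeta> ^ 4 = of_real E" "LS \<zeta> v0 v1 (\<lambda>_. 0) G G2" "G y \<noteq> 0"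
      by (rule LS_compactness[OF Zl E0 Z(1) LU Ri Rl0 U1 nzU])
    then have "E \<in> eigenvalues v0 v1" using LS0_eigenvalue by blast
    then show False using r(1) K(2) by blast
  qed
  then show ?thesis using that by metis
qed

end

section \<open>Solvability for nonreal spectral parameters\<close>

lemma riesz_lemma:
  fixes X Y :: "'a::real_normed_vector set"
  assumes X: "subspace X" and Y: "subspace Y" "closed Y" "Y \<subseteq> X" and x0: "x0 \<in> X" "x0 \<notin> Y"
  shows "\<exists>x\<in>X. norm x = 1 \<and> (\<forall>y\<in>Y. norm (x - y) \<ge> 1/2)"
proof -
  have ne: "Y \<noteq> {}" using subspace_0[OF Y(1)] by auto
  define d where "d = infdist x0 Y"
  have d: "d > 0" unfolding d_def by (rule infdist_pos_not_in_closed[OF Y(2) ne x0(2)])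
  have bb: "bdd_below ((\<lambda>y. dist x0 y) ` Y)" by (rule bdd_belowI2[of _ 0]) simp
  have "(INF y\<in>Y. dist x0 y) < 2 * d" using d infdist_notempty[OF ne, of x0] by (simp add: d_def)
  then obtain y0 where y0: "y0 \<in> Y" "dist x0 y0 < 2 * d"
    using cINF_less_iff[OF ne bb] by blast
  define t where "t = norm (x0 - y0)"
  have t: "t > 0" using x0(2) y0(1) by (auto simp: t_def)
  define x where "x = (1 / t) *\<^sub>R (x0 - y0)"
  have "x \<in> X" unfolding x_def using x0 y0 Y(3) by (intro subspace_scale[OF X] subspace_diff[OF X]) auto
  moreover have "norm x = 1" using t by (simp add: x_def t_def)
  moreover have "norm (x - y) \<ge> 1/2" if y: "y \<in> Y" for y
  proof -
    have "y0 + t *\<^sub>R y \<in> Y" by (intro subspace_add[OF Y(1)] subspace_scale[OF Y(1)] y0 y)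
    then have "d \<le> dist x0 (y0 + t *\<^sub>R y)" unfolding d_def by (rule infdist_le)
    also have "\<dots> = norm (t *\<^sub>R (x - y))" using t by (simp add: dist_norm x_def scaleR_diff_right algebra_simps)
    also have "\<dots> = t * norm (x - y)" using t by simp
    finally have "d \<le> t * norm (x - y)" .
    moreover have "t < 2 * d" using y0(2) by (simp add: t_def dist_norm)
    ultimately have "t < t * (2 * norm (x - y))" by linarith
    then have "1 < 2 * norm (x - y)" using t by simp
    then show ?thesis by linarith
  qed
  ultimately show ?thesis by blast
qed

text \<open>Only the square of \<open>T\<close> is assumed compact: for the Lippmann--Schwinger operator a pointwise convergent
  subsequence of \<open>T x\<close> is turned into a norm convergent one of \<open>T (T x)\<close> by dominated convergence.\<close>
lemma fredholm_square_compact: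
  fixes T :: "'a::{real_normed_vector,complete_space} \<Rightarrow> 'a"
  assumes T: "bounded_linear T"
    and cpt: "\<And>x. (\<And>n. norm (x n) \<le> 1) \<Longrightarrow> \<exists>r l. strict_mono (r :: nat \<Rightarrow> nat) \<and> (\<lambda>n. T (T (x (r n)))) \<longlonglongrightarrow> l"
    and inj: "\<And>x. T x = x \<Longrightarrow> x = 0"
  shows "\<exists>x. x - T x = y"
proof (rule ccontr)
  assume neg: "\<nexists>x. x - T x = y"
  interpret T: bounded_linear T by (rule T)
  define S where "S = (\<lambda>x. x - T x)"
  have S: "bounded_linear S" unfolding S_def by (intro bounded_linear_sub bounded_linear_ident T)
  interpret S: bounded_linear S by (rule S)
  \<comment> \<open>\<open>S\<close> is bounded below, so that the ranges of its powers are complete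
    and hence closed. Compactness of the square enters through
    \<open>z = T (T z) + S z + T (S z)\<close>: unit vectors with \<open>S z\<close> tending to 0
    have a convergent subsequence.\<close>
  have "\<exists>c>0. \<forall>x. c * norm x \<le> norm (S x)"
  proof (rule ccontr)
    assume n: "\<not> ?thesis"
    define d where "d = (\<lambda>n. inverse (real (Suc n)))"
    have d0: "d n > 0" for n by (simp add: d_def)
    have dl: "d \<longlonglongrightarrow> 0" unfolding d_def by (rule LIMSEQ_inverse_real_of_nat)
    have "\<exists>x. norm (S x) < d n * norm x" for n using n d0[of n] by (metis not_le)
    then obtain x where x: "\<And>n. norm (S (x n)) < d n * norm (x n)" by metis
    have xp: "norm (x n) > 0" for n
      using x[of n] norm_ge_zero[of "S (x n)"] d0[of n] by (metis le_less_trans zero_less_mult_pos)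
    define z where "z = (\<lambda>n. (1 / norm (x n)) *\<^sub>R x n)"
    have z1: "norm (z n) = 1" for n using xp[of n] by (simp add: z_def)
    have Sz: "norm (S (z n)) \<le> d n" for n
    proof -
      have "norm (S (z n)) = norm (S (x n)) / norm (x n)" using xp[of n] by (simp add: z_def S.scaleR)
      also have "\<dots> \<le> d n" using x[of n] xp[of n] by (simp add: pos_divide_le_eq)
      finally show ?thesis .
    qed
    obtain r l where r: "strict_mono (r :: nat \<Rightarrow> nat)" "(\<lambda>n. T (T (z (r n)))) \<longlonglongrightarrow> l"
      using cpt[of z] z1 by (metis order_refl)
    have dr: "(\<lambda>n. d (r n)) \<longlonglongrightarrow> 0" using LIMSEQ_subseq_LIMSEQ[OF dl r(1)] by (simp add: comp_def)
    have S0: "(\<lambda>n. S (z (r n))) \<longlonglongrightarrow> 0" by (rule Lim_null_comparison[OF always_eventually dr]) (use Sz in auto)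
    have TS0: "(\<lambda>n. T (S (z (r n)))) \<longlonglongrightarrow> T 0" by (rule T.tendsto[OF S0])
    have "(\<lambda>n. T (T (z (r n))) + S (z (r n)) + T (S (z (r n)))) \<longlonglongrightarrow> l + 0 + T 0"
      by (intro tendsto_add r(2) S0 TS0)
    moreover have "T (T (z n)) + S (z n) + T (S (z n)) = z n" for n by (simp add: S_def T.diff)
    ultimately have zl: "(\<lambda>n. z (r n)) \<longlonglongrightarrow> l" by (simp add: T.zero)
    have "norm l = 1" using LIMSEQ_unique[OF tendsto_norm[OF zl]] z1 by auto
    moreover have "S l = 0" using LIMSEQ_unique[OF S.tendsto[OF zl] S0] .
    then have "l = 0" using inj[of l] by (simp add: S_def)
    ultimately show False by simp
  qed
  then obtain c where c: "c > 0" "\<And>x. c * norm x \<le> norm (S x)" by blast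
  \<comment> \<open>If \<open>y\<close> is missed by \<open>S\<close>, injectivity makes these
    ranges strictly decreasing.\<close>
  define X where "X = (\<lambda>n. (S ^^ n) ` UNIV)"
  have XS: "X (Suc n) = S ` X n" for n unfolding X_def by (simp add: image_comp)
  have sub: "subspace (X n) \<and> complete (X n)" for n
  proof (induction n)
    case 0
    have "X 0 = UNIV" by (simp add: X_def)
    then show ?case by (simp add: complete_UNIV)
  next
    case (Suc n)
    have "complete (S ` X n)"
      by (rule complete_isometric_image[OF c(1) _ S]) (use Suc c(2) in auto)
    moreover have "subspace (S ` X n)"
      using Suc linear_subspace_image[OF S.linear] by blast
    ultimately show ?case by (simp add: XS)
  qed
  have clo: "closed (X n)" for n using sub complete_imp_closed by blast
  have dec1: "X (Suc n) \<subseteq> X n" for n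
  proof (induction n)
    case 0 then show ?case by (simp add: X_def)
  next
    case (Suc n) then show ?case using XS image_mono by metis
  qed
  have dec: "X m \<subseteq> X n" if "n \<le> m" for n m by (rule lift_Suc_antimono_le[of X, OF dec1 that])
  have Sinj: "S a = S b \<Longrightarrow> a = b" for a b
  proof -
    assume "S a = S b"
    then have "S (a - b) = 0" by (simp add: S.diff)
    then have "a - b = 0" using inj[of "a - b"] by (simp add: S_def)
    then show ?thesis by simp
  qed
  have "(S ^^ n) y \<in> X n \<and> (S ^^ n) y \<notin> X (Suc n)" for n
  proof (induction n)
    case 0
    have "y \<notin> S ` UNIV" using neg by (auto simp: S_def)
    then show ?case by (simp add: X_def)
  next
    case (Suc n)
    have "(S ^^ Suc n) y = S ((S ^^ n) y)" by simp
    then show ?case using Suc XS[of n] XS[of "Suc n"] Sinj by (metis (no_types, lifting) image_iff)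
  qed
  then have "\<exists>x\<in>X n. norm x = 1 \<and> (\<forall>y\<in>X (Suc n). norm (x - y) \<ge> 1/2)" for n
    using riesz_lemma[of "X n" "X (Suc n)"] sub clo dec1 by meson
  then obtain x where x: "\<And>n. x n \<in> X n" "\<And>n. norm (x n) = 1" "\<And>n y. y \<in> X (Suc n) \<Longrightarrow> norm (x n - y) \<ge> 1/2" by metis
  have TX: "T v \<in> X n" if "v \<in> X n" for v n
  proof -
    have "S v \<in> X n" using XS dec1 that by blast
    then have "v - S v \<in> X n" using subspace_diff sub that by blast
    then show ?thesis by (simp add: S_def)
  qed
  \<comment> \<open>Since \<open>T (T x) = x - S x - T (S x)\<close>, the difference is
    \<open>x n\<close> minus an element of \<open>X (Suc n)\<close>, at distance at least 1/2 by the
    choice of \<open>x n\<close>.\<close>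
  have far: "norm (T (T (x n)) - T (T (x m))) \<ge> 1/2" if "n < m" for n m
  proof -
    have "S (x n) \<in> X (Suc n)" using XS x(1) by blast
    moreover have "T (T (x m)) \<in> X (Suc n)" using TX x(1) dec[of "Suc n" m] that by (metis Suc_leI subsetD)
    ultimately have "S (x n) + T (S (x n)) + T (T (x m)) \<in> X (Suc n)" using TX sub subspace_add by metis
    from x(3)[OF this] show ?thesis by (simp add: S_def T.diff algebra_simps)
  qed
  obtain r l where r: "strict_mono (r :: nat \<Rightarrow> nat)" "(\<lambda>n. T (T (x (r n)))) \<longlonglongrightarrow> l"
    using cpt[of x] x(2) by (metis order_refl)
  then have "Cauchy (\<lambda>n. T (T (x (r n))))" by (intro LIMSEQ_imp_Cauchy)
  then obtain N where N: "\<And>m n. m \<ge> N \<Longrightarrow> n \<ge> N \<Longrightarrow> norm (T (T (x (r m))) - T (T (x (r n)))) < 1/2"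
    by (metis CauchyD half_gt_zero zero_less_one)
  have "r N < r (Suc N)" using r(1) by (simp add: strict_mono_def)
  then show False using far[of "r N" "r (Suc N)"] N[of N "Suc N"] by simp
qed

section \<open>The Lippmann--Schwinger operator\<close>

context potentials
begin

abbreviation source0 :: "(real \<Rightarrow> complex) \<Rightarrow> real \<Rightarrow> complex" where "source0 u \<equiv> \<lambda>x. 0 - of_real (v0 x) * u x"
abbreviation source1 :: "(real \<Rightarrow> complex) \<Rightarrow> real \<Rightarrow> complex" where "source1 w \<equiv> \<lambda>x. of_real (v1 x) * w x"

text \<open>The equation becomes \<open>U - LS_operator \<zeta> U = F\<close>, with \<open>F\<close>
  the free solution for the source \<open>f\<close>. Bounded continuous pairs form a complete space,
  as the Fredholm alternative requires.\<close>

definition LS_operator :: "complex \<Rightarrow> (real \<Rightarrow>\<^sub>C (complex \<times> complex)) \<Rightarrow> (real \<Rightarrow>\<^sub>C (complex \<times> complex))" where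
  "LS_operator \<zeta> U = Bcontfun (\<lambda>x. (green_op \<zeta> 0 (source0 (\<lambda>x. fst (U x))) (source1 (\<lambda>x. snd (U x))) x, green_op \<zeta> 1 (source0 (\<lambda>x. fst (U x))) (source1 (\<lambda>x. snd (U x))) x))"

lemma comp_bounds:
  fixes U :: "real \<Rightarrow>\<^sub>C (complex \<times> complex)"
  shows "cmod (fst (U x)) \<le> norm U" "cmod (snd (U x)) \<le> norm U"
    "(\<lambda>x. fst (U x)) \<in> borel_measurable lebesgue" "(\<lambda>x. snd (U x)) \<in> borel_measurable lebesgue"
proof -
  show "cmod (fst (U x)) \<le> norm U" "cmod (snd (U x)) \<le> norm U"
    using norm_bounded[of U x] norm_fst_le[of "fst (U x)" "snd (U x)"] norm_snd_le[of "snd (U x)" "fst (U x)"] by simp_all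
  show "(\<lambda>x. fst (U x)) \<in> borel_measurable lebesgue" "(\<lambda>x. snd (U x)) \<in> borel_measurable lebesgue"
    by (intro continuous_lebesgue_measurable continuous_intros continuous_on_apply_bcontfun)+
qed

lemma comp_integrable:
  fixes U :: "real \<Rightarrow>\<^sub>C (complex \<times> complex)"
  shows "integrable lebesgue (source0 (\<lambda>x. fst (U x)))" "integrable lebesgue (source1 (\<lambda>x. snd (U x)))"
  using bdd_mult_integrable[OF v0 comp_bounds(3,1)] bdd_mult_integrable[OF v1 comp_bounds(4,2)] by auto

lemma green_op_L1_bound:
  assumes z: "quadrant \<zeta>" and q: "integrable lebesgue q" and r: "integrable lebesgue r" and A: "green_norm \<zeta> j \<le> A" "green_norm \<zeta> (Suc j) \<le> A"
  shows "cmod (green_op \<zeta> j q r x) \<le> A * ((LINT y|lebesgue. cmod (q y)) + (LINT y|lebesgue. cmod (r y)))"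
proof -
  have "cmod (green_op \<zeta> j q r x) \<le> cmod (conv (green \<zeta> j) q x) + cmod (conv (green \<zeta> (Suc j)) r x)"
    unfolding green_op_def by (rule norm_triangle_ineq)
  also have "\<dots> \<le> A * (LINT y|lebesgue. cmod (q y)) + A * (LINT y|lebesgue. cmod (r y))"
    by (intro add_mono order_trans[OF conv_L1_bound[OF green_kern[OF z] decay_rate_nonneg[OF z] q] mult_right_mono[OF A(1)]]
        order_trans[OF conv_L1_bound[OF green_kern[OF z] decay_rate_nonneg[OF z] r] mult_right_mono[OF A(2)]]) simp_all
  finally show ?thesis by (simp add: distrib_left)
qed

lemma LS_operator_apply:
  assumes z: "quadrant \<zeta>"
  shows "LS_operator \<zeta> U x = (green_op \<zeta> 0 (source0 (\<lambda>x. fst (U x))) (source1 (\<lambda>x. snd (U x))) x, green_op \<zeta> 1 (source0 (\<lambda>x. fst (U x))) (source1 (\<lambda>x. snd (U x))) x)"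
proof -
  note s = src_L1[OF comp_integrable(1) decay_rate_nonneg[OF z], of U] src_L1[OF comp_integrable(2) decay_rate_nonneg[OF z], of U]
  obtain M0 where M0: "\<And>x. cmod (green_op \<zeta> 0 (source0 (\<lambda>x. fst (U x))) (source1 (\<lambda>x. snd (U x))) x) \<le> M0" using green_op_bounded[OF z s] by blast
  obtain M1 where M1: "\<And>x. cmod (green_op \<zeta> 1 (source0 (\<lambda>x. fst (U x))) (source1 (\<lambda>x. snd (U x))) x) \<le> M1" using green_op_bounded[OF z s] by blast
  have "(\<lambda>x. (green_op \<zeta> 0 (source0 (\<lambda>x. fst (U x))) (source1 (\<lambda>x. snd (U x))) x, green_op \<zeta> 1 (source0 (\<lambda>x. fst (U x))) (source1 (\<lambda>x. snd (U x))) x)) \<in> bcontfun"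
  proof (rule bcontfun_normI)
    show "continuous_on UNIV (\<lambda>x. (green_op \<zeta> 0 (source0 (\<lambda>x. fst (U x))) (source1 (\<lambda>x. snd (U x))) x, green_op \<zeta> 1 (source0 (\<lambda>x. fst (U x))) (source1 (\<lambda>x. snd (U x))) x))"
      by (intro continuous_on_Pair green_op_cont[OF z s])
    show "norm (green_op \<zeta> 0 (source0 (\<lambda>x. fst (U x))) (source1 (\<lambda>x. snd (U x))) x, green_op \<zeta> 1 (source0 (\<lambda>x. fst (U x))) (source1 (\<lambda>x. snd (U x))) x) \<le> M0 + M1" for x
      by (rule order_trans[OF norm_Pair_le add_mono[OF M0 M1]])
  qed
  then show ?thesis unfolding LS_operator_def by (simp add: Bcontfun_inverse)
qed

lemma LS_operator_linear:
  assumes z: "quadrant \<zeta>"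
  shows "LS_operator \<zeta> (U + V) = LS_operator \<zeta> U + LS_operator \<zeta> V" "LS_operator \<zeta> (a *\<^sub>R U) = a *\<^sub>R LS_operator \<zeta> U"
proof -
  have s: "src (decay_rate \<zeta>) (source0 (\<lambda>x. fst (U x)))" "src (decay_rate \<zeta>) (source1 (\<lambda>x. snd (U x)))" for U :: "real \<Rightarrow>\<^sub>C (complex \<times> complex)"
    by (rule src_L1[OF comp_integrable(1) decay_rate_nonneg[OF z]], rule src_L1[OF comp_integrable(2) decay_rate_nonneg[OF z]])
  have 1: "source0 (\<lambda>x. fst ((U + V) x)) = (\<lambda>x. source0 (\<lambda>x. fst (U x)) x + source0 (\<lambda>x. fst (V x)) x)"
    "source1 (\<lambda>x. snd ((U + V) x)) = (\<lambda>x. source1 (\<lambda>x. snd (U x)) x + source1 (\<lambda>x. snd (V x)) x)"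
    by (simp_all add: fun_eq_iff algebra_simps)
  have 2: "source0 (\<lambda>x. fst ((a *\<^sub>R U) x)) = (\<lambda>x. of_real a * source0 (\<lambda>x. fst (U x)) x)"
    "source1 (\<lambda>x. snd ((a *\<^sub>R U) x)) = (\<lambda>x. of_real a * source1 (\<lambda>x. snd (U x)) x)"
    by (simp_all add: fun_eq_iff algebra_simps scaleR_conv_of_real)
  have l1: "green_op \<zeta> j (source0 (\<lambda>x. fst ((U + V) x))) (source1 (\<lambda>x. snd ((U + V) x))) x =
     green_op \<zeta> j (source0 (\<lambda>x. fst (U x))) (source1 (\<lambda>x. snd (U x))) x + green_op \<zeta> j (source0 (\<lambda>x. fst (V x))) (source1 (\<lambda>x. snd (V x))) x" for j x
    unfolding 1 green_op_def conv_add[OF green_kern[OF z] s(1) s(1)] conv_add[OF green_kern[OF z] s(2) s(2)] by simp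
  have l2: "green_op \<zeta> j (source0 (\<lambda>x. fst ((a *\<^sub>R U) x))) (source1 (\<lambda>x. snd ((a *\<^sub>R U) x))) x =
     of_real a * green_op \<zeta> j (source0 (\<lambda>x. fst (U x))) (source1 (\<lambda>x. snd (U x))) x" for j x
    unfolding 2 green_op_def conv_cmult by (simp add: distrib_left)
  show "LS_operator \<zeta> (U + V) = LS_operator \<zeta> U + LS_operator \<zeta> V"
  proof (rule bcontfun_eqI)
    show "LS_operator \<zeta> (U + V) x = (LS_operator \<zeta> U + LS_operator \<zeta> V) x" for x
      unfolding LS_operator_apply[OF z, of "U + V"] l1 by (simp add: LS_operator_apply[OF z])
  qed
  show "LS_operator \<zeta> (a *\<^sub>R U) = a *\<^sub>R LS_operator \<zeta> U"
  proof (rule bcontfun_eqI)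
    show "LS_operator \<zeta> (a *\<^sub>R U) x = (a *\<^sub>R LS_operator \<zeta> U) x" for x
      unfolding LS_operator_apply[OF z, of "a *\<^sub>R U"] l2 by (simp add: LS_operator_apply[OF z] scaleR_conv_of_real)
  qed
qed

lemma LS_operator_norm:
  assumes z: "quadrant \<zeta>" and A: "\<And>j. j \<le> 2 \<Longrightarrow> green_norm \<zeta> j \<le> A"
  shows "norm (LS_operator \<zeta> U) \<le> 2 * A * ((LINT y|lebesgue. cmod (source0 (\<lambda>x. fst (U x)) y)) + (LINT y|lebesgue. cmod (source1 (\<lambda>x. snd (U x)) y)))"
proof (rule norm_bound)
  fix x
  let ?I = "(LINT y|lebesgue. cmod (source0 (\<lambda>x. fst (U x)) y)) + (LINT y|lebesgue. cmod (source1 (\<lambda>x. snd (U x)) y))"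
  have "norm (LS_operator \<zeta> U x) \<le> A * ?I + A * ?I"
    unfolding LS_operator_apply[OF z]
    by (rule order_trans[OF norm_Pair_le add_mono]) (rule green_op_L1_bound[OF z comp_integrable]; use A in simp)+
  then show "norm (LS_operator \<zeta> U x) \<le> 2 * A * ?I" by simp
qed

lemma source0_source1_bound:
  fixes U :: "real \<Rightarrow>\<^sub>C (complex \<times> complex)"
  shows "(LINT y|lebesgue. cmod (source0 (\<lambda>x. fst (U x)) y)) + (LINT y|lebesgue. cmod (source1 (\<lambda>x. snd (U x)) y)) \<le> norm U * (LINT y|lebesgue. potential_weight y)"
proof -
  have "(LINT y|lebesgue. cmod (source0 (\<lambda>x. fst (U x)) y)) \<le> (LINT y|lebesgue. norm U * \<bar>v0 y\<bar>)"
  proof (rule integral_mono[OF integrable_norm[OF comp_integrable(1)]])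
    show "integrable lebesgue (\<lambda>y. norm U * \<bar>v0 y\<bar>)" using v0 by simp
    show "cmod (source0 (\<lambda>x. fst (U x)) y) \<le> norm U * \<bar>v0 y\<bar>" for y
      using mult_left_mono[OF comp_bounds(1)[of U y] abs_ge_zero[of "v0 y"]] by (simp add: norm_mult mult.commute)
  qed
  moreover have "(LINT y|lebesgue. cmod (source1 (\<lambda>x. snd (U x)) y)) \<le> (LINT y|lebesgue. norm U * \<bar>v1 y\<bar>)"
  proof (rule integral_mono[OF integrable_norm[OF comp_integrable(2)]])
    show "integrable lebesgue (\<lambda>y. norm U * \<bar>v1 y\<bar>)" using v1 by simp
    show "cmod (source1 (\<lambda>x. snd (U x)) y) \<le> norm U * \<bar>v1 y\<bar>" for y
      using mult_left_mono[OF comp_bounds(2)[of U y] abs_ge_zero[of "v1 y"]] by (simp add: norm_mult mult.commute)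
  qed
  moreover have "(LINT y|lebesgue. potential_weight y) = (LINT y|lebesgue. \<bar>v0 y\<bar>) + (LINT y|lebesgue. \<bar>v1 y\<bar>)"
    unfolding potential_weight_def using v0 v1 by simp
  ultimately show ?thesis by (simp add: distrib_left)
qed

lemma green_norm_le:
  obtains A where "A > 0" "\<And>j. j \<le> 3 \<Longrightarrow> green_norm \<zeta> j \<le> A"
proof -
  have "green_norm \<zeta> j \<le> 1 + green_norm \<zeta> 0 + green_norm \<zeta> 1 + green_norm \<zeta> 2 + green_norm \<zeta> 3" if "j \<le> 3" for j
  proof -
    have "j = 0 \<or> j = 1 \<or> j = 2 \<or> j = 3" using that by auto
    then show ?thesis using green_norm_nonneg[of \<zeta> 0] green_norm_nonneg[of \<zeta> 1] green_norm_nonneg[of \<zeta> 2] green_norm_nonneg[of \<zeta> 3] by auto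
  qed
  moreover have "1 + green_norm \<zeta> 0 + green_norm \<zeta> 1 + green_norm \<zeta> 2 + green_norm \<zeta> 3 > 0"
    using green_norm_nonneg[of \<zeta> 0] green_norm_nonneg[of \<zeta> 1] green_norm_nonneg[of \<zeta> 2] green_norm_nonneg[of \<zeta> 3] by linarith
  ultimately show ?thesis using that by blast
qed

lemma LS_operator_bounded_linear:
  assumes z: "quadrant \<zeta>"
  shows "bounded_linear (LS_operator \<zeta>)"
proof -
  obtain A where A: "A > 0" "\<And>j. j \<le> 3 \<Longrightarrow> green_norm \<zeta> j \<le> A" using green_norm_le by blast
  have "norm (LS_operator \<zeta> U) \<le> norm U * (2 * A * (LINT y|lebesgue. potential_weight y))" for U
  proof -
    have "norm (LS_operator \<zeta> U) \<le> 2 * A * ((LINT y|lebesgue. cmod (source0 (\<lambda>x. fst (U x)) y)) + (LINT y|lebesgue. cmod (source1 (\<lambda>x. snd (U x)) y)))"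
      by (rule LS_operator_norm[OF z]) (use A in simp)
    also have "\<dots> \<le> 2 * A * (norm U * (LINT y|lebesgue. potential_weight y))"
      using A(1) by (intro mult_left_mono source0_source1_bound) auto
    finally show ?thesis by (simp add: mult_ac)
  qed
  then show ?thesis by (intro bounded_linear_intro LS_operator_linear[OF z])
qed

text \<open>One application yields equi-Lipschitz pairs and thus a pointwise limit \<open>G\<close>.
  The norm of a second application is controlled by integrals against the potentials, and these tend
  to 0 for the differences from \<open>G\<close>.\<close>

lemma LS_operator_square_compact:
  assumes z: "quadrant \<zeta>" and U: "\<And>n. norm (U n) \<le> 1"
  shows "\<exists>r l. strict_mono (r :: nat \<Rightarrow> nat) \<and> (\<lambda>n. LS_operator \<zeta> (LS_operator \<zeta> (U (r n)))) \<longlonglongrightarrow> l"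
proof -
  obtain A where A: "A > 0" "\<And>j. j \<le> 3 \<Longrightarrow> green_norm \<zeta> j \<le> A" using green_norm_le by blast
  interpret LS_operator: bounded_linear "LS_operator \<zeta>" by (rule LS_operator_bounded_linear[OF z])
  define N where "N = (LINT y|lebesgue. potential_weight y)"
  define V where "V = (\<lambda>n. LS_operator \<zeta> (U n))"
  let ?q = "\<lambda>n. source0 (\<lambda>x. fst (U n x))" and ?r = "\<lambda>n. source1 (\<lambda>x. snd (U n x))"
  have Vx: "V n x = (green_op \<zeta> 0 (?q n) (?r n) x, green_op \<zeta> 1 (?q n) (?r n) x)" for n x
    unfolding V_def by (rule LS_operator_apply[OF z])
  have I: "(LINT y|lebesgue. cmod (?q n y)) + (LINT y|lebesgue. cmod (?r n y)) \<le> N" for n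
  proof -
    have "N \<ge> 0" unfolding N_def using potential_weight_nonneg by simp
    then have "norm (U n) * N \<le> 1 * N" using U[of n] by (intro mult_right_mono) auto
    then show ?thesis using source0_source1_bound[of "U n"] by (simp add: N_def)
  qed
  have P: "cmod (green_op \<zeta> j (?q n) (?r n) x) \<le> A * N" if "j \<le> 2" for j n x
    by (rule order_trans[OF green_op_L1_bound[OF z comp_integrable] mult_left_mono[OF I]]) (use A that in auto)
  have s: "src (decay_rate \<zeta>) (?q n)" "src (decay_rate \<zeta>) (?r n)" for n
    by (rule src_L1[OF comp_integrable(1) decay_rate_nonneg[OF z]], rule src_L1[OF comp_integrable(2) decay_rate_nonneg[OF z]])
  have lip: "cmod (green_op \<zeta> j (?q n) (?r n) x - green_op \<zeta> j (?q n) (?r n) y) \<le> A * N * \<bar>x - y\<bar>" if "j \<le> 1" for j n x y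
    by (rule vector_lipschitz[OF green_op_deriv[OF z that s]]) (use P that in simp)
  have Vb: "norm (V n x) \<le> A * N + A * N" for n x
    unfolding Vx by (rule order_trans[OF norm_Pair_le add_mono[OF P P]]) auto
  have Vl: "norm (V n x - V n y) \<le> (A * N + A * N) * \<bar>x - y\<bar>" for n x y
  proof -
    have "norm (V n x - V n y) \<le> A * N * \<bar>x - y\<bar> + A * N * \<bar>x - y\<bar>"
      unfolding Vx diff_Pair by (rule order_trans[OF norm_Pair_le add_mono[OF lip lip]]) auto
    then show ?thesis by (simp add: distrib_right)
  qed
  obtain r G where r: "strict_mono (r :: nat \<Rightarrow> nat)" "\<And>x. (\<lambda>n. V (r n) x) \<longlonglongrightarrow> G x"
    by (rule pointwise_compactness[of "\<lambda>n x. V n x", OF Vb Vl]) blast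
  have Gb: "norm (G x) \<le> A * N + A * N" for x
    by (rule LIMSEQ_le_const2[OF tendsto_norm[OF r(2)]]) (use Vb in blast)
  have Gl: "norm (G x - G y) \<le> (A * N + A * N) * \<bar>x - y\<bar>" for x y
    by (rule LIMSEQ_le_const2[OF tendsto_norm[OF tendsto_diff[OF r(2) r(2)]]]) (use Vl in blast)
  have "G \<in> bcontfun"
  proof (rule bcontfun_normI[OF _ Gb])
    have "(A * N + A * N)-lipschitz_on UNIV G"
      using Gl order_trans[OF norm_ge_zero Gb] by (intro lipschitz_onI) (auto simp: dist_norm)
    then show "continuous_on UNIV G" by (rule lipschitz_on_continuous_on)
  qed
  then obtain GG where GG: "G = apply_bcontfun GG" by (rule bcontfunE)
  define D where "D = (\<lambda>n. V (r n) - GG)"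
  have Dx: "(\<lambda>n. D n x) \<longlonglongrightarrow> 0" for x
    unfolding D_def minus_bcontfun.rep_eq using tendsto_diff[OF r(2)[of x] tendsto_const[of "G x"]] by (simp add: GG)
  have Db: "norm (D n x) \<le> 4 * (A * N)" for n x
    unfolding D_def minus_bcontfun.rep_eq using norm_triangle_ineq4[of "V (r n) x" "GG x"] Vb[of "r n" x] Gb[of x] by (simp add: GG)
  have Dc: "cmod (fst (D n x)) \<le> 4 * (A * N)" "cmod (snd (D n x)) \<le> 4 * (A * N)" for n x
    using Db[of n x] norm_fst_le[of "fst (D n x)" "snd (D n x)"] norm_snd_le[of "snd (D n x)" "fst (D n x)"] by simp_all
  have l0: "(\<lambda>n. LINT y|lebesgue. cmod (source0 (\<lambda>x. fst (D n x)) y)) \<longlonglongrightarrow> integral\<^sup>L lebesgue (\<lambda>y::real. 0)"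
  proof (rule integral_dominated_convergence[where w="\<lambda>y. \<bar>v0 y\<bar> * (4 * (A * N))"])
    show "AE y in lebesgue. (\<lambda>n. cmod (source0 (\<lambda>x. fst (D n x)) y)) \<longlonglongrightarrow> 0"
    proof (intro AE_I2)
      fix y
      have "(\<lambda>n. fst (D n y)) \<longlonglongrightarrow> 0" using tendsto_fst[OF Dx[of y]] by simp
      then have "(\<lambda>n. cmod (0 - of_real (v0 y) * fst (D n y))) \<longlonglongrightarrow> cmod (0 - of_real (v0 y) * 0)"
        by (intro tendsto_intros)
      then show "(\<lambda>n. cmod (source0 (\<lambda>x. fst (D n x)) y)) \<longlonglongrightarrow> 0" by simp
    qed
    show "AE y in lebesgue. norm (cmod (source0 (\<lambda>x. fst (D n x)) y)) \<le> \<bar>v0 y\<bar> * (4 * (A * N))" for n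
      using Dc(1) by (intro AE_I2) (auto simp: norm_mult intro!: mult_left_mono)
    show "(\<lambda>y. cmod (source0 (\<lambda>x. fst (D n x)) y)) \<in> borel_measurable lebesgue" for n
      using borel_measurable_integrable[OF comp_integrable(1)[of "D n"]] by simp
  qed (use v0 in auto)
  have l1: "(\<lambda>n. LINT y|lebesgue. cmod (source1 (\<lambda>x. snd (D n x)) y)) \<longlonglongrightarrow> integral\<^sup>L lebesgue (\<lambda>y::real. 0)"
  proof (rule integral_dominated_convergence[where w="\<lambda>y. \<bar>v1 y\<bar> * (4 * (A * N))"])
    show "AE y in lebesgue. (\<lambda>n. cmod (source1 (\<lambda>x. snd (D n x)) y)) \<longlonglongrightarrow> 0"
    proof (intro AE_I2)
      fix y
      have "(\<lambda>n. snd (D n y)) \<longlonglongrightarrow> 0" using tendsto_snd[OF Dx[of y]] by simp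
      then have "(\<lambda>n. cmod (of_real (v1 y) * snd (D n y))) \<longlonglongrightarrow> cmod (of_real (v1 y) * 0)"
        by (intro tendsto_intros)
      then show "(\<lambda>n. cmod (source1 (\<lambda>x. snd (D n x)) y)) \<longlonglongrightarrow> 0" by simp
    qed
    show "AE y in lebesgue. norm (cmod (source1 (\<lambda>x. snd (D n x)) y)) \<le> \<bar>v1 y\<bar> * (4 * (A * N))" for n
      using Dc(2) by (intro AE_I2) (auto simp: norm_mult intro!: mult_left_mono)
    show "(\<lambda>y. cmod (source1 (\<lambda>x. snd (D n x)) y)) \<in> borel_measurable lebesgue" for n
      using borel_measurable_integrable[OF comp_integrable(2)[of "D n"]] by simp
  qed (use v1 in auto)
  have "(\<lambda>n. 2 * A * ((LINT y|lebesgue. cmod (source0 (\<lambda>x. fst (D n x)) y)) + (LINT y|lebesgue. cmod (source1 (\<lambda>x. snd (D n x)) y))))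
    \<longlonglongrightarrow> 2 * A * (integral\<^sup>L lebesgue (\<lambda>y::real. 0) + integral\<^sup>L lebesgue (\<lambda>y::real. 0))"
    by (intro tendsto_intros l0 l1)
  then have lim: "(\<lambda>n. 2 * A * ((LINT y|lebesgue. cmod (source0 (\<lambda>x. fst (D n x)) y)) + (LINT y|lebesgue. cmod (source1 (\<lambda>x. snd (D n x)) y)))) \<longlonglongrightarrow> 0"
    by simp
  have "(\<lambda>n. LS_operator \<zeta> (D n)) \<longlonglongrightarrow> 0"
  proof (rule Lim_null_comparison[OF always_eventually lim], intro allI)
    show "norm (LS_operator \<zeta> (D n)) \<le> 2 * A * ((LINT y|lebesgue. cmod (source0 (\<lambda>x. fst (D n x)) y)) + (LINT y|lebesgue. cmod (source1 (\<lambda>x. snd (D n x)) y)))" for n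
      by (rule LS_operator_norm[OF z]) (use A in simp)
  qed
  then have "(\<lambda>n. LS_operator \<zeta> (D n) + LS_operator \<zeta> GG) \<longlonglongrightarrow> 0 + LS_operator \<zeta> GG" by (intro tendsto_intros)
  then have "(\<lambda>n. LS_operator \<zeta> (LS_operator \<zeta> (U (r n)))) \<longlonglongrightarrow> LS_operator \<zeta> GG" by (simp add: D_def V_def LS_operator.diff)
  then show ?thesis using r(1) by blast
qed

text \<open>A fixed point would be an L2 eigenfunction for the nonreal number \<zeta>^4. Symmetry
  makes \<zeta>^4 times its squared norm real, so it vanishes, and its derivative with it.\<close>

lemma LS_operator_fixed_point:
  assumes z: "quadrant \<zeta>" and i: "Im (\<zeta> ^ 4) \<noteq> 0" and fp: "LS_operator \<zeta> U = U"
  shows "U = 0"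
proof -
  define u w where "u = (\<lambda>x. fst (U x))" and "w = (\<lambda>x. snd (U x))"
  have Ux: "U x = (green_op \<zeta> 0 (source0 u) (source1 w) x, green_op \<zeta> 1 (source0 u) (source1 w) x)" for x
    using LS_operator_apply[OF z, of U x] unfolding fp by (simp add: u_def w_def)
  have p: "fst (U x) = green_op \<zeta> 0 (source0 u) (source1 w) x" "snd (U x) = green_op \<zeta> 1 (source0 u) (source1 w) x" for x
    by (subst Ux, rule fst_conv, subst Ux, rule snd_conv)
  have d: "u x = fst (U x)" "w x = snd (U x)" for x by (simp_all only: u_def w_def)
  have e: "\<forall>x. u x = green_op \<zeta> 0 (source0 u) (source1 w) x" "\<forall>x. w x = green_op \<zeta> 1 (source0 u) (source1 w) x"
    by (rule allI, rule trans[OF d(1) p(1)], rule allI, rule trans[OF d(2) p(2)])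
  have L: "LS \<zeta> v0 v1 (\<lambda>_. 0) u w"
    unfolding LS_def
  proof (intro conjI)
    show "u \<in> borel_measurable lebesgue" "w \<in> borel_measurable lebesgue"
      unfolding u_def w_def by (rule comp_bounds)+
    show "\<exists>M. \<forall>x. cmod (u x) \<le> M \<and> cmod (w x) \<le> M"
      unfolding u_def w_def using comp_bounds(1,2)[of U] by blast
  qed (fact e)+
  have H: "Hop v0 v1 u (\<lambda>x. \<zeta> ^ 4 * u x)"
    using LS_Hop[OF L z decay_rate_pos[OF z i] L2_zero] by simp
  have "\<zeta> ^ 4 * l2_inner u u = cnj (\<zeta> ^ 4 * l2_inner u u)"
    using trans[OF Hop_symmetric[OF H H] l2_inner_sym] by (simp only: l2_inner_cmult_left)
  then have "\<zeta> ^ 4 * l2_inner u u \<in> \<real>" unfolding Reals_cnj_iff by (rule sym)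
  then have "Im (\<zeta> ^ 4 * l2_inner u u) = 0" unfolding complex_is_Real_iff .
  then have "Im (\<zeta> ^ 4) * (LINT x|lebesgue. (cmod (u x))\<^sup>2) = 0" unfolding l2_inner_self by simp
  then have "l2_inner u u = 0" using i unfolding l2_inner_self by simp
  moreover have "L2 u" using H by (auto simp: Hop_def H2_def)
  ultimately have u0: "u x = 0" for x
    using l2_inner_self_zero W2_cont(1)[OF LS_W2(1)[OF L z src_zero]] by blast
  then have "u = (\<lambda>x. 0)" by (rule ext)
  then have "((\<lambda>x. 0) has_vector_derivative w x) (at x)" for x
    using LS_W2(1)[OF L z src_zero] by (simp add: W2_def)
  then have w0: "w x = 0" for x
    using vector_derivative_unique_at has_vector_derivative_const by blast
  show ?thesis
    by (rule bcontfun_eqI) (use u0 w0 in \<open>simp add: u_def w_def prod_eq_iff\<close>)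
qed

text \<open>Injectivity gives surjectivity by the Fredholm alternative. Combined with
  \<open>LS_Hop\<close> this shows that \<open>H - z\<close> is onto for nonreal z, which is the
  self-adjointness of \<open>H\<close>.\<close>

lemma LS_exists:
  assumes z: "quadrant \<zeta>" and i: "Im (\<zeta> ^ 4) \<noteq> 0" and f: "L2 f"
  obtains u w where "LS \<zeta> v0 v1 f u w"
proof -
  have c: "decay_rate \<zeta> > 0" by (rule decay_rate_pos[OF z i])
  have sf: "src (decay_rate \<zeta>) f" by (rule src_L2[OF f c])
  define F where "F = (\<lambda>x. (green_op \<zeta> 0 f (\<lambda>_. 0) x, green_op \<zeta> 1 f (\<lambda>_. 0) x))"
  obtain M0 where M0: "\<And>x. cmod (green_op \<zeta> 0 f (\<lambda>_. 0) x) \<le> M0" using green_op_bounded[OF z sf src_zero] by blast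
  obtain M1 where M1: "\<And>x. cmod (green_op \<zeta> 1 f (\<lambda>_. 0) x) \<le> M1" using green_op_bounded[OF z sf src_zero] by blast
  have "F \<in> bcontfun"
  proof (rule bcontfun_normI)
    show "continuous_on UNIV F" unfolding F_def by (intro continuous_on_Pair green_op_cont[OF z sf src_zero])
    show "norm (F x) \<le> M0 + M1" for x unfolding F_def by (rule order_trans[OF norm_Pair_le add_mono[OF M0 M1]])
  qed
  then obtain FF where FF: "F = apply_bcontfun FF" by (rule bcontfunE)
  obtain U where U: "U - LS_operator \<zeta> U = FF"
  proof -
    have "\<exists>U. U - LS_operator \<zeta> U = FF"
    proof (rule fredholm_square_compact[OF LS_operator_bounded_linear[OF z]])
      fix V :: "nat \<Rightarrow> (real \<Rightarrow>\<^sub>C (complex \<times> complex))" assume "\<And>n. norm (V n) \<le> 1"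
      then show "\<exists>r l. strict_mono (r :: nat \<Rightarrow> nat) \<and> (\<lambda>n. LS_operator \<zeta> (LS_operator \<zeta> (V (r n)))) \<longlonglongrightarrow> l"
        by (rule LS_operator_square_compact[OF z])
    next
      fix V assume "LS_operator \<zeta> V = V"
      then show "V = 0" by (rule LS_operator_fixed_point[OF z i])
    qed
    then show ?thesis using that by blast
  qed
  define u w where "u = (\<lambda>x. fst (U x))" and "w = (\<lambda>x. snd (U x))"
  have s: "src (decay_rate \<zeta>) (source0 u)" "src (decay_rate \<zeta>) (source1 w)"
    unfolding u_def w_def by (rule src_L1[OF comp_integrable(1) decay_rate_nonneg[OF z]], rule src_L1[OF comp_integrable(2) decay_rate_nonneg[OF z]])
  have Ux: "U x = F x + (green_op \<zeta> 0 (source0 u) (source1 w) x, green_op \<zeta> 1 (source0 u) (source1 w) x)" for x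
  proof -
    have "U = FF + LS_operator \<zeta> U" using U by (simp add: algebra_simps)
    then have "U x = FF x + LS_operator \<zeta> U x" by (metis plus_bcontfun.rep_eq)
    then show ?thesis unfolding LS_operator_apply[OF z] by (simp add: FF u_def w_def)
  qed
  have P: "green_op \<zeta> j f (\<lambda>_. 0) x + green_op \<zeta> j (source0 u) (source1 w) x = green_op \<zeta> j (\<lambda>x. f x - of_real (v0 x) * u x) (source1 w) x" for j x
  proof -
    have "conv (green \<zeta> j) (\<lambda>x. f x + source0 u x) x = conv (green \<zeta> j) f x + conv (green \<zeta> j) (source0 u) x"
      by (rule conv_add[OF green_kern[OF z] sf s(1)])
    moreover have "conv (green \<zeta> (Suc j)) (\<lambda>_. 0) x = 0" by (simp add: conv_def)
    ultimately show ?thesis unfolding green_op_def by simp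
  qed
  have p: "fst (U x) = green_op \<zeta> 0 f (\<lambda>_. 0) x + green_op \<zeta> 0 (source0 u) (source1 w) x" "snd (U x) = green_op \<zeta> 1 f (\<lambda>_. 0) x + green_op \<zeta> 1 (source0 u) (source1 w) x" for x
    by (subst Ux, simp only: F_def fst_add fst_conv, subst Ux, simp only: F_def snd_add snd_conv)
  have d: "u x = fst (U x)" "w x = snd (U x)" for x by (simp_all only: u_def w_def)
  have e: "\<forall>x. u x = green_op \<zeta> 0 (\<lambda>x. f x - of_real (v0 x) * u x) (source1 w) x" "\<forall>x. w x = green_op \<zeta> 1 (\<lambda>x. f x - of_real (v0 x) * u x) (source1 w) x"
    by (rule allI, rule trans[OF d(1) trans[OF p(1) P]], rule allI, rule trans[OF d(2) trans[OF p(2) P]])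
  have "LS \<zeta> v0 v1 f u w"
    unfolding LS_def
  proof (intro conjI)
    show "u \<in> borel_measurable lebesgue" "w \<in> borel_measurable lebesgue"
      unfolding u_def w_def by (rule comp_bounds)+
    show "\<exists>M. \<forall>x. cmod (u x) \<le> M \<and> cmod (w x) \<le> M"
      unfolding u_def w_def using comp_bounds(1,2)[of U] by blast
  qed (fact e)+
  then show ?thesis using that by blast
qed

end

section \<open>Absence of singular continuous spectrum\<close>

lemma l2_inner_sum_left:
  assumes "finite I" "\<And>a. a \<in> I \<Longrightarrow> L2 (u a)" "L2 g"
  shows "l2_inner (\<lambda>x. \<Sum>a\<in>I. c a * u a x) g = (\<Sum>a\<in>I. c a * l2_inner (u a) g)"
proof -
  have "l2_inner (\<lambda>x. \<Sum>a\<in>I. c a * u a x) g = (LINT x|lebesgue. (\<Sum>a\<in>I. c a * (u a x * cnj (g x))))"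
    unfolding l2_inner_def by (simp add: sum_distrib_right mult.assoc)
  also have "\<dots> = (\<Sum>a\<in>I. (LINT x|lebesgue. c a * (u a x * cnj (g x))))"
    by (intro Bochner_Integration.integral_sum integrable_mult_right L2_prod(2) assms)
  finally show ?thesis by (simp only: l2_inner_def integral_mult_right_zero)
qed

text \<open>The resolvent identity in inner products, for \<open>u = R(z) f\<close> and
  \<open>y = R(w) g\<close>. When \<open>z = cnj w\<close> the left side vanishes, and the identity
  says that \<open>R(z)\<close> and \<open>R(w)\<close> are adjoint to each other.\<close>

lemma Hop_green:
  assumes u: "Hop v0 v1 u (\<lambda>x. f x + z * u x)" and y: "Hop v0 v1 y (\<lambda>x. g x + w * y x)" and l: "L2 f" "L2 g"
  shows "(z - cnj w) * l2_inner u y = l2_inner u g - l2_inner f y"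
proof -
  have lu: "L2 u" "L2 y" using u y by (auto simp: Hop_def H2_def)
  have "l2_inner f y + z * l2_inner u y = l2_inner u g + cnj w * l2_inner u y"
    using Hop_symmetric[OF u y] unfolding l2_inner_add_left[OF l(1) lu] l2_inner_add_right[OF l(2) lu(2,1)] .
  then show ?thesis by (simp add: algebra_simps)
qed

lemma cauchy_kernel:
  fixes z :: complex
  assumes f: "finite_measure \<mu>" and s: "sets \<mu> = sets borel" and z: "Im z \<noteq> 0"
  shows "(\<lambda>t. 1 / (complex_of_real t - z)) \<in> borel_measurable \<mu>" "integrable \<mu> (\<lambda>t. 1 / (complex_of_real t - z))"
    "complex_of_real t - z \<noteq> 0" "cmod (1 / (complex_of_real t - z)) \<le> 1 / \<bar>Im z\<bar>"
proof -
  show nz: "complex_of_real t - z \<noteq> 0" for t using z by (auto simp: complex_eq_iff)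
  have "(\<lambda>t. 1 / (complex_of_real t - z)) \<in> borel_measurable borel"
    using nz by (intro borel_measurable_continuous_onI continuous_intros) auto
  then show m: "(\<lambda>t. 1 / (complex_of_real t - z)) \<in> borel_measurable \<mu>"
    using measurable_cong_sets[OF s refl] by blast
  show b: "cmod (1 / (complex_of_real t - z)) \<le> 1 / \<bar>Im z\<bar>" for t
  proof -
    have "\<bar>Im z\<bar> \<le> cmod (complex_of_real t - z)" using abs_Im_le_cmod[of "complex_of_real t - z"] by simp
    then show ?thesis using z by (simp add: norm_divide frac_le)
  qed
  show "integrable \<mu> (\<lambda>t. 1 / (complex_of_real t - z))"
    by (rule finite_measure.integrable_const_bound[OF f _ m]) (use b in auto)
qed

text \<open>The spectral isometry on finitely many resolvent vectors, \<open>R(z) f\<close>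
  corresponding to \<open>1 / (t - z)\<close>. Partial fractions reduce a product of two Cauchy
  kernels to their difference, exactly as \<open>Hop_green\<close> does for the inner product of two
  resolvent vectors; \<open>ne\<close> keeps the common factor nonzero.\<close>

lemma cyclic_isometry:
  fixes c z :: "'i \<Rightarrow> complex" and f :: "real \<Rightarrow> complex" and u :: "'i \<Rightarrow> real \<Rightarrow> complex"
  assumes sp: "spectral_measure v0 v1 f \<mu>" and l: "L2 f" and I: "finite I"
    and H: "\<And>a. a \<in> I \<Longrightarrow> Hop v0 v1 (u a) (\<lambda>x. f x + z a * u a x)" and z: "\<And>a. a \<in> I \<Longrightarrow> Im (z a) \<noteq> 0"
    and ne: "\<And>a b. a \<in> I \<Longrightarrow> b \<in> I \<Longrightarrow> z a \<noteq> cnj (z b)"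
  defines "w \<equiv> \<lambda>x. \<Sum>a\<in>I. c a * u a x" and "W \<equiv> \<lambda>t. \<Sum>a\<in>I. c a * (1 / (complex_of_real t - z a))"
  shows "L2 w" "l2_inner w f = (LINT t|\<mu>. W t)" "(LINT x|lebesgue. (cmod (w x))\<^sup>2) = (LINT t|\<mu>. (cmod (W t))\<^sup>2)"
    "W \<in> borel_measurable \<mu>"
proof -
  have fm: "finite_measure \<mu>" and s: "sets \<mu> = sets borel" using sp by (auto simp: spectral_measure_def)
  have F: "l2_inner (u a) f = (LINT t|\<mu>. 1 / (complex_of_real t - z a))" if "a \<in> I" for a
    using sp H[OF that] z[OF that] unfolding spectral_measure_def by blast
  have lu: "L2 (u a)" if "a \<in> I" for a using H[OF that] by (auto simp: Hop_def H2_def)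
  note ck = cauchy_kernel[OF fm s]
  show lw: "L2 w" unfolding w_def by (intro L2_sum I L2_cmult lu)
  show "W \<in> borel_measurable \<mu>" unfolding W_def by (intro borel_measurable_sum borel_measurable_times borel_measurable_const ck(1) z)
  have "l2_inner w f = (\<Sum>a\<in>I. c a * (LINT t|\<mu>. 1 / (complex_of_real t - z a)))"
    unfolding w_def by (rule trans[OF l2_inner_sum_left[OF I lu l]]) (use F in \<open>auto intro!: sum.cong\<close>)
  also have "\<dots> = (LINT t|\<mu>. W t)"
    unfolding W_def by (subst Bochner_Integration.integral_sum) (auto intro!: ck(2) z integrable_mult_right simp del: times_divide_eq_right)
  finally show "l2_inner w f = (LINT t|\<mu>. W t)" .
  have cF: "l2_inner f (u a) = (LINT t|\<mu>. 1 / (complex_of_real t - cnj (z a)))" if "a \<in> I" for a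
  proof -
    have "l2_inner f (u a) = cnj (l2_inner (u a) f)" by (rule l2_inner_sym)
    also have "\<dots> = (LINT t|\<mu>. cnj (1 / (complex_of_real t - z a)))" unfolding F[OF that] by (rule Bochner_Integration.integral_cnj[symmetric])
    finally show ?thesis by simp
  qed
  let ?k = "\<lambda>a b t. (1 / (complex_of_real t - z a)) * (1 / (complex_of_real t - cnj (z b)))"
  have cz: "Im (cnj (z b)) \<noteq> 0" if "b \<in> I" for b using z[OF that] by simp
  have uu: "l2_inner (u a) (u b) = (LINT t|\<mu>. ?k a b t)" and ik: "integrable \<mu> (?k a b)" if ab: "a \<in> I" "b \<in> I" for a b
  proof -
    have d: "z a - cnj (z b) \<noteq> 0" using ne[OF ab] by simp
    have pt: "?k a b t = (1 / (z a - cnj (z b))) * (1 / (complex_of_real t - z a) - 1 / (complex_of_real t - cnj (z b)))" for t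
      using ck(3)[OF z[OF ab(1)], of t] ck(3)[OF cz[OF ab(2)], of t] d by (simp add: divide_simps)
    have i: "integrable \<mu> (\<lambda>t. 1 / (complex_of_real t - z a) - 1 / (complex_of_real t - cnj (z b)))"
      by (intro Bochner_Integration.integrable_diff ck(2) z cz ab)
    show "integrable \<mu> (?k a b)" unfolding pt by (intro integrable_mult_right i)
    have "(z a - cnj (z b)) * l2_inner (u a) (u b) = (LINT t|\<mu>. 1 / (complex_of_real t - z a)) - (LINT t|\<mu>. 1 / (complex_of_real t - cnj (z b)))"
      using Hop_green[OF H[OF ab(1)] H[OF ab(2)] l l] unfolding F[OF ab(1)] cF[OF ab(2)] .
    also have "\<dots> = (LINT t|\<mu>. 1 / (complex_of_real t - z a) - 1 / (complex_of_real t - cnj (z b)))"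
      by (intro Bochner_Integration.integral_diff[symmetric] ck(2) z cz ab)
    finally have "l2_inner (u a) (u b) = (1 / (z a - cnj (z b))) * (LINT t|\<mu>. 1 / (complex_of_real t - z a) - 1 / (complex_of_real t - cnj (z b)))"
      using d by (simp add: field_simps)
    then show "l2_inner (u a) (u b) = (LINT t|\<mu>. ?k a b t)" unfolding pt integral_mult_right_zero .
  qed
  have "l2_inner w w = (\<Sum>a\<in>I. c a * l2_inner (u a) w)"
    unfolding w_def by (rule l2_inner_sum_left[OF I lu]) (use lw in \<open>simp_all add: w_def\<close>)
  also have "\<dots> = (\<Sum>a\<in>I. c a * (\<Sum>b\<in>I. cnj (c b) * l2_inner (u a) (u b)))"
  proof (intro sum.cong refl arg_cong2[where f=times])
    fix a assume "a \<in> I"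
    have "l2_inner (u a) w = cnj (l2_inner w (u a))" by (rule l2_inner_sym)
    also have "l2_inner w (u a) = (\<Sum>b\<in>I. c b * l2_inner (u b) (u a))"
      unfolding w_def by (rule l2_inner_sum_left[OF I lu lu]) (use \<open>a \<in> I\<close> in auto)
    also have "cnj \<dots> = (\<Sum>b\<in>I. cnj (c b) * l2_inner (u a) (u b))"
      unfolding cnj_sum complex_cnj_mult by (intro sum.cong refl arg_cong2[where f=times]) (rule l2_inner_sym[symmetric])
    finally show "l2_inner (u a) w = (\<Sum>b\<in>I. cnj (c b) * l2_inner (u a) (u b))" .
  qed
  also have "\<dots> = (\<Sum>a\<in>I. \<Sum>b\<in>I. (LINT t|\<mu>. c a * (cnj (c b) * ?k a b t)))"
    unfolding sum_distrib_left using uu by (simp only: integral_mult_right_zero cong: sum.cong)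
  also have "\<dots> = (LINT t|\<mu>. (\<Sum>a\<in>I. \<Sum>b\<in>I. c a * (cnj (c b) * ?k a b t)))"
    by (subst Bochner_Integration.integral_sum, intro Bochner_Integration.integrable_sum integrable_mult_right ik, assumption, assumption,
        intro sum.cong refl Bochner_Integration.integral_sum[symmetric] integrable_mult_right ik)
  also have "(\<lambda>t. \<Sum>a\<in>I. \<Sum>b\<in>I. c a * (cnj (c b) * ?k a b t)) = (\<lambda>t. complex_of_real ((cmod (W t))\<^sup>2))"
  proof
    fix t
    have "complex_of_real ((cmod (W t))\<^sup>2) = W t * cnj (W t)" by (rule complex_norm_square)
    also have "\<dots> = (\<Sum>a\<in>I. \<Sum>b\<in>I. (c a * (1 / (complex_of_real t - z a))) * (cnj (c b) * (1 / (complex_of_real t - cnj (z b)))))"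
      unfolding W_def cnj_sum sum_product by simp
    also have "\<dots> = (\<Sum>a\<in>I. \<Sum>b\<in>I. c a * (cnj (c b) * ?k a b t))"
      by (intro sum.cong refl) (simp only: mult_ac)
    finally show "(\<Sum>a\<in>I. \<Sum>b\<in>I. c a * (cnj (c b) * ?k a b t)) = complex_of_real ((cmod (W t))\<^sup>2)" by simp
  qed
  finally have "complex_of_real (LINT x|lebesgue. (cmod (w x))\<^sup>2) = complex_of_real (LINT t|\<mu>. (cmod (W t))\<^sup>2)"
    unfolding l2_inner_self integral_complex_of_real .
  then show "(LINT x|lebesgue. (cmod (w x))\<^sup>2) = (LINT t|\<mu>. (cmod (W t))\<^sup>2)" by (simp only: of_real_eq_iff)
qed

section \<open>Lattice sums and covering by cells\<close>

lemma lattice_sum_bound: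
  obtains S :: real where "S > 0" "\<And>(\<tau>::real) J. finite J \<Longrightarrow> (\<Sum>j\<in>J. 1 / (1 + (\<tau> - real_of_int j)\<^sup>2)) \<le> S"
proof -
  define g where "g = (\<lambda>m::nat. 1 / (1 + (real m)\<^sup>2))"
  have sg: "summable g"
  proof (rule summable_comparison_test')
    show "summable (\<lambda>m. inverse ((real m) ^ 2))" by (rule inverse_power_summable) simp
    show "norm (g m) \<le> inverse ((real m) ^ 2)" if "m \<ge> 1" for m
    proof -
      have "1 / (1 + (real m)\<^sup>2) \<le> 1 / (real m)\<^sup>2" using that by (intro frac_le) auto
      then show ?thesis by (simp add: g_def inverse_eq_divide)
    qed
  qed
  have g0: "g m \<ge> 0" for m by (simp add: g_def)
  define S where "S = 2 * suminf g + 1"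
  have half: "(\<Sum>j\<in>J. 1 / (1 + (\<tau> - real_of_int j)\<^sup>2)) \<le> suminf g"
    if J: "finite J" and k: "inj_on k J" "\<And>j. j \<in> J \<Longrightarrow> real (k j) \<le> \<bar>\<tau> - real_of_int j\<bar>" for J k and \<tau> :: real
  proof -
    have "(\<Sum>j\<in>J. 1 / (1 + (\<tau> - real_of_int j)\<^sup>2)) \<le> (\<Sum>j\<in>J. g (k j))"
    proof (rule sum_mono)
      fix j assume "j \<in> J"
      have "(real (k j))\<^sup>2 \<le> (\<tau> - real_of_int j)\<^sup>2" using k(2)[OF \<open>j \<in> J\<close>] by (simp add: abs_le_square_iff[symmetric])
      then show "1 / (1 + (\<tau> - real_of_int j)\<^sup>2) \<le> g (k j)" unfolding g_def by (intro frac_le) (auto simp: add_pos_nonneg)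
    qed
    also have "\<dots> = sum g (k ` J)" by (simp add: sum.reindex[OF k(1)])
    also have "\<dots> \<le> suminf g" using J g0 by (intro sum_le_suminf sg) auto
    finally show ?thesis .
  qed
  have "(\<Sum>j\<in>J. 1 / (1 + (\<tau> - real_of_int j)\<^sup>2)) \<le> S" if J: "finite J" for J and \<tau> :: real
  proof -
    define n where "n = \<lfloor>\<tau>\<rfloor>"
    have n: "real_of_int n \<le> \<tau>" "\<tau> < real_of_int n + 1" unfolding n_def by linarith+
    have 1: "(\<Sum>j\<in>{j \<in> J. j \<le> n}. 1 / (1 + (\<tau> - real_of_int j)\<^sup>2)) \<le> suminf g"
      by (rule half[where k="\<lambda>j. nat (n - j)"]) (use J n in \<open>auto simp: inj_on_def\<close>)
    have 2: "(\<Sum>j\<in>{j \<in> J. \<not> j \<le> n}. 1 / (1 + (\<tau> - real_of_int j)\<^sup>2)) \<le> suminf g"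
    proof (rule half[where k="\<lambda>j. nat (j - n - 1)"])
      show "real (nat (j - n - 1)) \<le> \<bar>\<tau> - real_of_int j\<bar>" if "j \<in> {j \<in> J. \<not> j \<le> n}" for j
      proof -
        have "real (nat (j - n - 1)) = real_of_int (j - n - 1)" using that by simp
        also have "\<dots> \<le> real_of_int j - \<tau>" using n by simp
        finally show ?thesis by linarith
      qed
    qed (use J in \<open>auto simp: inj_on_def\<close>)
    have "(\<Sum>j\<in>J. 1 / (1 + (\<tau> - real_of_int j)\<^sup>2)) = (\<Sum>j\<in>{j \<in> J. j \<le> n}. 1 / (1 + (\<tau> - real_of_int j)\<^sup>2)) + (\<Sum>j\<in>{j \<in> J. \<not> j \<le> n}. 1 / (1 + (\<tau> - real_of_int j)\<^sup>2))"
      using sum.Int_Diff[OF J, of "\<lambda>j. 1 / (1 + (\<tau> - real_of_int j)\<^sup>2)" "{j. j \<le> n}"]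
      by (simp add: Int_def set_diff_eq)
    then show ?thesis using 1 2 by (simp add: S_def)
  qed
  moreover have "S > 0" using suminf_nonneg[OF sg g0] by (simp add: S_def)
  ultimately show ?thesis using that by blast
qed

text \<open>\<open>\<i> * Q\<close> is the difference of the simple poles at i and -2i; the
  denominator multiplies out to a + i\<tau>. The difference decays quadratically, so its sums over
  the lattice are bounded, which fails for the modulus of a single pole.\<close>

lemma double_pole:
  fixes \<tau> :: real
  defines "Q \<equiv> 3 / ((of_real \<tau> - \<i>) * (of_real \<tau> + 2 * \<i>))"
  shows "cmod Q \<le> 3 * (1 / (1 + \<tau>\<^sup>2))" "Re Q \<ge> 0" "\<bar>\<tau>\<bar> \<le> 1 \<Longrightarrow> Re Q \<ge> 1/2"
proof -
  define a where "a = \<tau>\<^sup>2 + 2"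
  have a: "a > 0" "a \<ge> 2" unfolding a_def using zero_le_power2[of \<tau>] by linarith+
  have e: "(of_real \<tau> - \<i>) * (of_real \<tau> + 2 * \<i>) = Complex a \<tau>"
    by (simp add: complex_eq_iff a_def power2_eq_square)
  have "a \<le> cmod (Complex a \<tau>)" using complex_Re_le_cmod[of "Complex a \<tau>"] by simp
  then have "1 + \<tau>\<^sup>2 \<le> cmod (Complex a \<tau>)" by (simp add: a_def)
  then show "cmod Q \<le> 3 * (1 / (1 + \<tau>\<^sup>2))"
    unfolding Q_def e norm_divide using zero_le_power2[of \<tau>] by (simp add: frac_le add_pos_nonneg)
  have R: "Re Q = 3 * a / (a\<^sup>2 + \<tau>\<^sup>2)" unfolding Q_def e by (simp add: Re_divide)
  show "Re Q \<ge> 0" unfolding R using a by (intro divide_nonneg_nonneg) auto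
  assume t: "\<bar>\<tau>\<bar> \<le> 1"
  have t2: "\<tau>\<^sup>2 \<le> 1" using t by (simp add: abs_square_le_1)
  have "a\<^sup>2 + \<tau>\<^sup>2 \<le> 6 * a"
  proof -
    have "a \<le> 3" using t2 by (simp add: a_def)
    then have "a * a \<le> 3 * a" using a by (intro mult_right_mono) auto
    then show ?thesis using t2 a unfolding power2_eq_square by linarith
  qed
  moreover have "a\<^sup>2 + \<tau>\<^sup>2 > 0" using a by (simp add: add_pos_nonneg)
  ultimately show "Re Q \<ge> 1/2" unfolding R by (simp add: field_simps)
qed

text \<open>\<open>J\<close> indexes the half-open cells of length h that meet \<open>K\<close>.
  They are disjoint, and every point of such a cell is within h of \<open>K\<close>, so their total
  length is at most the measure of the neighbourhood.\<close>

lemma cells_le_neighbourhood: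
  fixes K :: "real set"
  assumes K: "compact K" "K \<noteq> {}" and h: "h > 0"
  defines "J \<equiv> (\<lambda>t. \<lfloor>t / h\<rfloor>) ` K"
  shows "finite J" "\<And>j. j \<in> J \<Longrightarrow> infdist (real_of_int j * h) K \<le> h"
    "integrable lebesgue (indicat_real {x. infdist x K \<le> h})"
    "h * real (card J) \<le> (LINT x|lebesgue. indicat_real {x. infdist x K \<le> h} x)"
proof -
  obtain B where B: "\<And>x. x \<in> K \<Longrightarrow> \<bar>x\<bar> \<le> B" using compact_imp_bounded[OF K(1)] by (auto simp: bounded_iff)
  have fl: "real_of_int \<lfloor>t / h\<rfloor> * h \<le> t" "t < (real_of_int \<lfloor>t / h\<rfloor> + 1) * h" for t
  proof -
    have "real_of_int \<lfloor>t / h\<rfloor> \<le> t / h" "t / h < real_of_int \<lfloor>t / h\<rfloor> + 1" by linarith+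
    then show "real_of_int \<lfloor>t / h\<rfloor> * h \<le> t" "t < (real_of_int \<lfloor>t / h\<rfloor> + 1) * h" using h
      by (simp_all only: pos_le_divide_eq pos_divide_less_eq)
  qed
  have "J \<subseteq> {\<lfloor>- B / h\<rfloor>..\<lfloor>B / h\<rfloor>}"
    unfolding J_def
  proof (intro image_subsetI)
    fix t assume "t \<in> K"
    then have "- B \<le> t" "t \<le> B" using B[of t] by linarith+
    then have "- B / h \<le> t / h" "t / h \<le> B / h" using h by (intro divide_right_mono; simp)+
    then show "\<lfloor>t / h\<rfloor> \<in> {\<lfloor>- B / h\<rfloor>..\<lfloor>B / h\<rfloor>}" by (simp only: atLeastAtMost_iff floor_mono)
  qed
  then show J: "finite J" by (rule finite_subset) simp
  show "infdist (real_of_int j * h) K \<le> h" if "j \<in> J" for j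
  proof -
    obtain t where t: "t \<in> K" "j = \<lfloor>t / h\<rfloor>" using \<open>j \<in> J\<close> by (auto simp: J_def)
    have "dist (real_of_int j * h) t \<le> h" using fl[of t] t(2) h by (simp add: dist_real_def algebra_simps)
    then show ?thesis using infdist_le[OF t(1), of "real_of_int j * h"] by linarith
  qed
  have cl: "closed {x. infdist x K \<le> h}" by (intro closed_Collect_le continuous_intros)
  have "{x. infdist x K \<le> h} \<subseteq> {- (B + h)..B + h}"
  proof
    fix x assume x: "x \<in> {x. infdist x K \<le> h}"
    obtain k where "k \<in> K" "infdist x K = dist x k" using infdist_attains_inf[OF compact_imp_closed[OF K(1)] K(2)] by blast
    then show "x \<in> {- (B + h)..B + h}" using x B[of k] by (auto simp: dist_real_def abs_le_iff)
  qed
  then have bd: "bounded {x. infdist x K \<le> h}" using bounded_subset bounded_closed_interval by blast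
  have "emeasure lborel {x. infdist x K \<le> h} < \<infinity>" by (rule emeasure_bounded_finite[OF bd])
  then show iN: "integrable lebesgue (indicat_real {x. infdist x K \<le> h})"
    using borel_closed[OF cl] by (intro integrable_real_indicator) auto
  have cell: "(\<Sum>j\<in>J. indicat_real {real_of_int j * h..<(real_of_int j + 1) * h} x) \<le> indicat_real {x. infdist x K \<le> h} x" for x
  proof -
    have iff: "x \<in> {real_of_int j * h..<(real_of_int j + 1) * h} \<longleftrightarrow> j = \<lfloor>x / h\<rfloor>" for j
    proof -
      have "x \<in> {real_of_int j * h..<(real_of_int j + 1) * h} \<longleftrightarrow> real_of_int j \<le> x / h \<and> x / h < real_of_int j + 1"
        using h by (simp add: field_simps)
      then show ?thesis by linarith
    qed
    have "(\<Sum>j\<in>J. indicat_real {real_of_int j * h..<(real_of_int j + 1) * h} x) = (\<Sum>j\<in>J. if j = \<lfloor>x / h\<rfloor> then 1 else 0)"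
      by (intro sum.cong refl) (simp only: indicator_def iff of_bool_def)
    also have "\<dots> = (if \<lfloor>x / h\<rfloor> \<in> J then 1 else 0)" using J by (simp add: sum.delta)
    also have "\<dots> \<le> indicat_real {x. infdist x K \<le> h} x"
    proof (cases "\<lfloor>x / h\<rfloor> \<in> J")
      case True
      then obtain t where t: "t \<in> K" "\<lfloor>x / h\<rfloor> = \<lfloor>t / h\<rfloor>" by (auto simp: J_def)
      have "dist x t \<le> h" using fl[of x] fl[of t] t(2) h by (simp add: dist_real_def algebra_simps)
      then have "infdist x K \<le> h" using infdist_le[OF t(1), of x] by linarith
      then show ?thesis by simp
    qed simp
    finally show ?thesis .
  qed
  have le: "real_of_int j * h \<le> (real_of_int j + 1) * h" for j using h by (intro mult_right_mono) auto
  have ic: "integrable lebesgue (indicat_real {real_of_int j * h..<(real_of_int j + 1) * h})" for j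
    using emeasure_lborel_Ico[OF le[of j]] by (intro integrable_real_indicator) auto
  have ci: "(LINT x|lebesgue. indicat_real {real_of_int j * h..<(real_of_int j + 1) * h} x) = h" for j
    using emeasure_lborel_Ico[OF le[of j]] h by (simp add: measure_def algebra_simps)
  have "h * real (card J) = (\<Sum>j\<in>J. (LINT x|lebesgue. indicat_real {real_of_int j * h..<(real_of_int j + 1) * h} x))"
    unfolding ci by simp
  also have "\<dots> = (LINT x|lebesgue. (\<Sum>j\<in>J. indicat_real {real_of_int j * h..<(real_of_int j + 1) * h} x))"
    by (rule Bochner_Integration.integral_sum[symmetric]) (rule ic)
  also have "\<dots> \<le> (LINT x|lebesgue. indicat_real {x. infdist x K \<le> h} x)"
    by (intro integral_mono Bochner_Integration.integrable_sum ic iN cell)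
  finally show "h * real (card J) \<le> (LINT x|lebesgue. indicat_real {x. infdist x K \<le> h} x)" .
qed

text \<open>\<open>Hop_green\<close> of \<open>y\<close> with itself. Read as an estimate, it bounds
  the squared norm by the inverse height times a pairing that stays bounded, instead of the inverse
  square of the height.\<close>

lemma resolvent_norm:
  assumes y: "Hop v0 v1 y (\<lambda>x. g x + w * y x)" and g: "L2 g"
  shows "Im w * (LINT x|lebesgue. (cmod (y x))\<^sup>2) = Im (l2_inner y g)"
proof -
  have "(w - cnj w) * l2_inner y y = l2_inner y g - l2_inner g y" by (rule Hop_green[OF y y g g])
  then have "Im ((w - cnj w) * l2_inner y y) = Im (l2_inner y g) - Im (l2_inner g y)" by simp
  moreover have "Im (l2_inner g y) = - Im (l2_inner y g)" using arg_cong[OF l2_inner_sym[of g y], of Im] by simp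
  moreover have "Im ((w - cnj w) * l2_inner y y) = 2 * Im w * (LINT x|lebesgue. (cmod (y x))\<^sup>2)"
    unfolding l2_inner_self by simp
  ultimately show ?thesis by linarith
qed

text \<open>Rescaling by h turns the poles of a cell into those of \<open>double_pole\<close>,
  shifted to the lattice point j.\<close>

lemma pole_difference:
  fixes h t :: real and j :: int
  assumes h: "h > 0"
  shows "of_real h * (1 / (complex_of_real t - Complex (real_of_int j * h) h)) - of_real h * (1 / (complex_of_real t - Complex (real_of_int j * h) (- 2 * h)))
    = \<i> * (3 / ((of_real (t / h - real_of_int j) - \<i>) * (of_real (t / h - real_of_int j) + 2 * \<i>)))"
    "(cmod (of_real h * (1 / (complex_of_real t - Complex (real_of_int j * h) h))))\<^sup>2 = 1 / (1 + (t / h - real_of_int j)\<^sup>2)"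
proof -
  define s where "s = t / h - real_of_int j"
  have t: "t = (s + real_of_int j) * h" using h by (simp add: s_def)
  have e1: "complex_of_real t - Complex (real_of_int j * h) h = of_real h * (of_real s - \<i>)"
    by (simp add: complex_eq_iff t algebra_simps)
  have e2: "complex_of_real t - Complex (real_of_int j * h) (- 2 * h) = of_real h * (of_real s + 2 * \<i>)"
    by (simp add: complex_eq_iff t algebra_simps)
  have n: "of_real s - \<i> \<noteq> 0" "of_real s + 2 * \<i> \<noteq> 0" by (auto simp: complex_eq_iff)
  have c: "of_real h * (1 / (of_real h * a)) = 1 / (a :: complex)" for a using h by simp
  have "1 / (of_real s - \<i>) - 1 / (of_real s + 2 * \<i>) = \<i> * (3 / ((of_real s - \<i>) * (of_real s + 2 * \<i>)))"
    using n by (simp add: divide_simps)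
  then show "of_real h * (1 / (complex_of_real t - Complex (real_of_int j * h) h)) - of_real h * (1 / (complex_of_real t - Complex (real_of_int j * h) (- 2 * h)))
    = \<i> * (3 / ((of_real (t / h - real_of_int j) - \<i>) * (of_real (t / h - real_of_int j) + 2 * \<i>)))"
    unfolding e1 e2 c s_def .
  have "(cmod (of_real s - \<i>))\<^sup>2 = 1 + s\<^sup>2" by (simp add: cmod_power2)
  then show "(cmod (of_real h * (1 / (complex_of_real t - Complex (real_of_int j * h) h))))\<^sup>2 = 1 / (1 + (t / h - real_of_int j)\<^sup>2)"
    unfolding e1 c s_def by (simp add: norm_divide power_divide)
qed

lemma sum_int_bool:
  fixes F :: "int \<times> bool \<Rightarrow> complex"
  assumes "finite J"
  shows "(\<Sum>a\<in>J \<times> UNIV. F a) = (\<Sum>j\<in>J. F (j, True) + F (j, False))"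
  using sum.cartesian_product[of "\<lambda>j b. F (j, b)" "UNIV :: bool set" J] by (simp add: UNIV_bool add.commute)

context potentials
begin

lemma resolvent_exists:
  assumes z: "Im z \<noteq> 0" and f: "L2 f"
  obtains \<zeta> u w where "quadrant \<zeta>" "\<zeta> ^ 4 = z" "LS \<zeta> v0 v1 f u w" "Hop v0 v1 u (\<lambda>x. f x + z * u x)"
proof -
  have "z \<noteq> 0" using z by auto
  then obtain \<zeta> where q: "quadrant \<zeta>" and e: "\<zeta> ^ 4 = z" by (rule fourth_root)
  have i: "Im (\<zeta> ^ 4) \<noteq> 0" using z e by simp
  obtain u w where L: "LS \<zeta> v0 v1 f u w" by (rule LS_exists[OF q i f])
  have "Hop v0 v1 u (\<lambda>x. f x + z * u x)" using LS_Hop[OF L q decay_rate_pos[OF q i] f] unfolding e .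
  then show ?thesis using that[OF q e L] by blast
qed

text \<open>With the resolvent \<open>R(z)\<close> of \<open>H\<close>, \<open>z\<^sub>j = jh + ih\<close> and \<open>w\<^sub>j = jh - 2ih\<close>, the sum over the cells of
  \<open>h (R(z\<^sub>j) - R(w\<^sub>j))\<close> corresponds to a function that is bounded, has nonnegative imaginary part, and
  imaginary part at least \<open>1/2\<close> on \<open>K\<close>. By the resolvent identity each summand is
  \<open>3 i h\<^sup>2 R(w\<^sub>j) R(z\<^sub>j)\<close>: the factor acting on \<open>f\<close> is summed with the spectral measure, the one acting on
  \<open>g\<close> is estimated by limiting absorption.\<close>
lemma sc_estimate:
  assumes sp: "spectral_measure v0 v1 f \<mu>" and lf: "L2 f" and K: "compact K" "K \<noteq> {}"
    and S: "S > 0" "\<And>(\<tau>::real) J. finite J \<Longrightarrow> (\<Sum>j\<in>J. 1 / (1 + (\<tau> - real_of_int j)\<^sup>2)) \<le> S"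
    and la: "\<And>\<zeta> g u w x. quadrant \<zeta> \<Longrightarrow> 0 < Im (\<zeta> ^ 4) \<Longrightarrow> Im (\<zeta> ^ 4) < \<delta> \<Longrightarrow> infdist (Re (\<zeta> ^ 4)) K < \<delta> \<Longrightarrow>
     integrable lebesgue g \<Longrightarrow> LS \<zeta> v0 v1 g u w \<Longrightarrow> cmod (u x) + cmod (w x) \<le> C * (LINT x|lebesgue. cmod (g x))"
    and g: "L2 g" "integrable lebesgue g" and h: "h > 0" "2 * h < \<delta>"
  defines "D \<equiv> C * (LINT x|lebesgue. cmod (g x))\<^sup>2" and "M \<equiv> measure \<mu> UNIV"
  shows "measure \<mu> K / 2 \<le> 3 * sqrt (S * M * ((LINT x|lebesgue. indicat_real {x. infdist x K \<le> h} x) * (D / 2)))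
    + 3 * sqrt (S\<^sup>2 * M * (LINT x|lebesgue. (cmod (f x - g x))\<^sup>2))"
proof -
  have fm: "finite_measure \<mu>" and sets: "sets \<mu> = sets borel" using sp by (auto simp: spectral_measure_def)
  interpret finite_measure \<mu> by (rule fm)
  have space: "space \<mu> = UNIV" using sets_eq_imp_space_eq[OF sets] by simp
  define J where "J = (\<lambda>t. \<lfloor>t / h\<rfloor>) ` K"
  note cells = cells_le_neighbourhood[OF K h(1), folded J_def]
  \<comment> \<open>\<open>True\<close> marks the pole at height h above the lattice point,
    \<open>False\<close> the one at height -2h. A pair of mirror images would violate
    \<open>ne\<close>.\<close>
  define z where "z = (\<lambda>a::int \<times> bool. Complex (real_of_int (fst a) * h) (if snd a then h else - 2 * h))"
  define c where "c = (\<lambda>a::int \<times> bool. if snd a then complex_of_real h else - of_real h)"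
  define I where "I = J \<times> (UNIV :: bool set)"
  have fI: "finite I" using cells(1) by (simp add: I_def)
  have zi: "Im (z a) \<noteq> 0" for a using h by (simp add: z_def)
  have ne: "z a \<noteq> cnj (z b)" for a b using h by (auto simp: z_def complex_eq_iff)
  have "\<forall>a. \<exists>u. Hop v0 v1 u (\<lambda>x. f x + z a * u x)" using resolvent_exists[OF zi lf] by metis
  then obtain u where u: "\<And>a. Hop v0 v1 (u a) (\<lambda>x. f x + z a * u a x)" by metis
  have lu: "L2 (u a)" for a using u[of a] by (auto simp: Hop_def H2_def)
  \<comment> \<open>The conjugate of the lower pole. It lies in the upper half plane and within
    reach of \<open>la\<close>, since its height is below \<delta> and its real part is within h of
    \<open>K\<close>.\<close>
  let ?w = "\<lambda>j::int. Complex (real_of_int j * h) (2 * h)"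
  have "\<exists>y. Hop v0 v1 y (\<lambda>x. g x + ?w j * y x) \<and> (\<forall>x. cmod (y x) \<le> C * (LINT x|lebesgue. cmod (g x)))" if "j \<in> J" for j
  proof -
    have "Im (?w j) \<noteq> 0" using h by simp
    then obtain \<zeta> y w where y: "quadrant \<zeta>" "\<zeta> ^ 4 = ?w j" "LS \<zeta> v0 v1 g y w" "Hop v0 v1 y (\<lambda>x. g x + ?w j * y x)"
      by (rule resolvent_exists[OF _ g(1)])
    have "cmod (y x) + cmod (w x) \<le> C * (LINT x|lebesgue. cmod (g x))" for x
      by (rule la[OF y(1) _ _ _ g(2) y(3)]) (use y(2) h cells(2)[OF that] in auto)
    then have "cmod (y x) \<le> C * (LINT x|lebesgue. cmod (g x))" for x by (smt (verit) norm_ge_zero)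
    then show ?thesis using y(4) by blast
  qed
  then obtain y where y: "\<And>j. j \<in> J \<Longrightarrow> Hop v0 v1 (y j) (\<lambda>x. g x + ?w j * y j x)"
      and yb: "\<And>j x. j \<in> J \<Longrightarrow> cmod (y j x) \<le> C * (LINT x|lebesgue. cmod (g x))" by metis
  have ly: "L2 (y j)" if "j \<in> J" for j using y[OF that] by (auto simp: Hop_def H2_def)
  define w where "w = (\<lambda>x. \<Sum>a\<in>I. c a * u a x)"
  define W where "W = (\<lambda>t. \<Sum>a\<in>I. c a * (1 / (complex_of_real t - z a)))"
  define Q where "Q = (\<lambda>\<tau>::real. 3 / ((of_real \<tau> - \<i>) * (of_real \<tau> + 2 * \<i>)))"
  have cy: "L2 w" "l2_inner w f = (LINT t|\<mu>. W t)" "(LINT x|lebesgue. (cmod (w x))\<^sup>2) = (LINT t|\<mu>. (cmod (W t))\<^sup>2)"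
    "W \<in> borel_measurable \<mu>"
    unfolding w_def W_def by (rule cyclic_isometry[OF sp lf fI u zi ne])+
  have WQ: "W t = \<i> * (\<Sum>j\<in>J. Q (t / h - real_of_int j))" for t
  proof -
    have "W t = (\<Sum>j\<in>J. of_real h * (1 / (complex_of_real t - Complex (real_of_int j * h) h)) - of_real h * (1 / (complex_of_real t - Complex (real_of_int j * h) (- 2 * h))))"
      unfolding W_def I_def sum_int_bool[OF cells(1)] by (simp add: c_def z_def)
    also have "\<dots> = (\<Sum>j\<in>J. \<i> * Q (t / h - real_of_int j))"
      unfolding Q_def by (intro sum.cong refl pole_difference(1) h(1))
    finally show ?thesis by (simp only: sum_distrib_left)
  qed
  have WB: "cmod (W t) \<le> 3 * S" for t
  proof -
    have "cmod (W t) = cmod (\<Sum>j\<in>J. Q (t / h - real_of_int j))" by (simp add: WQ norm_mult)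
    also have "\<dots> \<le> (\<Sum>j\<in>J. 3 * (1 / (1 + (t / h - real_of_int j)\<^sup>2)))"
      unfolding Q_def by (intro order_trans[OF norm_sum] sum_mono double_pole(1))
    also have "\<dots> \<le> 3 * S" unfolding sum_distrib_left[symmetric] by (intro mult_left_mono S(2) cells(1)) simp
    finally show ?thesis .
  qed
  have ImW: "Im (W t) = (\<Sum>j\<in>J. Re (Q (t / h - real_of_int j)))" for t by (simp add: WQ)
  have W0: "Im (W t) \<ge> 0" for t unfolding ImW Q_def by (intro sum_nonneg double_pole(2))
  have WK: "Im (W t) \<ge> 1 / 2" if "t \<in> K" for t
  proof -
    have j: "\<lfloor>t / h\<rfloor> \<in> J" using that by (simp add: J_def)
    have "\<bar>t / h - real_of_int \<lfloor>t / h\<rfloor>\<bar> \<le> 1" by linarith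
    then have "1 / 2 \<le> Re (Q (t / h - real_of_int \<lfloor>t / h\<rfloor>))" unfolding Q_def by (rule double_pole(3))
    also have "\<dots> \<le> Im (W t)"
      unfolding ImW by (rule member_le_sum[OF j _ cells(1)]) (unfold Q_def, rule double_pole(2))
    finally show ?thesis .
  qed
  have iW: "integrable \<mu> W" by (rule integrable_const_bound[OF _ cy(4)]) (use WB in auto)
  have Ks: "K \<in> sets \<mu>" using K(1) by (simp add: sets borel_compact)
  have fi: "emeasure \<mu> K < \<infinity>" by (simp add: emeasure_eq_measure)
  have ik: "integrable \<mu> (\<lambda>t. indicat_real K t / 2)" using fi Ks by (intro integrable_divide_zero integrable_real_indicator) auto
  have "measure \<mu> K / 2 = (LINT t|\<mu>. indicat_real K t / 2)" using Ks by (simp add: space)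
  also have "\<dots> \<le> (LINT t|\<mu>. Im (W t))"
    using W0 WK by (intro integral_mono ik integrable_Im iW) (auto simp: indicator_def)
  also have "\<dots> = Im (l2_inner w f)" unfolding cy(2) by (rule integral_Im[OF iW])
  \<comment> \<open>The bound \<open>la\<close> concerns integrable vectors, so \<open>f\<close> is
    replaced by \<open>g\<close> and the remainder is estimated by the norm of
    \<open>w\<close>.\<close>
  also have "\<dots> \<le> cmod (l2_inner w g) + cmod (l2_inner w (\<lambda>x. f x - g x))"
  proof -
    have lfg: "L2 (\<lambda>x. f x - g x)" using L2_add[OF lf L2_cmult[OF g(1), of "-1"]] by simp
    have "l2_inner w f = l2_inner w g + l2_inner w (\<lambda>x. f x - g x)"
      using l2_inner_add_right[OF g(1) lfg cy(1), of 1] by simp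
    then show ?thesis using abs_Im_le_cmod[of "l2_inner w f"] norm_triangle_ineq[of "l2_inner w g" "l2_inner w (\<lambda>x. f x - g x)"] by simp
  qed
  finally have main: "measure \<mu> K / 2 \<le> cmod (l2_inner w g) + cmod (l2_inner w (\<lambda>x. f x - g x))" .
  have M0: "M \<ge> 0" by (simp add: M_def)
  have second: "cmod (l2_inner w (\<lambda>x. f x - g x)) \<le> 3 * sqrt (S\<^sup>2 * M * (LINT x|lebesgue. (cmod (f x - g x))\<^sup>2))"
  proof -
    let ?e = "LINT x|lebesgue. (cmod (f x - g x))\<^sup>2"
    have lfg: "L2 (\<lambda>x. f x - g x)" using L2_add[OF lf L2_cmult[OF g(1), of "-1"]] by simp
    have W2: "(cmod (W t))\<^sup>2 \<le> (3 * S)\<^sup>2" for t by (intro power_mono WB) simp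
    have "integrable \<mu> (\<lambda>t. (cmod (W t))\<^sup>2)"
      by (rule integrable_const_bound[where B="(3 * S)\<^sup>2"])
        (use W2 in simp, intro borel_measurable_power measurable_compose[OF cy(4) borel_measurable_norm])
    then have "(LINT t|\<mu>. (cmod (W t))\<^sup>2) \<le> (LINT t|\<mu>. (3 * S)\<^sup>2)"
      by (rule integral_mono[OF _ integrable_const W2])
    also have "\<dots> = 9 * S\<^sup>2 * M" by (simp add: M_def space power_mult_distrib mult_ac)
    finally have "(LINT x|lebesgue. (cmod (w x))\<^sup>2) * ?e \<le> 9 * S\<^sup>2 * M * ?e" unfolding cy(3)[symmetric] by (intro mult_right_mono) auto
    with l2_CS[OF cy(1) lfg] have "(cmod (l2_inner w (\<lambda>x. f x - g x)))\<^sup>2 \<le> 9 * (S\<^sup>2 * M * ?e)" by (simp add: mult_ac)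
    then have "cmod (l2_inner w (\<lambda>x. f x - g x)) \<le> sqrt (9 * (S\<^sup>2 * M * ?e))" by (rule real_le_rsqrt)
    then show ?thesis by (simp add: real_sqrt_mult)
  qed
  \<comment> \<open>Scaled norms of the resolvent vectors of \<open>f\<close> and of
    \<open>g\<close>. The squares of \<open>p\<close> sum to at most \<open>S * M\<close>, uniformly
    in h; those of \<open>q\<close> are of order h per cell and sum to the small factor.\<close>
  define p where "p = (\<lambda>j. h * sqrt (LINT x|lebesgue. (cmod (u (j, True) x))\<^sup>2))"
  define q where "q = (\<lambda>j. h * sqrt (LINT x|lebesgue. (cmod (y j x))\<^sup>2))"
  have p2: "(p j)\<^sup>2 = (LINT t|\<mu>. 1 / (1 + (t / h - real_of_int j)\<^sup>2))"
      and ip: "integrable \<mu> (\<lambda>t. 1 / (1 + (t / h - real_of_int j)\<^sup>2))" for j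
  proof -
    let ?a = "(j, True)"
    note c1 = cyclic_isometry[OF sp lf, of "{?a}" u z "\<lambda>_. of_real h", OF _ u zi ne]
    have k: "(cmod (of_real h * (1 / (complex_of_real t - z ?a))))\<^sup>2 = 1 / (1 + (t / h - real_of_int j)\<^sup>2)" for t
      using pole_difference(2)[OF h(1), of t j] by (simp add: z_def)
    have "(\<lambda>t. of_real h * (1 / (complex_of_real t - z ?a))) \<in> borel_measurable \<mu>" using c1(4) by simp
    then have "(\<lambda>t. (cmod (of_real h * (1 / (complex_of_real t - z ?a))))\<^sup>2) \<in> borel_measurable \<mu>"
      by (intro borel_measurable_power measurable_compose[OF _ borel_measurable_norm])
    then have m: "(\<lambda>t. 1 / (1 + (t / h - real_of_int j)\<^sup>2)) \<in> borel_measurable \<mu>" unfolding k .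
    show "integrable \<mu> (\<lambda>t. 1 / (1 + (t / h - real_of_int j)\<^sup>2))"
      by (rule integrable_const_bound[where B=1, OF _ m]) (auto simp: add_pos_nonneg divide_le_eq_1)
    have "(p j)\<^sup>2 = h\<^sup>2 * (LINT x|lebesgue. (cmod (u ?a x))\<^sup>2)" by (simp add: p_def power_mult_distrib)
    also have "\<dots> = (LINT x|lebesgue. (cmod (of_real h * u ?a x))\<^sup>2)" by (simp add: norm_mult power_mult_distrib)
    also have "\<dots> = (LINT t|\<mu>. (cmod (of_real h * (1 / (complex_of_real t - z ?a))))\<^sup>2)" using c1(3) by simp
    finally show "(p j)\<^sup>2 = (LINT t|\<mu>. 1 / (1 + (t / h - real_of_int j)\<^sup>2))" unfolding k .
  qed
  have sp2: "(\<Sum>j\<in>J. (p j)\<^sup>2) \<le> S * M"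
  proof -
    have "(\<Sum>j\<in>J. (p j)\<^sup>2) = (LINT t|\<mu>. (\<Sum>j\<in>J. 1 / (1 + (t / h - real_of_int j)\<^sup>2)))"
      unfolding p2 by (rule Bochner_Integration.integral_sum[symmetric]) (rule ip)
    also have "\<dots> \<le> (LINT t|\<mu>. S)"
      by (intro integral_mono Bochner_Integration.integrable_sum ip integrable_const S(2) cells(1))
    finally show ?thesis by (simp add: M_def space mult_ac)
  qed
  \<comment> \<open>\<open>resolvent_norm\<close> at height 2h, with the pairing of
    \<open>y j\<close> and \<open>g\<close> bounded by \<open>D\<close> through the sup bound on
    \<open>y j\<close>: the squared norm is of order 1/h, and the scaling by the square of h leaves
    order h.\<close>
  have q2: "(q j)\<^sup>2 \<le> h * (D / 2)" if j: "j \<in> J" for j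
  proof -
    have "2 * h * (LINT x|lebesgue. (cmod (y j x))\<^sup>2) = Im (l2_inner (y j) g)"
      using resolvent_norm[OF y[OF j] g(1)] by simp
    also have "\<dots> \<le> cmod (l2_inner (y j) g)" using abs_Im_le_cmod by (rule order_trans[OF abs_ge_self])
    also have "\<dots> \<le> (LINT x|lebesgue. cmod (y j x * cnj (g x)))" unfolding l2_inner_def by (rule integral_norm_bound)
    also have "\<dots> \<le> (LINT x|lebesgue. C * (LINT x|lebesgue. cmod (g x)) * cmod (g x))"
      by (intro integral_mono integrable_norm L2_prod(2) ly j g integrable_mult_right) (auto simp: norm_mult intro!: mult_right_mono yb j)
    also have "\<dots> = D" by (simp add: D_def power2_eq_square mult_ac)
    finally have "h * (2 * h * (LINT x|lebesgue. (cmod (y j x))\<^sup>2)) \<le> h * D" using h(1) by (intro mult_left_mono) auto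
    moreover have "(q j)\<^sup>2 = h * (h * (LINT x|lebesgue. (cmod (y j x))\<^sup>2))"
      by (simp add: q_def power_mult_distrib power2_eq_square[of h] mult.assoc)
    ultimately show ?thesis by (simp add: algebra_simps)
  qed
  let ?L = "LINT x|lebesgue. indicat_real {x. infdist x K \<le> h} x"
  have D0: "D \<ge> 0" if "j \<in> J" for j
    using order_trans[OF zero_le_power2 q2[OF that]] h(1) by (simp add: zero_le_mult_iff)
  have sq2: "(\<Sum>j\<in>J. (q j)\<^sup>2) \<le> ?L * (D / 2)"
  proof (cases "J = {}")
    case False
    then have "D / 2 \<ge> 0" using D0 by auto
    have "(\<Sum>j\<in>J. (q j)\<^sup>2) \<le> (\<Sum>j\<in>J. h * (D / 2))" by (intro sum_mono q2)
    also have "\<dots> = h * real (card J) * (D / 2)" by simp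
    also have "\<dots> \<le> ?L * (D / 2)" using cells(4) \<open>D / 2 \<ge> 0\<close> by (rule mult_right_mono)
    finally show ?thesis .
  next
    case True
    then show ?thesis using K(2) by (simp add: J_def)
  qed
  have first: "cmod (l2_inner w g) \<le> 3 * sqrt (S * M * (?L * (D / 2)))"
  proof -
    have "l2_inner w g = (\<Sum>a\<in>I. c a * l2_inner (u a) g)"
      unfolding w_def by (rule l2_inner_sum_left[OF fI lu g(1)])
    also have "\<dots> = (\<Sum>j\<in>J. of_real h * l2_inner (u (j, True)) g - of_real h * l2_inner (u (j, False)) g)"
      unfolding I_def sum_int_bool[OF cells(1)] by (simp add: c_def)
    also have "\<dots> = (\<Sum>j\<in>J. 3 * \<i> * (of_real h * of_real h * l2_inner (u (j, True)) (y j)))"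
    proof (intro sum.cong refl)
      fix j assume j: "j \<in> J"
      \<comment> \<open>At the lower pole the factor in \<open>Hop_green\<close> vanishes, which
        identifies \<open>l2_inner f (y j)\<close> with the pairing there and so eliminates it from
        the identity at the upper pole.\<close>
      have "z (j, True) - cnj (?w j) = 3 * \<i> * of_real h" "z (j, False) - cnj (?w j) = 0"
        by (auto simp: z_def complex_eq_iff)
      then have "3 * \<i> * of_real h * l2_inner (u (j, True)) (y j) = l2_inner (u (j, True)) g - l2_inner f (y j)"
          "0 = l2_inner (u (j, False)) g - l2_inner f (y j)"
        using Hop_green[OF u[of "(j, True)"] y[OF j] lf g(1)] Hop_green[OF u[of "(j, False)"] y[OF j] lf g(1)] by simp_all
      then have "l2_inner (u (j, True)) g - l2_inner (u (j, False)) g = 3 * \<i> * of_real h * l2_inner (u (j, True)) (y j)" by simp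
      then have "of_real h * (l2_inner (u (j, True)) g - l2_inner (u (j, False)) g) = of_real h * (3 * \<i> * of_real h * l2_inner (u (j, True)) (y j))" by simp
      then show "of_real h * l2_inner (u (j, True)) g - of_real h * l2_inner (u (j, False)) g = 3 * \<i> * (of_real h * of_real h * l2_inner (u (j, True)) (y j))"
        by (simp add: algebra_simps)
    qed
    finally have "cmod (l2_inner w g) \<le> (\<Sum>j\<in>J. 3 * (h * h * cmod (l2_inner (u (j, True)) (y j))))"
      using h(1) by (simp only:) (rule order_trans[OF norm_sum], simp add: norm_mult)
    also have "\<dots> \<le> (\<Sum>j\<in>J. 3 * (p j * q j))"
    proof (intro sum_mono mult_left_mono)
      fix j assume j: "j \<in> J"
      have "cmod (l2_inner (u (j, True)) (y j)) \<le> sqrt (LINT x|lebesgue. (cmod (u (j, True) x))\<^sup>2) * sqrt (LINT x|lebesgue. (cmod (y j x))\<^sup>2)"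
        unfolding real_sqrt_mult[symmetric] by (rule real_le_rsqrt[OF l2_CS[OF lu ly[OF j]]])
      then have "h * h * cmod (l2_inner (u (j, True)) (y j)) \<le> h * h * (sqrt (LINT x|lebesgue. (cmod (u (j, True) x))\<^sup>2) * sqrt (LINT x|lebesgue. (cmod (y j x))\<^sup>2))"
        using h(1) by (intro mult_left_mono) auto
      then show "h * h * cmod (l2_inner (u (j, True)) (y j)) \<le> p j * q j" by (simp add: p_def q_def mult_ac)
    qed simp
    also have "\<dots> = 3 * (\<Sum>j\<in>J. p j * q j)" by (simp only: sum_distrib_left)
    also have "\<dots> \<le> 3 * sqrt (S * M * (?L * (D / 2)))"
    proof -
      have "(\<Sum>j\<in>J. p j * q j)\<^sup>2 \<le> (\<Sum>j\<in>J. (p j)\<^sup>2) * (\<Sum>j\<in>J. (q j)\<^sup>2)" by (rule Cauchy_Schwarz_ineq_sum)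
      also have "\<dots> \<le> S * M * (?L * (D / 2))" using S(1) M0 by (intro mult_mono sp2 sq2 sum_nonneg mult_nonneg_nonneg) auto
      finally show ?thesis using real_le_rsqrt by auto
    qed
    finally show ?thesis .
  qed
  show ?thesis using main first second by linarith
qed

end

section \<open>Passage to the limit\<close>

lemma neighbourhood_measure_tendsto:
  fixes K :: "real set"
  assumes K: "compact K" "K \<noteq> {}" and N: "emeasure lborel K = 0" and h: "\<And>n. h n > 0" "\<And>n. h n \<le> h 0" "h \<longlonglongrightarrow> 0"
  shows "(\<lambda>n. LINT x|lebesgue. indicat_real {x. infdist x K \<le> h n} x) \<longlonglongrightarrow> 0"
proof -
  have "(\<lambda>n. LINT x|lebesgue. indicat_real {x. infdist x K \<le> h n} x) \<longlonglongrightarrow> (LINT x|lebesgue. indicat_real K x)"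
  proof (rule integral_dominated_convergence[where w="indicat_real {x. infdist x K \<le> h 0}"])
    show "indicat_real K \<in> borel_measurable lebesgue"
      using borel_compact[OF K(1)] by (intro borel_measurable_indicator) auto
    show "indicat_real {x. infdist x K \<le> h n} \<in> borel_measurable lebesgue" for n
      by (rule borel_measurable_integrable[OF cells_le_neighbourhood(3)[OF K h(1)]])
    show "integrable lebesgue (indicat_real {x. infdist x K \<le> h 0})" by (rule cells_le_neighbourhood(3)[OF K h(1)])
    show "AE x in lebesgue. norm (indicat_real {x. infdist x K \<le> h n} x) \<le> indicat_real {x. infdist x K \<le> h 0} x" for n
      using h(2)[of n] by (auto simp: indicator_def)
    show "AE x in lebesgue. (\<lambda>n. indicat_real {x. infdist x K \<le> h n} x) \<longlonglongrightarrow> indicat_real K x"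
    proof (rule AE_I2)
      fix x
      show "(\<lambda>n. indicat_real {x. infdist x K \<le> h n} x) \<longlonglongrightarrow> indicat_real K x"
      proof (cases "x \<in> K")
        case True
        then have "indicat_real {x. infdist x K \<le> h n} x = indicat_real K x" for n using h(1)[of n] by simp
        then show ?thesis by simp
      next
        case False
        then have "infdist x K > 0" using in_closed_iff_infdist_zero[OF compact_imp_closed[OF K(1)] K(2), of x] infdist_nonneg[of x K] by linarith
        then have "eventually (\<lambda>n. h n < infdist x K) sequentially" by (rule order_tendstoD(2)[OF h(3)])
        then have "eventually (\<lambda>n. indicat_real {x. infdist x K \<le> h n} x = indicat_real K x) sequentially"
          by (rule eventually_mono) (use False in simp)
        then show ?thesis by (rule tendsto_eventually)
      qed
    qed
  qed
  moreover have "(LINT x|lebesgue. indicat_real K x) = 0"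
    using N borel_compact[OF K(1)] by (simp add: measure_def)
  ultimately show ?thesis by simp
qed

lemma L2_truncation:
  assumes f: "L2 f"
  defines "g \<equiv> \<lambda>n x. complex_of_real (indicat_real {- real n..real n} x) * f x"
  shows "L2 (g n)" "integrable lebesgue (g n)" "(\<lambda>n. LINT x|lebesgue. (cmod (f x - g n x))\<^sup>2) \<longlonglongrightarrow> 0"
proof -
  have m: "g n \<in> borel_measurable lebesgue" for n
    unfolding g_def by (intro borel_measurable_times borel_measurable_of_real borel_measurable_indicator L2D(1)[OF f]) auto
  show "L2 (g n)" for n by (rule L2_bound[OF m f]) (simp add: g_def indicator_def)
  show "integrable lebesgue (g n)" for n
    using L2_set_integrable[OF f, of "- real n" "real n"] unfolding g_def set_integrable_def scaleR_conv_of_real .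
  have "(\<lambda>n. LINT x|lebesgue. (cmod (f x - g n x))\<^sup>2) \<longlonglongrightarrow> (LINT x::real|lebesgue. 0)"
  proof (rule integral_dominated_convergence[where w="\<lambda>x. (cmod (f x))\<^sup>2"])
    show "(\<lambda>x. (cmod (f x - g n x))\<^sup>2) \<in> borel_measurable lebesgue" for n
      using m[of n] L2D(1)[OF f] by measurable
    show "AE x in lebesgue. norm ((cmod (f x - g n x))\<^sup>2) \<le> (cmod (f x))\<^sup>2" for n
      by (simp add: g_def indicator_def)
    show "AE x in lebesgue. (\<lambda>n. (cmod (f x - g n x))\<^sup>2) \<longlonglongrightarrow> 0"
    proof (rule AE_I2)
      fix x
      have "eventually (\<lambda>n. (cmod (f x - g n x))\<^sup>2 = 0) sequentially"
        using eventually_ge_at_top[of "nat \<lceil>\<bar>x\<bar>\<rceil>"]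
      proof eventually_elim
        case (elim n)
        then have "\<bar>x\<bar> \<le> real n" by linarith
        then have "x \<in> {- real n..real n}" by (simp add: abs_le_iff)
        then show ?case by (simp add: g_def)
      qed
      then show "(\<lambda>n. (cmod (f x - g n x))\<^sup>2) \<longlonglongrightarrow> 0" by (rule tendsto_eventually)
    qed
  qed (use L2D(2)[OF f] in auto)
  then show "(\<lambda>n. LINT x|lebesgue. (cmod (f x - g n x))\<^sup>2) \<longlonglongrightarrow> 0" by simp
qed

context potentials
begin

text \<open>The order of the limits matters: in \<open>sc_estimate\<close> the constant
  \<open>D\<close> depends on \<open>g\<close>. For fixed integrable \<open>g\<close> the cell
  length is sent to 0, and only afterwards \<open>g\<close> runs through truncations of
  \<open>f\<close>.\<close>

lemma null_compact_measure_zero: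
  assumes sp: "spectral_measure v0 v1 f \<mu>" and lf: "L2 f"
    and K: "compact K" "K \<inter> eigenvalues v0 v1 = {}" "0 \<notin> K" "emeasure lborel K = 0"
  shows "measure \<mu> K = 0"
proof (cases "K = {}")
  case False
  obtain S where S: "S > 0" "\<And>(\<tau>::real) J. finite J \<Longrightarrow> (\<Sum>j\<in>J. 1 / (1 + (\<tau> - real_of_int j)\<^sup>2)) \<le> S"
    using lattice_sum_bound by blast
  obtain \<delta> C where d: "\<delta> > 0" "C > 0" and la: "\<And>\<zeta> g u w x. quadrant \<zeta> \<Longrightarrow> 0 < Im (\<zeta> ^ 4) \<Longrightarrow> Im (\<zeta> ^ 4) < \<delta> \<Longrightarrow> infdist (Re (\<zeta> ^ 4)) K < \<delta> \<Longrightarrow>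
     integrable lebesgue g \<Longrightarrow> LS \<zeta> v0 v1 g u w \<Longrightarrow> cmod (u x) + cmod (w x) \<le> C * (LINT x|lebesgue. cmod (g x))"
    by (rule limiting_absorption[OF K(1-3) False], rule that; assumption)
  define M where "M = measure \<mu> UNIV"
  \<comment> \<open>The factor 1/3 guarantees \<open>2 * h n < \<delta>\<close>, the height of the
    conjugated lower poles.\<close>
  define h where "h = (\<lambda>n. \<delta> / 3 * inverse (real (Suc n)))"
  have h0: "h n > 0" for n using d by (simp add: h_def)
  have hl: "h n \<le> h 0" for n
    unfolding h_def using d by (intro mult_left_mono le_imp_inverse_le) auto
  have h3: "2 * h n < \<delta>" for n
  proof -
    have "h 0 = \<delta> / 3" by (simp add: h_def)
    then show ?thesis using hl[of n] d by linarith
  qed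
  have ht: "h \<longlonglongrightarrow> 0" unfolding h_def using tendsto_mult[OF tendsto_const LIMSEQ_inverse_real_of_nat] by force
  have L: "(\<lambda>n. LINT x|lebesgue. indicat_real {x. infdist x K \<le> h n} x) \<longlonglongrightarrow> 0"
    by (rule neighbourhood_measure_tendsto[OF K(1) False K(4) h0 hl ht])
  have step: "measure \<mu> K / 2 \<le> 3 * sqrt (S\<^sup>2 * M * (LINT x|lebesgue. (cmod (f x - g x))\<^sup>2))"
    if g: "L2 g" "integrable lebesgue g" for g
  proof -
    define D where "D = C * (LINT x|lebesgue. cmod (g x))\<^sup>2"
    define e where "e = (LINT x|lebesgue. (cmod (f x - g x))\<^sup>2)"
    define F where "F = (\<lambda>n. 3 * sqrt (S * M * ((LINT x|lebesgue. indicat_real {x. infdist x K \<le> h n} x) * (D / 2))) + 3 * sqrt (S\<^sup>2 * M * e))"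
    have "F \<longlonglongrightarrow> 3 * sqrt (S * M * (0 * (D / 2))) + 3 * sqrt (S\<^sup>2 * M * e)"
      unfolding F_def by (intro tendsto_intros L)
    then have "F \<longlonglongrightarrow> 3 * sqrt (S\<^sup>2 * M * e)" by simp
    moreover have "measure \<mu> K / 2 \<le> F n" for n
      unfolding F_def D_def e_def M_def
      by (rule sc_estimate[OF sp lf K(1) False S(1) _ _ g h0 h3]) (rule S(2) la; assumption)+
    ultimately show ?thesis unfolding e_def by (intro LIMSEQ_le_const) auto
  qed
  have "(\<lambda>n. 3 * sqrt (S\<^sup>2 * M * (LINT x|lebesgue. (cmod (f x - complex_of_real (indicat_real {- real n..real n} x) * f x))\<^sup>2)))
      \<longlonglongrightarrow> 3 * sqrt (S\<^sup>2 * M * 0)"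
    by (intro tendsto_intros L2_truncation(3)[OF lf])
  then have "measure \<mu> K / 2 \<le> 3 * sqrt (S\<^sup>2 * M * 0)"
    by (rule LIMSEQ_le_const) (use step[OF L2_truncation(1,2)[OF lf]] in blast)
  then show ?thesis using measure_nonneg[of \<mu> K] by simp
qed simp

text \<open>The line splits into the complement of \<open>N\<close>, the countable set
  \<open>B\<close>, and \<open>N - B\<close>. Absence of atoms disposes of \<open>B\<close>, which
  collects exactly the points that \<open>null_compact_measure_zero\<close> forbids; compact subsets
  of \<open>N - B\<close> are therefore covered by it.\<close>

lemma sc_vector_zero:
  assumes sc: "sc_vector v0 v1 f \<mu>"
  shows "emeasure \<mu> UNIV = 0"
proof -
  have lf: "L2 f" and sp: "spectral_measure v0 v1 f \<mu>" and atom: "\<And>x. emeasure \<mu> {x} = 0"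
    using sc by (auto simp: sc_vector_def)
  obtain N where N: "N \<in> sets borel" "emeasure lborel N = 0" "emeasure \<mu> (UNIV - N) = 0"
    using sc by (auto simp: sc_vector_def)
  have fm: "finite_measure \<mu>" and sets: "sets \<mu> = sets borel" using sp by (auto simp: spectral_measure_def)
  have space: "space \<mu> = UNIV" using sets_eq_imp_space_eq[OF sets] by simp
  have fin: "emeasure \<mu> A \<noteq> \<infinity>" for A by (simp add: finite_measure.emeasure_eq_measure[OF fm])
  define B where "B = insert 0 (eigenvalues v0 v1)"
  have cB: "countable B" using countable_eigenvalues by (simp add: B_def)
  have sB: "B \<in> sets borel" by (rule sets.countable[OF _ cB]) simp
  have "(\<Union>x\<in>B. {x}) \<in> null_sets \<mu>"
    using atom by (intro null_sets_UN' cB) (auto simp: null_sets_def sets)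
  then have nB: "emeasure \<mu> B = 0" by (simp add: null_sets_def)
  have "emeasure \<mu> (N - B) = (SUP K\<in>{K. K \<subseteq> N - B \<and> compact K}. emeasure \<mu> K)"
    using fin N(1) sB by (intro inner_regular sets) auto
  also have "\<dots> = 0"
  proof -
    have "emeasure \<mu> K = 0" if "K \<subseteq> N - B" "compact K" for K
    proof -
      have "emeasure lborel K \<le> emeasure lborel N" using that N(1) by (intro emeasure_mono) auto
      then have "measure \<mu> K = 0"
        using that N(2) by (intro null_compact_measure_zero[OF sp lf that(2)]) (auto simp: B_def)
      then show ?thesis by (simp add: finite_measure.emeasure_eq_measure[OF fm])
    qed
    then show ?thesis by (auto intro!: antisym SUP_least)
  qed
  finally have nN: "emeasure \<mu> (N - B) = 0" .
  have "UNIV = (UNIV - N) \<union> ((N - B) \<union> B)" by auto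
  then have "emeasure \<mu> UNIV = emeasure \<mu> ((UNIV - N) \<union> ((N - B) \<union> B))" by simp
  also have "\<dots> \<le> emeasure \<mu> (UNIV - N) + (emeasure \<mu> (N - B) + emeasure \<mu> B)"
    using N(1) sB by (intro order_trans[OF emeasure_subadditive] add_left_mono emeasure_subadditive) (auto simp: sets)
  finally show ?thesis using N(3) nN nB by simp
qed

lemma sc_spectrum_empty: "sc_spectrum v0 v1 = {}"
proof -
  have False if E: "E \<in> sc_spectrum v0 v1" for E
  proof -
    obtain f \<mu> where m: "sc_vector v0 v1 f \<mu>" "emeasure \<mu> {E - 1<..<E + 1} > 0"
      using CollectD[OF E[unfolded sc_spectrum_def]] zero_less_one by blast
    have "sets \<mu> = sets borel" using m(1) by (auto simp: sc_vector_def spectral_measure_def)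
    then have "emeasure \<mu> {E - 1<..<E + 1} \<le> emeasure \<mu> UNIV" by (intro emeasure_mono) auto
    then show False using m(2) sc_vector_zero[OF m(1)] by simp
  qed
  then show ?thesis by blast
qed

end

theorem theorem3p10:
  fixes v0 v1 :: "real \<Rightarrow> real"
  assumes "integrable lebesgue v0" and "integrable lebesgue v1"
  shows "Ncal v0 v1 = {E \<in> eigenvalues v0 v1. E > 0}
    \<and> sc_spectrum v0 v1 = {}
    \<and> (\<forall>x. x islimpt eigenvalues v0 v1 \<longrightarrow> x = 0)"
proof -
  interpret potentials v0 v1 by unfold_locales (fact assms)+
  show ?thesis using Ncal_eq sc_spectrum_empty islimpt_eigenvalues by blast
qed

end
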